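(* Let $X$ be a Banach space and let $1<p<\infty$. Then $$\hbar_{p,X}\ge\max\{\beta_{p,X}^{\gamma,+},\beta_{p,X}^{\gamma,-}\}$$ and $$\hbar_{p,X}\ge C\max\{\beta_{p,X}^{\Delta,+},\beta_{p,X}^{\Delta,-}\},$$ where $C=\mathbb E|\gamma|\,\mathbb E\sqrt{\tau}$, $\gamma$ is a standard normal random variable, and $\tau=\inf\{t\ge0:|W_t|=1\}$ for a standard (real-valued) Brownian motion $W$.
   Context: All Banach spaces are real. All constants below take values in $[0,\infty]$ (equal to $\infty$ if no finite constant works). $\hbar_{p,X}$ is the norm of the periodic Hilbert transform on $L^p(\mathbb T;X)$, $\mathbb T\simeq[-\pi,\pi)$: the least $c$ with $\|\mathcal H^{\mathbb T}_Xf\|_{L^p(\mathbb T;X)}\le c\|f\|_{L^p(\mathbb T;X)}$ for all step functions $f:\mathbb T\to X$ (finite linear combinations, with coefficients in $X$, of indicators of intervals), where $\mathcal H^{\mathbb T}_Xf(t)=\frac1{2\pi}\,\mathrm{p.v.}\int_{-\pi}^{\pi}f(s)\cot\frac{t-s}{2}\,ds$. A Paley–Walsh martingale is a martingale on $([0,1],\mathcal B(0,1),\text{Lebesgue})$ adapted to the dyadic filtration generated by the Haar system $(h_n)_{n\ge0}$; $df_n=f_n-f_{n-1}$ (with $f_{-1}=0$). $\beta_{p,X}^{\Delta,+}$ and $\beta_{p,X}^{\Delta,-}$ are the smallest $\beta^+$ and $\beta^-$ such that $$\frac1{(\beta^-)^p}\mathbb E\Bigl\|\sum_{n\ge0}df_n\Bigr\|^p\le\mathbb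 E\Bigl\|\sum_{n\ge0}r_n\,df_n\Bigr\|^p\le(\beta^+)^p\,\mathbb E\Bigl\|\sum_{n\ge0}df_n\Bigr\|^p$$ for every finite $X$-valued Paley–Walsh martingale $(f_n)_{n\ge0}$ and every Rademacher sequence $(r_n)_{n\ge0}$ independent of it. $\beta_{p,X}^{\gamma,+}$ and $\beta_{p,X}^{\gamma,-}$ are the least $\beta^+$ and $\beta^-$ such that $$\frac1{(\beta^-)^p}\mathbb E\Bigl\|\int_0^\infty\phi\,dW\Bigr\|^p\le\mathbb E\Bigl\|\int_0^\infty\phi\,d\widetilde W\Bigr\|^p\le(\beta^+)^p\,\mathbb E\Bigl\|\int_0^\infty\phi\,dW\Bigr\|^p$$ for every standard Brownian motion $W$, every elementary progressive process $\phi:\mathbb R_+\times\Omega\to X$ and every Brownian motion $\widetilde W$ independent of $\phi$ and $W$. Here $\phi$ is elementary progressive if $\phi=\sum_{k=1}^K\sum_{m=1}^{M}\mathbf 1_{(t_{k-1},t_k]\times B_{mk}}\,x_{km}$ with $0\le t_0<\dots<t_K<\infty$, $B_{mk}\in\mathcal F_{t_{k-1}}$, $x_{km}\in X$, and the stochastic integral is defined by the usual finite sum. *)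

theory Defs
  imports "HOL-Probability.Probability" "HOL-Library.Discrete_Functions"
begin

text \<open>
  The Banach space is an arbitrary type of class \<open>banach\<close>; it need not be separable, so the Bochner
  integral of the library (which needs a second countable range) is not available. All the
  vector-valued functions that have to be integrated are, away from finitely many points, continuous
  functions on finite unions of bounded intervals, or step functions; for these the
  Henstock--Kurzweil integral \<open>integral\<close> is the Bochner integral. \<open>L\<^sup>p\<close> norms only involve scalar
  functions and are taken with the nonnegative Lebesgue integral, hence may be infinite.

  All constants are values in \<open>[0,\<infinity>]\<close>: the infimum in \<open>ennreal\<close> of the admissible finite constants
  (the infimum of the empty set being \<open>\<infinity>\<close>). The defining inequalities are stated with \<open>p\<close>-th powers.
\<close>

section \<open>The periodic Hilbert transform\<close>

text \<open>The torus is \<open>{-pi..<pi}\<close>.\<close>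

definition step_function :: "(real \<Rightarrow> 'a::real_vector) \<Rightarrow> bool" where
  "step_function f \<longleftrightarrow> (\<exists>(n::nat) I x.
     (\<forall>i<n. is_interval (I i) \<and> I i \<subseteq> {-pi..<pi}) \<and>
     f = (\<lambda>t. \<Sum>i<n. indicator (I i) t *\<^sub>R x i))"

text \<open>The principal value removes the points \<open>s\<close> whose distance to \<open>t\<close> \<^emph>\<open>on the circle\<close> is less than
  \<open>\<epsilon>\<close>. At the finitely many \<open>t\<close> where the limit may not exist the value is irrelevant.\<close>

definition hilbert_transform :: "(real \<Rightarrow> 'a::banach) \<Rightarrow> real \<Rightarrow> 'a" where
  "hilbert_transform f t = (1 / (2 * pi)) *\<^sub>R
     Lim (at_right 0) (\<lambda>\<epsilon>. integral {s \<in> {-pi..<pi}. \<epsilon> \<le> \<bar>t - s\<bar> \<and> \<bar>t - s\<bar> \<le> 2 * pi - \<epsilon>}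
                              (\<lambda>s. cot ((t - s) / 2) *\<^sub>R f s))"

definition hilbert_const :: "'a::banach itself \<Rightarrow> real \<Rightarrow> ennreal" where
  "hilbert_const X p = Inf (ennreal ` {c. 0 \<le> c \<and> (\<forall>f :: real \<Rightarrow> 'a. step_function f \<longrightarrow>
     (\<integral>\<^sup>+ t \<in> {-pi..<pi}. ennreal (norm (hilbert_transform f t) powr p) \<partial>lborel)
       \<le> ennreal (c powr p) * (\<integral>\<^sup>+ t \<in> {-pi..<pi}. ennreal (norm (f t) powr p) \<partial>lborel))})"

section \<open>Paley--Walsh martingales\<close>

abbreviation unit_interval :: "real measure" where
  "unit_interval \<equiv> restrict_space lborel {0..1}"

text \<open>The normalisation of the Haar functions does not matter for the filtration they generate;
  for \<open>n = 2 ^ k + j\<close> with \<open>j < 2 ^ k\<close> the support of the \<open>n\<close>-th one is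
  \<open>[j / 2 ^ k, (j + 1) / 2 ^ k)\<close>.\<close>

definition haar :: "nat \<Rightarrow> real \<Rightarrow> real" where
  "haar n x = (if n = 0 then 1 else
     (let k = floor_log n; j = real n - 2 ^ k
      in indicator {j / 2 ^ k ..< (j + 1/2) / 2 ^ k} x
         - indicator {(j + 1/2) / 2 ^ k ..< (j + 1) / 2 ^ k} x))"

definition haar_filtration :: "nat \<Rightarrow> real measure" where
  "haar_filtration n = sigma {0..1} {haar k -` A \<inter> {0..1} | k A. k \<le> n \<and> A \<in> sets borel}"

text \<open>The finite martingale \<open>(f\<^sub>n)\<close> is indexed by \<open>n \<le> N\<close>. The \<open>\<sigma>\<close>-algebras are finite, so the
  \<open>f\<^sub>n\<close> are step functions on the unit interval.\<close>

definition paley_walsh :: "nat \<Rightarrow> (nat \<Rightarrow> real \<Rightarrow> 'a::banach) \<Rightarrow> bool" where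
  "paley_walsh N f \<longleftrightarrow>
     (\<forall>n\<le>N. f n \<in> borel_measurable (haar_filtration n)) \<and>
     (\<forall>m n A. m \<le> n \<and> n \<le> N \<and> A \<in> sets (haar_filtration m) \<longrightarrow>
        integral A (f n) = integral A (f m))"

definition mdiff :: "(nat \<Rightarrow> real \<Rightarrow> 'a::ab_group_add) \<Rightarrow> nat \<Rightarrow> real \<Rightarrow> 'a" where
  "mdiff f n x = f n x - (if n = 0 then 0 else f (n - 1) x)"

definition rademacher_seq :: "'w measure \<Rightarrow> (nat \<Rightarrow> 'w \<Rightarrow> real) \<Rightarrow> bool" where
  "rademacher_seq M r \<longleftrightarrow> prob_space M \<and> prob_space.indep_vars M (\<lambda>_. borel) r UNIV \<and>
     (\<forall>n. measure M {\<omega> \<in> space M. r n \<omega> = 1} = 1/2 \<and>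
          measure M {\<omega> \<in> space M. r n \<omega> = -1} = 1/2)"

text \<open>The first type argument of the constants below is the type of the sample points. A statement
  which is polymorphic in it covers random variables on all probability spaces (over a type that
  carries no such random variables the constant is \<open>0\<close>). A Rademacher sequence independent of the
  martingale lives on the second factor of the product of the unit interval with \<open>M\<close>.\<close>

definition beta_Delta_plus :: "'w itself \<Rightarrow> 'a::banach itself \<Rightarrow> real \<Rightarrow> ennreal" where
  "beta_Delta_plus Omega X p = Inf (ennreal ` {c. 0 \<le> c \<and>
     (\<forall>N (f :: nat \<Rightarrow> real \<Rightarrow> 'a) (M :: 'w measure) r. paley_walsh N f \<and> rademacher_seq M r \<longrightarrow>
       (\<integral>\<^sup>+ z. ennreal (norm (\<Sum>n\<le>N. r n (snd z) *\<^sub>R mdiff f n (fst z)) powr p)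
           \<partial>(unit_interval \<Otimes>\<^sub>M M))
         \<le> ennreal (c powr p) *
           (\<integral>\<^sup>+ x. ennreal (norm (\<Sum>n\<le>N. mdiff f n x) powr p) \<partial>unit_interval))})"

definition beta_Delta_minus :: "'w itself \<Rightarrow> 'a::banach itself \<Rightarrow> real \<Rightarrow> ennreal" where
  "beta_Delta_minus Omega X p = Inf (ennreal ` {c. 0 \<le> c \<and>
     (\<forall>N (f :: nat \<Rightarrow> real \<Rightarrow> 'a) (M :: 'w measure) r. paley_walsh N f \<and> rademacher_seq M r \<longrightarrow>
       1 / ennreal (c powr p) *
           (\<integral>\<^sup>+ x. ennreal (norm (\<Sum>n\<le>N. mdiff f n x) powr p) \<partial>unit_interval)
         \<le> (\<integral>\<^sup>+ z. ennreal (norm (\<Sum>n\<le>N. r n (snd z) *\<^sub>R mdiff f n (fst z)) powr p)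
           \<partial>(unit_interval \<Otimes>\<^sub>M M)))})"

section \<open>Brownian motion and decoupling\<close>

text \<open>Processes are indexed by \<open>real\<close>, but only times \<open>t \<ge> 0\<close> are constrained or used.\<close>

definition brownian_motion_wrt ::
    "'w measure \<Rightarrow> (real \<Rightarrow> 'w measure) \<Rightarrow> (real \<Rightarrow> 'w \<Rightarrow> real) \<Rightarrow> bool" where
  "brownian_motion_wrt M F W \<longleftrightarrow>
     prob_space M \<and> filtration (space M) F \<and> (\<forall>t\<ge>0. sets (F t) \<subseteq> sets M) \<and>
     (\<forall>t\<ge>0. W t \<in> borel_measurable (F t)) \<and>
     (AE \<omega> in M. W 0 \<omega> = 0) \<and>
     (AE \<omega> in M. continuous_on {0..} (\<lambda>t. W t \<omega>)) \<and>
     (\<forall>s t. 0 \<le> s \<and> s < t \<longrightarrow>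
        distributed M lborel (\<lambda>\<omega>. W t \<omega> - W s \<omega>) (normal_density 0 (sqrt (t - s))) \<and>
        prob_space.indep_set M (sets (F s))
          (sets (vimage_algebra (space M) (\<lambda>\<omega>. W t \<omega> - W s \<omega>) borel)))"

definition natural_filtration ::
    "'w measure \<Rightarrow> (real \<Rightarrow> 'w \<Rightarrow> real) \<Rightarrow> real \<Rightarrow> 'w measure" where
  "natural_filtration M W t =
     sigma (space M) {W s -` A \<inter> space M | s A. 0 \<le> s \<and> s \<le> t \<and> A \<in> sets borel}"

definition brownian_motion :: "'w measure \<Rightarrow> (real \<Rightarrow> 'w \<Rightarrow> real) \<Rightarrow> bool" where
  "brownian_motion M W \<longleftrightarrow> brownian_motion_wrt M (natural_filtration M W) W"

text \<open>Elementary progressive processes and their integrals are given by their data \<open>K J t B x\<close>.\<close>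

definition elementary_data ::
    "(real \<Rightarrow> 'w measure) \<Rightarrow> nat \<Rightarrow> nat \<Rightarrow> (nat \<Rightarrow> real) \<Rightarrow> (nat \<Rightarrow> nat \<Rightarrow> 'w set) \<Rightarrow> bool" where
  "elementary_data F K J t B \<longleftrightarrow>
     0 \<le> t 0 \<and> (\<forall>k\<in>{1..K}. t (k - 1) < t k) \<and>
     (\<forall>k\<in>{1..K}. \<forall>m\<in>{1..J}. B m k \<in> sets (F (t (k - 1))))"

definition elementary_process ::
    "nat \<Rightarrow> nat \<Rightarrow> (nat \<Rightarrow> real) \<Rightarrow> (nat \<Rightarrow> nat \<Rightarrow> 'w set) \<Rightarrow> (nat \<Rightarrow> nat \<Rightarrow> 'a::real_vector)
      \<Rightarrow> real \<Rightarrow> 'w \<Rightarrow> 'a" where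
  "elementary_process K J t B x s \<omega> =
     (\<Sum>k=1..K. \<Sum>m=1..J. indicator ({t (k - 1)<..t k} \<times> B m k) (s, \<omega>) *\<^sub>R x k m)"

definition elementary_integral ::
    "nat \<Rightarrow> nat \<Rightarrow> (nat \<Rightarrow> real) \<Rightarrow> (nat \<Rightarrow> nat \<Rightarrow> 'w set) \<Rightarrow> (nat \<Rightarrow> nat \<Rightarrow> 'a::real_vector)
      \<Rightarrow> (real \<Rightarrow> 'w \<Rightarrow> real) \<Rightarrow> 'w \<Rightarrow> 'a" where
  "elementary_integral K J t B x W \<omega> =
     (\<Sum>k=1..K. \<Sum>m=1..J. (indicator (B m k) \<omega> * (W (t k) \<omega> - W (t (k - 1)) \<omega>)) *\<^sub>R x k m)"

text \<open>Independence of \<open>V\<close> from the pair \<open>(\<phi>, W)\<close>, as processes indexed by \<open>{0..}\<close>.\<close>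

definition independent_of_processes ::
    "'w measure \<Rightarrow> (real \<Rightarrow> 'w \<Rightarrow> real) \<Rightarrow> (real \<Rightarrow> 'w \<Rightarrow> 'a::topological_space)
      \<Rightarrow> (real \<Rightarrow> 'w \<Rightarrow> real) \<Rightarrow> bool" where
  "independent_of_processes M V \<phi> W \<longleftrightarrow>
     (\<forall>t\<ge>0. V t \<in> borel_measurable M \<and> \<phi> t \<in> borel_measurable M \<and> W t \<in> borel_measurable M) \<and>
     prob_space.indep_set M
       (sets (vimage_algebra (space M) (\<lambda>\<omega>. \<lambda>t\<in>{0..}. V t \<omega>) (PiM {0..} (\<lambda>_. borel))))
       (sets (vimage_algebra (space M) (\<lambda>\<omega>. (\<lambda>t\<in>{0..}. \<phi> t \<omega>, \<lambda>t\<in>{0..}. W t \<omega>))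
          (PiM {0..} (\<lambda>_. borel) \<Otimes>\<^sub>M PiM {0..} (\<lambda>_. borel))))"

definition beta_gamma_plus :: "'w itself \<Rightarrow> 'a::banach itself \<Rightarrow> real \<Rightarrow> ennreal" where
  "beta_gamma_plus Omega X p = Inf (ennreal ` {c. 0 \<le> c \<and>
     (\<forall>(M :: 'w measure) F W V K J t B (x :: nat \<Rightarrow> nat \<Rightarrow> 'a).
       brownian_motion_wrt M F W \<and> elementary_data F K J t B \<and> brownian_motion M V \<and>
       independent_of_processes M V (elementary_process K J t B x) W \<longrightarrow>
       (\<integral>\<^sup>+ \<omega>. ennreal (norm (elementary_integral K J t B x V \<omega>) powr p) \<partial>M)
         \<le> ennreal (c powr p) *
           (\<integral>\<^sup>+ \<omega>. ennreal (norm (elementary_integral K J t B x W \<omega>) powr p) \<partial>M))})"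

definition beta_gamma_minus :: "'w itself \<Rightarrow> 'a::banach itself \<Rightarrow> real \<Rightarrow> ennreal" where
  "beta_gamma_minus Omega X p = Inf (ennreal ` {c. 0 \<le> c \<and>
     (\<forall>(M :: 'w measure) F W V K J t B (x :: nat \<Rightarrow> nat \<Rightarrow> 'a).
       brownian_motion_wrt M F W \<and> elementary_data F K J t B \<and> brownian_motion M V \<and>
       independent_of_processes M V (elementary_process K J t B x) W \<longrightarrow>
       1 / ennreal (c powr p) *
           (\<integral>\<^sup>+ \<omega>. ennreal (norm (elementary_integral K J t B x W \<omega>) powr p) \<partial>M)
         \<le> (\<integral>\<^sup>+ \<omega>. ennreal (norm (elementary_integral K J t B x V \<omega>) powr p) \<partial>M))})"

text \<open>For a Brownian motion the set is almost surely nonempty, so that a real-valued infimum suffices.\<close>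

definition exit_time :: "(real \<Rightarrow> 'w \<Rightarrow> real) \<Rightarrow> 'w \<Rightarrow> real" where
  "exit_time W \<omega> = Inf {t. 0 \<le> t \<and> \<bar>W t \<omega>\<bar> = 1}"

end

theory Submission
  imports Defs "HOL-Real_Asymp.Real_Asymp"
begin

text \<open>
  If \<open>c\<close> is admissible for the Hilbert transform, then \<open>Q(x, y) = \<parallel>y\<parallel>\<^sup>p - c\<^sup>p \<parallel>x\<parallel>\<^sup>p\<close> has nonpositive mean
  along every pair of a trigonometric polynomial and its conjugate function. Multiplying such a pair
  \<open>(\<xi>, \<eta>)\<close> by a trigonometric polynomial \<open>v\<close>, after replacing its variable by a much higher frequency,
  yields another pair up to a small error; the mean along \<open>(f + \<xi> v, g + \<eta> v)\<close> is then
  close to the mean over an independent copy of \<open>(\<xi>, \<eta>)\<close>. Hence nonpositivity survives when \<open>Q\<close> is replaced by its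
  average over independent increments \<open>(\<xi> v, \<eta> v)\<close>, maximised over finitely many vectors \<open>v\<close> that may
  depend on the position. By dynamic programming, the decoupling inequalities follow for every law of \<open>(\<xi>, \<eta>)\<close>
  that can be reached in this way. Sums of pairs of the form \<open>(cos, sin)\<close> reach planar Gaussians, which gives
  the decoupling of stochastic integrals. The boundary values of the conformal map from the disc to
  the strip \<open>\<bar>Re z\<bar> < 1\<close> have real part \<open>\<plusminus>1\<close> and a symmetric imaginary part; since \<open>Q\<close> is convex in \<open>y\<close>, Jensen's
  inequality replaces the modulus of the imaginary part by its mean and leaves a pair of independent signs, the increments
  of a decoupled Paley--Walsh martingale. That mean is \<open>E \<bar>\<gamma>\<bar> E sqrt \<tau>\<close> because
  the imaginary part is distributed like an independent Brownian motion at the time \<open>\<tau>\<close>.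
\<close>

section \<open>Conjugate trigonometric polynomials\<close>

text \<open>The obstacle is that an increment vector may depend on the past in an arbitrary
  measurable way, while a conjugate pair is a single function on the circle. Maximising over the
  finite set of vectors that occur turns this dependence into a dependence on the position alone.
  Four properties have to survive each backward step: growth of order \<open>p\<close>, for
  integrability; a lower bound in terms of \<open>x\<close> alone, because the boundary values of
  the strip have a bounded real but an unbounded imaginary part and Fatou's lemma has to apply;
  convexity in \<open>y\<close>, for Jensen's inequality; and evenness, because the Haar function of
  index 0 is constant and leaves only one of the two signs random. The exit time enters through the
  inequality \<open>1 / cosh s \<le> E exp (- s^2 * \<tau> / 2)\<close>. Since
  \<open>\<bar>x\<bar>\<close> is a mixture of the functions \<open>1 - cos (s * x)\<close>, a lower
  bound for a characteristic function is an upper bound for a first absolute moment, and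
  \<open>1 / cosh s\<close> is the characteristic function of the imaginary part.\<close>

definition circ :: "real measure" where
  "circ = uniform_measure lborel {-pi..<pi}"

lemma emeasure_circle: "emeasure lborel {-pi..<pi} = ennreal (2 * pi)"
  by simp

lemma prob_space_circ: "prob_space circ"
  unfolding circ_def by (rule prob_space_uniform_measure) (auto simp: emeasure_circle)

interpretation circ: prob_space circ by (rule prob_space_circ)

lemma sets_circ [measurable_cong, simp]: "sets circ = sets borel"
  and space_circ [simp]: "space circ = UNIV"
  by (simp_all add: circ_def)

lemma prob_circ_UNIV [simp]: "measure circ UNIV = 1"
  using circ.prob_space by simp

lemma nn_integral_circ:
  assumes "f \<in> borel_measurable borel"
  shows "(\<integral>\<^sup>+x. f x \<partial>circ) = (\<integral>\<^sup>+x\<in>{-pi..<pi}. f x \<partial>lborel) / ennreal (2 * pi)"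
  unfolding circ_def using assms by (subst nn_integral_uniform_measure) (auto simp: emeasure_circle)

lemma AE_circ: "(AE x in circ. P x) \<longleftrightarrow> (AE x in lborel. x \<in> {-pi..<pi} \<longrightarrow> P x)"
  unfolding circ_def by (subst AE_uniform_measure) (auto simp: emeasure_circle)

lemma nn_integral_interval_shift:
  fixes f :: "real \<Rightarrow> ennreal"
  assumes [measurable]: "f \<in> borel_measurable borel"
  shows "(\<integral>\<^sup>+x\<in>{u..<v}. f (x + a) \<partial>lborel) = (\<integral>\<^sup>+x\<in>{u+a..<v+a}. f x \<partial>lborel)"
proof -
  have "(\<integral>\<^sup>+x\<in>{u+a..<v+a}. f x \<partial>lborel) = (\<integral>\<^sup>+x. f (a + 1 * x) * indicator {u+a..<v+a} (a + 1 * x) \<partial>lborel)"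
    by (subst nn_integral_real_affine[where c=1 and t=a]) auto
  also have "\<dots> = (\<integral>\<^sup>+x\<in>{u..<v}. f (x + a) \<partial>lborel)"
    by (intro nn_integral_cong) (auto simp: indicator_def add_ac)
  finally show ?thesis by simp
qed

text \<open>A shift by at most one period cuts the period in two and moves one piece back by
  \<open>2 * pi\<close>; longer shifts are compositions of equal short ones, and a negative shift is
  undone by a positive one.\<close>

lemma nn_integral_circ_shift:
  fixes f :: "real \<Rightarrow> ennreal"
  assumes f[measurable]: "f \<in> borel_measurable borel" and per: "\<And>x. f (x + 2 * pi) = f x"
  shows "(\<integral>\<^sup>+x. f (x + a) \<partial>circ) = (\<integral>\<^sup>+x. f x \<partial>circ)"
proof -
  define I where "I = (\<lambda>a. \<integral>\<^sup>+x\<in>{-pi..<pi}. f (x + a) \<partial>lborel)"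
  have small: "(\<integral>\<^sup>+x\<in>{-pi..<pi}. g (x + a) \<partial>lborel) = (\<integral>\<^sup>+x\<in>{-pi..<pi}. g x \<partial>lborel)"
    if a: "0 \<le> a" "a \<le> 2 * pi" and g[measurable]: "g \<in> borel_measurable borel"
      and per: "\<And>x. g (x + 2 * pi) = g x" for a and g :: "real \<Rightarrow> ennreal"
  proof -
    have "(\<integral>\<^sup>+x\<in>{-pi..<pi}. g (x + a) \<partial>lborel) = (\<integral>\<^sup>+x\<in>{-pi+a..<pi+a}. g x \<partial>lborel)"
      by (rule nn_integral_interval_shift) auto
    also have "\<dots> = (\<integral>\<^sup>+x. g x * indicator {-pi+a..<pi} x + g x * indicator {pi..<pi+a} x \<partial>lborel)"
      using a by (intro nn_integral_cong) (auto simp: indicator_def)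
    also have "\<dots> = (\<integral>\<^sup>+x\<in>{-pi+a..<pi}. g x \<partial>lborel) + (\<integral>\<^sup>+x\<in>{pi..<pi+a}. g x \<partial>lborel)"
      by (subst nn_integral_add) auto
    also have "(\<integral>\<^sup>+x\<in>{pi..<pi+a}. g x \<partial>lborel) = (\<integral>\<^sup>+x\<in>{-pi..<-pi+a}. g (x + 2 * pi) \<partial>lborel)"
      by (subst nn_integral_interval_shift) (auto simp: algebra_simps)
    also have "\<dots> = (\<integral>\<^sup>+x\<in>{-pi..<-pi+a}. g x \<partial>lborel)" by (simp add: per)
    also have "(\<integral>\<^sup>+x\<in>{-pi+a..<pi}. g x \<partial>lborel) + \<dots> =
        (\<integral>\<^sup>+x. g x * indicator {-pi+a..<pi} x + g x * indicator {-pi..<-pi+a} x \<partial>lborel)"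
      by (subst nn_integral_add) auto
    also have "\<dots> = (\<integral>\<^sup>+x\<in>{-pi..<pi}. g x \<partial>lborel)"
      using a by (intro nn_integral_cong) (auto simp: indicator_def)
    finally show ?thesis .
  qed
  have pos: "(\<integral>\<^sup>+x\<in>{-pi..<pi}. g (x + a) \<partial>lborel) = (\<integral>\<^sup>+x\<in>{-pi..<pi}. g x \<partial>lborel)"
    if "0 \<le> a" and g[measurable]: "g \<in> borel_measurable borel"
      and per: "\<And>x. g (x + 2 * pi) = g x" for a and g :: "real \<Rightarrow> ennreal"
  proof -
    obtain n :: nat where n: "a / (2 * pi) < real n" using reals_Archimedean2 by blast
    have n0: "0 < real n" using n that(1) by (smt (verit) divide_nonneg_pos pi_gt_zero)
    have b: "0 \<le> a / real n" "a / real n \<le> 2 * pi"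
      using n n0 that by (auto simp: field_simps)
    have "(\<integral>\<^sup>+x\<in>{-pi..<pi}. g (x + real m * (a / real n)) \<partial>lborel) = (\<integral>\<^sup>+x\<in>{-pi..<pi}. g x \<partial>lborel)" for m
    proof (induction m)
      case (Suc m)
      have "(\<integral>\<^sup>+x\<in>{-pi..<pi}. g ((x + a / real n) + real m * (a / real n)) \<partial>lborel)
          = (\<integral>\<^sup>+x\<in>{-pi..<pi}. g (x + real m * (a / real n)) \<partial>lborel)"
        proof (rule small[OF b, of "\<lambda>x. g (x + real m * (a / real n))"])
        show "g (x + 2 * pi + real m * (a / real n)) = g (x + real m * (a / real n))" for x
          using per[of "x + real m * (a / real n)"] by (simp add: algebra_simps)
      qed simp
      then show ?case using Suc by (simp add: algebra_simps add_divide_distrib)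
    qed auto
    from this[of n] show ?thesis using n0 by simp
  qed
  have "(\<integral>\<^sup>+x\<in>{-pi..<pi}. f (x + a) \<partial>lborel) = (\<integral>\<^sup>+x\<in>{-pi..<pi}. f x \<partial>lborel)"
  proof (cases "0 \<le> a")
    case True
    then show ?thesis by (rule pos) (auto simp: per)
  next
    case False
    have "(\<integral>\<^sup>+x\<in>{-pi..<pi}. f ((x + - a) + a) \<partial>lborel) = (\<integral>\<^sup>+x\<in>{-pi..<pi}. f (x + a) \<partial>lborel)"
    proof (rule pos[of "-a" "\<lambda>x. f (x + a)"])
      show "f (x + 2 * pi + a) = f (x + a)" for x
        using per[of "x + a"] by (simp add: algebra_simps)
    qed (use False in auto)
    then show ?thesis by simp
  qed
  then show ?thesis by (simp add: nn_integral_circ)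
qed

lemma nn_integral_circ_uminus:
  fixes f :: "real \<Rightarrow> ennreal"
  assumes [measurable]: "f \<in> borel_measurable borel"
  shows "(\<integral>\<^sup>+x. f (- x) \<partial>circ) = (\<integral>\<^sup>+x. f x \<partial>circ)"
proof -
  have "(\<integral>\<^sup>+x\<in>{-pi..<pi}. f x \<partial>lborel) = (\<integral>\<^sup>+x. f (0 + (-1) * x) * indicator {-pi..<pi} (0 + (-1) * x) \<partial>lborel)"
    by (subst nn_integral_real_affine[where c="-1" and t=0]) auto
  also have "\<dots> = (\<integral>\<^sup>+x\<in>{-pi..<pi}. f (- x) \<partial>lborel)"
  proof (rule nn_integral_cong_AE)
    \<comment> \<open>Reflection exchanges the ends of the half-open period; only these two points
      disagree.\<close>
    have "AE x in lborel. x \<noteq> pi \<and> x \<noteq> -pi"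
      using AE_lborel_singleton[of pi] AE_lborel_singleton[of "-pi"] by eventually_elim auto
    then show "AE x in lborel. f (0 + (-1) * x) * indicator {-pi..<pi} (0 + (-1) * x) = f (- x) * indicator {-pi..<pi} x"
      by eventually_elim (auto simp: indicator_def)
  qed
  finally show ?thesis by (simp add: nn_integral_circ)
qed

text \<open>The second function is the periodic Hilbert transform of the first.\<close>

inductive conj_pair :: "(real \<Rightarrow> 'a::real_normed_vector) \<Rightarrow> (real \<Rightarrow> 'a) \<Rightarrow> bool" where
  base: "0 < k \<Longrightarrow> conj_pair (\<lambda>t. cos (real k * t + \<phi>) *\<^sub>R x) (\<lambda>t. sin (real k * t + \<phi>) *\<^sub>R x)"
| add: "conj_pair f g \<Longrightarrow> conj_pair f' g' \<Longrightarrow> conj_pair (\<lambda>t. f t + f' t) (\<lambda>t. g t + g' t)"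

text \<open>Frequency 0 is allowed, so that constants are included; in \<open>conj_pair\<close> it
  is excluded because \<open>cos \<phi>\<close> and \<open>sin \<phi>\<close>, as constant
  functions, are not conjugate. The phase produces the sines.\<close>

inductive trig_poly :: "(real \<Rightarrow> 'a::real_normed_vector) \<Rightarrow> bool" where
  base: "trig_poly (\<lambda>t. cos (real k * t + \<phi>) *\<^sub>R x)"
| add: "trig_poly f \<Longrightarrow> trig_poly f' \<Longrightarrow> trig_poly (\<lambda>t. f t + f' t)"

lemma conj_pair_zero: "conj_pair (\<lambda>t. 0) (\<lambda>t. 0)"
  using conj_pair.base[of 1 0 0] by simp

lemma conj_pair_continuous: "conj_pair f g \<Longrightarrow> continuous_on UNIV f \<and> continuous_on UNIV g"
  by (induction rule: conj_pair.induct) (auto intro!: continuous_intros)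

lemma trig_poly_continuous: "trig_poly f \<Longrightarrow> continuous_on UNIV f"
  by (induction rule: trig_poly.induct) (auto intro!: continuous_intros)

lemma cos_sin_period:
  "cos (real k * (t + 2 * pi) + \<phi>) = cos (real k * t + \<phi>)"
  "sin (real k * (t + 2 * pi) + \<phi>) = sin (real k * t + \<phi>)"
proof -
  have "real k * (t + 2 * pi) + \<phi> = (real k * t + \<phi>) + 2 * real k * pi" by (simp add: algebra_simps)
  then show "cos (real k * (t + 2 * pi) + \<phi>) = cos (real k * t + \<phi>)"
    "sin (real k * (t + 2 * pi) + \<phi>) = sin (real k * t + \<phi>)"
    by (simp_all add: cos_add sin_add)
qed

lemma conj_pair_periodic: "conj_pair f g \<Longrightarrow> f (t + 2 * pi) = f t \<and> g (t + 2 * pi) = g t"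
  by (induction rule: conj_pair.induct) (auto simp: cos_sin_period)

lemma conj_pair_bounded: "conj_pair f g \<Longrightarrow> \<exists>B. \<forall>t. norm (f t) \<le> B \<and> norm (g t) \<le> B"
proof (induction rule: conj_pair.induct)
  case (base k \<phi> x)
  show ?case by (intro exI[of _ "norm x"]) (auto intro!: mult_left_le_one_le)
next
  case (add f g f' g')
  then obtain B B' where "\<forall>t. norm (f t) \<le> B \<and> norm (g t) \<le> B" "\<forall>t. norm (f' t) \<le> B' \<and> norm (g' t) \<le> B'"
    by auto
  then show ?case
    by (intro exI[of _ "B + B'"]) (meson add_mono norm_triangle_ineq order_trans)
qed

lemma trig_poly_bounded: "trig_poly f \<Longrightarrow> \<exists>B. \<forall>t. norm (f t) \<le> B"
proof (induction rule: trig_poly.induct)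
  case (base k \<phi> x)
  show ?case by (intro exI[of _ "norm x"]) (auto intro!: mult_left_le_one_le)
next
  case (add f f')
  then obtain B B' where "\<forall>t. norm (f t) \<le> B" "\<forall>t. norm (f' t) \<le> B'"
    by auto
  then show ?case
    by (intro exI[of _ "B + B'"]) (meson add_mono norm_triangle_ineq order_trans)
qed

lemma trig_poly_const: "trig_poly (\<lambda>t. x)"
  using trig_poly.base[of 0 0 x] by simp

section \<open>Modulation of trigonometric polynomials by high frequencies\<close>

lemma product_to_sum:
  fixes x :: "'a::real_vector"
  shows "cos (a + b) *\<^sub>R ((1/2) *\<^sub>R x) + cos (a - b) *\<^sub>R ((1/2) *\<^sub>R x) = cos a *\<^sub>R cos b *\<^sub>R x"
    and "sin (a + b) *\<^sub>R ((1/2) *\<^sub>R x) + sin (a - b) *\<^sub>R ((1/2) *\<^sub>R x) = sin a *\<^sub>R cos b *\<^sub>R x"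
  unfolding scaleR_scaleR scaleR_left_distrib[symmetric]
  by (simp_all add: cos_add cos_diff sin_add sin_diff field_simps)

text \<open>Once the carrier frequency exceeds every frequency of \<open>v\<close>, the product
  contains positive frequencies only, and conjugation acts on the carrier alone. The threshold does
  not depend on the phase \<open>s\<close>, which makes it possible to average over \<open>s\<close>
  later.\<close>

lemma conj_pair_modulate:
  "trig_poly v \<Longrightarrow> \<exists>m0>0. \<forall>m\<ge>m0. \<forall>s. conj_pair (\<lambda>t. cos (real m * t + s) *\<^sub>R v t) (\<lambda>t. sin (real m * t + s) *\<^sub>R v t)"
proof (induction rule: trig_poly.induct)
  case (base k \<phi> x)
  show ?case
  \<comment> \<open>\<open>m \<ge> Suc k\<close> keeps the difference frequency \<open>m - k\<close>
    positive.\<close>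
  proof (intro exI[of _ "Suc k"] conjI allI impI)
    fix m s assume m: "Suc k \<le> m"
    have "conj_pair (\<lambda>t. cos (real (m + k) * t + (s + \<phi>)) *\<^sub>R ((1/2) *\<^sub>R x) + cos (real (m - k) * t + (s - \<phi>)) *\<^sub>R ((1/2) *\<^sub>R x))
       (\<lambda>t. sin (real (m + k) * t + (s + \<phi>)) *\<^sub>R ((1/2) *\<^sub>R x) + sin (real (m - k) * t + (s - \<phi>)) *\<^sub>R ((1/2) *\<^sub>R x))"
      using m by (intro conj_pair.add conj_pair.base) auto
    moreover have "cos (real (m + k) * t + (s + \<phi>)) *\<^sub>R ((1/2) *\<^sub>R x) + cos (real (m - k) * t + (s - \<phi>)) *\<^sub>R ((1/2) *\<^sub>R x)
        = cos (real m * t + s) *\<^sub>R cos (real k * t + \<phi>) *\<^sub>R x" for t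
    proof -
      have e: "real (m + k) * t + (s + \<phi>) = (real m * t + s) + (real k * t + \<phi>)"
           "real (m - k) * t + (s - \<phi>) = (real m * t + s) - (real k * t + \<phi>)"
        using m by (auto simp: algebra_simps of_nat_diff)
      show ?thesis
        unfolding e by (rule product_to_sum)
    qed
    moreover have "sin (real (m + k) * t + (s + \<phi>)) *\<^sub>R ((1/2) *\<^sub>R x) + sin (real (m - k) * t + (s - \<phi>)) *\<^sub>R ((1/2) *\<^sub>R x)
        = sin (real m * t + s) *\<^sub>R cos (real k * t + \<phi>) *\<^sub>R x" for t
    proof -
      have e: "real (m + k) * t + (s + \<phi>) = (real m * t + s) + (real k * t + \<phi>)"
           "real (m - k) * t + (s - \<phi>) = (real m * t + s) - (real k * t + \<phi>)"
        using m by (auto simp: algebra_simps of_nat_diff)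
      show ?thesis
        unfolding e by (rule product_to_sum)
    qed
    ultimately show "conj_pair (\<lambda>t. cos (real m * t + s) *\<^sub>R cos (real k * t + \<phi>) *\<^sub>R x)
       (\<lambda>t. sin (real m * t + s) *\<^sub>R cos (real k * t + \<phi>) *\<^sub>R x)" by simp
  qed auto
next
  case (add f f')
  then obtain m0 m1 where "0 < m0"
    "\<forall>m\<ge>m0. \<forall>s. conj_pair (\<lambda>t. cos (real m * t + s) *\<^sub>R f t) (\<lambda>t. sin (real m * t + s) *\<^sub>R f t)"
    "\<forall>m\<ge>m1. \<forall>s. conj_pair (\<lambda>t. cos (real m * t + s) *\<^sub>R f' t) (\<lambda>t. sin (real m * t + s) *\<^sub>R f' t)"
    by blast
  then show ?case
    by (intro exI[of _ "max m0 m1"]) (auto simp: scaleR_right_distrib intro!: conj_pair.add)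
qed

lemma conj_pair_compose_modulate:
  assumes "conj_pair \<xi> \<xi>'" "trig_poly v"
  shows "\<exists>m0. \<forall>m\<ge>m0. \<forall>s. conj_pair (\<lambda>t. \<xi> (real m * t + s) *\<^sub>R v t) (\<lambda>t. \<xi>' (real m * t + s) *\<^sub>R v t)"
  using assms
proof (induction rule: conj_pair.induct)
  case (base k \<phi> x)
  have "trig_poly (\<lambda>t. x *\<^sub>R v t)"
    using base.prems
  proof (induction rule: trig_poly.induct)
    case (base k \<phi> y)
    then show ?case using trig_poly.base[of k \<phi> "x *\<^sub>R y"] by (simp add: mult.commute)
  next
    case (add f f')
    then show ?case by (simp add: scaleR_right_distrib trig_poly.add)
  qed
  from conj_pair_modulate[OF this] obtain m0 where m0: "\<forall>m\<ge>m0. \<forall>s.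
      conj_pair (\<lambda>t. cos (real m * t + s) *\<^sub>R x *\<^sub>R v t) (\<lambda>t. sin (real m * t + s) *\<^sub>R x *\<^sub>R v t)"
    by blast
  show ?case
  proof (intro exI[of _ m0] allI impI)
    fix m s assume m: "m0 \<le> m"
    \<comment> \<open>Every frequency of \<open>\<xi>\<close> is at least 1, so the substitution of
      \<open>m * t + s\<close> moves all of them beyond the threshold.\<close>
    have "1 * m \<le> k * m" using base.hyps by (intro mult_le_mono1) auto
    with m have "m0 \<le> k * m" by linarith
    then have "conj_pair (\<lambda>t. cos (real (k * m) * t + (real k * s + \<phi>)) *\<^sub>R x *\<^sub>R v t)
         (\<lambda>t. sin (real (k * m) * t + (real k * s + \<phi>)) *\<^sub>R x *\<^sub>R v t)"
      using m0 by blast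
    then show "conj_pair (\<lambda>t. (cos (real k * (real m * t + s) + \<phi>) *\<^sub>R x) *\<^sub>R v t)
         (\<lambda>t. (sin (real k * (real m * t + s) + \<phi>) *\<^sub>R x) *\<^sub>R v t)"
      by (simp add: algebra_simps)
  qed
next
  case (add f g f' g')
  then obtain m0 m1 where
    "\<forall>m\<ge>m0. \<forall>s. conj_pair (\<lambda>t. f (real m * t + s) *\<^sub>R v t) (\<lambda>t. g (real m * t + s) *\<^sub>R v t)"
    "\<forall>m\<ge>m1. \<forall>s. conj_pair (\<lambda>t. f' (real m * t + s) *\<^sub>R v t) (\<lambda>t. g' (real m * t + s) *\<^sub>R v t)"
    by blast
  then show ?case
    by (intro exI[of _ "max m0 m1"]) (auto simp: scaleR_left_distrib intro!: conj_pair.add)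
qed

text \<open>The difference of two frequencies may be negative; evenness of the cosine reflects it
  and reverses the phase. Trigonometric polynomials thus form an algebra, as Stone-Weierstrass and
  the selection of a maximiser require.\<close>

lemma trig_poly_real_mult:
  fixes f g :: "real \<Rightarrow> real"
  assumes "trig_poly f" "trig_poly v"
  shows "trig_poly (\<lambda>t. f t *\<^sub>R v t)"
  using assms
proof (induction rule: trig_poly.induct)
  case (base k \<phi> x)
  from base.prems show ?case
  proof (induction rule: trig_poly.induct)
    case (base l \<psi> y)
    have *: "trig_poly (\<lambda>t. cos (real_of_int j * t + \<phi>) *\<^sub>R y)" for j \<phi> and y :: 'a
    proof (cases "0 \<le> j")
      case True
      then show ?thesis using trig_poly.base[of "nat j" \<phi> y] by simp
    next
      case False
      then have "real_of_int j * t + \<phi> = - (real (nat (- j)) * t + (- \<phi>))" for t by simp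
      then have "cos (real_of_int j * t + \<phi>) = cos (real (nat (- j)) * t + (- \<phi>))" for t
        by (metis cos_minus)
      then show ?thesis using trig_poly.base[of "nat (-j)" "-\<phi>" y] by simp
    qed
    have "trig_poly (\<lambda>t. cos (real_of_int (int k + int l) * t + (\<phi> + \<psi>)) *\<^sub>R ((x/2) *\<^sub>R y)
        + cos (real_of_int (int k - int l) * t + (\<phi> - \<psi>)) *\<^sub>R ((x/2) *\<^sub>R y))"
      by (intro trig_poly.add *)
    moreover have "cos (real_of_int (int k + int l) * t + (\<phi> + \<psi>)) *\<^sub>R ((x/2) *\<^sub>R y)
        + cos (real_of_int (int k - int l) * t + (\<phi> - \<psi>)) *\<^sub>R ((x/2) *\<^sub>R y)
       = (cos (real k * t + \<phi>) *\<^sub>R x) *\<^sub>R cos (real l * t + \<psi>) *\<^sub>R y" for t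
    proof -
      have e: "real_of_int (int k + int l) * t + (\<phi> + \<psi>) = (real k * t + \<phi>) + (real l * t + \<psi>)"
           "real_of_int (int k - int l) * t + (\<phi> - \<psi>) = (real k * t + \<phi>) - (real l * t + \<psi>)"
        by (auto simp: algebra_simps)
      show ?thesis
        unfolding e by (simp add: cos_add cos_diff scaleR_left_distrib[symmetric]) (simp add: field_simps)
    qed
    ultimately show ?case by simp
  next
    case (add f f')
    then show ?case by (simp add: scaleR_right_distrib trig_poly.add)
  qed
next
  case (add f f')
  then show ?case by (simp add: scaleR_left_distrib trig_poly.add)
qed

text \<open>The Banach space may be nonseparable, so measurability of vector-valued random variables is
  expressed by real coordinates with respect to finitely many vectors.\<close>

lemma measurable_finite_span:
  fixes x :: "nat \<Rightarrow> 'a::real_normed_vector" and h :: "'a \<Rightarrow> 'b::topological_space"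
  assumes a: "\<And>i. i < n \<Longrightarrow> a i \<in> borel_measurable M" and h: "continuous_on UNIV h"
  shows "(\<lambda>\<omega>. h (\<Sum>i<n. a i \<omega> *\<^sub>R x i)) \<in> borel_measurable M"
proof -
  \<comment> \<open>Padding by zeros gives a map into the real sequences, a second countable space
    whose Borel sets come from the coordinates. The vectors enter through a continuous map on that
    space.\<close>
  define b where "b = (\<lambda>\<omega> i. if i < n then a i \<omega> else 0)"
  have b: "b \<in> borel_measurable M"
  proof (rule measurable_coordinatewise_then_product)
    show "(\<lambda>\<omega>. b \<omega> i) \<in> borel_measurable M" for i
      by (cases "i < n") (simp_all add: b_def a)
  qed
  have "continuous_on UNIV (\<lambda>c::nat \<Rightarrow> real. \<Sum>i<n. c i *\<^sub>R x i)"
    by (intro continuous_intros continuous_on_product_coordinates)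
  then have "continuous_on UNIV (\<lambda>c::nat \<Rightarrow> real. h (\<Sum>i<n. c i *\<^sub>R x i))"
    by (rule continuous_on_compose2[OF h]) auto
  then have "(\<lambda>\<omega>. h (\<Sum>i<n. b \<omega> i *\<^sub>R x i)) \<in> borel_measurable M"
    by (rule borel_measurable_continuous_on[OF _ b])
  moreover have "(\<Sum>i<n. b \<omega> i *\<^sub>R x i) = (\<Sum>i<n. a i \<omega> *\<^sub>R x i)" for \<omega>
    by (intro sum.cong) (auto simp: b_def)
  ultimately show ?thesis by simp
qed

section \<open>The Hilbert transform of sampled functions\<close>

text \<open>\<open>- 2 * logsin (t - s)\<close> is a primitive in \<open>s\<close> of the kernel
  \<open>cot ((t - s) / 2)\<close> on both sides of the singularity. That \<open>logsin\<close> is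
  even produces the cancellation in the principal value.\<close>

definition logsin :: "real \<Rightarrow> real" where
  "logsin u = ln \<bar>sin (u / 2)\<bar>"

definition grid :: "nat \<Rightarrow> nat \<Rightarrow> real" where
  "grid J l = - pi + 2 * pi * real l / real J"

text \<open>The hypotheses keep \<open>t\<close> and its translates by \<open>2 * pi\<close> off the
  interval. The sine has a constant sign there, so the absolute value in \<open>logsin\<close> can
  be resolved.\<close>

lemma has_integral_cot:
  fixes t :: real
  assumes "a \<le> b" and t: "t < a \<or> b < t" "\<bar>t - a\<bar> < 2 * pi" "\<bar>t - b\<bar> < 2 * pi"
  shows "((\<lambda>s. cot ((t - s) / 2)) has_integral 2 * (logsin (t - a) - logsin (t - b))) {a..b}"
proof -
  have "((\<lambda>s. cot ((t - s) / 2)) has_integral (- 2 * logsin (t - b)) - (- 2 * logsin (t - a))) {a..b}"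
  proof (rule fundamental_theorem_of_calculus)
    fix s assume s: "s \<in> {a..b}"
    have "((\<lambda>s. - 2 * logsin (t - s)) has_real_derivative cot ((t - s) / 2)) (at s within {a..b})"
    proof (cases "s < t")
      case True
      with s t have pos: "0 < sin ((t - s') / 2)" if "s' \<in> {a..b}" for s'
        using that by (intro sin_gt_zero) auto
      have "((\<lambda>s. - 2 * ln (sin ((t - s) / 2))) has_real_derivative cot ((t - s) / 2)) (at s within {a..b})"
        using pos[OF s] by (auto intro!: derivative_eq_intros simp: cot_def field_simps)
      then show ?thesis
        by (rule has_field_derivative_transform_within[OF _ zero_less_one s]) (use pos in \<open>auto simp: logsin_def abs_of_pos\<close>)
    next
      case False
      with s t have pos: "0 < sin ((s' - t) / 2)" if "s' \<in> {a..b}" for s'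
        using that by (intro sin_gt_zero) auto
      have eq: "sin ((t - s') / 2) = - sin ((s' - t) / 2)" "cos ((t - s') / 2) = cos ((s' - t) / 2)" for s'
      proof -
        have "(t - s') / 2 = - ((s' - t) / 2)" by (simp add: field_simps)
        then show "sin ((t - s') / 2) = - sin ((s' - t) / 2)" "cos ((t - s') / 2) = cos ((s' - t) / 2)"
          by (metis sin_minus, metis cos_minus)
      qed
      have "((\<lambda>s. - 2 * ln (sin ((s - t) / 2))) has_real_derivative cot ((t - s) / 2)) (at s within {a..b})"
        using pos[OF s] unfolding cot_def eq by (auto intro!: derivative_eq_intros simp: field_simps)
      then show ?thesis
        by (rule has_field_derivative_transform_within[OF _ zero_less_one s]) (use pos in \<open>auto simp: logsin_def eq abs_of_pos\<close>)
    qed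
    then show "((\<lambda>s. - 2 * logsin (t - s)) has_vector_derivative cot ((t - s) / 2)) (at s within {a..b})"
      by (simp add: has_real_derivative_iff_has_vector_derivative)
  qed fact
  then show ?thesis by (simp add: algebra_simps)
qed

text \<open>Passes between the closed intervals of the fundamental theorem of calculus and the
  half-open cells of step functions.\<close>

lemma has_integral_off_point:
  fixes f :: "real \<Rightarrow> 'a::banach"
  assumes "(f has_integral i) S" and eq: "S - {b} = T - {b}"
  shows "(f has_integral i) T"
proof -
  have "S - T \<subseteq> {b}" "T - S \<subseteq> {b}" using eq by auto
  then have "(f has_integral i) S \<longleftrightarrow> (f has_integral i) T"
    by (intro has_integral_spike_set_eq negligible_subset[OF negligible_sing[of b]]) auto
  with assms show ?thesis by simp
qed

text \<open>If \<open>t\<close> lies inside, the cut points \<open>t - \<epsilon>\<close> and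
  \<open>t + \<epsilon>\<close> contribute the same value of the even function \<open>logsin\<close>
  with opposite signs. The truncated integral is therefore independent of \<open>\<epsilon>\<close>:
  the principal value is attained, not merely approached.\<close>

lemma has_integral_cot_truncated:
  fixes t :: real
  assumes ab: "a < b" "-pi \<le> a" "b \<le> pi" and t: "-pi < t" "t < pi" and e: "0 < \<epsilon>"
    and far: "\<epsilon> \<le> \<bar>t - a\<bar>" "\<epsilon> \<le> \<bar>t - b\<bar>"
  shows "((\<lambda>s. cot ((t - s) / 2)) has_integral 2 * (logsin (t - a) - logsin (t - b)))
           {s \<in> {a..<b}. \<epsilon> \<le> \<bar>t - s\<bar>}"
proof -
  let ?f = "\<lambda>s. cot ((t - s) / 2)"
  consider "t < a" | "b < t" | "a < t" "t < b" using e far by fastforce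
  then show ?thesis
  proof cases
    case 3
    have 1: "(?f has_integral 2 * (logsin (t - a) - logsin (t - (t - \<epsilon>)))) {a..t-\<epsilon>}"
      using 3 far e ab t by (intro has_integral_cot) auto
    have 2: "(?f has_integral 2 * (logsin (t - (t + \<epsilon>)) - logsin (t - b))) {t+\<epsilon>..b}"
      using 3 far e ab t by (intro has_integral_cot) auto
    have "{a..t-\<epsilon>} \<inter> {t+\<epsilon>..b} = {}" using e by auto
    then have "(?f has_integral 2 * (logsin (t - a) - logsin (t - (t - \<epsilon>))) + 2 * (logsin (t - (t + \<epsilon>)) - logsin (t - b)))
       ({a..t-\<epsilon>} \<union> {t+\<epsilon>..b})"
      by (intro has_integral_Un[OF 1 2]) auto
    moreover have "logsin (t - (t - \<epsilon>)) = logsin (t - (t + \<epsilon>))" by (simp add: logsin_def)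
    ultimately have "(?f has_integral 2 * (logsin (t - a) - logsin (t - b))) ({a..t-\<epsilon>} \<union> {t+\<epsilon>..b})"
      by (simp add: algebra_simps)
    then show ?thesis
      by (rule has_integral_off_point[of _ _ _ b]) (use 3 far e in auto)
  next
    case 1
    then have "(?f has_integral 2 * (logsin (t - a) - logsin (t - b))) {a..b}"
      using ab t by (intro has_integral_cot) auto
    then show ?thesis
      by (rule has_integral_off_point[of _ _ _ b]) (use 1 far in auto)
  next
    case 2
    then have "(?f has_integral 2 * (logsin (t - a) - logsin (t - b))) {a..b}"
      using ab t by (intro has_integral_cot) auto
    then show ?thesis
      by (rule has_integral_off_point[of _ _ _ b]) (use 2 far in auto)
  qed
qed

section \<open>Step functions on a uniform grid of the circle\<close>

lemma grid_simps:
  assumes "0 < J"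
  shows "grid J 0 = -pi" "grid J J = pi" "grid J l < grid J (Suc l)" "-pi \<le> grid J l"
    "l \<le> J \<Longrightarrow> grid J l \<le> pi" "grid J (Suc l) = grid J l + 2 * pi / real J"
proof -
  show "l \<le> J \<Longrightarrow> grid J l \<le> pi"
    using assms mult_left_mono[of "real l" "real J" "2 * pi"] by (simp add: grid_def field_simps)
qed (use assms in \<open>auto simp: grid_def field_simps\<close>)

definition sample_index :: "nat \<Rightarrow> real \<Rightarrow> nat" where
  "sample_index J t = nat \<lfloor>(t + pi) * real J / (2 * pi)\<rfloor>"

lemma mem_grid_cell:
  assumes J: "0 < J" and t: "-pi \<le> t"
  shows "t \<in> {grid J l..<grid J (Suc l)} \<longleftrightarrow> l = sample_index J t"
proof -
  have "t \<in> {grid J l..<grid J (Suc l)} \<longleftrightarrow> real l \<le> (t + pi) * real J / (2 * pi) \<and> (t + pi) * real J / (2 * pi) < real l + 1"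
    using J by (auto simp: grid_def field_simps)
  also have "\<dots> \<longleftrightarrow> \<lfloor>(t + pi) * real J / (2 * pi)\<rfloor> = int l" by (auto simp: floor_eq_iff)
  also have "\<dots> \<longleftrightarrow> l = sample_index J t"
  proof -
    have "0 \<le> (t + pi) * real J / (2 * pi)" using t by simp
    then show ?thesis unfolding sample_index_def by (auto simp: nat_eq_iff)
  qed
  finally show ?thesis .
qed

lemma sample_index_less:
  assumes J: "0 < J" and t: "t \<in> {-pi..<pi}"
  shows "sample_index J t < J"
proof -
  have "(t + pi) * real J / (2 * pi) < real J"
    using t J by (auto simp: field_simps)
  moreover have "0 \<le> (t + pi) * real J / (2 * pi)"
    using t by (intro divide_nonneg_pos mult_nonneg_nonneg) auto
  ultimately
  show ?thesis unfolding sample_index_def by (simp add: nat_less_iff floor_less_iff)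
qed

lemma sum_cells:
  fixes x :: "nat \<Rightarrow> 'a::real_vector"
  assumes J: "0 < J" and t: "t \<in> {-pi..<pi}"
  shows "(\<Sum>l<J. indicator {grid J l..<grid J (Suc l)} t *\<^sub>R x l) = x (sample_index J t)"
proof -
  have "(\<Sum>l<J. indicator {grid J l..<grid J (Suc l)} t *\<^sub>R x l) = (\<Sum>l<J. if l = sample_index J t then x l else 0)"
    using mem_grid_cell[OF J] t by (intro sum.cong) (auto simp: indicator_def)
  then show ?thesis using sample_index_less[OF assms] by simp
qed

lemma dist_sample:
  assumes J: "0 < J" and t: "t \<in> {-pi..<pi}"
  shows "\<bar>grid J (sample_index J t) - t\<bar> \<le> 2 * pi / real J"
proof -
  have "t \<in> {grid J (sample_index J t)..<grid J (Suc (sample_index J t))}"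
    using mem_grid_cell[OF J, of t "sample_index J t"] t by auto
  then show ?thesis using grid_simps(6)[OF J] by auto
qed

definition sample_hold :: "nat \<Rightarrow> (real \<Rightarrow> 'a::real_vector) \<Rightarrow> real \<Rightarrow> 'a" where
  "sample_hold J f t = (\<Sum>l<J. indicator {grid J l..<grid J (Suc l)} t *\<^sub>R f (grid J l))"

text \<open>The exact Hilbert transform of \<open>sample_hold J f\<close> away from the grid: each
  cell contributes the difference of the primitive at its ends, and the factor 2 of the primitive
  cancels against \<open>1 / (2 * pi)\<close>.\<close>

definition hilbert_sample :: "nat \<Rightarrow> (real \<Rightarrow> 'a::real_vector) \<Rightarrow> real \<Rightarrow> 'a" where
  "hilbert_sample J f t =
     (\<Sum>l<J. ((logsin (t - grid J l) - logsin (t - grid J (Suc l))) / pi) *\<^sub>R f (grid J l))"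

lemma step_function_sample_hold: "0 < J \<Longrightarrow> step_function (sample_hold J f)"
  unfolding step_function_def
  by (rule exI[of _ J], rule exI[of _ "\<lambda>l. {grid J l..<grid J (Suc l)}"], rule exI[of _ "\<lambda>l. f (grid J l)"])
     (auto simp: sample_hold_def is_interval_co intro: order_trans[OF grid_simps(4)]
        less_le_trans[OF _ grid_simps(5)] grid_simps(5))

lemma has_integral_sample_hold:
  fixes f :: "real \<Rightarrow> 'a::banach"
  assumes J: "0 < J" and t: "-pi < t" "t < pi" and e: "0 < \<epsilon>"
    and far: "\<And>l. l \<le> J \<Longrightarrow> \<epsilon> \<le> \<bar>t - grid J l\<bar>"
  shows "((\<lambda>s. cot ((t - s) / 2) *\<^sub>R sample_hold J f s) has_integral (2 * pi) *\<^sub>R hilbert_sample J f t)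
           {s \<in> {-pi..<pi}. \<epsilon> \<le> \<bar>t - s\<bar>}"
proof -
  let ?A = "{s \<in> {-pi..<pi}. \<epsilon> \<le> \<bar>t - s\<bar>}"
  let ?I = "\<lambda>l. {grid J l..<grid J (Suc l)}"
  have "((\<lambda>s. \<Sum>l<J. (if s \<in> ?I l then cot ((t - s) / 2) else 0) *\<^sub>R f (grid J l)) has_integral
     (\<Sum>l<J. (2 * (logsin (t - grid J l) - logsin (t - grid J (Suc l)))) *\<^sub>R f (grid J l))) ?A"
  proof (intro has_integral_sum has_integral_scaleR_left)
    fix l assume "l \<in> {..<J}"
    then have l: "l < J" by simp
    have "((\<lambda>s. cot ((t - s) / 2)) has_integral 2 * (logsin (t - grid J l) - logsin (t - grid J (Suc l))))
       {s \<in> ?I l. \<epsilon> \<le> \<bar>t - s\<bar>}"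
      using l J t e far[of l] far[of "Suc l"] grid_simps(3)[OF J, of l] grid_simps(4)[OF J, of l] grid_simps(5)[OF J, of "Suc l"]
      by (intro has_integral_cot_truncated) auto
    moreover have "{s \<in> ?I l. \<epsilon> \<le> \<bar>t - s\<bar>} \<subseteq> ?A"
      using l grid_simps(4)[OF J, of l] grid_simps(5)[OF J, of "Suc l"] by auto
    ultimately have "((\<lambda>s. if s \<in> {s \<in> ?I l. \<epsilon> \<le> \<bar>t - s\<bar>} then cot ((t - s) / 2) else 0)
        has_integral 2 * (logsin (t - grid J l) - logsin (t - grid J (Suc l)))) ?A"
      by (subst has_integral_restrict) auto
    then show "((\<lambda>s. if s \<in> ?I l then cot ((t - s) / 2) else 0)
        has_integral 2 * (logsin (t - grid J l) - logsin (t - grid J (Suc l)))) ?A"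
      by (rule has_integral_eq[rotated]) auto
  qed auto
  then show ?thesis
    by (rule has_integral_eq_rhs[OF has_integral_eq[rotated]])
       (auto simp: sample_hold_def hilbert_sample_def scaleR_right.sum scaleR_sum_right indicator_def
         intro!: sum.cong)
qed

lemma hilbert_transform_sample_hold:
  fixes f :: "real \<Rightarrow> 'a::banach"
  assumes J: "0 < J" and t: "-pi < t" "t < pi" and off: "\<And>l. l \<le> J \<Longrightarrow> t \<noteq> grid J l"
  shows "hilbert_transform (sample_hold J f) t = hilbert_sample J f t"
proof -
  define \<rho> where "\<rho> = Min ((\<lambda>l. \<bar>t - grid J l\<bar>) ` {..J})"
  have \<rho>0: "0 < \<rho>" unfolding \<rho>_def using off by (subst Min_gr_iff) auto
  have \<rho>: "\<rho> \<le> \<bar>t - grid J l\<bar>" if "l \<le> J" for l unfolding \<rho>_def using that by (intro Min_le) auto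
  \<comment> \<open>Since \<open>- pi\<close> and \<open>pi\<close> are grid points,
    \<open>\<epsilon> < \<rho>\<close> also makes the cut-off at \<open>2 * pi - \<epsilon>\<close>
    vacuous: no point of the period is that close to \<open>t\<close> across the end.\<close>
  have edge: "\<rho> \<le> pi - \<bar>t\<bar>" using \<rho>[of 0] \<rho>[of J] grid_simps[OF J] t by auto
  have "eventually (\<lambda>\<epsilon>. integral {s \<in> {-pi..<pi}. \<epsilon> \<le> \<bar>t - s\<bar> \<and> \<bar>t - s\<bar> \<le> 2 * pi - \<epsilon>}
         (\<lambda>s. cot ((t - s) / 2) *\<^sub>R sample_hold J f s) = (2 * pi) *\<^sub>R hilbert_sample J f t) (at_right 0)"
    using eventually_at_right_less[of 0] eventually_at_right_real[OF \<rho>0]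
  proof eventually_elim
    case (elim \<epsilon>)
    then have "{s \<in> {-pi..<pi}. \<epsilon> \<le> \<bar>t - s\<bar> \<and> \<bar>t - s\<bar> \<le> 2 * pi - \<epsilon>} = {s \<in> {-pi..<pi}. \<epsilon> \<le> \<bar>t - s\<bar>}"
      using edge by auto
    moreover have "\<epsilon> \<le> \<bar>t - grid J l\<bar>" if "l \<le> J" for l using \<rho>[OF that] elim by simp
    ultimately show ?case
      using elim by (simp only:) (intro integral_unique has_integral_sample_hold[OF J t], auto)
  qed
  then have "((\<lambda>\<epsilon>. integral {s \<in> {-pi..<pi}. \<epsilon> \<le> \<bar>t - s\<bar> \<and> \<bar>t - s\<bar> \<le> 2 * pi - \<epsilon>}
         (\<lambda>s. cot ((t - s) / 2) *\<^sub>R sample_hold J f s)) \<longlongrightarrow> (2 * pi) *\<^sub>R hilbert_sample J f t) (at_right 0)"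
    by (rule tendsto_eventually)
  then have "Lim (at_right 0) (\<lambda>\<epsilon>. integral {s \<in> {-pi..<pi}. \<epsilon> \<le> \<bar>t - s\<bar> \<and> \<bar>t - s\<bar> \<le> 2 * pi - \<epsilon>}
         (\<lambda>s. cot ((t - s) / 2) *\<^sub>R sample_hold J f s)) = (2 * pi) *\<^sub>R hilbert_sample J f t"
    by (intro tendsto_Lim) auto
  then show ?thesis unfolding hilbert_transform_def by simp
qed

section \<open>Pointwise convergence of the transforms of sampled functions\<close>

lemma cot_bound:
  assumes t: "-pi < t" "t < pi"
  shows "\<exists>C>0. \<forall>s\<in>{-pi..<pi}. \<bar>cot ((t - s) / 2)\<bar> * \<bar>t - s\<bar> \<le> C"
proof -
  \<comment> \<open>A bound for \<open>\<bar>t - s\<bar> / 2\<close> over the period. As it is below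
    \<open>pi\<close>, \<open>sinc\<close> has a positive minimum \<open>m\<close> on
    \<open>{-R..R}\<close>, and \<open>2 / m\<close> serves as the constant.\<close>
  define R where "R = (pi + \<bar>t\<bar>) / 2"
  have R: "0 < R" "R < pi" using t by (auto simp: R_def)
  have "\<exists>x\<in>{-R..R}. \<forall>y\<in>{-R..R}. sinc x \<le> sinc y"
    using R by (intro continuous_attains_inf continuous_on_sinc continuous_on_id) auto
  then obtain x where x: "x \<in> {-R..R}" "\<And>y. y \<in> {-R..R} \<Longrightarrow> sinc x \<le> sinc y" by blast
  define m where "m = sinc x"
  have m0: "0 < m"
  proof -
    consider "x = 0" | "0 < x" | "x < 0" by linarith
    then show ?thesis
    proof cases
      case 2
      then have "0 < sin x" using x(1) R by (intro sin_gt_zero) auto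
      then show ?thesis using 2 by (simp add: m_def)
    next
      case 3
      then have "0 < sin (-x)" using x(1) R by (intro sin_gt_zero) auto
      then show ?thesis using 3 by (simp add: m_def divide_neg_neg)
    qed (simp add: m_def)
  qed
  have "\<bar>cot ((t - s) / 2)\<bar> * \<bar>t - s\<bar> \<le> 2 / m" if s: "s \<in> {-pi..<pi}" for s
  proof (cases "t = s")
    case False
    define y where "y = (t - s) / 2"
    have y0: "y \<noteq> 0" using False by (simp add: y_def)
    have "\<bar>t - s\<bar> \<le> pi + \<bar>t\<bar>" using s by auto
    then have "y \<in> {-R..R}" by (auto simp: y_def R_def abs_le_iff field_simps)
    then have "m \<le> sinc y" unfolding m_def by (rule x(2))
    then have "m \<le> sin y / y" using y0 by simp
    then have "m \<le> \<bar>sin y\<bar> / \<bar>y\<bar>" by (metis abs_divide abs_ge_self order_trans)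
    then have my: "m * \<bar>y\<bar> \<le> \<bar>sin y\<bar>" using y0 by (simp add: field_simps)
    then have "0 < \<bar>sin y\<bar>" using m0 y0 by (smt (verit) mult_pos_pos)
    then have "\<bar>cot y\<bar> * \<bar>y\<bar> \<le> 1 / m"
      using my m0 mult_mono[OF abs_cos_le_one[of y] my]
      by (auto simp: cot_def field_simps abs_mult)
    then show ?thesis by (simp add: y_def abs_mult field_simps)
  qed (use m0 in auto)
  then show ?thesis using m0 by (intro exI[of _ "2 / m"]) auto
qed

text \<open>The singularity of order 2/3 that remains when, on the range
  \<open>\<bar>t - s\<bar> \<ge> 1 / J ^ 3\<close>, a sampling error of size \<open>1 / J\<close> is
  estimated by the cube root of \<open>\<bar>t - s\<bar>\<close>.\<close>

lemma integrable_inverse_root: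
  "(\<lambda>s::real. 1 / (root 3 (t - s))\<^sup>2) integrable_on {-pi..<pi}"
proof -
  have "((\<lambda>s::real. 1 / (root 3 (t - s))\<^sup>2) has_integral (- 3 * root 3 (t - pi)) - (- 3 * root 3 (t - (- pi)))) {-pi..pi}"
  proof (rule fundamental_theorem_of_calculus_interior_strong[of "{t}"])
    fix s assume s: "s \<in> {- pi<..<pi} - {t}"
    then have "((\<lambda>s. - 3 * root 3 (t - s)) has_real_derivative - 3 * (inverse (real 3 * root 3 (t - s) ^ (3 - Suc 0)) * (0 - 1))) (at s)"
      by (intro DERIV_cmult DERIV_chain2[OF DERIV_odd_real_root] DERIV_diff) auto
    then show "((\<lambda>s. - 3 * root 3 (t - s)) has_vector_derivative 1 / (root 3 (t - s))\<^sup>2) (at s)"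
      by (simp add: has_real_derivative_iff_has_vector_derivative[symmetric] power2_eq_square field_simps)
  qed (auto intro!: continuous_intros)
  then have "((\<lambda>s::real. 1 / (root 3 (t - s))\<^sup>2) has_integral (- 3 * root 3 (t - pi)) - (- 3 * root 3 (t - (- pi)))) {-pi..<pi}"
    by (rule has_integral_off_point[of _ _ _ pi]) auto
  then show ?thesis by blast
qed

lemma has_integral_cis:
  "((\<lambda>s. cis (real k * s)) has_integral (if k = 0 then 2 * of_real pi else 0)) {-pi..pi}"
proof (cases "k = 0")
  case True
  then show ?thesis
    using has_integral_const_real[of "1::complex" "-pi" pi] by (simp add: scaleR_conv_of_real)
next
  case False
  have "((\<lambda>s. cis (real k * s)) has_integral cis (real k * pi) / (\<i> * of_nat k) - cis (real k * (-pi)) / (\<i> * of_nat k)) {-pi..pi}"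
  proof (rule fundamental_theorem_of_calculus)
    fix s :: real assume "s \<in> {-pi..pi}"
    have "((\<lambda>z. exp (\<i> * of_nat k * z) / (\<i> * of_nat k)) has_field_derivative exp (\<i> * of_nat k * of_real s)) (at (of_real s))"
      using False by (auto intro!: derivative_eq_intros)
    then have "((\<lambda>s. exp (\<i> * of_nat k * of_real s) / (\<i> * of_nat k)) has_vector_derivative exp (\<i> * of_nat k * of_real s)) (at s within {-pi..pi})"
      by (rule has_vector_derivative_real_field)
    then show "((\<lambda>s. cis (real k * s) / (\<i> * of_nat k)) has_vector_derivative cis (real k * s)) (at s within {-pi..pi})"
      by (simp add: cis_conv_exp mult_ac)
  qed simp
  moreover have "cis (real k * pi) = cis (real k * (-pi))" by (simp add: complex_eq_iff)
  ultimately show ?thesis using False by simp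
qed

text \<open>The identity \<open>cot ((t - s) / 2) * (cis t - cis s) = \<i> * (cis t + cis s)\<close>
  removes the singularity, because \<open>cis t - cis s\<close> divides the difference of the
  \<open>k\<close>-th powers. What remains is a trigonometric polynomial in \<open>s\<close> with
  frequencies between 0 and \<open>k\<close>.\<close>

lemma cot_times_cos_diff:
  assumes "sin ((t - s) / 2) \<noteq> 0"
  shows "cot ((t - s) / 2) * (cos (real k * s + \<phi>) - cos (real k * t + \<phi>)) =
    Re (cis \<phi> * (- \<i> * (\<Sum>j<k. cis (real (k - j) * t) * cis (real j * s) + cis (real (k - 1 - j) * t) * cis (real (Suc j) * s))))"
proof -
  let ?S = "cis s" and ?T = "cis t"
  have half: "?T = cis ((t + s) / 2) * cis ((t - s) / 2)" "?S = cis ((t + s) / 2) * cis (- ((t - s) / 2))"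
    by (simp_all add: cis_mult add_divide_distrib diff_divide_distrib)
  have key: "of_real (cot ((t - s) / 2)) * (?T - ?S) = \<i> * (?T + ?S)"
  proof -
    have "of_real (cos ((t - s) / 2)) * (?T - ?S) = of_real (sin ((t - s) / 2)) * (\<i> * (?T + ?S))"
      unfolding half by (simp add: complex_eq_iff algebra_simps)
    then show ?thesis using assms by (simp add: cot_def field_simps)
  qed
  have "of_real (cot ((t - s) / 2)) * (?S ^ k - ?T ^ k) = of_real (cot ((t - s) / 2)) * ((?S - ?T) * (\<Sum>j<k. ?T ^ (k - Suc j) * ?S ^ j))"
    by (subst power_diff_sumr2) (simp add: algebra_simps)
  also have "\<dots> = - (of_real (cot ((t - s) / 2)) * (?T - ?S)) * (\<Sum>j<k. ?T ^ (k - Suc j) * ?S ^ j)"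
    by (simp add: algebra_simps)
  also have "\<dots> = - \<i> * (\<Sum>j<k. (?T + ?S) * (?T ^ (k - Suc j) * ?S ^ j))"
    unfolding key by (simp add: sum_distrib_left algebra_simps)
  also have "(\<Sum>j<k. (?T + ?S) * (?T ^ (k - Suc j) * ?S ^ j)) = (\<Sum>j<k. ?T ^ (k - j) * ?S ^ j + ?T ^ (k - 1 - j) * ?S ^ Suc j)"
  proof (intro sum.cong refl)
    fix j assume "j \<in> {..<k}"
    then have "k - j = Suc (k - Suc j)" by auto
    then have p: "?T ^ (k - j) = ?T * ?T ^ (k - Suc j)" by simp
    show "(?T + ?S) * (?T ^ (k - Suc j) * ?S ^ j) = ?T ^ (k - j) * ?S ^ j + ?T ^ (k - 1 - j) * ?S ^ Suc j"
      unfolding p by (simp add: algebra_simps)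
  qed
  finally have "cis \<phi> * (of_real (cot ((t - s) / 2)) * (?S ^ k - ?T ^ k)) =
    cis \<phi> * (- \<i> * (\<Sum>j<k. ?T ^ (k - j) * ?S ^ j + ?T ^ (k - 1 - j) * ?S ^ Suc j))"
    by (rule arg_cong)
  note this[unfolded Complex.DeMoivre]
  moreover have "Re (cis \<phi> * (of_real (cot ((t - s) / 2)) * (cis (real k * s) - cis (real k * t)))) =
      cot ((t - s) / 2) * (cos (real k * s + \<phi>) - cos (real k * t + \<phi>))"
    by (simp add: cos_add algebra_simps)
  ultimately show ?thesis by simp
qed

lemma has_integral_conjugate_cos:
  assumes k: "0 < k" and t: "-pi < t" "t < pi"
  shows "((\<lambda>s. cot ((t - s) / 2) * (cos (real k * s + \<phi>) - cos (real k * t + \<phi>)))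
           has_integral 2 * pi * sin (real k * t + \<phi>)) {-pi..<pi}"
proof -
  define G where "G = (\<lambda>s. cis \<phi> * (- \<i> * (\<Sum>j<k. cis (real (k - j) * t) * cis (real j * s) + cis (real (k - 1 - j) * t) * cis (real (Suc j) * s))))"
  have "(G has_integral cis \<phi> * (- \<i> * (\<Sum>j<k. cis (real (k - j) * t) * (if j = 0 then 2 * of_real pi else 0) + cis (real (k - 1 - j) * t) * (if Suc j = 0 then 2 * of_real pi else 0)))) {-pi..pi}"
    unfolding G_def
  proof (rule has_integral_mult_right, rule has_integral_mult_right, rule has_integral_sum)
    show "((\<lambda>s. cis (real (k - j) * t) * cis (real j * s) + cis (real (k - 1 - j) * t) * cis (real (Suc j) * s))
        has_integral cis (real (k - j) * t) * (if j = 0 then 2 * of_real pi else 0) + cis (real (k - 1 - j) * t) * (if Suc j = 0 then 2 * of_real pi else 0)) {-pi..pi}" for j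
      by (rule has_integral_add; rule has_integral_mult_right; rule has_integral_cis)
  qed simp
  \<comment> \<open>Integration keeps frequency 0 only, which occurs just once: in the first summand
    at \<open>j = 0\<close>.\<close>
  also have "(\<Sum>j<k. cis (real (k - j) * t) * (if j = 0 then 2 * of_real pi else 0) + cis (real (k - 1 - j) * t) * (if Suc j = 0 then 2 * of_real pi else 0))
      = (\<Sum>j<k. if j = 0 then cis (real k * t) * (2 * of_real pi) else 0)"
    by (intro sum.cong) auto
  also have "\<dots> = cis (real k * t) * (2 * of_real pi)" using k by simp
  finally have I: "(G has_integral cis \<phi> * (- \<i> * (cis (real k * t) * (2 * of_real pi)))) {-pi..pi}" .
  have "((\<lambda>s. Re (G s)) has_integral Re (cis \<phi> * (- \<i> * (cis (real k * t) * (2 * of_real pi))))) {-pi..pi}"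
    using has_integral_linear[OF I bounded_linear_Re] by (simp only: o_def)
  moreover have "Re (cis \<phi> * (- \<i> * (cis (real k * t) * (2 * of_real pi)))) = 2 * pi * sin (real k * t + \<phi>)"
    by (simp add: sin_add algebra_simps)
  ultimately have "((\<lambda>s. Re (G s)) has_integral 2 * pi * sin (real k * t + \<phi>)) {-pi..pi}" by simp
  then have "((\<lambda>s. Re (G s)) has_integral 2 * pi * sin (real k * t + \<phi>)) {-pi..<pi}"
    by (rule has_integral_off_point[of _ _ _ pi]) auto
  then show ?thesis
  proof (rule has_integral_spike[OF negligible_sing[of t], rotated])
    fix s assume s: "s \<in> {-pi..<pi} - {t}"
    have "sin ((t - s) / 2) \<noteq> 0"
    proof (cases "s < t")
      case True
      then have "0 < sin ((t - s) / 2)" using s t by (intro sin_gt_zero) auto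
      then show ?thesis by simp
    next
      case False
      have "- ((t - s) / 2) < pi" using s t by (auto simp: field_simps)
      then have "0 < sin (- ((t - s) / 2))" using s False by (intro sin_gt_zero) auto
      then show ?thesis by simp
    qed
    then show "cot ((t - s) / 2) * (cos (real k * s + \<phi>) - cos (real k * t + \<phi>)) = Re (G s)"
      unfolding G_def by (rule cot_times_cos_diff)
  qed
qed

lemma cos_lipschitz: "\<bar>cos (real k * s + \<phi>) - cos (real k * t + \<phi>)\<bar> \<le> real k * \<bar>s - t\<bar>"
proof -
  have "\<bar>cos a - cos b\<bar> \<le> \<bar>a - b\<bar>" for a b :: real
  proof -
    have "\<bar>cos a - cos b\<bar> = 2 * \<bar>sin ((a + b) / 2)\<bar> * \<bar>sin ((b - a) / 2)\<bar>"
      by (simp add: cos_diff_cos abs_mult)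
    also have "\<dots> \<le> 2 * 1 * \<bar>(b - a) / 2\<bar>"
      by (intro mult_mono abs_sin_x_le_abs_x) auto
    finally show ?thesis by simp
  qed
  from this[of "real k * s + \<phi>" "real k * t + \<phi>"] show ?thesis
    by (simp add: right_diff_distrib[symmetric] abs_mult)
qed

lemma sample_hold_eq:
  "0 < J \<Longrightarrow> t \<in> {-pi..<pi} \<Longrightarrow> sample_hold J f t = f (grid J (sample_index J t))"
  unfolding sample_hold_def by (rule sum_cells)

lemma tendsto_sample:
  fixes f :: "real \<Rightarrow> 'a::real_normed_vector"
  assumes "isCont f t" and t: "t \<in> {-pi..<pi}"
  shows "(\<lambda>J. sample_hold J f t) \<longlonglongrightarrow> f t"
proof -
  have "(\<lambda>J. grid J (sample_index J t) - t) \<longlonglongrightarrow> 0"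
  proof (rule Lim_null_comparison)
    show "\<forall>\<^sub>F J in sequentially. norm (grid J (sample_index J t) - t) \<le> 2 * pi / real J"
      using eventually_gt_at_top[of 0] by eventually_elim (use dist_sample t in auto)
    show "(\<lambda>J. 2 * pi / real J) \<longlonglongrightarrow> 0" by real_asymp
  qed
  then have lim: "(\<lambda>J. grid J (sample_index J t)) \<longlonglongrightarrow> t" by (rule LIM_zero_cancel)
  have "(\<lambda>J. f (grid J (sample_index J t))) \<longlonglongrightarrow> f t"
    by (rule isCont_tendsto_compose[OF assms(1) lim])
  moreover have "\<forall>\<^sub>F J in sequentially. f (grid J (sample_index J t)) = sample_hold J f t"
    using eventually_gt_at_top[of 0] by eventually_elim (use t in \<open>simp add: sample_hold_eq\<close>)
  ultimately show ?thesis by (rule Lim_transform_eventually)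
qed

text \<open>Dominated convergence after subtraction of the constant value at \<open>t\<close>, whose
  sampled transform vanishes. Truncation at \<open>1 / J ^ 3\<close> does not change the integral,
  by \<open>has_integral_sample_hold\<close>; on the remaining range the sampling error of order
  \<open>1 / J\<close> is at most of the order of the cube root of \<open>\<bar>t - s\<bar>\<close>,
  which makes the singularity of the cotangent integrable.\<close>

lemma hilbert_sample_cos_tendsto:
  assumes k: "0 < k" and t: "-pi < t" "t < pi"
    and good: "\<forall>\<^sub>F J in sequentially. \<forall>l\<le>J. 1 / real J ^ 3 \<le> \<bar>t - grid J l\<bar>"
  shows "(\<lambda>J. hilbert_sample J (\<lambda>s. cos (real k * s + \<phi>)) t) \<longlonglongrightarrow> sin (real k * t + \<phi>)"
proof -
  define c where "c = (\<lambda>s. cos (real k * s + \<phi>))"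
  define g where "g = (\<lambda>s. cot ((t - s) / 2) * (c s - c t))"
  obtain C where C: "C > 0" "\<And>s. s \<in> {-pi..<pi} \<Longrightarrow> \<bar>cot ((t - s) / 2)\<bar> * \<bar>t - s\<bar> \<le> C"
    using cot_bound[OF t] by blast
  obtain J0 where J0: "0 < J0" "\<And>J l. J \<ge> J0 \<Longrightarrow> l \<le> J \<Longrightarrow> 1 / real J ^ 3 \<le> \<bar>t - grid J l\<bar>"
  proof -
    obtain J1 where "\<forall>J\<ge>J1. \<forall>l\<le>J. 1 / real J ^ 3 \<le> \<bar>t - grid J l\<bar>"
      using good unfolding eventually_sequentially by blast
    then show thesis by (intro that[of "Suc J1"]) auto
  qed
  define F where "F = (\<lambda>n s. if 1 / real (J0 + n) ^ 3 \<le> \<bar>t - s\<bar> then cot ((t - s) / 2) * (sample_hold (J0 + n) c s - c t) else 0)"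
  have int: "(F n has_integral 2 * pi * hilbert_sample (J0 + n) c t) {-pi..<pi}" for n
  proof -
    let ?J = "J0 + n" and ?A = "{s \<in> {-pi..<pi}. 1 / real (J0 + n) ^ 3 \<le> \<bar>t - s\<bar>}"
    have J: "0 < ?J" "0 < 1 / real ?J ^ 3" using J0 by auto
    have far: "l \<le> ?J \<Longrightarrow> 1 / real ?J ^ 3 \<le> \<bar>t - grid ?J l\<bar>" for l using J0(2)[of ?J l] by simp
    have 1: "((\<lambda>s. cot ((t - s) / 2) *\<^sub>R sample_hold ?J c s) has_integral (2 * pi) *\<^sub>R hilbert_sample ?J c t) ?A"
      by (rule has_integral_sample_hold[OF J(1) t J(2) far])
    have 2: "((\<lambda>s. cot ((t - s) / 2) *\<^sub>R sample_hold ?J (\<lambda>_. c t) s) has_integral (2 * pi) *\<^sub>R hilbert_sample ?J (\<lambda>_. c t) t) ?A"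
      by (rule has_integral_sample_hold[OF J(1) t J(2) far])
    \<comment> \<open>For a constant function the sum telescopes, and its ends \<open>t + pi\<close>
      and \<open>t - pi\<close> differ by a period of \<open>logsin\<close>.\<close>
    have "hilbert_sample ?J (\<lambda>_. c t) t = (\<Sum>l<?J. logsin (t - grid ?J l) - logsin (t - grid ?J (Suc l))) * c t / pi"
      by (simp add: hilbert_sample_def sum_distrib_right sum_divide_distrib)
    also have "(\<Sum>l<?J. logsin (t - grid ?J l) - logsin (t - grid ?J (Suc l))) = logsin (t - grid ?J 0) - logsin (t - grid ?J ?J)"
      by (rule sum_lessThan_telescope')
    also have "\<dots> = 0"
    proof -
      have "\<bar>sin ((t + pi) / 2)\<bar> = \<bar>sin ((t - pi) / 2)\<bar>"
        by (simp add: add_divide_distrib diff_divide_distrib sin_add sin_diff)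
      then show ?thesis using J by (simp add: grid_simps logsin_def)
    qed
    finally have z: "hilbert_sample ?J (\<lambda>_. c t) t = 0" by simp
    have "((\<lambda>s. cot ((t - s) / 2) * (sample_hold ?J c s - c t)) has_integral 2 * pi * hilbert_sample ?J c t) ?A"
      using has_integral_diff[OF 1 2] unfolding z
    proof (rule has_integral_eq_rhs[OF has_integral_eq[rotated]])
      fix s assume "s \<in> ?A"
      then have "sample_hold ?J (\<lambda>_. c t) s = c t"
        using sum_cells[OF J(1), of s "\<lambda>_. c t"] by (simp add: sample_hold_def)
      then show "cot ((t - s) / 2) *\<^sub>R sample_hold ?J c s - cot ((t - s) / 2) *\<^sub>R sample_hold ?J (\<lambda>_. c t) s
          = cot ((t - s) / 2) * (sample_hold ?J c s - c t)"
        by (simp add: right_diff_distrib)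
    qed simp
    then have "((\<lambda>s. if s \<in> ?A then cot ((t - s) / 2) * (sample_hold ?J c s - c t) else 0) has_integral 2 * pi * hilbert_sample ?J c t) {-pi..<pi}"
      by (subst has_integral_restrict) auto
    then show ?thesis
      by (rule has_integral_eq[rotated]) (auto simp: F_def)
  qed
  \<comment> \<open>The first term bounds the increment of \<open>c\<close> between \<open>s\<close>
    and \<open>t\<close>, the second one the sampling error with \<open>1 / J\<close> replaced by
    the cube root of \<open>\<bar>t - s\<bar>\<close>.\<close>
  define h where "h = (\<lambda>s. C * real k * 1 + (C * real k * 2 * pi) * (1 / (root 3 (t - s))\<^sup>2))"
  have h: "h integrable_on {-pi..<pi}"
  proof -
    have "((\<lambda>s::real. C * real k * 1) has_integral integral {-pi..pi} (\<lambda>s. C * real k * 1)) {-pi..<pi}"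
      by (rule has_integral_off_point[of _ _ "{-pi..pi}" pi], rule integrable_integral,
          rule integrable_const_ivl) auto
    then have "(\<lambda>s::real. C * real k * 1) integrable_on {-pi..<pi}" by blast
    then show ?thesis
      unfolding h_def by (rule integrable_add) (intro integrable_on_mult_right integrable_inverse_root)
  qed
  have bound: "norm (F n s) \<le> h s" if s: "s \<in> {-pi..<pi}" for n s
  proof (cases "1 / real (J0 + n) ^ 3 \<le> \<bar>t - s\<bar>")
    case True
    let ?J = "J0 + n" and ?u = "\<bar>t - s\<bar>"
    have J: "0 < real ?J" using J0 by simp
    have "0 < 1 / real ?J ^ 3" using J by simp
    then have u: "0 < ?u" using True by linarith
    have "root 3 (1 / real ?J ^ 3) \<le> root 3 ?u" using True by simp
    moreover have "root 3 (1 / real ?J ^ 3) = 1 / real ?J"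
      using J by (intro real_root_pos_unique) (auto simp: power_divide)
    ultimately have J3: "1 / real ?J \<le> root 3 ?u" by (simp only:)
    have r: "0 < root 3 ?u" "?u = root 3 ?u ^ 3" using u by auto
    have "\<bar>sample_hold ?J c s - c t\<bar> \<le> real k * \<bar>grid ?J (sample_index ?J s) - t\<bar>"
      using J0 s by (simp add: sample_hold_eq c_def cos_lipschitz)
    also have "\<dots> \<le> real k * (?u + 2 * pi / real ?J)"
    proof (rule mult_left_mono)
      have "\<bar>grid ?J (sample_index ?J s) - s\<bar> \<le> 2 * pi / real ?J"
        using dist_sample[of ?J s] J0 s by simp
      then show "\<bar>grid ?J (sample_index ?J s) - t\<bar> \<le> ?u + 2 * pi / real ?J" by linarith
    qed simp
    also have "\<dots> \<le> real k * (?u + 2 * pi * root 3 ?u)"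
      using mult_left_mono[OF J3, of "2 * pi"] by (intro mult_left_mono add_left_mono) auto
    finally have 1: "\<bar>sample_hold ?J c s - c t\<bar> \<le> real k * (?u + 2 * pi * root 3 ?u)" .
    have 2: "\<bar>cot ((t - s) / 2)\<bar> \<le> C / ?u" using C(2)[OF s] u by (simp add: field_simps)
    have "norm (F n s) = \<bar>cot ((t - s) / 2)\<bar> * \<bar>sample_hold ?J c s - c t\<bar>"
      using True by (simp add: F_def abs_mult)
    also have "\<dots> \<le> (C / ?u) * (real k * (?u + 2 * pi * root 3 ?u))"
      by (intro mult_mono 1 2) (use C u in auto)
    also have "\<dots> = C * real k + C * real k * 2 * pi * (root 3 ?u / ?u)" using u by (simp add: field_simps)
    also have "root 3 ?u / ?u = 1 / (root 3 ?u)\<^sup>2"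
      by (subst (2) r(2)) (use r(1) in \<open>simp add: power2_eq_square power3_eq_cube\<close>)
    also have "(root 3 ?u)\<^sup>2 = (root 3 (t - s))\<^sup>2" by (simp add: real_root_abs)
    finally show ?thesis by (simp add: h_def)
  next
    case False
    then show ?thesis using C by (simp add: F_def h_def)
  qed
  have lim: "(\<lambda>n. F n s) \<longlonglongrightarrow> g s" if s: "s \<in> {-pi..<pi}" for s
  proof (cases "s = t")
    case True
    then show ?thesis using J0 by (simp add: F_def g_def)
  next
    case False
    have "isCont c s" unfolding c_def by (intro continuous_intros)
    then have "(\<lambda>J. sample_hold J c s) \<longlonglongrightarrow> c s" by (rule tendsto_sample) (rule s)
    then have "(\<lambda>n. sample_hold (J0 + n) c s) \<longlonglongrightarrow> c s"
      using LIMSEQ_ignore_initial_segment[of _ _ J0] by (simp add: add.commute)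
    then have "(\<lambda>n. cot ((t - s) / 2) * (sample_hold (J0 + n) c s - c t)) \<longlonglongrightarrow> g s"
      unfolding g_def by (intro tendsto_intros)
    moreover have "\<forall>\<^sub>F n in sequentially. F n s = cot ((t - s) / 2) * (sample_hold (J0 + n) c s - c t)"
    proof -
      have "(\<lambda>n. 1 / real (J0 + n) ^ 3) \<longlonglongrightarrow> 0" by real_asymp
      then have "\<forall>\<^sub>F n in sequentially. 1 / real (J0 + n) ^ 3 < \<bar>t - s\<bar>"
        using False by (intro order_tendstoD) auto
      then show ?thesis by eventually_elim (simp add: F_def)
    qed
    ultimately show ?thesis by (simp add: tendsto_cong)
  qed
  have "(\<lambda>n. integral {-pi..<pi} (F n)) \<longlonglongrightarrow> integral {-pi..<pi} g"
    using int h bound lim by (intro dominated_convergence(2)[where h = h]) blast+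
  moreover have "integral {-pi..<pi} g = 2 * pi * sin (real k * t + \<phi>)"
    unfolding g_def c_def using has_integral_conjugate_cos[OF k t] by (rule integral_unique)
  moreover have "integral {-pi..<pi} (F n) = 2 * pi * hilbert_sample (J0 + n) c t" for n
    using int by (rule integral_unique)
  ultimately have "(\<lambda>n. (2 * pi * hilbert_sample (J0 + n) c t) / (2 * pi)) \<longlonglongrightarrow> (2 * pi * sin (real k * t + \<phi>)) / (2 * pi)"
    by (intro tendsto_divide tendsto_const) auto
  then have "(\<lambda>n. hilbert_sample (n + J0) c t) \<longlonglongrightarrow> sin (real k * t + \<phi>)"
    by (simp add: add.commute)
  then show ?thesis unfolding c_def by (rule LIMSEQ_offset)
qed

text \<open>Borel-Cantelli: the exceptional set for \<open>J\<close> consists of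
  \<open>J + 1\<close> intervals of length \<open>2 / J ^ 3\<close>, and the total lengths are
  summable. Exponent 2 would lead to the harmonic series.\<close>

lemma AE_far_from_grid:
  "AE t in lborel. \<forall>\<^sub>F J in sequentially. \<forall>l\<le>J. 1 / real J ^ 3 \<le> \<bar>t - grid J l\<bar>"
proof -
  define A where "A = (\<lambda>J. \<Union>l\<le>J. {grid J l - 1 / real J ^ 3<..<grid J l + 1 / real J ^ 3})"
  have A[measurable]: "A J \<in> sets lborel" for J unfolding A_def by auto
  have em: "emeasure lborel (A J) \<le> ennreal (real (Suc J) * (2 / real J ^ 3))" for J
  proof -
    have "emeasure lborel (A J) \<le> (\<Sum>l\<le>J. emeasure lborel {grid J l - 1 / real J ^ 3<..<grid J l + 1 / real J ^ 3})"
      unfolding A_def by (rule emeasure_subadditive_finite) auto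
    also have "\<dots> = (\<Sum>l\<le>J. ennreal (2 / real J ^ 3))" by (intro sum.cong) auto
    also have "\<dots> = ennreal (real (Suc J) * (2 / real J ^ 3))"
      by (subst sum_ennreal) (auto simp: mult.commute)
    finally show ?thesis .
  qed
  have fin: "emeasure lborel (A J) < \<infinity>" for J using em[of J] by (rule order_le_less_trans) simp
  have "summable (\<lambda>J. measure lborel (A J))"
  proof (rule summable_comparison_test_ev)
    have "measure lborel (A J) \<le> real (Suc J) * (2 / real J ^ 3)" for J
      unfolding measure_def using enn2real_mono[OF em[of J]] by simp
    note m = this
    show "\<forall>\<^sub>F J in sequentially. norm (measure lborel (A J)) \<le> 4 * (1 / real J ^ 2)"
      using eventually_gt_at_top[of 0]
    proof eventually_elim
      case (elim J)
      have "real (Suc J) * (2 / real J ^ 3) \<le> (2 * real J) * (2 / real J ^ 3)"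
        using elim by (intro mult_right_mono) auto
      also have "\<dots> = 4 * (1 / real J ^ 2)" using elim by (simp add: field_simps power2_eq_square power3_eq_cube)
      finally show ?case using m[of J] by simp
    qed
    show "summable (\<lambda>J. 4 * (1 / real J ^ 2))"
      using inverse_power_summable[of 2, where 'a=real] by (intro summable_mult) (simp add: divide_inverse)
  qed
  from borel_cantelli_AE1[OF A fin this] show ?thesis
  proof eventually_elim
    case (elim t)
    from elim show ?case
    proof eventually_elim
      case (elim J)
      show ?case
      proof (intro allI impI)
        fix l assume "l \<le> J"
        then have "t \<notin> {grid J l - 1 / real J ^ 3<..<grid J l + 1 / real J ^ 3}" using elim by (auto simp: A_def)
        then show "1 / real J ^ 3 \<le> \<bar>t - grid J l\<bar>" by auto
      qed
    qed
  qed
qed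

lemma hilbert_sample_conj_tendsto:
  assumes "conj_pair f g" and t: "-pi < t" "t < pi"
    and good: "\<forall>\<^sub>F J in sequentially. \<forall>l\<le>J. 1 / real J ^ 3 \<le> \<bar>t - grid J l\<bar>"
  shows "(\<lambda>J. hilbert_sample J f t) \<longlonglongrightarrow> g t"
  using assms(1)
proof (induction rule: conj_pair.induct)
  case (base k \<phi> x)
  have "hilbert_sample J (\<lambda>t. cos (real k * t + \<phi>) *\<^sub>R x) t = hilbert_sample J (\<lambda>t. cos (real k * t + \<phi>)) t *\<^sub>R x" for J
    by (simp add: hilbert_sample_def scaleR_sum_left)
  then show ?case
    using tendsto_scaleR[OF hilbert_sample_cos_tendsto[OF base t good] tendsto_const] by simp
next
  case (add f g f' g')
  have "hilbert_sample J (\<lambda>t. f t + f' t) t = hilbert_sample J f t + hilbert_sample J f' t" for J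
    by (simp add: hilbert_sample_def scaleR_right_distrib sum.distrib)
  then show ?case using tendsto_add[OF add.IH] by simp
qed

lemma logsin_measurable [measurable]: "logsin \<in> borel_measurable borel"
  unfolding logsin_def by measurable

text \<open>The sampled functions converge boundedly, and their transforms converge almost everywhere;
  Fatou's lemma transfers the inequality.\<close>

theorem conj_pair_inequality:
  fixes f g :: "real \<Rightarrow> 'a::banach"
  assumes cp: "conj_pair f g" and p: "1 < p" and c0: "0 \<le> c"
    and c: "\<And>f :: real \<Rightarrow> 'a. step_function f \<Longrightarrow>
     (\<integral>\<^sup>+ t \<in> {-pi..<pi}. ennreal (norm (hilbert_transform f t) powr p) \<partial>lborel)
       \<le> ennreal (c powr p) * (\<integral>\<^sup>+ t \<in> {-pi..<pi}. ennreal (norm (f t) powr p) \<partial>lborel)"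
  shows "(\<integral>\<^sup>+ t \<in> {-pi..<pi}. ennreal (norm (g t) powr p) \<partial>lborel)
       \<le> ennreal (c powr p) * (\<integral>\<^sup>+ t \<in> {-pi..<pi}. ennreal (norm (f t) powr p) \<partial>lborel)"
proof -
  have contf: "continuous_on UNIV f" using conj_pair_continuous[OF cp] by simp
  then have icf: "isCont f t" for t by (simp add: continuous_on_eq_continuous_at)
  obtain B where B: "\<And>t. norm (f t) \<le> B" using conj_pair_bounded[OF cp] by blast
  have powr_cont: "continuous_on UNIV (\<lambda>x::'a. norm x powr p)"
    using p by (intro continuous_on_powr' continuous_intros) auto
  have meas1: "(\<lambda>t. norm (hilbert_sample J f t) powr p) \<in> borel_measurable borel" for J
    unfolding hilbert_sample_def
    by (rule measurable_finite_span[OF _ powr_cont]) measurable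
  have meas2: "(\<lambda>t. norm (sample_hold J f t) powr p) \<in> borel_measurable borel" for J
    unfolding sample_hold_def
    by (rule measurable_finite_span[OF _ powr_cont]) measurable
  note [measurable] = meas1 meas2
  have le: "(\<integral>\<^sup>+ t \<in> {-pi..<pi}. ennreal (norm (hilbert_sample J f t) powr p) \<partial>lborel)
      \<le> ennreal (c powr p) * (\<integral>\<^sup>+ t \<in> {-pi..<pi}. ennreal (norm (sample_hold J f t) powr p) \<partial>lborel)" if J: "0 < J" for J
  proof -
    have "AE t in lborel. \<forall>l\<in>{..J}. t \<noteq> grid J l"
      by (subst AE_ball_countable) (auto intro: AE_lborel_singleton)
    then have "AE t in lborel. ennreal (norm (hilbert_sample J f t) powr p) * indicator {-pi..<pi} t
        = ennreal (norm (hilbert_transform (sample_hold J f) t) powr p) * indicator {-pi..<pi} t"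
    proof eventually_elim
      case (elim t)
      show ?case
      proof (cases "t \<in> {-pi..<pi}")
        case True
        moreover have "t \<noteq> -pi" using elim grid_simps(1)[OF J] by force
        ultimately show ?thesis using hilbert_transform_sample_hold[OF J, of t f] elim by auto
      qed auto
    qed
    then have "(\<integral>\<^sup>+ t \<in> {-pi..<pi}. ennreal (norm (hilbert_sample J f t) powr p) \<partial>lborel)
       = (\<integral>\<^sup>+ t \<in> {-pi..<pi}. ennreal (norm (hilbert_transform (sample_hold J f) t) powr p) \<partial>lborel)"
      by (rule nn_integral_cong_AE)
    with c[OF step_function_sample_hold[OF J, of f]] show ?thesis by simp
  qed
  have "(\<integral>\<^sup>+ t \<in> {-pi..<pi}. ennreal (norm (g t) powr p) \<partial>lborel)
      = (\<integral>\<^sup>+ t. liminf (\<lambda>J. ennreal (norm (hilbert_sample J f t) powr p) * indicator {-pi..<pi} t) \<partial>lborel)"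
  proof (rule nn_integral_cong_AE)
    show "AE t in lborel. ennreal (norm (g t) powr p) * indicator {-pi..<pi} t
      = liminf (\<lambda>J. ennreal (norm (hilbert_sample J f t) powr p) * indicator {-pi..<pi} t)"
      using AE_far_from_grid AE_lborel_singleton[of "-pi"]
    proof eventually_elim
      case (elim t)
      show ?case
      proof (cases "t \<in> {-pi..<pi}")
        case True
        with elim have "(\<lambda>J. hilbert_sample J f t) \<longlonglongrightarrow> g t"
          by (intro hilbert_sample_conj_tendsto[OF cp]) auto
        then have "(\<lambda>J. norm (hilbert_sample J f t) powr p) \<longlonglongrightarrow> norm (g t) powr p"
          using p by (intro tendsto_powr' tendsto_intros) auto
        then have "liminf (\<lambda>J. ennreal (norm (hilbert_sample J f t) powr p)) = ennreal (norm (g t) powr p)"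
          by (intro lim_imp_Liminf tendsto_ennrealI) auto
        with True show ?thesis by simp
      qed (auto simp: Liminf_const)
    qed
  qed
  also have "\<dots> \<le> liminf (\<lambda>J. \<integral>\<^sup>+ t. ennreal (norm (hilbert_sample J f t) powr p) * indicator {-pi..<pi} t \<partial>lborel)"
    by (rule nn_integral_liminf) measurable
  also have "\<dots> \<le> liminf (\<lambda>J. ennreal (c powr p) * (\<integral>\<^sup>+ t \<in> {-pi..<pi}. ennreal (norm (sample_hold J f t) powr p) \<partial>lborel))"
    by (rule Liminf_mono, rule eventually_mono[OF eventually_gt_at_top[of 0]]) (rule le)
  also have "\<dots> = ennreal (c powr p) * (\<integral>\<^sup>+ t \<in> {-pi..<pi}. ennreal (norm (f t) powr p) \<partial>lborel)"
  proof (rule lim_imp_Liminf)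
    have "(\<lambda>J. \<integral>\<^sup>+ t \<in> {-pi..<pi}. ennreal (norm (sample_hold J f t) powr p) \<partial>lborel)
       \<longlonglongrightarrow> (\<integral>\<^sup>+ t \<in> {-pi..<pi}. ennreal (norm (f t) powr p) \<partial>lborel)"
    proof (rule nn_integral_dominated_convergence[where w = "\<lambda>t. ennreal (B powr p) * indicator {-pi..<pi} t"])
      show "(\<lambda>t. ennreal (norm (f t) powr p) * indicator {-pi..<pi} t) \<in> borel_measurable lborel"
        using borel_measurable_continuous_onI[OF continuous_on_compose2[OF powr_cont contf]] by measurable
      show "(\<integral>\<^sup>+ t. ennreal (B powr p) * indicator {-pi..<pi} t \<partial>lborel) < \<infinity>"
        by (simp add: nn_integral_cmult ennreal_mult[symmetric])
      show "AE t in lborel. ennreal (norm (sample_hold J f t) powr p) * indicator {-pi..<pi} t \<le> ennreal (B powr p) * indicator {-pi..<pi} t" for J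
      proof (rule AE_I2)
        fix t
        have B0: "0 \<le> B" using norm_ge_zero[of "f 0"] B[of 0] by linarith
        show "ennreal (norm (sample_hold J f t) powr p) * indicator {-pi..<pi} t \<le> ennreal (B powr p) * indicator {-pi..<pi} t"
        proof (cases "0 < J \<and> t \<in> {-pi..<pi}")
          case True
          then have "sample_hold J f t = f (grid J (sample_index J t))"
            unfolding sample_hold_def by (intro sum_cells) auto
          then show ?thesis using B p by (auto intro!: mult_right_mono ennreal_leI powr_mono2)
        next
          case False
          then have "J = 0 \<or> t \<notin> {-pi..<pi}" by auto
          then show ?thesis using p by (auto simp: sample_hold_def)
        qed
      qed
      show "AE t in lborel. (\<lambda>J. ennreal (norm (sample_hold J f t) powr p) * indicator {-pi..<pi} t)
          \<longlonglongrightarrow> ennreal (norm (f t) powr p) * indicator {-pi..<pi} t"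
      proof (rule AE_I2)
        fix t
        show "(\<lambda>J. ennreal (norm (sample_hold J f t) powr p) * indicator {-pi..<pi} t)
          \<longlonglongrightarrow> ennreal (norm (f t) powr p) * indicator {-pi..<pi} t"
        proof (cases "t \<in> {-pi..<pi}")
          case True
          have "(\<lambda>J. norm (sample_hold J f t) powr p) \<longlonglongrightarrow> norm (f t) powr p"
            using p by (intro tendsto_powr' tendsto_intros tendsto_sample[OF icf True]) auto
          then show ?thesis using True by (auto intro!: tendsto_ennrealI)
        qed auto
      qed
    qed measurable
    then show "(\<lambda>J. ennreal (c powr p) * (\<integral>\<^sup>+ t \<in> {-pi..<pi}. ennreal (norm (sample_hold J f t) powr p) \<partial>lborel))
       \<longlonglongrightarrow> ennreal (c powr p) * (\<integral>\<^sup>+ t \<in> {-pi..<pi}. ennreal (norm (f t) powr p) \<partial>lborel)"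
      by (intro ennreal_tendsto_cmult) auto
  qed simp
  finally show ?thesis .
qed

section \<open>Modulation and value functions\<close>

text \<open>Value functions of the dynamic programming argument.\<close>

definition good :: "real \<Rightarrow> ('a::real_normed_vector \<times> 'a \<Rightarrow> real) \<Rightarrow> bool" where
  "good p Q \<longleftrightarrow> continuous_on UNIV Q \<and>
     (\<exists>K\<ge>0. \<forall>x y. \<bar>Q (x, y)\<bar> \<le> K * (1 + norm x + norm y) powr p \<and> - K * (1 + norm x) powr p \<le> Q (x, y)) \<and>
     (\<forall>x. convex_on UNIV (\<lambda>y. Q (x, y))) \<and> (\<forall>x y. Q (- x, - y) = Q (x, y))"

definition circ_nonpos :: "('a::real_normed_vector \<times> 'a \<Rightarrow> real) \<Rightarrow> bool" where
  "circ_nonpos Q \<longleftrightarrow> (\<forall>f g. conj_pair f g \<longrightarrow> (\<integral>t. Q (f t, g t) \<partial>circ) \<le> 0)"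

lemma goodD:
  assumes "good p Q"
  shows "continuous_on UNIV Q" "convex_on UNIV (\<lambda>y. Q (x, y))" "Q (- x, - y) = Q (x, y)"
    and "\<exists>K\<ge>0. \<forall>x y. \<bar>Q (x, y)\<bar> \<le> K * (1 + norm x + norm y) powr p \<and> - K * (1 + norm x) powr p \<le> Q (x, y)"
  using assms unfolding good_def by auto

text \<open>The zero functions form a conjugate pair. Dynamic programming ends with the value at the
  origin, where all partial sums are empty.\<close>

lemma circ_nonpos_zero: "circ_nonpos Q \<Longrightarrow> Q (0, 0) \<le> 0"
  using conj_pair_zero circ.prob_space unfolding circ_nonpos_def by fastforce

lemma integral_circ_shift:
  fixes f :: "real \<Rightarrow> real"
  assumes f[measurable]: "f \<in> borel_measurable borel" and per: "\<And>x. f (x + 2 * pi) = f x"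
    and B: "\<And>x. \<bar>f x\<bar> \<le> B"
  shows "(\<integral>x. f (x + a) \<partial>circ) = (\<integral>x. f x \<partial>circ)"
proof -
  have int: "integrable circ f" "integrable circ (\<lambda>x. f (x + a))"
    using B by (auto intro!: circ.integrable_const_bound[where B = B])
  have nn: "0 \<le> f x + B" for x using B[of x] by (simp add: abs_le_iff)
  have "(\<integral>x. f (x + a) + B \<partial>circ) = enn2real (\<integral>\<^sup>+x. ennreal (f (x + a) + B) \<partial>circ)"
    using nn by (intro integral_eq_nn_integral) auto
  also have "(\<integral>\<^sup>+x. ennreal (f (x + a) + B) \<partial>circ) = (\<integral>\<^sup>+x. ennreal (f x + B) \<partial>circ)"
    by (rule nn_integral_circ_shift[of "\<lambda>x. ennreal (f x + B)"]) (auto simp: per)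
  also have "enn2real \<dots> = (\<integral>x. f x + B \<partial>circ)"
    using nn by (intro integral_eq_nn_integral[symmetric]) auto
  finally show ?thesis using int circ.prob_space by simp
qed

lemma bounded_growth:
  assumes "p \<ge> 0" and Q: "\<And>x y. \<bar>Q (x, y)\<bar> \<le> K * (1 + norm x + norm y) powr p" and "0 \<le> K"
    and "norm x \<le> B" "norm y \<le> B"
  shows "\<bar>Q (x, y)\<bar> \<le> K * (1 + B + B) powr p"
  using assms by (intro order_trans[OF Q] mult_left_mono powr_mono2) auto

text \<open>The phase \<open>s\<close> of the modulation is averaged over the circle. For each
  \<open>t\<close> the point \<open>s + m * t\<close> is then uniform, so the mean over
  \<open>s\<close> is the mean over an independent copy, exactly and for a single frequency
  \<open>m\<close>. After Fubini, the inner integral runs along a genuine conjugate pair for every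
  \<open>s\<close>.\<close>

lemma circ_nonpos_modulate:
  fixes Q :: "'a::real_normed_vector \<times> 'a \<Rightarrow> real"
  assumes p: "1 < p" and Q: "good p Q" "circ_nonpos Q" and fg: "conj_pair f g" and v: "trig_poly v"
    and \<xi>: "conj_pair \<xi> \<xi>'"
  shows "(\<integral>t. (\<integral>\<theta>. Q (f t + \<xi> \<theta> *\<^sub>R v t, g t + \<xi>' \<theta> *\<^sub>R v t) \<partial>circ) \<partial>circ) \<le> 0"
proof -
  define G where "G = (\<lambda>t \<theta>. Q (f t + \<xi> \<theta> *\<^sub>R v t, g t + \<xi>' \<theta> *\<^sub>R v t))"
  obtain K where K: "0 \<le> K" "\<And>x y. \<bar>Q (x, y)\<bar> \<le> K * (1 + norm x + norm y) powr p"
    using goodD(4)[OF Q(1)] by blast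
  obtain B1 where B1: "\<And>t. norm (f t) \<le> B1" "\<And>t. norm (g t) \<le> B1" using conj_pair_bounded[OF fg] by blast
  obtain B2 where B2: "\<And>t. norm (v t) \<le> B2" using trig_poly_bounded[OF v] by blast
  obtain B3 where B3: "\<And>t. norm (\<xi> t) \<le> B3" "\<And>t. norm (\<xi>' t) \<le> B3" using conj_pair_bounded[OF \<xi>] by blast
  have nnB: "0 \<le> B2" "0 \<le> B3" using order_trans[OF norm_ge_zero B2] order_trans[OF norm_ge_zero B3(1)] .
  define B where "B = B1 + B3 * B2"
  have "norm (f t + \<xi> \<theta> *\<^sub>R v t) \<le> B" "norm (g t + \<xi>' \<theta> *\<^sub>R v t) \<le> B" for t \<theta>
    using B1 B2 B3 nnB unfolding B_def
    by (auto intro!: order_trans[OF norm_triangle_ineq] add_mono mult_mono)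
  then have GB: "\<bar>G t \<theta>\<bar> \<le> K * (1 + B + B) powr p" for t \<theta>
    unfolding G_def using p K by (intro bounded_growth) auto
  note c = conj_pair_continuous[OF fg] trig_poly_continuous[OF v] conj_pair_continuous[OF \<xi>]
  have c': "continuous_on UNIV (\<lambda>z. f (h z))" "continuous_on UNIV (\<lambda>z. g (h z))"
    "continuous_on UNIV (\<lambda>z. v (h z))" "continuous_on UNIV (\<lambda>z. \<xi> (h z))" "continuous_on UNIV (\<lambda>z. \<xi>' (h z))"
    if "continuous_on UNIV h" for h :: "real \<times> real \<Rightarrow> real"
    using c that by (auto intro: continuous_on_compose2)
  have Gcont: "continuous_on UNIV (\<lambda>z. G (h z) (k z))"
    if "continuous_on UNIV h" "continuous_on UNIV k" for h k :: "real \<times> real \<Rightarrow> real"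
    unfolding G_def
    by (rule continuous_on_compose2[OF goodD(1)[OF Q(1)]]) (auto intro!: continuous_intros c' that)
  have Gm: "(\<lambda>z. G (h z) (k z)) \<in> borel_measurable borel"
    if "continuous_on UNIV h" "continuous_on UNIV k" for h k :: "real \<times> real \<Rightarrow> real"
    using Gcont[OF that] by (rule borel_measurable_continuous_onI)
  have Gm1: "(\<lambda>\<theta>. G t \<theta>) \<in> borel_measurable borel" for t
    unfolding G_def
    by (intro borel_measurable_continuous_onI continuous_on_compose2[OF goodD(1)[OF Q(1)]])
       (auto intro!: continuous_intros simp: c)
  obtain m where m: "\<And>s. conj_pair (\<lambda>t. \<xi> (real m * t + s) *\<^sub>R v t) (\<lambda>t. \<xi>' (real m * t + s) *\<^sub>R v t)"
    using conj_pair_compose_modulate[OF \<xi> v] by blast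
  have neg: "(\<integral>t. G t (real m * t + s) \<partial>circ) \<le> 0" for s
    using Q(2) conj_pair.add[OF fg m[of s]] unfolding circ_nonpos_def G_def by blast
  interpret P: pair_prob_space circ circ ..
  have sb: "sets (circ \<Otimes>\<^sub>M circ) = sets borel"
    by (simp add: borel_prod[symmetric] cong: sets_pair_measure_cong)
  have "(\<integral>\<theta>. G t \<theta> \<partial>circ) = (\<integral>s. G t (s + real m * t) \<partial>circ)" for t
  proof (rule integral_circ_shift[symmetric, of "G t" _ "real m * t"])
    show "G t (x + 2 * pi) = G t x" for x using conj_pair_periodic[OF \<xi>] by (simp add: G_def)
  qed (rule Gm1, rule GB)
  then have "(\<integral>t. (\<integral>\<theta>. G t \<theta> \<partial>circ) \<partial>circ) = (\<integral>t. (\<integral>s. G t (s + real m * t) \<partial>circ) \<partial>circ)"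
    by simp
  also have "\<dots> = (\<integral>s. (\<integral>t. G t (s + real m * t) \<partial>circ) \<partial>circ)"
  proof (rule P.Fubini_integral[symmetric])
    have "(\<lambda>z. G (fst z) (snd z + real m * fst z)) \<in> borel_measurable (circ \<Otimes>\<^sub>M circ)"
      unfolding measurable_cong_sets[OF sb refl] by (rule Gm) (auto intro!: continuous_intros)
    then show "integrable (circ \<Otimes>\<^sub>M circ) (\<lambda>(t, s). G t (s + real m * t))"
      using GB by (intro P.integrable_const_bound[where B = "K * (1 + B + B) powr p"]) (auto simp: split_beta')
  qed
  also have "\<dots> \<le> 0"
    using Bochner_Integration.integral_nonneg[of circ "\<lambda>s. - (\<integral>t. G t (s + real m * t) \<partial>circ)"] neg
    by (simp add: add.commute)
  finally show ?thesis unfolding G_def .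
qed

section \<open>The terminal value function\<close>

lemma continuous_norm_powr:
  "0 < p \<Longrightarrow> continuous_on UNIV (\<lambda>x::'a::real_normed_vector. norm x powr p)"
  by (intro continuous_on_powr' continuous_intros) auto

text \<open>If one of the points is 0, the claim reduces to \<open>u powr p \<le> u\<close> for
  \<open>0 < u < 1\<close>; otherwise it is convexity on the positive half-line.\<close>

lemma powr_convex_nonneg:
  fixes a b t p :: real
  assumes "1 \<le> p" "0 \<le> a" "0 \<le> b" "0 < t" "t < 1"
  shows "((1 - t) * a + t * b) powr p \<le> (1 - t) * a powr p + t * b powr p"
proof -
  have small: "(u * x) powr p \<le> u * x powr p" if "0 < u" "u < 1" "0 \<le> x" for u x
  proof -
    have "u powr p \<le> u powr 1" using that assms by (intro powr_mono') auto
    then show ?thesis using that by (simp add: powr_mult mult_right_mono)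
  qed
  consider "a = 0" | "b = 0" | "0 < a" "0 < b" using assms by fastforce
  then show ?thesis
  proof cases
    case 3
    then show ?thesis
      using convex_onD[OF powr_convex[OF assms(1)], of t a b] assms by simp
  qed (use assms small[of t b] small[of "1 - t" a] in auto)
qed

lemma convex_on_norm_powr:
  assumes "1 \<le> p"
  shows "convex_on UNIV (\<lambda>y::'a::real_normed_vector. norm y powr p)"
proof (rule convex_onI)
  fix t :: real and x y :: 'a assume t: "0 < t" "t < 1"
  have "norm ((1 - t) *\<^sub>R x + t *\<^sub>R y) powr p \<le> ((1 - t) * norm x + t * norm y) powr p"
    using t assms by (intro powr_mono2 order_trans[OF norm_triangle_ineq]) auto
  also have "\<dots> \<le> (1 - t) * norm x powr p + t * norm y powr p"
    using t assms by (intro powr_convex_nonneg) auto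
  finally show "norm ((1 - t) *\<^sub>R x + t *\<^sub>R y) powr p \<le> (1 - t) * norm x powr p + t * norm y powr p" .
qed simp

definition base_value :: "real \<Rightarrow> real \<Rightarrow> 'a::real_normed_vector \<times> 'a \<Rightarrow> real" where
  "base_value p c = (\<lambda>(x, y). norm y powr p - c powr p * norm x powr p)"

lemma good_base_value:
  assumes p: "1 < p"
  shows "good p (base_value p c :: 'a::real_normed_vector \<times> 'a \<Rightarrow> real)"
  unfolding good_def
proof (intro conjI allI)
  show "continuous_on UNIV (base_value p c :: 'a \<times> 'a \<Rightarrow> real)"
    unfolding base_value_def split_beta'
    using p by (intro continuous_intros continuous_on_powr') auto
  show "\<exists>K\<ge>0. \<forall>(x::'a) y. \<bar>base_value p c (x, y)\<bar> \<le> K * (1 + norm x + norm y) powr p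
        \<and> - K * (1 + norm x) powr p \<le> base_value p c (x, y)"
  proof (intro exI[of _ "1 + c powr p"] conjI allI)
    fix x y :: 'a
    have 1: "norm y powr p \<le> (1 + norm x + norm y) powr p" "norm x powr p \<le> (1 + norm x + norm y) powr p"
      "norm x powr p \<le> (1 + norm x) powr p"
      using p by (auto intro!: powr_mono2)
    have 2: "c powr p * norm x powr p \<le> c powr p * (1 + norm x + norm y) powr p"
      "c powr p * norm x powr p \<le> c powr p * (1 + norm x) powr p"
      using 1 by (auto intro!: mult_left_mono)
    have 3: "0 \<le> norm y powr p" "0 \<le> c powr p * norm x powr p" "0 \<le> (1 + norm x) powr p" by auto
    show "\<bar>base_value p c (x, y)\<bar> \<le> (1 + c powr p) * (1 + norm x + norm y) powr p"
      unfolding base_value_def prod.case ring_distribs using 1 2 3 by linarith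
    show "- (1 + c powr p) * (1 + norm x) powr p \<le> base_value p c (x, y)"
    proof -
      have "- (1 + c powr p) * (1 + norm x) powr p = - ((1 + norm x) powr p) - c powr p * (1 + norm x) powr p"
        by (simp add: algebra_simps)
      then show ?thesis unfolding base_value_def prod.case using 1 2 3 by linarith
    qed
  qed simp
  show "convex_on UNIV (\<lambda>y::'a. base_value p c (x, y))" for x
  proof -
    have "convex_on UNIV (\<lambda>y::'a. norm y powr p + (- (c powr p * norm x powr p)))"
      using p by (intro convex_on_add convex_on_norm_powr) (auto simp: convex_on_def algebra_simps simp flip: distrib_right)
    then show ?thesis by (simp add: base_value_def)
  qed
qed (simp add: base_value_def)

lemma circ_nonpos_base_value:
  assumes p: "1 < p" and c0: "0 \<le> c"
    and c: "\<And>f :: real \<Rightarrow> 'a::banach. step_function f \<Longrightarrow>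
     (\<integral>\<^sup>+ t \<in> {-pi..<pi}. ennreal (norm (hilbert_transform f t) powr p) \<partial>lborel)
       \<le> ennreal (c powr p) * (\<integral>\<^sup>+ t \<in> {-pi..<pi}. ennreal (norm (f t) powr p) \<partial>lborel)"
  shows "circ_nonpos (base_value p c :: 'a \<times> 'a \<Rightarrow> real)"
  unfolding circ_nonpos_def
proof (intro allI impI)
  fix f g :: "real \<Rightarrow> 'a" assume fg: "conj_pair f g"
  obtain B where B: "\<And>t. norm (f t) \<le> B" "\<And>t. norm (g t) \<le> B" using conj_pair_bounded[OF fg] by blast
  have m[measurable]: "(\<lambda>t. norm (f t) powr p) \<in> borel_measurable borel" "(\<lambda>t. norm (g t) powr p) \<in> borel_measurable borel"
    using conj_pair_continuous[OF fg] p
    by (auto intro!: borel_measurable_continuous_onI continuous_on_compose2[OF continuous_norm_powr])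
  have int: "integrable circ (\<lambda>t. norm (f t) powr p)" "integrable circ (\<lambda>t. norm (g t) powr p)"
    using B p by (auto intro!: circ.integrable_const_bound[where B = "B powr p"] AE_I2 powr_mono2)
  have "(\<integral>\<^sup>+ t. ennreal (norm (g t) powr p) \<partial>circ) \<le> ennreal (c powr p) * (\<integral>\<^sup>+ t. ennreal (norm (f t) powr p) \<partial>circ)"
    using divide_right_mono_ennreal[OF conj_pair_inequality[OF fg p c0 c], of "ennreal (2 * pi)"]
    by (simp add: nn_integral_circ ennreal_times_divide)
  also have "\<dots> = ennreal (c powr p * (\<integral>t. norm (f t) powr p \<partial>circ))"
    using int by (simp add: nn_integral_eq_integral ennreal_mult)
  finally have "(\<integral>t. norm (g t) powr p \<partial>circ) \<le> c powr p * (\<integral>t. norm (f t) powr p \<partial>circ)"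
    using int by (subst (asm) nn_integral_eq_integral) (auto simp: ennreal_le_iff intro!: mult_nonneg_nonneg integral_nonneg)
  then show "(\<integral>t. base_value p c (f t, g t) \<partial>circ) \<le> 0"
    using int by (simp add: base_value_def)
qed

text \<open>A closed periodic set corresponds to a compact subset \<open>K\<close> of the unit
  circle. Its indicator is the pointwise limit of the continuous functions
  \<open>max 0 (1 - n * infdist z K)\<close>, each of which is uniformly close to a trigonometric
  polynomial by Stone-Weierstrass. The uniform bound prepares for dominated convergence.\<close>

lemma trig_poly_approx_closed:
  assumes E: "closed E" and per: "\<And>t. t \<in> E \<longleftrightarrow> t + 2 * pi \<in> E"
  shows "\<exists>e :: nat \<Rightarrow> real \<Rightarrow> real. (\<forall>n. trig_poly (e n)) \<and> (\<forall>n t. \<bar>e n t\<bar> \<le> 2) \<and>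
    (\<forall>t. (\<lambda>n. e n t) \<longlonglongrightarrow> indicator E t)"
proof -
  have perint: "s + 2 * pi * real_of_int k \<in> E" if "s \<in> E" for s k
  proof -
    have 1: "s + 2 * pi * real n \<in> E" for n
    proof (induction n)
      case (Suc n)
      then have "s + 2 * pi * real n + 2 * pi \<in> E" using per by blast
      then show ?case by (simp add: algebra_simps)
    qed (use that in simp)
    have 2: "s - 2 * pi * real n \<in> E" for n
    proof (induction n)
      case (Suc n)
      have "s - 2 * pi * real n = (s - 2 * pi * real (Suc n)) + 2 * pi" by (simp add: algebra_simps)
      with Suc have "(s - 2 * pi * real (Suc n)) + 2 * pi \<in> E" by metis
      then show ?case using per by blast
    qed (use that in simp)
    show ?thesis using 1[of "nat k"] 2[of "nat (- k)"] by (cases "0 \<le> k") auto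
  qed
  have reduce: "\<exists>k::int. t + 2 * pi * real_of_int k \<in> {-pi..pi}" for t
  proof (intro exI[of _ "- \<lfloor>(t + pi) / (2 * pi)\<rfloor>"])
    define x where "x = (t + pi) / (2 * pi)"
    have t: "t = 2 * pi * x - pi" by (simp add: x_def)
    have "0 \<le> 2 * pi * (x - real_of_int \<lfloor>x\<rfloor>)" "2 * pi * (x - real_of_int \<lfloor>x\<rfloor>) \<le> 2 * pi * 1"
      by (rule mult_nonneg_nonneg, simp, linarith) (rule mult_left_mono, linarith, simp)
    moreover have "t + 2 * pi * real_of_int (- \<lfloor>x\<rfloor>) = 2 * pi * (x - real_of_int \<lfloor>x\<rfloor>) - pi"
      by (simp add: t algebra_simps)
    ultimately show "t + 2 * pi * real_of_int (- \<lfloor>(t + pi) / (2 * pi)\<rfloor>) \<in> {-pi..pi}"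
      unfolding x_def[symmetric] by simp
  qed
  show ?thesis
proof (cases "E \<inter> {-pi..pi} = {}")
  case True
  have "t \<notin> E" for t
    using True perint reduce[of t] by blast
  then have "E = {}" by auto
  then show ?thesis using trig_poly_const[of "0::real"] by (intro exI[of _ "\<lambda>_ _. 0"]) auto
next
  case False
  define K where "K = cis ` (E \<inter> {-pi..pi})"
  have K: "compact K" "K \<noteq> {}"
    unfolding K_def using False E
    by (auto intro!: compact_continuous_image closed_Int_compact continuous_intros)
  have memK: "cis t \<in> K \<longleftrightarrow> t \<in> E" for t
  proof
    assume "cis t \<in> K"
    then obtain s where s: "s \<in> E" "cis t = cis s" by (auto simp: K_def)
    then have "sin t = sin s \<and> cos t = cos s" by (simp add: complex_eq_iff)
    then obtain k :: int where "t = s + 2 * pi * real_of_int k" by (auto simp: sin_cos_eq_iff)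
    with s perint show "t \<in> E" by blast
  next
    assume t: "t \<in> E"
    obtain k :: int where "t + 2 * pi * real_of_int k \<in> {-pi..pi}" using reduce by blast
    moreover have "t + 2 * pi * real_of_int k \<in> E" using perint[OF t] .
    moreover have "sin (t + 2 * pi * real_of_int k) = sin t \<and> cos (t + 2 * pi * real_of_int k) = cos t"
      by (subst sin_cos_eq_iff) auto
    then have "cis (t + 2 * pi * real_of_int k) = cis t" by (simp add: complex_eq_iff)
    ultimately show "cis t \<in> K" unfolding K_def by (metis IntI image_eqI)
  qed
  \<comment> \<open>The algebra of continuous functions on the circle whose pull-back along
    \<open>cis\<close> is a trigonometric polynomial. It contains \<open>Re\<close> and
    \<open>Im\<close>, which separate points.\<close>
  define R where "R = {h :: complex \<Rightarrow> real. continuous_on (sphere 0 1) h \<and> (\<exists>f. trig_poly f \<and> (\<forall>t. h (cis t) = f t))}"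
  have RI: "h \<in> R" if "continuous_on (sphere 0 1) h" "trig_poly f" "\<And>t. h (cis t) = f t" for h f
    using that by (auto simp: R_def)
  have RE: "\<exists>f. trig_poly f \<and> (\<forall>t. h (cis t) = f t)" "continuous_on (sphere 0 1) h" if "h \<in> R" for h
    using that by (auto simp: R_def)
  interpret function_ring_on R "sphere 0 1"
  proof
    fix f g assume fg: "f \<in> R" "g \<in> R"
    then obtain f' g' where *: "trig_poly f'" "trig_poly g'" "\<And>t. f (cis t) = f' t" "\<And>t. g (cis t) = g' t"
      using RE(1) by metis
    show "(\<lambda>x. f x + g x) \<in> R"
      by (rule RI[of _ "\<lambda>t. f' t + g' t"]) (auto intro!: continuous_intros trig_poly.add simp: * RE fg)
    show "(\<lambda>x. f x * g x) \<in> R"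
      by (rule RI[of _ "\<lambda>t. f' t * g' t"])
         (use trig_poly_real_mult[OF *(1,2)] in \<open>auto intro!: continuous_intros simp: * RE fg\<close>)
  next
    show "(\<lambda>_. c) \<in> R" for c by (rule RI[of _ "\<lambda>_. c"]) (auto intro: trig_poly_const)
  next
    fix x y :: complex assume "x \<noteq> y"
    then consider "Re x \<noteq> Re y" | "Im x \<noteq> Im y" by (auto simp: complex_eq_iff)
    then show "\<exists>f\<in>R. f x \<noteq> f y"
    proof cases
      case 1
      have "trig_poly (\<lambda>t. cos t :: real)" using trig_poly.base[of 1 0 "1::real"] by simp
      then have "Re \<in> R" by (rule RI[rotated]) (auto intro!: continuous_intros)
      with 1 show ?thesis by blast
    next
      case 2
      have "cos (t + - pi / 2) = sin t" for t :: real by (simp add: cos_diff)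
      then have "trig_poly (\<lambda>t. sin t :: real)" using trig_poly.base[of 1 "- pi / 2" "1::real"] by simp
      then have "Im \<in> R" by (rule RI[rotated]) (auto intro!: continuous_intros)
      with 2 show ?thesis by blast
    qed
  qed (auto simp: R_def)
  define h where "h = (\<lambda>n z. max 0 (1 - real n * infdist z K))"
  have "\<exists>e. trig_poly e \<and> (\<forall>t. \<bar>h n (cis t) - e t\<bar> < 1 / real (Suc n))" for n
  proof -
    have "continuous_on (sphere 0 1) (h n)" unfolding h_def by (intro continuous_intros)
    then obtain g where "g \<in> R" "\<forall>x\<in>sphere 0 1. \<bar>h n x - g x\<bar> < 1 / real (Suc n)"
      using Stone_Weierstrass_basic[of "h n" "1 / real (Suc n)"] by auto
    then show ?thesis using RE(1)[of g] by (metis mem_sphere_0 norm_cis)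
  qed
  then obtain e where e: "\<And>n. trig_poly (e n)" "\<And>n t. \<bar>h n (cis t) - e n t\<bar> < 1 / real (Suc n)" by metis
  have h01: "0 \<le> h n z" "h n z \<le> 1" for n z using infdist_nonneg[of z K] by (auto simp: h_def)
  show ?thesis
  proof (intro exI[of _ e] conjI allI)
    show "trig_poly (e n)" for n by (rule e)
    \<comment> \<open>A function with values in \<open>{0..1}\<close> plus an error of at most
      1.\<close>
    show "\<bar>e n t\<bar> \<le> 2" for n t
    proof -
      have "1 / real (Suc n) \<le> 1" by simp
      with e(2)[of n t] h01[of n "cis t"] show ?thesis by linarith
    qed
    show "(\<lambda>n. e n t) \<longlonglongrightarrow> indicator E t" for t
    proof -
      have "(\<lambda>n. h n (cis t)) \<longlonglongrightarrow> indicator E t"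
      proof (cases "t \<in> E")
        case True
        then have "infdist (cis t) K = 0" using memK[of t] by simp
        with True show ?thesis by (simp add: h_def)
      next
        case False
        then have "0 < infdist (cis t) K"
          using memK[of t] in_closed_iff_infdist_zero[OF compact_imp_closed[OF K(1)] K(2), of "cis t"] infdist_nonneg[of "cis t" K] by auto
        then have "\<forall>\<^sub>F n in sequentially. h n (cis t) = 0"
        proof -
          assume pos: "0 < infdist (cis t) K"
          obtain n0 :: nat where n0: "1 < real n0 * infdist (cis t) K" using pos reals_Archimedean3 by blast
          show ?thesis
            using eventually_ge_at_top[of n0]
          proof eventually_elim
            case (elim n)
            have "real n0 * infdist (cis t) K \<le> real n * infdist (cis t) K"
              using elim pos by (intro mult_right_mono) auto
            with n0 show ?case by (simp add: h_def)
          qed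
        qed
        with False show ?thesis by (simp add: tendsto_eventually)
      qed
      moreover have "(\<lambda>n. h n (cis t) - e n t) \<longlonglongrightarrow> 0"
      proof (rule Lim_null_comparison)
        show "\<forall>\<^sub>F n in sequentially. norm (h n (cis t) - e n t) \<le> 1 / real (Suc n)"
          by (intro always_eventually allI) (use e(2)[of _ t] in \<open>simp add: less_imp_le\<close>)
        show "(\<lambda>n. 1 / real (Suc n)) \<longlonglongrightarrow> 0" by real_asymp
      qed
      ultimately have "(\<lambda>n. h n (cis t) - (h n (cis t) - e n t)) \<longlonglongrightarrow> indicator E t - 0"
        by (intro tendsto_diff)
      then show ?thesis by simp
    qed
  qed
qed
qed

text \<open>Abstracts from the law of the increment coefficients, so that Gaussian pairs and pairs
  of signs share one step of the dynamic programming. The moment condition preserves growth of order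
  \<open>p\<close>, and the symmetry of the joint law preserves evenness.\<close>

locale step_law = prob_space N for N :: "'n measure" +
  fixes a b :: "'n \<Rightarrow> real" and p :: real
  assumes p: "1 < p"
    and ab_measurable [measurable]: "a \<in> borel_measurable N" "b \<in> borel_measurable N"
    and moment: "integrable N (\<lambda>w. (1 + \<bar>a w\<bar> + \<bar>b w\<bar>) powr p)"
    and symmetric: "distr N (borel \<Otimes>\<^sub>M borel) (\<lambda>w. (- a w, - b w)) = distr N (borel \<Otimes>\<^sub>M borel) (\<lambda>w. (a w, b w))"
begin

definition avg :: "('a::real_normed_vector \<times> 'a \<Rightarrow> real) \<Rightarrow> 'a \<Rightarrow> 'a \<Rightarrow> 'a \<Rightarrow> real" where
  "avg Q x y v = (\<integral>w. Q (x + a w *\<^sub>R v, y + b w *\<^sub>R v) \<partial>N)"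

text \<open>The Bellman operator of a control problem with state \<open>(x, y)\<close> and control
  \<open>v\<close>. Finiteness of \<open>S\<close> makes the maximum attained and
  continuous.\<close>

definition step :: "'a::real_normed_vector set \<Rightarrow> ('a \<times> 'a \<Rightarrow> real) \<Rightarrow> 'a \<times> 'a \<Rightarrow> real" where
  "step S Q z = Max ((\<lambda>v. avg Q (fst z) (snd z) v) ` S)"

lemma line_measurable:
  fixes Q :: "'a::real_normed_vector \<times> 'a \<Rightarrow> real"
  assumes "continuous_on UNIV Q"
  shows "(\<lambda>(s, r). Q (x + s *\<^sub>R v, y + r *\<^sub>R v)) \<in> borel_measurable (borel \<Otimes>\<^sub>M borel :: (real \<times> real) measure)"
  unfolding borel_prod split_beta'
  by (intro borel_measurable_continuous_onI continuous_on_compose2[OF assms]) (auto intro!: continuous_intros)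

lemma integrand_measurable:
  fixes Q :: "'a::real_normed_vector \<times> 'a \<Rightarrow> real"
  assumes "continuous_on UNIV Q"
  shows "(\<lambda>w. Q (x + a w *\<^sub>R v, y + b w *\<^sub>R v)) \<in> borel_measurable N"
proof -
  have "(\<lambda>w. (a w, b w)) \<in> measurable N (borel \<Otimes>\<^sub>M borel)" by measurable
  from measurable_compose[OF this line_measurable[OF assms]] show ?thesis by simp
qed

text \<open>The bound separates the position, the vector and the random coefficients, so that only
  the last factor is integrated. The second estimate contains no \<open>y\<close>, as the lower
  bound in \<open>good\<close> requires.\<close>

lemma growth_mult:
  fixes x y v :: "'a::real_normed_vector"
  shows "1 + norm (x + s *\<^sub>R v) + norm (y + r *\<^sub>R v) \<le> (1 + norm x + norm y) * (1 + norm v) * (1 + \<bar>s\<bar> + \<bar>r\<bar>)"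
    and "1 + norm (x + s *\<^sub>R v) \<le> (1 + norm x) * (1 + norm v) * (1 + \<bar>s\<bar> + \<bar>r\<bar>)"
proof -
  have 1: "norm (x + s *\<^sub>R v) \<le> norm x + \<bar>s\<bar> * norm v" "norm (y + r *\<^sub>R v) \<le> norm y + \<bar>r\<bar> * norm v"
    by (metis norm_scaleR norm_triangle_ineq)+
  have gen: "1 + A + (S + R) * V \<le> (1 + A) * (1 + V) * (1 + S + R)"
    if "0 \<le> A" "0 \<le> V" "0 \<le> S" "0 \<le> R" for A V S R :: real
  proof -
    have "(1 + A) * (1 + V) * (1 + S + R) - (1 + A + (S + R) * V) = (1 + A) * V + (1 + A) * (S + R) + A * V * (S + R)"
      by (simp add: algebra_simps)
    moreover have "0 \<le> (1 + A) * V + (1 + A) * (S + R) + A * V * (S + R)" using that by simp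
    ultimately show ?thesis by linarith
  qed
  have e: "(\<bar>s\<bar> + \<bar>r\<bar>) * norm v = \<bar>s\<bar> * norm v + \<bar>r\<bar> * norm v" by (simp add: distrib_right)
  have "1 + norm (x + s *\<^sub>R v) + norm (y + r *\<^sub>R v) \<le> 1 + (norm x + norm y) + (\<bar>s\<bar> + \<bar>r\<bar>) * norm v"
    unfolding e using 1 by linarith
  also have "\<dots> \<le> (1 + (norm x + norm y)) * (1 + norm v) * (1 + \<bar>s\<bar> + \<bar>r\<bar>)"
    by (rule gen) auto
  finally show "1 + norm (x + s *\<^sub>R v) + norm (y + r *\<^sub>R v) \<le> (1 + norm x + norm y) * (1 + norm v) * (1 + \<bar>s\<bar> + \<bar>r\<bar>)"
    by (simp add: add.assoc)
  have "0 \<le> \<bar>r\<bar> * norm v" by simp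
  then have "1 + norm (x + s *\<^sub>R v) \<le> 1 + norm x + (\<bar>s\<bar> + \<bar>r\<bar>) * norm v"
    unfolding e using 1 by linarith
  also have "\<dots> \<le> (1 + norm x) * (1 + norm v) * (1 + \<bar>s\<bar> + \<bar>r\<bar>)"
    by (rule gen) auto
  finally show "1 + norm (x + s *\<^sub>R v) \<le> (1 + norm x) * (1 + norm v) * (1 + \<bar>s\<bar> + \<bar>r\<bar>)" .
qed

definition "mom = (\<integral>w. (1 + \<bar>a w\<bar> + \<bar>b w\<bar>) powr p \<partial>N)"

lemma mom_nonneg: "0 \<le> mom" unfolding mom_def by (rule integral_nonneg_AE) auto

lemma integrand_bound:
  fixes x y v :: "'a::real_normed_vector"
  assumes "\<And>x y. \<bar>Q (x, y)\<bar> \<le> K * (1 + norm x + norm y) powr p" "0 \<le> K"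
  shows "\<bar>Q (x + s *\<^sub>R v, y + r *\<^sub>R v)\<bar> \<le> K * ((1 + norm x + norm y) powr p * (1 + norm v) powr p * (1 + \<bar>s\<bar> + \<bar>r\<bar>) powr p)"
proof -
  have "\<bar>Q (x + s *\<^sub>R v, y + r *\<^sub>R v)\<bar> \<le> K * (1 + norm (x + s *\<^sub>R v) + norm (y + r *\<^sub>R v)) powr p"
    by (rule assms)
  also have "\<dots> \<le> K * ((1 + norm x + norm y) * (1 + norm v) * (1 + \<bar>s\<bar> + \<bar>r\<bar>)) powr p"
    using p assms(2) by (intro mult_left_mono powr_mono2 growth_mult) auto
  finally show ?thesis by (simp add: powr_mult)
qed

lemma integrand_integrable:
  fixes Q :: "'a::real_normed_vector \<times> 'a \<Rightarrow> real"
  assumes Q: "good p Q"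
  shows "integrable N (\<lambda>w. Q (x + a w *\<^sub>R v, y + b w *\<^sub>R v))"
proof -
  obtain K where K: "0 \<le> K" "\<And>x y. \<bar>Q (x, y)\<bar> \<le> K * (1 + norm x + norm y) powr p"
    using goodD(4)[OF Q] by blast
  have "integrable N (\<lambda>w. K * ((1 + norm x + norm y) powr p * (1 + norm v) powr p * (1 + \<bar>a w\<bar> + \<bar>b w\<bar>) powr p))"
    using moment by simp
  then show ?thesis
    by (rule Bochner_Integration.integrable_bound)
       (use integrand_measurable[OF goodD(1)[OF Q]] integrand_bound[of Q K x _ v y, OF K(2,1)] in \<open>auto intro!: AE_I2 order_trans[OF _ abs_ge_self]\<close>)
qed

text \<open>Joint continuity in position and vector: the vector moves as well when a maximiser is
  approximated by trigonometric polynomials.\<close>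

lemma avg_tendsto:
  fixes Q :: "'a::real_normed_vector \<times> 'a \<Rightarrow> real"
  assumes Q: "good p Q" and lim: "x \<longlonglongrightarrow> x0" "y \<longlonglongrightarrow> y0" "v \<longlonglongrightarrow> v0"
  shows "(\<lambda>n. avg Q (x n) (y n) (v n)) \<longlonglongrightarrow> avg Q x0 y0 v0"
proof -
  obtain K where K: "0 \<le> K" "\<And>x y. \<bar>Q (x, y)\<bar> \<le> K * (1 + norm x + norm y) powr p"
    using goodD(4)[OF Q] by blast
  have "\<exists>B. \<forall>n. norm (u n) \<le> B" if "u \<longlonglongrightarrow> u0" for u :: "nat \<Rightarrow> 'a" and u0
    using convergent_imp_Bseq[OF convergentI[OF that]] by (auto simp: Bseq_def)
  then obtain B1 B2 B3 where B: "\<And>n. norm (x n) \<le> B1" "\<And>n. norm (y n) \<le> B2" "\<And>n. norm (v n) \<le> B3"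
    using lim by metis
  have nnB: "0 \<le> B1" "0 \<le> B2" "0 \<le> B3"
    using order_trans[OF norm_ge_zero B(1)] order_trans[OF norm_ge_zero B(2)] order_trans[OF norm_ge_zero B(3)] by auto
  have cQ: "isCont Q z" for z using goodD(1)[OF Q] unfolding continuous_on_eq_continuous_at[OF open_UNIV] by blast
  show ?thesis
    unfolding avg_def
  proof (rule integral_dominated_convergence[where w = "\<lambda>w. K * ((1 + B1 + B2) powr p * (1 + B3) powr p * (1 + \<bar>a w\<bar> + \<bar>b w\<bar>) powr p)"])
    show "AE w in N. (\<lambda>n. Q (x n + a w *\<^sub>R v n, y n + b w *\<^sub>R v n)) \<longlonglongrightarrow> Q (x0 + a w *\<^sub>R v0, y0 + b w *\<^sub>R v0)"
      by (intro AE_I2 isCont_tendsto_compose[OF cQ] tendsto_intros lim)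
    show "AE w in N. norm (Q (x n + a w *\<^sub>R v n, y n + b w *\<^sub>R v n)) \<le> K * ((1 + B1 + B2) powr p * (1 + B3) powr p * (1 + \<bar>a w\<bar> + \<bar>b w\<bar>) powr p)" for n
    proof (rule AE_I2)
      fix w
      have "norm (Q (x n + a w *\<^sub>R v n, y n + b w *\<^sub>R v n)) \<le> K * ((1 + norm (x n) + norm (y n)) powr p * (1 + norm (v n)) powr p * (1 + \<bar>a w\<bar> + \<bar>b w\<bar>) powr p)"
        using integrand_bound[of Q K, OF K(2,1)] by simp
      also have "\<dots> \<le> K * ((1 + B1 + B2) powr p * (1 + B3) powr p * (1 + \<bar>a w\<bar> + \<bar>b w\<bar>) powr p)"
        using K(1) p B nnB by (intro mult_left_mono mult_mono powr_mono2 add_mono) auto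
      finally show "norm (Q (x n + a w *\<^sub>R v n, y n + b w *\<^sub>R v n)) \<le> K * ((1 + B1 + B2) powr p * (1 + B3) powr p * (1 + \<bar>a w\<bar> + \<bar>b w\<bar>) powr p)" .
    qed
  qed (use moment integrand_measurable[OF goodD(1)[OF Q]] in auto)
qed

lemma avg_bounds:
  fixes Q :: "'a::real_normed_vector \<times> 'a \<Rightarrow> real"
  assumes Q: "good p Q" and K: "0 \<le> K" "\<And>x y. \<bar>Q (x, y)\<bar> \<le> K * (1 + norm x + norm y) powr p"
    "\<And>x y. - K * (1 + norm x) powr p \<le> Q (x, y)"
  shows "\<bar>avg Q x y v\<bar> \<le> (K * (1 + norm v) powr p * mom) * (1 + norm x + norm y) powr p"
    and "- (K * (1 + norm v) powr p * mom) * (1 + norm x) powr p \<le> avg Q x y v"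
proof -
  have "\<bar>avg Q x y v\<bar> \<le> (\<integral>w. K * ((1 + norm x + norm y) powr p * (1 + norm v) powr p * (1 + \<bar>a w\<bar> + \<bar>b w\<bar>) powr p) \<partial>N)"
    unfolding avg_def
    by (rule order_trans[OF integral_abs_bound])
       (intro integral_mono integrable_abs integrand_integrable[OF Q] integrand_bound K, use moment in auto)
  then show "\<bar>avg Q x y v\<bar> \<le> (K * (1 + norm v) powr p * mom) * (1 + norm x + norm y) powr p"
    by (simp add: mom_def mult_ac)
  have "(\<integral>w. - (K * ((1 + norm x) powr p * (1 + norm v) powr p * (1 + \<bar>a w\<bar> + \<bar>b w\<bar>) powr p)) \<partial>N) \<le> avg Q x y v"
    unfolding avg_def
  proof (intro integral_mono integrand_integrable[OF Q])
    fix w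
    have "(1 + norm (x + a w *\<^sub>R v)) powr p \<le> ((1 + norm x) * (1 + norm v) * (1 + \<bar>a w\<bar> + \<bar>b w\<bar>)) powr p"
      using p by (intro powr_mono2 growth_mult) auto
    then have "K * (1 + norm (x + a w *\<^sub>R v)) powr p \<le> K * ((1 + norm x) powr p * (1 + norm v) powr p * (1 + \<bar>a w\<bar> + \<bar>b w\<bar>) powr p)"
      using K(1) by (intro mult_left_mono) (simp_all add: powr_mult)
    then show "- (K * ((1 + norm x) powr p * (1 + norm v) powr p * (1 + \<bar>a w\<bar> + \<bar>b w\<bar>) powr p)) \<le> Q (x + a w *\<^sub>R v, y + b w *\<^sub>R v)"
      using K(3)[of "x + a w *\<^sub>R v" "y + b w *\<^sub>R v"] by linarith
  qed (use moment in auto)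
  then show "- (K * (1 + norm v) powr p * mom) * (1 + norm x) powr p \<le> avg Q x y v"
    by (simp add: mom_def mult_ac)
qed

lemma avg_convex:
  fixes Q :: "'a::real_normed_vector \<times> 'a \<Rightarrow> real"
  assumes Q: "good p Q"
  shows "convex_on UNIV (\<lambda>y. avg Q x y v)"
proof (rule convex_onI)
  fix t :: real and y1 y2 :: 'a assume t: "0 < t" "t < 1"
  have "avg Q x ((1 - t) *\<^sub>R y1 + t *\<^sub>R y2) v \<le>
     (\<integral>w. (1 - t) * Q (x + a w *\<^sub>R v, y1 + b w *\<^sub>R v) + t * Q (x + a w *\<^sub>R v, y2 + b w *\<^sub>R v) \<partial>N)"
    unfolding avg_def
  proof (intro integral_mono integrand_integrable[OF Q])
    fix w
    have "(1 - t) *\<^sub>R y1 + t *\<^sub>R y2 + b w *\<^sub>R v = (1 - t) *\<^sub>R (y1 + b w *\<^sub>R v) + t *\<^sub>R (y2 + b w *\<^sub>R v)"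
      by (simp add: algebra_simps)
    then show "Q (x + a w *\<^sub>R v, (1 - t) *\<^sub>R y1 + t *\<^sub>R y2 + b w *\<^sub>R v) \<le>
       (1 - t) * Q (x + a w *\<^sub>R v, y1 + b w *\<^sub>R v) + t * Q (x + a w *\<^sub>R v, y2 + b w *\<^sub>R v)"
      using convex_onD[OF goodD(2)[OF Q, of "x + a w *\<^sub>R v"], of t "y1 + b w *\<^sub>R v" "y2 + b w *\<^sub>R v"] t by simp
  qed (use integrand_integrable[OF Q] in auto)
  also have "\<dots> = (1 - t) * avg Q x y1 v + t * avg Q x y2 v"
    unfolding avg_def using integrand_integrable[OF Q] by simp
  finally show "avg Q x ((1 - t) *\<^sub>R y1 + t *\<^sub>R y2) v \<le> (1 - t) * avg Q x y1 v + t * avg Q x y2 v" .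
qed simp

text \<open>\<open>Q\<close> does not change when position and increment are both negated, and
  negating the increment does not change its law.\<close>

lemma avg_even:
  fixes Q :: "'a::real_normed_vector \<times> 'a \<Rightarrow> real"
  assumes Q: "good p Q"
  shows "avg Q (- x) (- y) v = avg Q x y v"
proof -
  note m = line_measurable[OF goodD(1)[OF Q], of x v y]
  have "avg Q (- x) (- y) v = (\<integral>w. Q (- (x + (- a w) *\<^sub>R v), - (y + (- b w) *\<^sub>R v)) \<partial>N)"
    by (simp add: avg_def)
  also have "\<dots> = (\<integral>w. Q (x + (- a w) *\<^sub>R v, y + (- b w) *\<^sub>R v) \<partial>N)" by (simp only: goodD(3)[OF Q])
  also have "\<dots> = (\<integral>z. (case z of (s, r) \<Rightarrow> Q (x + s *\<^sub>R v, y + r *\<^sub>R v)) \<partial>distr N (borel \<Otimes>\<^sub>M borel) (\<lambda>w. (- a w, - b w)))"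
    by (subst integral_distr[OF _ m]) auto
  also have "\<dots> = avg Q x y v"
    unfolding symmetric by (subst integral_distr[OF _ m]) (auto simp: avg_def)
  finally show ?thesis .
qed

lemma avg_le_step: "finite S \<Longrightarrow> v \<in> S \<Longrightarrow> avg Q x y v \<le> step S Q (x, y)"
  unfolding step_def by (intro Max_ge) auto

lemma step_attained: "finite S \<Longrightarrow> S \<noteq> {} \<Longrightarrow> \<exists>v\<in>S. step S Q (x, y) = avg Q x y v"
  unfolding step_def using Max_in[of "(\<lambda>v. avg Q x y v) ` S"] by fastforce

lemma continuous_avg:
  fixes Q :: "'a::real_normed_vector \<times> 'a \<Rightarrow> real"
  assumes Q: "good p Q"
  shows "continuous_on UNIV (\<lambda>z. avg Q (fst z) (snd z) v)"
  unfolding continuous_on_eq_continuous_at[OF open_UNIV]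
  by (intro ballI continuous_at_sequentiallyI avg_tendsto[OF Q] tendsto_fst tendsto_snd tendsto_const)

text \<open>A maximum of finitely many averages inherits each property. For convexity, the vector
  that is optimal at the intermediate point is tested at the two ends.\<close>

lemma good_step:
  fixes Q :: "'a::real_normed_vector \<times> 'a \<Rightarrow> real"
  assumes Q: "good p Q" and S: "finite S" "S \<noteq> {}"
  shows "good p (step S Q)"
  unfolding good_def
proof (intro conjI allI)
  have "continuous_on UNIV (\<lambda>z. Max ((\<lambda>v. avg Q (fst z) (snd z) v) ` S))"
    using S
  proof (induction S rule: finite_ne_induct)
    case (insert v S)
    then have "Max ((\<lambda>v. avg Q (fst z) (snd z) v) ` insert v S) = max (avg Q (fst z) (snd z) v) (Max ((\<lambda>v. avg Q (fst z) (snd z) v) ` S))" for z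
      by simp
    then show ?case using insert continuous_avg[OF Q] by (simp only:) (intro continuous_on_max)
  qed (simp add: continuous_avg[OF Q])
  then show "continuous_on UNIV (step S Q)" unfolding step_def .
  obtain K where K: "0 \<le> K" "\<And>x y. \<bar>Q (x, y)\<bar> \<le> K * (1 + norm x + norm y) powr p"
    "\<And>x y. - K * (1 + norm x) powr p \<le> Q (x, y)"
    using goodD(4)[OF Q] by blast
  define L where "L = (\<Sum>v\<in>S. K * (1 + norm v) powr p * mom)"
  have L: "K * (1 + norm v) powr p * mom \<le> L" if "v \<in> S" for v
    unfolding L_def using that S K mom_nonneg by (intro member_le_sum) auto
  have L0: "0 \<le> L" unfolding L_def using K mom_nonneg by (intro sum_nonneg) auto
  show "\<exists>K\<ge>0. \<forall>x y. \<bar>step S Q (x, y)\<bar> \<le> K * (1 + norm x + norm y) powr p \<and> - K * (1 + norm x) powr p \<le> step S Q (x, y)"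
  proof (intro exI[of _ L] conjI allI L0)
    fix x y
    obtain v where v: "v \<in> S" "step S Q (x, y) = avg Q x y v" using step_attained[OF S] by metis
    show "\<bar>step S Q (x, y)\<bar> \<le> L * (1 + norm x + norm y) powr p"
      unfolding v(2) by (rule order_trans[OF avg_bounds(1)[OF Q K]]) (intro mult_right_mono L v, simp)
    show "- L * (1 + norm x) powr p \<le> step S Q (x, y)"
      unfolding v(2) by (rule order_trans[OF _ avg_bounds(2)[OF Q K]]) (intro mult_right_mono le_imp_neg_le L v, simp)
  qed
  show "convex_on UNIV (\<lambda>y. step S Q (x, y))" for x
  proof (rule convex_onI)
    fix t :: real and y1 y2 :: 'a assume t: "0 < t" "t < 1"
    obtain v where v: "v \<in> S" "step S Q (x, (1 - t) *\<^sub>R y1 + t *\<^sub>R y2) = avg Q x ((1 - t) *\<^sub>R y1 + t *\<^sub>R y2) v"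
      using step_attained[OF S] by metis
    have "avg Q x ((1 - t) *\<^sub>R y1 + t *\<^sub>R y2) v \<le> (1 - t) * avg Q x y1 v + t * avg Q x y2 v"
      using convex_onD[OF avg_convex[OF Q], of t y1 y2] t by simp
    also have "\<dots> \<le> (1 - t) * step S Q (x, y1) + t * step S Q (x, y2)"
      using t S v by (intro add_mono mult_left_mono avg_le_step) auto
    finally show "step S Q (x, (1 - t) *\<^sub>R y1 + t *\<^sub>R y2) \<le> (1 - t) * step S Q (x, y1) + t * step S Q (x, y2)"
      unfolding v(2) .
  qed simp
  show "step S Q (- x, - y) = step S Q (x, y)" for x y
    unfolding step_def using avg_even[OF Q] by simp
qed

text \<open>The maximiser is a measurable function of the position; on the trajectory of a conjugate pair
  it is approximated by trigonometric polynomials.\<close>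

lemma circ_nonpos_step:
  fixes Q :: "'a::real_normed_vector \<times> 'a \<Rightarrow> real"
  assumes Q: "good p Q" and S: "finite S" "S \<noteq> {}"
    and adm: "\<And>f g v. conj_pair f g \<Longrightarrow> trig_poly v \<Longrightarrow> (\<integral>t. avg Q (f t) (g t) (v t) \<partial>circ) \<le> 0"
  shows "circ_nonpos (step S Q)"
  unfolding circ_nonpos_def
proof (intro allI impI)
  fix f g :: "real \<Rightarrow> 'a" assume fg: "conj_pair f g"
  obtain d :: nat and V where V: "S = V ` {i. i < d}" using S(1) unfolding finite_conv_nat_seg_image by blast
  have d0: "0 < d" using S(2) V by (cases d) auto
  define W where "W = (\<lambda>i t. avg Q (f t) (g t) (V i))"
  note cfg = conj_pair_continuous[OF fg]
  have Wc: "continuous_on UNIV (W i)" for i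
    unfolding W_def
    using continuous_on_compose2[OF continuous_avg[OF Q], of UNIV "\<lambda>t. (f t, g t)"] cfg
    by (auto intro!: continuous_intros)
  have Wper: "W i (t + 2 * pi) = W i t" for i t unfolding W_def using conj_pair_periodic[OF fg] by simp
  \<comment> \<open>The closed periodic set on which the vector \<open>V i\<close> is optimal. These
    sets cover the line and may overlap.\<close>
  define E where "E = (\<lambda>i. {t. \<forall>j<d. W j t \<le> W i t})"
  have Ecl: "closed (E i)" for i
  proof -
    have "E i = (\<Inter>j\<in>{..<d}. {t. W j t \<le> W i t})" by (auto simp: E_def)
    then show ?thesis by (auto intro!: closed_INT closed_Collect_le Wc)
  qed
  have "\<exists>e :: nat \<Rightarrow> real \<Rightarrow> real. (\<forall>n. trig_poly (e n)) \<and> (\<forall>n t. \<bar>e n t\<bar> \<le> 2) \<and>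
    (\<forall>t. (\<lambda>n. e n t) \<longlonglongrightarrow> indicator (E i) t)" for i
    using Wper by (intro trig_poly_approx_closed Ecl) (auto simp: E_def)
  then obtain e :: "nat \<Rightarrow> nat \<Rightarrow> real \<Rightarrow> real" where e: "\<And>i n. trig_poly (e i n)"
    "\<And>i n t. \<bar>e i n t\<bar> \<le> 2" "\<And>i t. (\<lambda>n. e i n t) \<longlonglongrightarrow> indicator (E i) t"
    by metis
  \<comment> \<open>The coefficient of \<open>V i\<close> approximates the indicator of
    \<open>E i\<close> outside all earlier \<open>E j\<close>. Ties are thus broken by the smallest
    index, and the limit \<open>w0\<close> is an optimal vector of \<open>S\<close> at every
    point.\<close>
  define w where "w = (\<lambda>n t. \<Sum>i<d. (e i n t * (\<Prod>j<i. 1 - e j n t)) *\<^sub>R V i)"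
  have trig_sum: "trig_poly (\<lambda>t. \<Sum>i\<in>I. h i t)" if "finite I" "\<And>i. i \<in> I \<Longrightarrow> trig_poly (h i)" for I :: "nat set" and h :: "nat \<Rightarrow> real \<Rightarrow> 'a"
    using that by (induction I rule: finite_induct) (auto intro: trig_poly.add trig_poly_const)
  have trig_1minus: "trig_poly (\<lambda>t. 1 - e j n t)" for j n
    using trig_poly.add[OF trig_poly_const[of "1::real"] trig_poly_real_mult[OF trig_poly_const[of "-1"] e(1)[of j n]]] by simp
  have trig_prod: "trig_poly (\<lambda>t. \<Prod>j<i. 1 - e j n t)" for i n
  proof (induction i)
    case (Suc i)
    from trig_poly_real_mult[OF this trig_1minus[of i n]] show ?case by simp
  qed (simp add: trig_poly_const)
  have trigw: "trig_poly (w n)" for n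
    unfolding w_def
    using trig_poly_real_mult[OF trig_poly_real_mult[OF e(1) trig_prod] trig_poly_const]
    by (intro trig_sum) auto
  \<comment> \<open>From \<open>\<bar>e i n t\<bar> \<le> 2\<close> and hence
    \<open>\<bar>1 - e j n t\<bar> \<le> 3\<close>.\<close>
  define B where "B = (\<Sum>i<d. (2 * 3 ^ i) * norm (V i))"
  have wB: "norm (w n t) \<le> B" for n t
    unfolding w_def B_def
  proof (rule order_trans[OF norm_sum], rule sum_mono)
    fix i
    have "\<bar>\<Prod>j<i. 1 - e j n t\<bar> \<le> (\<Prod>j<i. 3)"
      unfolding abs_prod
    proof (rule prod_mono)
      show "0 \<le> \<bar>1 - e j n t\<bar> \<and> \<bar>1 - e j n t\<bar> \<le> 3" for j using e(2)[of j n t] by linarith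
    qed
    then have "\<bar>e i n t\<bar> * \<bar>\<Prod>j<i. 1 - e j n t\<bar> \<le> 2 * 3 ^ i"
      using e(2)[of i n t] by (intro mult_mono) auto
    then show "norm ((e i n t * (\<Prod>j<i. 1 - e j n t)) *\<^sub>R V i) \<le> (2 * 3 ^ i) * norm (V i)"
      by (simp add: abs_mult mult_right_mono)
  qed
  define w0 where "w0 = (\<lambda>t. \<Sum>i<d. (indicator (E i) t * (\<Prod>j<i. 1 - indicator (E j) t)) *\<^sub>R V i)"
  have wlim: "(\<lambda>n. w n t) \<longlonglongrightarrow> w0 t" for t
    unfolding w_def w0_def by (intro tendsto_intros e(3))
  have w0: "avg Q (f t) (g t) (w0 t) = step S Q (f t, g t)" for t
  proof -
    obtain i0 where i0: "i0 < d" "t \<in> E i0"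
    proof -
      have "Max ((\<lambda>i. W i t) ` {..<d}) \<in> (\<lambda>i. W i t) ` {..<d}" using d0 by (intro Max_in) auto
      then obtain i where "i < d" "W i t = Max ((\<lambda>i. W i t) ` {..<d})" by auto
      then show thesis using that[of i] by (auto simp: E_def)
    qed
    define k where "k = (LEAST i. t \<in> E i)"
    have k: "t \<in> E k" "k \<le> i0" "\<And>j. j < k \<Longrightarrow> t \<notin> E j"
      unfolding k_def using i0 by (auto intro: LeastI Least_le dest: not_less_Least)
    have "w0 t = (\<Sum>i<d. if i = k then V k else 0)"
      unfolding w0_def
    proof (intro sum.cong refl)
      fix i assume "i \<in> {..<d}"
      consider "i < k" | "i = k" | "k < i" by linarith
      then show "(indicator (E i) t * (\<Prod>j<i. 1 - indicator (E j) t)) *\<^sub>R V i = (if i = k then V k else 0)"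
      proof cases
        case 3
        have "(\<Prod>j<i. 1 - indicator (E j) t :: real) = 0"
          using 3 k by (intro prod_zero bexI[of _ k]) auto
        with 3 show ?thesis by simp
      qed (use k in auto)
    qed
    then have w0k: "w0 t = V k" using k i0 by simp
    show ?thesis
      unfolding w0k
    proof (rule antisym)
      show "avg Q (f t) (g t) (V k) \<le> step S Q (f t, g t)"
        using k i0 V S by (intro avg_le_step) auto
      obtain v where v: "v \<in> S" "step S Q (f t, g t) = avg Q (f t) (g t) v" using step_attained[OF S] by metis
      then obtain j where "j < d" "v = V j" using V by auto
      then show "step S Q (f t, g t) \<le> avg Q (f t) (g t) (V k)"
        using k(1) v by (auto simp: E_def W_def)
    qed
  qed
  obtain K where K: "0 \<le> K" "\<And>x y. \<bar>Q (x, y)\<bar> \<le> K * (1 + norm x + norm y) powr p"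
    "\<And>x y. - K * (1 + norm x) powr p \<le> Q (x, y)"
    using goodD(4)[OF Q] by blast
  obtain C where C: "\<And>t. norm (f t) \<le> C" "\<And>t. norm (g t) \<le> C" using conj_pair_bounded[OF fg] by blast
  have avgB: "\<bar>avg Q (f t) (g t) (w n t)\<bar> \<le> (K * (1 + B) powr p * mom) * (1 + C + C) powr p" for n t
    by (rule order_trans[OF avg_bounds(1)[OF Q K]])
       (use C[of t] wB[of n t] K mom_nonneg p in \<open>intro mult_mono powr_mono2 add_mono mult_nonneg_nonneg\<close>, auto)
  have cont: "continuous_on UNIV (\<lambda>t. avg Q (f t) (g t) (w n t))" for n
    unfolding continuous_on_eq_continuous_at[OF open_UNIV]
  proof (intro ballI continuous_at_sequentiallyI avg_tendsto[OF Q])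
    fix t and u :: "nat \<Rightarrow> real" assume u: "u \<longlonglongrightarrow> t"
    have "isCont f t" "isCont g t" "isCont (w n) t"
      using cfg trig_poly_continuous[OF trigw[of n]] by (simp_all add: continuous_on_eq_continuous_at)
    then show "(\<lambda>k. f (u k)) \<longlonglongrightarrow> f t" "(\<lambda>k. g (u k)) \<longlonglongrightarrow> g t" "(\<lambda>k. w n (u k)) \<longlonglongrightarrow> w n t"
      using u by (auto intro: isCont_tendsto_compose)
  qed
  have meas: "(\<lambda>t. avg Q (f t) (g t) (w n t)) \<in> borel_measurable circ" for n
    using borel_measurable_continuous_onI[OF cont[of n]] by (simp cong: measurable_cong_sets)
  have lim: "(\<lambda>n. avg Q (f t) (g t) (w n t)) \<longlonglongrightarrow> step S Q (f t, g t)" for t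
    unfolding w0[symmetric] by (rule avg_tendsto[OF Q tendsto_const tendsto_const wlim])
  have "(\<lambda>n. \<integral>t. avg Q (f t) (g t) (w n t) \<partial>circ) \<longlonglongrightarrow> (\<integral>t. step S Q (f t, g t) \<partial>circ)"
  proof (rule integral_dominated_convergence[where w = "\<lambda>t. (K * (1 + B) powr p * mom) * (1 + C + C) powr p"])
    show "(\<lambda>t. step S Q (f t, g t)) \<in> borel_measurable circ"
      by (rule borel_measurable_LIMSEQ_real[OF lim meas])
  qed (use meas avgB lim in auto)
  then show "(\<integral>t. step S Q (f t, g t) \<partial>circ) \<le> 0"
    by (rule LIMSEQ_le_const2) (use adm[OF fg trigw] in auto)
qed

end

section \<open>Gaussian increments\<close>

definition gauss :: "real \<Rightarrow> real measure" where
  "gauss \<sigma> = density lborel (normal_density 0 \<sigma>)"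

definition gauss2 :: "real \<Rightarrow> (real \<times> real) measure" where
  "gauss2 \<sigma> = gauss \<sigma> \<Otimes>\<^sub>M gauss \<sigma>"

lemma sets_gauss [measurable_cong, simp]: "sets (gauss \<sigma>) = sets borel"
  and space_gauss [simp]: "space (gauss \<sigma>) = UNIV"
  by (simp_all add: gauss_def)

lemma sets_gauss2 [measurable_cong]: "sets (gauss2 \<sigma>) = sets (borel \<Otimes>\<^sub>M borel)"
  unfolding gauss2_def by (rule sets_pair_measure_cong) simp_all

lemma space_gauss2 [simp]: "space (gauss2 \<sigma>) = UNIV"
  by (simp add: gauss2_def space_pair_measure)

lemma prob_space_gauss: "0 < \<sigma> \<Longrightarrow> prob_space (gauss \<sigma>)"
  unfolding gauss_def by (rule prob_space_normal_density)

lemma prob_space_gauss2: "0 < \<sigma> \<Longrightarrow> prob_space (gauss2 \<sigma>)"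
  unfolding gauss2_def by (intro prob_space_pair prob_space_gauss)

text \<open>With one coordinate fixed, a shear is a translation of the other coordinate; Tonelli
  does the rest.\<close>

lemma distr_lborel_shear:
  "distr (lborel \<Otimes>\<^sub>M lborel) (borel \<Otimes>\<^sub>M borel) (\<lambda>(x, y). (x + \<alpha> * y, y)) = (lborel \<Otimes>\<^sub>M lborel :: (real \<times> real) measure)"
  "distr (lborel \<Otimes>\<^sub>M lborel) (borel \<Otimes>\<^sub>M borel) (\<lambda>(x, y). (x, y + \<alpha> * x)) = (lborel \<Otimes>\<^sub>M lborel :: (real \<times> real) measure)"
proof -
  have s: "sets (lborel \<Otimes>\<^sub>M lborel :: (real \<times> real) measure) = sets (borel \<Otimes>\<^sub>M borel)"
    by (rule sets_pair_measure_cong) simp_all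
  show "distr (lborel \<Otimes>\<^sub>M lborel) (borel \<Otimes>\<^sub>M borel) (\<lambda>(x, y). (x + \<alpha> * y, y)) = (lborel \<Otimes>\<^sub>M lborel :: (real \<times> real) measure)"
  proof (rule measure_eqI)
    fix A :: "(real \<times> real) set"
    assume "A \<in> sets (distr (lborel \<Otimes>\<^sub>M lborel) (borel \<Otimes>\<^sub>M borel) (\<lambda>(x, y). (x + \<alpha> * y, y)))"
    then have A[measurable]: "A \<in> sets (borel \<Otimes>\<^sub>M borel)" by simp
    have "emeasure (distr (lborel \<Otimes>\<^sub>M lborel) (borel \<Otimes>\<^sub>M borel) (\<lambda>(x, y). (x + \<alpha> * y, y))) A
       = (\<integral>\<^sup>+z. indicator A (fst z + \<alpha> * snd z, snd z) \<partial>(lborel \<Otimes>\<^sub>M lborel))"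
      by (subst nn_integral_indicator[symmetric], simp, subst nn_integral_distr) (auto simp: split_beta')
    also have "\<dots> = (\<integral>\<^sup>+y. \<integral>\<^sup>+x. indicator A (x + \<alpha> * y, y) \<partial>lborel \<partial>lborel)"
      by (subst lborel_pair.nn_integral_snd[symmetric]) auto
    also have "\<dots> = (\<integral>\<^sup>+y. \<integral>\<^sup>+x. indicator A (x, y) \<partial>lborel \<partial>lborel)"
    proof (rule nn_integral_cong)
      fix y :: real
      have "(\<integral>\<^sup>+x. indicator A (x, y) \<partial>lborel) = (\<integral>\<^sup>+x. indicator A (\<alpha> * y + 1 * x, y) \<partial>lborel)"
        by (subst nn_integral_real_affine[where c = 1 and t = "\<alpha> * y"]) auto
      then show "(\<integral>\<^sup>+x. indicator A (x + \<alpha> * y, y) \<partial>lborel) = (\<integral>\<^sup>+x. indicator A (x, y) \<partial>lborel)"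
        by (simp add: add.commute)
    qed
    also have "\<dots> = (\<integral>\<^sup>+z. indicator A z \<partial>(lborel \<Otimes>\<^sub>M lborel))"
      by (subst lborel_pair.nn_integral_snd) auto
    finally show "emeasure (distr (lborel \<Otimes>\<^sub>M lborel) (borel \<Otimes>\<^sub>M borel) (\<lambda>(x, y). (x + \<alpha> * y, y))) A = emeasure (lborel \<Otimes>\<^sub>M lborel) A"
      using A by (simp add: s)
  qed (simp add: s)
  show "distr (lborel \<Otimes>\<^sub>M lborel) (borel \<Otimes>\<^sub>M borel) (\<lambda>(x, y). (x, y + \<alpha> * x)) = (lborel \<Otimes>\<^sub>M lborel :: (real \<times> real) measure)"
  proof (rule measure_eqI)
    fix A :: "(real \<times> real) set"
    assume "A \<in> sets (distr (lborel \<Otimes>\<^sub>M lborel) (borel \<Otimes>\<^sub>M borel) (\<lambda>(x, y). (x, y + \<alpha> * x)))"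
    then have A[measurable]: "A \<in> sets (borel \<Otimes>\<^sub>M borel)" by simp
    have "emeasure (distr (lborel \<Otimes>\<^sub>M lborel) (borel \<Otimes>\<^sub>M borel) (\<lambda>(x, y). (x, y + \<alpha> * x))) A
       = (\<integral>\<^sup>+z. indicator A (fst z, snd z + \<alpha> * fst z) \<partial>(lborel \<Otimes>\<^sub>M lborel))"
      by (subst nn_integral_indicator[symmetric], simp, subst nn_integral_distr) (auto simp: split_beta')
    also have "\<dots> = (\<integral>\<^sup>+x. \<integral>\<^sup>+y. indicator A (x, y + \<alpha> * x) \<partial>lborel \<partial>lborel)"
      by (subst lborel.nn_integral_fst[symmetric]) auto
    also have "\<dots> = (\<integral>\<^sup>+x. \<integral>\<^sup>+y. indicator A (x, y) \<partial>lborel \<partial>lborel)"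
    proof (rule nn_integral_cong)
      fix x :: real
      have "(\<integral>\<^sup>+y. indicator A (x, y) \<partial>lborel) = (\<integral>\<^sup>+y. indicator A (x, \<alpha> * x + 1 * y) \<partial>lborel)"
        by (subst nn_integral_real_affine[where c = 1 and t = "\<alpha> * x"]) auto
      then show "(\<integral>\<^sup>+y. indicator A (x, y + \<alpha> * x) \<partial>lborel) = (\<integral>\<^sup>+y. indicator A (x, y) \<partial>lborel)"
        by (simp add: add.commute)
    qed
    also have "\<dots> = (\<integral>\<^sup>+z. indicator A z \<partial>(lborel \<Otimes>\<^sub>M lborel))"
      by (subst lborel.nn_integral_fst) auto
    finally show "emeasure (distr (lborel \<Otimes>\<^sub>M lborel) (borel \<Otimes>\<^sub>M borel) (\<lambda>(x, y). (x, y + \<alpha> * x))) A = emeasure (lborel \<Otimes>\<^sub>M lborel) A"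
      using A by (simp add: s)
  qed (simp add: s)
qed

section \<open>Rotation invariance of planar Gaussian laws\<close>

definition rot :: "real \<Rightarrow> real \<times> real \<Rightarrow> real \<times> real" where
  "rot \<theta> z = (cos \<theta> * fst z - sin \<theta> * snd z, sin \<theta> * fst z + cos \<theta> * snd z)"

lemma rot_measurable [measurable]: "rot \<theta> \<in> measurable (borel \<Otimes>\<^sub>M borel) (borel \<Otimes>\<^sub>M borel)"
  unfolding rot_def by measurable

text \<open>A rotation is a product of three shears.\<close>

lemma distr_lborel_rot:
  assumes "cos \<theta> \<noteq> -1"
  shows "distr (lborel \<Otimes>\<^sub>M lborel) (borel \<Otimes>\<^sub>M borel) (rot \<theta>) = (lborel \<Otimes>\<^sub>M lborel :: (real \<times> real) measure)"
proof -
  \<comment> \<open>The tangent of half the angle; it is infinite at the half-turn, which the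
    assumption excludes.\<close>
  define t where "t = sin \<theta> / (1 + cos \<theta>)"
  define S1 where "S1 = (\<lambda>(x, y). (x + (- t) * y, y :: real))"
  define S2 where "S2 = (\<lambda>(x, y). (x :: real, y + sin \<theta> * x))"
  have m[measurable]: "S1 \<in> measurable (borel \<Otimes>\<^sub>M borel) (borel \<Otimes>\<^sub>M borel)" "S2 \<in> measurable (borel \<Otimes>\<^sub>M borel) (borel \<Otimes>\<^sub>M borel)"
    unfolding S1_def S2_def split_beta' by measurable
  have 0: "1 + cos \<theta> \<noteq> 0" using assms by linarith
  have ts: "1 - t * sin \<theta> = cos \<theta>"
  proof -
    have "sin \<theta> * sin \<theta> = (1 - cos \<theta>) * (1 + cos \<theta>)"
      using sin_cos_squared_add[of \<theta>] by (simp add: power2_eq_square algebra_simps)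
    then have "t * sin \<theta> = 1 - cos \<theta>" using 0 by (simp add: t_def field_simps)
    then show ?thesis by simp
  qed
  have tc: "t * (1 + cos \<theta>) = sin \<theta>" using 0 by (simp add: t_def)
  have rot: "rot \<theta> = S1 \<circ> (S2 \<circ> S1)"
  proof
    fix z :: "real \<times> real"
    obtain x y where z: "z = (x, y)" by force
    have y1: "y + sin \<theta> * (x + - t * y) = sin \<theta> * x + cos \<theta> * y"
      unfolding ts[symmetric] by (simp add: algebra_simps)
    have "x + - t * y + - t * (sin \<theta> * x + cos \<theta> * y) = (1 - t * sin \<theta>) * x - t * (1 + cos \<theta>) * y"
      by (simp add: algebra_simps)
    then have "x + - t * y + - t * (sin \<theta> * x + cos \<theta> * y) = cos \<theta> * x - sin \<theta> * y"
      unfolding ts tc .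
    then show "rot \<theta> z = (S1 \<circ> (S2 \<circ> S1)) z"
      unfolding z rot_def S1_def S2_def o_def prod.case y1 fst_conv snd_conv by simp
  qed
  have m': "S1 \<in> measurable (lborel \<Otimes>\<^sub>M lborel) (borel \<Otimes>\<^sub>M borel)" "S2 \<in> measurable (lborel \<Otimes>\<^sub>M lborel) (borel \<Otimes>\<^sub>M borel)"
    by (simp_all cong: measurable_cong_sets sets_pair_measure_cong)
  have "distr (lborel \<Otimes>\<^sub>M lborel) (borel \<Otimes>\<^sub>M borel) (rot \<theta>) =
    distr (distr (lborel \<Otimes>\<^sub>M lborel) (borel \<Otimes>\<^sub>M borel) (S2 \<circ> S1)) (borel \<Otimes>\<^sub>M borel) S1"
    unfolding rot by (rule distr_distr[OF m(1) measurable_comp[OF m'(1) m(2)], symmetric])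
  also have "distr (lborel \<Otimes>\<^sub>M lborel) (borel \<Otimes>\<^sub>M borel) (S2 \<circ> S1) =
    distr (distr (lborel \<Otimes>\<^sub>M lborel) (borel \<Otimes>\<^sub>M borel) S1) (borel \<Otimes>\<^sub>M borel) S2"
    by (rule distr_distr[OF m(2) m'(1), symmetric])
  also have "distr (distr (distr (lborel \<Otimes>\<^sub>M lborel) (borel \<Otimes>\<^sub>M borel) S1) (borel \<Otimes>\<^sub>M borel) S2) (borel \<Otimes>\<^sub>M borel) S1 = lborel \<Otimes>\<^sub>M lborel"
    unfolding S1_def S2_def distr_lborel_shear ..
  finally show ?thesis .
qed

lemma gauss2_density:
  assumes "0 < \<sigma>"
  shows "gauss2 \<sigma> = density (lborel \<Otimes>\<^sub>M lborel) (\<lambda>(x, y). ennreal (normal_density 0 \<sigma> x) * ennreal (normal_density 0 \<sigma> y))"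
proof -
  interpret G: prob_space "gauss \<sigma>" using assms by (rule prob_space_gauss)
  show ?thesis
    unfolding gauss2_def gauss_def
    by (rule pair_measure_density)
       (use G.sigma_finite_measure_axioms sigma_finite_lborel in \<open>auto simp: gauss_def\<close>)
qed

text \<open>The density is a function of \<open>x^2 + y^2\<close>, and rotations preserve Lebesgue
  measure.\<close>

lemma distr_gauss2_rot:
  assumes \<sigma>: "0 < \<sigma>" and \<theta>: "cos \<theta> \<noteq> -1"
  shows "distr (gauss2 \<sigma>) (borel \<Otimes>\<^sub>M borel) (rot \<theta>) = gauss2 \<sigma>"
proof -
  define D where "D = (\<lambda>z :: real \<times> real. ennreal (normal_density 0 \<sigma> (fst z)) * ennreal (normal_density 0 \<sigma> (snd z)))"
  have Dm[measurable]: "D \<in> borel_measurable (borel \<Otimes>\<^sub>M borel)" unfolding D_def by measurable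
  have inv: "D (rot \<theta> z) = D z" for z
  proof -
    have "(c * x - s * y)\<^sup>2 + (s * x + c * y)\<^sup>2 = (c\<^sup>2 + s\<^sup>2) * (x\<^sup>2 + y\<^sup>2)" for c s x y :: real
      by (simp add: power2_eq_square algebra_simps)
    then have "(fst (rot \<theta> z))\<^sup>2 + (snd (rot \<theta> z))\<^sup>2 = ((cos \<theta>)\<^sup>2 + (sin \<theta>)\<^sup>2) * ((fst z)\<^sup>2 + (snd z)\<^sup>2)"
      by (simp only: rot_def fst_conv snd_conv)
    then have e: "(fst (rot \<theta> z))\<^sup>2 + (snd (rot \<theta> z))\<^sup>2 = (fst z)\<^sup>2 + (snd z)\<^sup>2" by simp
    define k where "k = 1 / sqrt (2 * pi * \<sigma>\<^sup>2)"
    have nd: "normal_density 0 \<sigma> x = k * exp (- x\<^sup>2 / (2 * \<sigma>\<^sup>2))" for x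
      by (simp add: normal_density_def k_def)
    have "normal_density 0 \<sigma> x * normal_density 0 \<sigma> y = k * k * exp (- (x\<^sup>2 + y\<^sup>2) / (2 * \<sigma>\<^sup>2))" for x y
    proof -
      have "- (x\<^sup>2 + y\<^sup>2) / (2 * \<sigma>\<^sup>2) = - x\<^sup>2 / (2 * \<sigma>\<^sup>2) + - y\<^sup>2 / (2 * \<sigma>\<^sup>2)"
        by (simp add: add_divide_distrib diff_divide_distrib)
      then show ?thesis unfolding nd by (simp only: exp_add mult_ac)
    qed
    then have D: "D z = ennreal (k * k * exp (- ((fst z)\<^sup>2 + (snd z)\<^sup>2) / (2 * \<sigma>\<^sup>2)))" for z
      unfolding D_def by (subst ennreal_mult[symmetric]) simp_all
    show ?thesis unfolding D e ..
  qed
  have G: "gauss2 \<sigma> = density (lborel \<Otimes>\<^sub>M lborel) D"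
    unfolding gauss2_density[OF \<sigma>] D_def split_beta' ..
  have s: "sets (lborel \<Otimes>\<^sub>M lborel :: (real \<times> real) measure) = sets (borel \<Otimes>\<^sub>M borel)"
    by (rule sets_pair_measure_cong) simp_all
  have mr: "rot \<theta> \<in> measurable (lborel \<Otimes>\<^sub>M lborel) (borel \<Otimes>\<^sub>M borel)"
    using rot_measurable by (simp cong: measurable_cong_sets add: s)
  have "distr (gauss2 \<sigma>) (borel \<Otimes>\<^sub>M borel) (rot \<theta>) = distr (density (lborel \<Otimes>\<^sub>M lborel) (\<lambda>z. D (rot \<theta> z))) (borel \<Otimes>\<^sub>M borel) (rot \<theta>)"
    unfolding G inv ..
  also have "\<dots> = density (distr (lborel \<Otimes>\<^sub>M lborel) (borel \<Otimes>\<^sub>M borel) (rot \<theta>)) D"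
    by (rule density_distr[OF Dm mr, symmetric])
  also have "\<dots> = gauss2 \<sigma>" unfolding distr_lborel_rot[OF \<theta>] G ..
  finally show ?thesis .
qed

lemma integrable_gauss_powr:
  assumes \<sigma>: "0 < \<sigma>" and p: "1 < p"
  shows "integrable (gauss \<sigma>) (\<lambda>x. (1 + \<bar>x\<bar>) powr p)"
proof -
  define n where "n = nat \<lceil>p\<rceil>"
  have pn: "p \<le> real n" using p by (simp add: n_def of_nat_ceiling)
  have "integrable lborel (\<lambda>x. 2 ^ n * (normal_density 0 \<sigma> x + normal_density 0 \<sigma> x * \<bar>x - 0\<bar> ^ n))"
    using \<sigma> by (intro integrable_mult_right Bochner_Integration.integrable_add integrable_normal_density integrable_normal_moment_abs)
  then have "integrable lborel (\<lambda>x. normal_density 0 \<sigma> x *\<^sub>R (1 + \<bar>x\<bar>) powr p)"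
  proof (rule Bochner_Integration.integrable_bound)
    show "AE x in lborel. norm (normal_density 0 \<sigma> x *\<^sub>R (1 + \<bar>x\<bar>) powr p) \<le> norm (2 ^ n * (normal_density 0 \<sigma> x + normal_density 0 \<sigma> x * \<bar>x - 0\<bar> ^ n))"
    proof (rule AE_I2)
      fix x :: real
      have "(1 + \<bar>x\<bar>) powr p \<le> (1 + \<bar>x\<bar>) powr real n" using pn by (intro powr_mono) auto
      also have "\<dots> = (1 + \<bar>x\<bar>) ^ n" by (simp add: powr_realpow)
      also have "\<dots> \<le> 2 ^ n * (1 + \<bar>x\<bar> ^ n)"
      proof (cases "\<bar>x\<bar> \<le> 1")
        case True
        then have "(1 + \<bar>x\<bar>) ^ n \<le> 2 ^ n * 1" by (simp add: power_mono)
        also have "\<dots> \<le> 2 ^ n * (1 + \<bar>x\<bar> ^ n)" by (intro mult_left_mono) auto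
        finally show ?thesis .
      next
        case False
        then have "(1 + \<bar>x\<bar>) ^ n \<le> (2 * \<bar>x\<bar>) ^ n" by (intro power_mono) auto
        also have "\<dots> \<le> 2 ^ n * (1 + \<bar>x\<bar> ^ n)" by (simp add: power_mult_distrib algebra_simps)
        finally show ?thesis .
      qed
      finally have "normal_density 0 \<sigma> x * (1 + \<bar>x\<bar>) powr p \<le> normal_density 0 \<sigma> x * (2 ^ n * (1 + \<bar>x\<bar> ^ n))"
        by (intro mult_left_mono) auto
      also have "\<dots> = 2 ^ n * (normal_density 0 \<sigma> x + normal_density 0 \<sigma> x * \<bar>x - 0\<bar> ^ n)"
        by (simp add: algebra_simps)
      finally show "norm (normal_density 0 \<sigma> x *\<^sub>R (1 + \<bar>x\<bar>) powr p) \<le> norm (2 ^ n * (normal_density 0 \<sigma> x + normal_density 0 \<sigma> x * \<bar>x - 0\<bar> ^ n))"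
        by (simp add: abs_mult)
    qed
  qed measurable
  then show ?thesis
    unfolding gauss_def by (subst integrable_density) auto
qed

lemma integrable_gauss2_powr:
  assumes \<sigma>: "0 < \<sigma>" and p: "1 < p"
  shows "integrable (gauss2 \<sigma>) (\<lambda>z. (1 + \<bar>fst z\<bar> + \<bar>snd z\<bar>) powr p)"
proof -
  interpret G: prob_space "gauss \<sigma>" using \<sigma> by (rule prob_space_gauss)
  interpret P: pair_prob_space "gauss \<sigma>" "gauss \<sigma>" ..
  have "integrable (gauss \<sigma> \<Otimes>\<^sub>M gauss \<sigma>) (\<lambda>(x, y). (1 + \<bar>x\<bar>) powr p * (1 + \<bar>y\<bar>) powr p)"
    using integrable_gauss_powr[OF assms]
    by (intro P.Fubini_integrable) (auto simp: abs_mult)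
  then show ?thesis
    unfolding gauss2_def
  proof (rule Bochner_Integration.integrable_bound)
    show "AE z in gauss \<sigma> \<Otimes>\<^sub>M gauss \<sigma>. norm ((1 + \<bar>fst z\<bar> + \<bar>snd z\<bar>) powr p) \<le> norm (case z of (x, y) \<Rightarrow> (1 + \<bar>x\<bar>) powr p * (1 + \<bar>y\<bar>) powr p)"
    proof (rule AE_I2)
      fix z :: "real \<times> real"
      have "(1 + \<bar>fst z\<bar> + \<bar>snd z\<bar>) powr p \<le> ((1 + \<bar>fst z\<bar>) * (1 + \<bar>snd z\<bar>)) powr p"
        using p by (intro powr_mono2) (auto simp: algebra_simps)
      then show "norm ((1 + \<bar>fst z\<bar> + \<bar>snd z\<bar>) powr p) \<le> norm (case z of (x, y) \<Rightarrow> (1 + \<bar>x\<bar>) powr p * (1 + \<bar>y\<bar>) powr p)"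
        by (simp add: powr_mult split_beta')
    qed
  qed measurable
qed

lemma step_law_gauss2:
  assumes \<sigma>: "0 < \<sigma>" and p: "1 < p"
  shows "step_law (gauss2 \<sigma>) fst snd p"
proof -
  interpret G: prob_space "gauss2 \<sigma>" using \<sigma> by (rule prob_space_gauss2)
  show ?thesis
  proof
    show "distr (gauss2 \<sigma>) (borel \<Otimes>\<^sub>M borel) (\<lambda>w. (- fst w, - snd w)) = distr (gauss2 \<sigma>) (borel \<Otimes>\<^sub>M borel) (\<lambda>w. (fst w, snd w))"
    proof -
      \<comment> \<open>The half-turn is outside the scope of \<open>distr_gauss2_rot\<close> and is
        therefore written as two quarter-turns.\<close>
      have r: "(\<lambda>w :: real \<times> real. (- fst w, - snd w)) = rot (pi / 2) \<circ> rot (pi / 2)"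
        by (rule ext) (simp add: rot_def)
      have mr: "rot (pi / 2) \<in> measurable (gauss2 \<sigma>) (borel \<Otimes>\<^sub>M borel)"
        using rot_measurable by (simp cong: measurable_cong_sets add: sets_gauss2)
      have "distr (gauss2 \<sigma>) (borel \<Otimes>\<^sub>M borel) (rot (pi / 2) \<circ> rot (pi / 2)) =
          distr (distr (gauss2 \<sigma>) (borel \<Otimes>\<^sub>M borel) (rot (pi / 2))) (borel \<Otimes>\<^sub>M borel) (rot (pi / 2))"
        by (rule distr_distr[OF rot_measurable mr, symmetric])
      also have "\<dots> = gauss2 \<sigma>" using \<sigma> by (simp add: distr_gauss2_rot)
      also have "\<dots> = distr (gauss2 \<sigma>) (borel \<Otimes>\<^sub>M borel) (\<lambda>w. (fst w, snd w))"
        using distr_id2[OF sets_gauss2[symmetric]] by (simp add: id_def)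
      finally show ?thesis unfolding r .
    qed
    show "fst \<in> borel_measurable (gauss2 \<sigma>)" "snd \<in> borel_measurable (gauss2 \<sigma>)"
      by (simp_all cong: measurable_cong_sets add: sets_gauss2)
  qed (use p integrable_gauss2_powr[OF assms] in auto)
qed

lemma integrable_pair_snd:
  assumes "prob_space M" "prob_space N" "integrable N h"
  shows "integrable (M \<Otimes>\<^sub>M N) (\<lambda>z. h (snd z) :: real)"
proof -
  interpret M: prob_space M by fact
  interpret N: prob_space N by fact
  interpret P: pair_prob_space M N ..
  have m: "h \<in> borel_measurable N" using assms(3) by auto
  have "integrable (M \<Otimes>\<^sub>M N) (\<lambda>(x, y). h y)"
    using assms(3) m by (intro P.Fubini_integrable) (auto simp: M.prob_space)
  then show ?thesis by (simp add: split_beta')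
qed

text \<open>By rotation invariance the Gaussian law is a mixture over \<open>z\<close> of the laws
  of \<open>rot \<theta> z\<close> with uniform \<open>\<theta>\<close>. For fixed \<open>z\<close>
  the coordinates of this orbit are a real conjugate pair of frequency 1, to which
  \<open>circ_nonpos_modulate\<close> applies; Fubini assembles the orbits.\<close>

lemma circ_nonpos_gauss2:
  fixes Q :: "'a::real_normed_vector \<times> 'a \<Rightarrow> real"
  assumes \<sigma>: "0 < \<sigma>" and p: "1 < p" and Q: "good p Q" "circ_nonpos Q" and fg: "conj_pair f g" and v: "trig_poly v"
  shows "(\<integral>t. step_law.avg (gauss2 \<sigma>) fst snd Q (f t) (g t) (v t) \<partial>circ) \<le> 0"
proof -
  interpret step_law "gauss2 \<sigma>" fst snd p using \<sigma> p by (rule step_law_gauss2)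
  define F where "F = (\<lambda>t \<theta> z. Q (f t + fst (rot \<theta> z) *\<^sub>R v t, g t + snd (rot \<theta> z) *\<^sub>R v t))"
  obtain K where K: "0 \<le> K" "\<And>x y. \<bar>Q (x, y)\<bar> \<le> K * (1 + norm x + norm y) powr p"
    using goodD(4)[OF Q(1)] by blast
  obtain B1 where B1: "\<And>t. norm (f t) \<le> B1" "\<And>t. norm (g t) \<le> B1" using conj_pair_bounded[OF fg] by blast
  obtain B2 where B2: "\<And>t. norm (v t) \<le> B2" using trig_poly_bounded[OF v] by blast
  have nnB: "0 \<le> B2" "0 \<le> B1" using order_trans[OF norm_ge_zero B2] order_trans[OF norm_ge_zero B1(1)] .
  \<comment> \<open>Rotated coordinates are at most
    \<open>\<bar>fst z\<bar> + \<bar>snd z\<bar>\<close>. This costs the factor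
    \<open>2 powr p\<close> and makes the majorant independent of \<open>\<theta>\<close> and
    \<open>t\<close>.\<close>
  define h where "h = (\<lambda>z :: real \<times> real. K * ((1 + B1 + B1) powr p * (1 + B2) powr p * (2 powr p * (1 + \<bar>fst z\<bar> + \<bar>snd z\<bar>) powr p)))"
  have h: "integrable (gauss2 \<sigma>) h" unfolding h_def using moment by simp
  have Fh: "\<bar>F t \<theta> z\<bar> \<le> h z" for t \<theta> z
  proof -
    have "\<bar>F t \<theta> z\<bar> \<le> K * ((1 + norm (f t) + norm (g t)) powr p * (1 + norm (v t)) powr p * (1 + \<bar>fst (rot \<theta> z)\<bar> + \<bar>snd (rot \<theta> z)\<bar>) powr p)"
      unfolding F_def by (rule integrand_bound[OF K(2,1)])
    also have "\<dots> \<le> K * ((1 + B1 + B1) powr p * (1 + B2) powr p * (2 * (1 + \<bar>fst z\<bar> + \<bar>snd z\<bar>)) powr p)"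
    proof (intro mult_left_mono mult_mono powr_mono2 add_mono)
      have "\<bar>cos \<theta> * x\<bar> \<le> \<bar>x\<bar>" "\<bar>sin \<theta> * x\<bar> \<le> \<bar>x\<bar>" for x
        by (simp_all add: abs_mult mult_left_le_one_le)
      then have "\<bar>fst (rot \<theta> z)\<bar> \<le> \<bar>fst z\<bar> + \<bar>snd z\<bar>" "\<bar>snd (rot \<theta> z)\<bar> \<le> \<bar>fst z\<bar> + \<bar>snd z\<bar>"
        unfolding rot_def fst_conv snd_conv by (smt (verit))+
      then show "1 + \<bar>fst (rot \<theta> z)\<bar> + \<bar>snd (rot \<theta> z)\<bar> \<le> 2 * (1 + \<bar>fst z\<bar> + \<bar>snd z\<bar>)" by simp
    qed (use K(1) p B1 B2 nnB in auto)
    also have "(2 * (1 + \<bar>fst z\<bar> + \<bar>snd z\<bar>)) powr p = 2 powr p * (1 + \<bar>fst z\<bar> + \<bar>snd z\<bar>) powr p"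
      by (rule powr_mult)
    also have "K * ((1 + B1 + B1) powr p * (1 + B2) powr p * \<dots>) = h z" by (simp only: h_def)
    finally show ?thesis .
  qed
  note c = conj_pair_continuous[OF fg] trig_poly_continuous[OF v]
  have cf: "continuous_on UNIV (\<lambda>z. f (k z))" "continuous_on UNIV (\<lambda>z. g (k z))" "continuous_on UNIV (\<lambda>z. v (k z))"
    if "continuous_on UNIV k" for k :: "'z::topological_space \<Rightarrow> real"
    using c that by (auto intro: continuous_on_compose2)
  have Fm: "(\<lambda>u. F (fst (fst u)) (snd u) (snd (fst u))) \<in> borel_measurable (borel :: ((real \<times> real \<times> real) \<times> real) measure)"
    unfolding F_def rot_def
    by (intro borel_measurable_continuous_onI continuous_on_compose2[OF goodD(1)[OF Q(1)]])
       (auto intro!: continuous_intros cf)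
  have sb: "sets ((circ \<Otimes>\<^sub>M gauss2 \<sigma>) \<Otimes>\<^sub>M circ) = sets (borel :: ((real \<times> real \<times> real) \<times> real) measure)"
  proof -
    have "sets ((circ \<Otimes>\<^sub>M gauss2 \<sigma>) \<Otimes>\<^sub>M circ) = sets ((borel \<Otimes>\<^sub>M (borel \<Otimes>\<^sub>M borel)) \<Otimes>\<^sub>M borel)"
      by (intro sets_pair_measure_cong sets_gauss2) auto
    then show ?thesis by (simp only: borel_prod)
  qed
  have Fm3: "(\<lambda>u. F (fst (fst u)) (snd u) (snd (fst u))) \<in> borel_measurable ((circ \<Otimes>\<^sub>M gauss2 \<sigma>) \<Otimes>\<^sub>M circ)"
    using Fm unfolding measurable_cong_sets[OF sb refl] .
  interpret P: pair_prob_space circ "gauss2 \<sigma>" ..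
  have avgF: "avg Q (f t) (g t) (v t) = (\<integral>z. F t \<theta> z \<partial>gauss2 \<sigma>)" if \<theta>: "cos \<theta> \<noteq> -1" for t \<theta>
  proof -
    have m1: "(\<lambda>(s, r). Q (f t + s *\<^sub>R v t, g t + r *\<^sub>R v t)) \<in> borel_measurable (borel \<Otimes>\<^sub>M borel)"
      by (rule line_measurable[OF goodD(1)[OF Q(1)]])
    have mr: "rot \<theta> \<in> measurable (gauss2 \<sigma>) (borel \<Otimes>\<^sub>M borel)"
      using rot_measurable by (simp cong: measurable_cong_sets add: sets_gauss2)
    have "avg Q (f t) (g t) (v t) = (\<integral>z. (case z of (s, r) \<Rightarrow> Q (f t + s *\<^sub>R v t, g t + r *\<^sub>R v t)) \<partial>distr (gauss2 \<sigma>) (borel \<Otimes>\<^sub>M borel) (rot \<theta>))"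
      unfolding distr_gauss2_rot[OF \<sigma> \<theta>] avg_def by (simp add: split_beta')
    also have "\<dots> = (\<integral>z. F t \<theta> z \<partial>gauss2 \<sigma>)"
      by (subst integral_distr[OF mr m1]) (simp add: F_def split_beta')
    finally show ?thesis .
  qed
  have ae: "AE \<theta> in circ. cos \<theta> \<noteq> -1"
    unfolding AE_circ
    using AE_lborel_singleton[of "-pi"]
  proof eventually_elim
    case (elim \<theta>)
    show ?case
    proof
      assume \<theta>: "\<theta> \<in> {-pi..<pi}"
      show "cos \<theta> \<noteq> -1"
      proof
        assume "cos \<theta> = -1"
        then have "cos \<bar>\<theta>\<bar> = cos pi" by simp
        then have "\<bar>\<theta>\<bar> = pi" using \<theta> by (auto intro: cos_inj_pi[of _ pi])
        then show False using \<theta> elim by auto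
      qed
    qed
  qed
  have mF: "(\<lambda>(\<theta>, z). F t \<theta> z) \<in> borel_measurable (circ \<Otimes>\<^sub>M gauss2 \<sigma>)" for t
  proof -
    have "(\<lambda>u. ((t, snd u), fst u)) \<in> measurable (circ \<Otimes>\<^sub>M gauss2 \<sigma>) ((circ \<Otimes>\<^sub>M gauss2 \<sigma>) \<Otimes>\<^sub>M circ)"
      by (intro measurable_Pair measurable_const measurable_snd measurable_fst) auto
    from measurable_compose[OF this Fm3]
    show "(\<lambda>(\<theta>, z). F t \<theta> z) \<in> borel_measurable (circ \<Otimes>\<^sub>M gauss2 \<sigma>)" by (simp add: split_beta')
  qed
  have intF: "integrable (circ \<Otimes>\<^sub>M gauss2 \<sigma>) (\<lambda>(\<theta>, z). F t \<theta> z)" for t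
  proof (rule Bochner_Integration.integrable_bound[OF integrable_pair_snd[OF prob_space_circ prob_space_axioms h]])
    show "(\<lambda>(\<theta>, z). F t \<theta> z) \<in> borel_measurable (circ \<Otimes>\<^sub>M gauss2 \<sigma>)" by (rule mF)
    show "AE x in circ \<Otimes>\<^sub>M gauss2 \<sigma>. norm (case x of (\<theta>, z) \<Rightarrow> F t \<theta> z) \<le> norm (h (snd x))"
      using Fh by (auto intro!: AE_I2 order_trans[OF _ abs_ge_self])
  qed
  have swap1: "avg Q (f t) (g t) (v t) = (\<integral>z. (\<integral>\<theta>. F t \<theta> z \<partial>circ) \<partial>gauss2 \<sigma>)" for t
  proof -
    have "avg Q (f t) (g t) (v t) = (\<integral>\<theta>. avg Q (f t) (g t) (v t) \<partial>circ)" by simp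
    also have "\<dots> = (\<integral>\<theta>. (\<integral>z. F t \<theta> z \<partial>gauss2 \<sigma>) \<partial>circ)"
      by (rule integral_cong_AE) (use ae avgF borel_measurable_lebesgue_integral[OF mF] in auto)
    also have "\<dots> = (\<integral>z. (\<integral>\<theta>. F t \<theta> z \<partial>circ) \<partial>gauss2 \<sigma>)"
      by (rule P.Fubini_integral[OF intF, symmetric])
    finally show ?thesis .
  qed
  have "(\<integral>t. avg Q (f t) (g t) (v t) \<partial>circ) = (\<integral>t. (\<integral>z. (\<integral>\<theta>. F t \<theta> z \<partial>circ) \<partial>gauss2 \<sigma>) \<partial>circ)"
    using swap1 by simp
  also have "\<dots> = (\<integral>z. (\<integral>t. (\<integral>\<theta>. F t \<theta> z \<partial>circ) \<partial>circ) \<partial>gauss2 \<sigma>)"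
  proof (rule P.Fubini_integral[symmetric], rule Bochner_Integration.integrable_bound[OF integrable_pair_snd[OF prob_space_circ prob_space_axioms h]])
    show "(\<lambda>(t, z). \<integral>\<theta>. F t \<theta> z \<partial>circ) \<in> borel_measurable (circ \<Otimes>\<^sub>M gauss2 \<sigma>)"
      using circ.borel_measurable_lebesgue_integral[of "\<lambda>u \<theta>. F (fst u) \<theta> (snd u)" "circ \<Otimes>\<^sub>M gauss2 \<sigma>"] Fm3
      by (simp add: split_beta')
    have "\<bar>\<integral>\<theta>. F t \<theta> z \<partial>circ\<bar> \<le> (\<integral>\<theta>. h z \<partial>circ)" for t z
    proof (rule integral_abs_bound_integral)
      have "(\<lambda>\<theta>. ((t, z), \<theta>)) \<in> measurable circ ((circ \<Otimes>\<^sub>M gauss2 \<sigma>) \<Otimes>\<^sub>M circ)"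
        by (intro measurable_Pair measurable_const measurable_ident) (auto simp: space_pair_measure)
      from measurable_compose[OF this Fm3] have "(\<lambda>\<theta>. F t \<theta> z) \<in> borel_measurable circ" by simp
      then show "integrable circ (\<lambda>\<theta>. F t \<theta> z)"
        by (intro circ.integrable_const_bound[where B = "h z"] AE_I2) (simp_all add: Fh)
    qed (simp_all add: Fh)
    then show "AE x in circ \<Otimes>\<^sub>M gauss2 \<sigma>. norm (case x of (t, z) \<Rightarrow> \<integral>\<theta>. F t \<theta> z \<partial>circ) \<le> norm (h (snd x))"
      by (auto intro!: AE_I2 order_trans[OF _ abs_ge_self] simp del: circ.prob_space)
  qed
  also have "\<dots> \<le> 0"
  proof -
    have "(\<integral>t. (\<integral>\<theta>. F t \<theta> z \<partial>circ) \<partial>circ) \<le> 0" for z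
    proof -
      have base: "conj_pair (\<lambda>\<theta>. r * cos (\<theta> + \<phi>)) (\<lambda>\<theta>. r * sin (\<theta> + \<phi>))" for r \<phi> :: real
        using conj_pair.base[of 1 \<phi> r] by (simp add: mult.commute)
      \<comment> \<open>A quarter-turn of the phase changes the pair of cosine and sine into the
        pair of negative sine and cosine, the coefficients of \<open>snd z\<close> in
        \<open>rot\<close>.\<close>
      have "conj_pair (\<lambda>\<theta>. fst z * cos (\<theta> + 0) + snd z * cos (\<theta> + pi / 2)) (\<lambda>\<theta>. fst z * sin (\<theta> + 0) + snd z * sin (\<theta> + pi / 2))"
        by (intro conj_pair.add base)
      then have "conj_pair (\<lambda>\<theta>. fst (rot \<theta> z)) (\<lambda>\<theta>. snd (rot \<theta> z))"
        by (simp add: rot_def cos_add sin_add mult.commute)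
      from circ_nonpos_modulate[OF p Q fg v this] show ?thesis by (simp add: F_def)
    qed
    then have "0 \<le> (\<integral>z. - (\<integral>t. (\<integral>\<theta>. F t \<theta> z \<partial>circ) \<partial>circ) \<partial>gauss2 \<sigma>)"
      by (intro Bochner_Integration.integral_nonneg) simp
    then show ?thesis by simp
  qed
  finally show ?thesis .
qed

section \<open>The conformal map of the strip\<close>

text \<open>A shift by half a period, \<open>pi / k\<close>, changes the sign of the
  integrand.\<close>

lemma integral_circ_cos: 
  assumes "0 < k" shows "(\<integral>t. cos (real k * t + \<phi>) \<partial>circ) = 0"
proof -
  have "(\<integral>t. cos (real k * (t + pi / real k) + \<phi>) \<partial>circ) = (\<integral>t. cos (real k * t + \<phi>) \<partial>circ)"
    by (rule integral_circ_shift[where B = 1]) (auto simp: cos_sin_period)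
  moreover have "cos (real k * (t + pi / real k) + \<phi>) = - cos (real k * t + \<phi>)" for t
  proof -
    have "real k * (t + pi / real k) + \<phi> = (real k * t + \<phi>) + pi"
      using assms by (simp add: field_simps)
    then show ?thesis by (simp only: cos_periodic_pi)
  qed
  ultimately show ?thesis by simp
qed

section \<open>Mean value property of analytic polynomials\<close>

lemma conj_pair_measurable:
  fixes \<xi> \<xi>' :: "real \<Rightarrow> real"
  assumes "conj_pair \<xi> \<xi>'"
  shows "\<xi> \<in> borel_measurable borel" "\<xi>' \<in> borel_measurable borel"
  using conj_pair_continuous[OF assms] by (auto intro: borel_measurable_continuous_onI)

lemma conj_pair_mean_zero:
  fixes \<xi> \<xi>' :: "real \<Rightarrow> real"
  assumes "conj_pair \<xi> \<xi>'"
  shows "(\<integral>t. \<xi> t \<partial>circ) = 0 \<and> (\<integral>t. \<xi>' t \<partial>circ) = 0"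
  using assms
proof (induction rule: conj_pair.induct)
  case (base k \<phi> x)
  have "sin (real k * t + \<phi>) = cos (real k * t + (\<phi> - pi / 2))" for t
    using cos_diff[of "real k * t + \<phi>" "pi / 2"] by (simp add: add_diff_eq)
  then show ?case using integral_circ_cos[OF base] by (simp add: integral_circ_cos[OF base])
next
  case (add f g f' g')
  have int: "integrable circ f \<and> integrable circ g" if fg: "conj_pair f g" for f g :: "real \<Rightarrow> real"
  proof -
    obtain B where "\<And>t. norm (f t) \<le> B \<and> norm (g t) \<le> B" using conj_pair_bounded[OF fg] by blast
    then show ?thesis
      using conj_pair_measurable[OF fg] by (auto intro!: circ.integrable_const_bound[where B = B])
  qed
  show ?case using add.IH int[OF add.hyps(1)] int[OF add.hyps(2)] by simp
qed

text \<open>A real conjugate pair consists of the real and the imaginary part, on the unit circle,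
  of a complex polynomial vanishing at 0. The formula is the complex product.\<close>

lemma conj_pair_mult:
  fixes f g f' g' :: "real \<Rightarrow> real"
  assumes "conj_pair f g" "conj_pair f' g'"
  shows "conj_pair (\<lambda>t. f t * f' t - g t * g' t) (\<lambda>t. f t * g' t + g t * f' t)"
  using assms
proof (induction rule: conj_pair.induct)
  case (base k \<phi> x)
  from base.prems show ?case
  proof (induction rule: conj_pair.induct)
    case (base l \<psi> y)
    have "conj_pair (\<lambda>t. cos (real (k + l) * t + (\<phi> + \<psi>)) *\<^sub>R (x * y)) (\<lambda>t. sin (real (k + l) * t + (\<phi> + \<psi>)) *\<^sub>R (x * y))"
      using base by (intro conj_pair.base) simp
    moreover have "real (k + l) * t + (\<phi> + \<psi>) = (real k * t + \<phi>) + (real l * t + \<psi>)" for t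
      by (simp add: algebra_simps)
    ultimately show ?case
      by (simp only: cos_add[of "real k * _ + \<phi>" "real l * _ + \<psi>"] sin_add[of "real k * _ + \<phi>" "real l * _ + \<psi>"])
         (simp add: algebra_simps)
  next
    case (add f g f' g')
    from conj_pair.add[OF add.IH] show ?case by (simp add: algebra_simps)
  qed
next
  case (add f1 g1 f2 g2)
  from conj_pair.add[OF add.IH(1)[OF add.prems] add.IH(2)[OF add.prems]] show ?case by (simp add: algebra_simps)
qed

text \<open>Positive powers of a polynomial vanishing at 0 vanish there as well, and the mean over
  the circle is the value at the centre.\<close>

lemma conj_pair_power_mean:
  assumes "conj_pair \<xi> \<xi>'"
  shows "(\<integral>t. Complex (\<xi> t) (\<xi>' t) ^ Suc m \<partial>circ) = 0"
proof -
  have "conj_pair (\<lambda>t. Re (Complex (\<xi> t) (\<xi>' t) ^ Suc m)) (\<lambda>t. Im (Complex (\<xi> t) (\<xi>' t) ^ Suc m))"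
  proof (induction m)
    case (Suc m)
    from conj_pair_mult[OF assms this] show ?case by simp
  qed (simp add: assms)
  note cp = this
  obtain B where B: "\<And>t. \<bar>\<xi> t\<bar> \<le> B" "\<And>t. \<bar>\<xi>' t\<bar> \<le> B" using conj_pair_bounded[OF assms] by auto
  have m[measurable]: "\<xi> \<in> borel_measurable borel" "\<xi>' \<in> borel_measurable borel"
    using conj_pair_measurable[OF assms] by auto
  have mc: "(\<lambda>t. Complex (\<xi> t) (\<xi>' t)) \<in> borel_measurable borel"
    unfolding Complex_eq by measurable
  have "norm (Complex (\<xi> t) (\<xi>' t)) \<le> B + B" for t
    using cmod_le[of "Complex (\<xi> t) (\<xi>' t)"] B[of t] by (simp; linarith)
  then have "norm (Complex (\<xi> t) (\<xi>' t) ^ Suc m) \<le> (B + B) ^ Suc m" for t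
    unfolding norm_power by (intro power_mono) auto
  then have int: "integrable circ (\<lambda>t. Complex (\<xi> t) (\<xi>' t) ^ Suc m)"
    using borel_measurable_power[OF mc, of "Suc m"]
    by (intro circ.integrable_const_bound[where B = "(B + B) ^ Suc m"]) (auto cong: measurable_cong_sets)
  show ?thesis
    using conj_pair_mean_zero[OF cp] int by (simp add: complex_eq_iff flip: integral_Re integral_Im)
qed

text \<open>The mean value property of \<open>exp (c * F)\<close> for a polynomial \<open>F\<close>
  vanishing at 0: in the exponential series only the term of order 0 has a nonzero mean. Both the
  characteristic function and the exponential moments of the strip map are drawn from this
  identity.\<close>

lemma conj_pair_mean_exp:
  assumes "conj_pair \<xi> \<xi>'"
  shows "(\<integral>t. exp (c * Complex (\<xi> t) (\<xi>' t)) \<partial>circ) = 1"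
proof -
  let ?F = "\<lambda>t. Complex (\<xi> t) (\<xi>' t)"
  obtain B where B: "\<And>t. \<bar>\<xi> t\<bar> \<le> B" "\<And>t. \<bar>\<xi>' t\<bar> \<le> B" using conj_pair_bounded[OF assms] by auto
  have m[measurable]: "\<xi> \<in> borel_measurable borel" "\<xi>' \<in> borel_measurable borel"
    using conj_pair_measurable[OF assms] by auto
  have mc[measurable]: "?F \<in> borel_measurable borel"
    unfolding Complex_eq by measurable
  have FB: "norm (?F t) \<le> B + B" for t
    using cmod_le[of "?F t"] B[of t] by (simp; linarith)
  define S where "S = (\<lambda>n t. \<Sum>m<n. (c * ?F t) ^ m /\<^sub>R fact m)"
  have Sm[measurable]: "S n \<in> borel_measurable borel" for n unfolding S_def by measurable
  have "(\<lambda>n. \<integral>t. S n t \<partial>circ) \<longlonglongrightarrow> (\<integral>t. exp (c * ?F t) \<partial>circ)"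
  proof (rule integral_dominated_convergence[where w = "\<lambda>_. exp (norm c * (B + B))"])
    show "AE t in circ. (\<lambda>n. S n t) \<longlonglongrightarrow> exp (c * ?F t)"
      unfolding S_def using exp_converges[of "c * ?F _"] by (intro AE_I2) (simp add: sums_def)
    have "norm (S n t) \<le> exp (norm c * (B + B))" for n t
    proof -
      have "norm (S n t) \<le> (\<Sum>m<n. norm (c * ?F t) ^ m /\<^sub>R fact m)"
        unfolding S_def by (rule order_trans[OF norm_sum]) (simp add: norm_power)
      also have "\<dots> \<le> exp (norm (c * ?F t))"
        using exp_converges[of "norm (c * ?F t)"]
        by (intro sum_le_suminf[THEN order_trans] ) (auto simp: sums_iff)
      also have "\<dots> \<le> exp (norm c * (B + B))"
        using FB by (simp add: norm_mult mult_left_mono)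
      finally show ?thesis .
    qed
    then show "AE t in circ. norm (S n t) \<le> exp (norm c * (B + B))" for n by simp
  qed (auto cong: measurable_cong_sets)
  moreover have "(\<integral>t. S n t \<partial>circ) = 1" if "0 < n" for n
  proof -
    have int: "integrable circ (\<lambda>t. ?F t ^ m)" for m
    proof (rule circ.integrable_const_bound[where B = "(B + B) ^ m"])
      show "AE t in circ. norm (?F t ^ m) \<le> (B + B) ^ m"
        unfolding norm_power using FB by (intro AE_I2 power_mono) auto
    qed (auto cong: measurable_cong_sets)
    have "(\<integral>t. S n t \<partial>circ) = (\<Sum>m<n. (\<integral>t. (c * ?F t) ^ m /\<^sub>R fact m \<partial>circ))"
      unfolding S_def using int by (intro Bochner_Integration.integral_sum) (simp add: power_mult_distrib)
    also have "\<dots> = (\<Sum>m<n. if m = 0 then 1 else 0)"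
    proof (intro sum.cong refl)
      fix m show "(\<integral>t. (c * ?F t) ^ m /\<^sub>R fact m \<partial>circ) = (if m = 0 then 1 else 0)"
      proof -
        have "(c * ?F t) ^ m /\<^sub>R fact m = (c ^ m / of_real (fact m)) * ?F t ^ m" for t
          by (simp add: power_mult_distrib scaleR_conv_of_real field_simps)
        then have "(\<integral>t. (c * ?F t) ^ m /\<^sub>R fact m \<partial>circ) = (c ^ m / of_real (fact m)) * (\<integral>t. ?F t ^ m \<partial>circ)"
          by (simp only: integral_mult_right_zero)
        then show ?thesis
          using conj_pair_power_mean[OF assms, of "m - 1"] by (cases m) (simp_all del: power_Suc)
      qed
    qed
    also have "\<dots> = 1" using that by simp
    finally show ?thesis .
  qed
  then have "(\<lambda>n. \<integral>t. S n t \<partial>circ) \<longlonglongrightarrow> 1"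
    by (intro tendsto_eventually eventually_mono[OF eventually_gt_at_top[of 0]])
  ultimately show ?thesis by (rule LIMSEQ_unique)
qed

text \<open>The conformal map of the unit disc onto the strip of all \<open>z\<close> with \<open>\<bar>Re z\<bar> < 1\<close>. Its boundary
  values are distributed like a planar Brownian motion when it leaves the strip.\<close>

definition strip_map :: "complex \<Rightarrow> complex" where
  "strip_map z = of_real (4 / pi) * Arctan z"

text \<open>On the circle, \<open>(1 - \<i> * z) / (1 + \<i> * z)\<close> is purely imaginary and
  nonzero, so its logarithm, which defines \<open>Arctan\<close>, has imaginary part
  \<open>pi / 2\<close> or \<open>- pi / 2\<close>. The excluded points with \<open>Re z = 0\<close>
  are the singular points \<open>\<i>\<close> and \<open>- \<i>\<close>.\<close>

lemma Re_strip_map_circle: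
  assumes z: "norm z = 1" and "Re z \<noteq> 0"
  shows "Re (strip_map z) \<in> {1, -1}"
proof -
  have zz: "(Re z)\<^sup>2 + (Im z)\<^sup>2 = 1" using z by (metis cmod_power2 one_power2)
  define w where "w = (1 - \<i> * z) / (1 + \<i> * z)"
  have nz: "1 + \<i> * z \<noteq> 0" using assms by (auto simp: complex_eq_iff)
  have Im1: "Im z \<noteq> 1" using zz assms by auto
  have w: "w = \<i> * of_real (- Re z / (1 - Im z))"
  proof -
    have "(1 - \<i> * z) = \<i> * of_real (- Re z / (1 - Im z)) * (1 + \<i> * z)"
    proof -
      have "(1 - Im z) * (1 + Im z) = Re z * Re z" using zz by (simp add: power2_eq_square algebra_simps)
      then show ?thesis using Im1 by (simp add: complex_eq_iff field_simps)
    qed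
    then show ?thesis using nz by (simp add: w_def)
  qed
  define r where "r = - Re z / (1 - Im z)"
  have r0: "r \<noteq> 0" using assms Im1 by (simp add: r_def)
  have "Im (Ln w) = pi / 2 \<or> Im (Ln w) = - (pi / 2)"
  proof (cases "0 < r")
    case True
    then have "Ln w = ln r + \<i> * (of_real pi / 2)"
      unfolding w r_def[symmetric] by (simp add: Ln_times_ii Ln_of_real)
    then show ?thesis using True by (simp add: Ln_of_real)
  next
    case False
    then have "w = - \<i> * of_real (- r)" unfolding w r_def[symmetric] by simp
    moreover have "Ln (- \<i> * of_real (- r)) = ln (- r) - \<i> * (of_real pi / 2)"
    proof (rule Ln_unique)
      show "exp (of_real (ln (- r)) - \<i> * (of_real pi / 2)) = - \<i> * of_real (- r)"
        using False r0 by (simp add: exp_diff exp_of_real exp_Euler[symmetric] exp_eq_polar cis_conv_exp[symmetric] complex_eq_iff)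
    qed (use pi_gt_zero in \<open>auto simp del: pi_gt_zero\<close>)
    ultimately show ?thesis by simp
  qed
  moreover have "Re (Arctan z) = - Im (Ln w) / 2" unfolding Arctan_def w_def[symmetric] by simp
  ultimately show ?thesis unfolding strip_map_def by (auto simp: field_simps)
qed

text \<open>The strip map has logarithmic singularities at \<open>\<i>\<close> and
  \<open>- \<i>\<close>, that is where \<open>cos \<theta> = 0\<close>. The default 1 keeps the
  values in \<open>{1, -1}\<close> everywhere.\<close>

definition strip_re :: "real \<Rightarrow> real" where
  "strip_re \<theta> = (if cos \<theta> = 0 then 1 else Re (strip_map (cis \<theta>)))"

definition strip_im :: "real \<Rightarrow> real" where
  "strip_im \<theta> = (if cos \<theta> = 0 then 0 else Im (strip_map (cis \<theta>)))"

lemma strip_re_values: "strip_re \<theta> \<in> {1, -1}"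
  unfolding strip_re_def using Re_strip_map_circle[of "cis \<theta>"] by auto

lemma strip_periodic: "strip_re (\<theta> + 2 * pi) = strip_re \<theta>" "strip_im (\<theta> + 2 * pi) = strip_im \<theta>"
proof -
  have "cis (\<theta> + 2 * pi) = cis \<theta>" by (simp add: complex_eq_iff cos_add sin_add)
  then show "strip_re (\<theta> + 2 * pi) = strip_re \<theta>" "strip_im (\<theta> + 2 * pi) = strip_im \<theta>"
    by (simp_all add: strip_re_def strip_im_def)
qed

text \<open>The arctangent series converges uniformly on every smaller disc. It has real
  coefficients and odd exponents only, which is the origin of the symmetries in
  \<open>strip_approximation\<close>.\<close>

lemma strip_map_partial_sums:
  assumes r: "0 < r" "r < 1" and e: "0 < e"
  shows "\<exists>c J. \<forall>\<theta>. norm ((\<Sum>k<J. of_real (c k) * cis (real (2 * k + 1) * \<theta>)) - strip_map (of_real r * cis \<theta>)) < e"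
proof -
  define h where "h = (\<lambda>(k::nat) z::complex. (-1)^k / of_nat (2*k+1) * z^(2*k+1))"
  have "uniform_limit (cball 0 r) (\<lambda>n z. \<Sum>k<n. h k z) (\<lambda>z. suminf (\<lambda>k. h k z)) sequentially"
  proof (rule Weierstrass_m_test)
    fix k and z :: complex assume z: "z \<in> cball 0 r"
    have "norm (h k z) = norm z ^ (2 * k + 1) / real (2 * k + 1)"
      by (simp only: h_def norm_mult norm_divide norm_power norm_minus_cancel norm_one power_one norm_of_nat)
         simp
    also have "\<dots> \<le> norm z ^ (2 * k + 1) / 1" by (intro divide_left_mono) auto
    also have "\<dots> \<le> r ^ (2 * k + 1)" using z by (simp only: div_by_1) (intro power_mono, auto)
    also have "\<dots> \<le> r ^ k" using r by (intro power_decreasing) auto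
    finally show "norm (h k z) \<le> r ^ k" .
  qed (use r in \<open>simp add: summable_geometric\<close>)
  then have "\<forall>\<^sub>F n in sequentially. \<forall>z\<in>cball 0 r. dist (\<Sum>k<n. h k z) (suminf (\<lambda>k. h k z)) < e * pi / 4"
    using e by (intro uniform_limitD) auto
  then obtain J where J: "\<And>z. z \<in> cball 0 r \<Longrightarrow> dist (\<Sum>k<J. h k z) (suminf (\<lambda>k. h k z)) < e * pi / 4"
    unfolding eventually_sequentially by blast
  define c where "c = (\<lambda>k::nat. 4 / pi * ((-1)^k / real (2*k+1) * r ^ (2*k+1)))"
  show ?thesis
  proof (intro exI[of _ c] exI[of _ J] allI)
    fix \<theta>
    let ?z = "of_real r * cis \<theta>"
    have nz: "norm ?z = r" using r by (simp add: norm_mult)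
    have "suminf (\<lambda>k. h k ?z) = Arctan ?z"
      using Arctan_series(2)[of ?z] nz r unfolding h_def by (simp add: sums_iff)
    then have d: "norm ((\<Sum>k<J. h k ?z) - Arctan ?z) < e * pi / 4"
      using J[of ?z] nz by (simp add: dist_norm)
    have "(\<Sum>k<J. of_real (c k) * cis (real (2 * k + 1) * \<theta>)) = of_real (4 / pi) * (\<Sum>k<J. h k ?z)"
      unfolding sum_distrib_left
    proof (intro sum.cong refl)
      fix k
      show "of_real (c k) * cis (real (2 * k + 1) * \<theta>) = of_real (4 / pi) * h k ?z"
        unfolding h_def c_def power_mult_distrib Complex.DeMoivre by simp
    qed
    then have "(\<Sum>k<J. of_real (c k) * cis (real (2 * k + 1) * \<theta>)) - strip_map ?z = of_real (4 / pi) * ((\<Sum>k<J. h k ?z) - Arctan ?z)"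
      by (simp add: strip_map_def algebra_simps)
    then have "norm ((\<Sum>k<J. of_real (c k) * cis (real (2 * k + 1) * \<theta>)) - strip_map ?z) = 4 / pi * norm ((\<Sum>k<J. h k ?z) - Arctan ?z)"
      by (simp only: norm_mult norm_of_real) simp
    also have "\<dots> < 4 / pi * (e * pi / 4)" using d by (intro mult_strict_left_mono) auto
    finally show "norm ((\<Sum>k<J. of_real (c k) * cis (real (2 * k + 1) * \<theta>)) - strip_map ?z) < e" by simp
  qed
qed

lemma strip_approximation:
  obtains \<xi> \<xi>' :: "nat \<Rightarrow> real \<Rightarrow> real"
  where "\<And>n. conj_pair (\<xi> n) (\<xi>' n)" "\<And>n \<theta>. \<bar>\<xi> n \<theta>\<bar> \<le> 3"
    "\<And>\<theta>. cos \<theta> \<noteq> 0 \<Longrightarrow> (\<lambda>n. \<xi> n \<theta>) \<longlonglongrightarrow> strip_re \<theta>"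
    "\<And>\<theta>. cos \<theta> \<noteq> 0 \<Longrightarrow> (\<lambda>n. \<xi>' n \<theta>) \<longlonglongrightarrow> strip_im \<theta>"
    "\<And>n \<theta>. \<xi> n (- \<theta>) = \<xi> n \<theta>" "\<And>n \<theta>. \<xi>' n (- \<theta>) = - \<xi>' n \<theta>"
    "\<And>n \<theta>. \<xi> n (\<theta> + pi) = - \<xi> n \<theta>" "\<And>n \<theta>. \<xi>' n (\<theta> + pi) = - \<xi>' n \<theta>"
proof -
  \<comment> \<open>Radii increasing to 1; the offset 2 makes the first one positive.\<close>
  define r where "r = (\<lambda>n. 1 - 1 / real (n + 2))"
  have r: "0 < r n" "r n < 1" for n by (auto simp: r_def field_simps)
  have "\<exists>c J. \<forall>\<theta>. norm ((\<Sum>k<J. of_real (c k) * cis (real (2 * k + 1) * \<theta>)) - strip_map (of_real (r n) * cis \<theta>)) < 1 / real (n + 1)" for n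
    by (rule strip_map_partial_sums[OF r]) simp
  then have "\<exists>c. \<forall>n. \<exists>J. \<forall>\<theta>. norm ((\<Sum>k<J. of_real (c n k) * cis (real (2 * k + 1) * \<theta>)) - strip_map (of_real (r n) * cis \<theta>)) < 1 / real (n + 1)"
    by (intro choice allI)
  then obtain c where "\<forall>n. \<exists>J. \<forall>\<theta>. norm ((\<Sum>k<J. of_real (c n k) * cis (real (2 * k + 1) * \<theta>)) - strip_map (of_real (r n) * cis \<theta>)) < 1 / real (n + 1)"
    by (rule exE)
  from choice[OF this] obtain J where cJ: "\<And>n \<theta>. norm ((\<Sum>k<J n. of_real (c n k) * cis (real (2 * k + 1) * \<theta>)) - strip_map (of_real (r n) * cis \<theta>)) < 1 / real (n + 1)"
    by blast
  define F where "F = (\<lambda>n \<theta>. \<Sum>k<J n. of_real (c n k) * cis (real (2 * k + 1) * \<theta>) :: complex)"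
  have FRe: "Re (F n \<theta>) = (\<Sum>k<J n. c n k * cos (real (2 * k + 1) * \<theta>))" and FIm: "Im (F n \<theta>) = (\<Sum>k<J n. c n k * sin (real (2 * k + 1) * \<theta>))" for n \<theta>
    by (simp_all add: F_def)
  have csum: "conj_pair (\<lambda>\<theta>. \<Sum>k<j. d k * cos (real (2 * k + 1) * \<theta>)) (\<lambda>\<theta>. \<Sum>k<j. d k * sin (real (2 * k + 1) * \<theta>))" for d :: "nat \<Rightarrow> real" and j
  proof (induction j)
    case (Suc j)
    have "conj_pair (\<lambda>\<theta>. d j * cos (real (2 * j + 1) * \<theta>)) (\<lambda>\<theta>. d j * sin (real (2 * j + 1) * \<theta>))"
      using conj_pair.base[of "2 * j + 1" 0 "d j"] by (simp add: mult.commute)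
    from conj_pair.add[OF Suc this] show ?case by simp
  qed (simp add: conj_pair_zero)
  have near: "norm (F n \<theta> - strip_map (of_real (r n) * cis \<theta>)) < 1 / real (n + 1)" for n \<theta>
    using cJ[of n \<theta>] by (simp add: F_def)
  have lim: "(\<lambda>n. F n \<theta>) \<longlonglongrightarrow> strip_map (cis \<theta>)" if "cos \<theta> \<noteq> 0" for \<theta>
  proof -
    have "isCont Arctan (cis \<theta>)" using that by (intro continuous_at_Arctan) auto
    moreover have "(\<lambda>n. of_real (r n) * cis \<theta>) \<longlonglongrightarrow> of_real 1 * cis \<theta>"
    proof (intro tendsto_intros)
      show "r \<longlonglongrightarrow> 1" unfolding r_def by real_asymp
    qed
    ultimately have "(\<lambda>n. strip_map (of_real (r n) * cis \<theta>)) \<longlonglongrightarrow> strip_map (cis \<theta>)"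
      unfolding strip_map_def by (intro tendsto_intros isCont_tendsto_compose[of _ Arctan]) auto
    moreover have "(\<lambda>n. F n \<theta> - strip_map (of_real (r n) * cis \<theta>)) \<longlonglongrightarrow> 0"
    proof (rule Lim_null_comparison)
      show "\<forall>\<^sub>F n in sequentially. norm (F n \<theta> - strip_map (of_real (r n) * cis \<theta>)) \<le> 1 / real (n + 1)"
        using near by (intro always_eventually allI less_imp_le)
      show "(\<lambda>n. 1 / real (n + 1)) \<longlonglongrightarrow> 0" by real_asymp
    qed
    ultimately have "(\<lambda>n. (F n \<theta> - strip_map (of_real (r n) * cis \<theta>)) + strip_map (of_real (r n) * cis \<theta>)) \<longlonglongrightarrow> 0 + strip_map (cis \<theta>)"
      by (intro tendsto_add)
    then show ?thesis by simp
  qed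
  show thesis
  proof (rule that[of "\<lambda>n \<theta>. Re (F n \<theta>)" "\<lambda>n \<theta>. Im (F n \<theta>)"])
    show "conj_pair (\<lambda>\<theta>. Re (F n \<theta>)) (\<lambda>\<theta>. Im (F n \<theta>))" for n
      unfolding FRe FIm by (rule csum)
    show "\<bar>Re (F n \<theta>)\<bar> \<le> 3" for n \<theta>
    proof -
      let ?z = "of_real (r n) * cis \<theta>"
      have "\<bar>Im ?z\<bar> < 1"
      proof -
        have "\<bar>Im ?z\<bar> \<le> norm ?z" by (rule abs_Im_le_cmod)
        also have "\<dots> < 1" using r[of n] by (simp add: norm_mult)
        finally show ?thesis .
      qed
      \<comment> \<open>This general bound for \<open>Arctan\<close> gives 2 for the strip map, and
        an approximation error of at most 1 leads to the uniform bound 3. The imaginary parts have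
        no bound uniform in \<open>n\<close>.\<close>
      then have "\<bar>Re (Arctan ?z)\<bar> < pi / 2" by (intro Re_Arctan_bounds) auto
      then have "4 / pi * \<bar>Re (Arctan ?z)\<bar> < 4 / pi * (pi / 2)" by (intro mult_strict_left_mono) auto
      then have "\<bar>Re (strip_map ?z)\<bar> < 2" by (simp add: strip_map_def abs_mult)
      moreover have "\<bar>Re (F n \<theta> - strip_map ?z)\<bar> < 1 / real (n + 1)"
        using near abs_Re_le_cmod order_le_less_trans by blast
      moreover have "1 / real (n + 1) \<le> 1" by simp
      ultimately show ?thesis unfolding minus_complex.simps by linarith
    qed
    show "(\<lambda>n. Re (F n \<theta>)) \<longlonglongrightarrow> strip_re \<theta>" "(\<lambda>n. Im (F n \<theta>)) \<longlonglongrightarrow> strip_im \<theta>" if "cos \<theta> \<noteq> 0" for \<theta>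
      using lim[OF that] that by (auto simp: strip_re_def strip_im_def intro: tendsto_Re tendsto_Im)
    have ang: "real (2 * k + 1) * (\<theta> + pi) = (real (2 * k + 1) * \<theta> + pi) + 2 * real k * pi" for k \<theta>
      by (simp add: algebra_simps)
    have c: "cos (x + 2 * real k * pi) = cos x" "sin (x + 2 * real k * pi) = sin x" for x k
      by (simp_all add: cos_add sin_add)
    show "Re (F n (\<theta> + pi)) = - Re (F n \<theta>)" "Im (F n (\<theta> + pi)) = - Im (F n \<theta>)" for n \<theta>
      unfolding FRe FIm ang c cos_periodic_pi sin_periodic_pi by (simp_all add: sum_negf)
  qed (simp_all add: FRe FIm sum_negf)
qed

section \<open>Law of the boundary values of the strip map\<close>

lemma AE_cos_nonzero: "AE \<theta> in circ. cos \<theta> \<noteq> 0"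
  unfolding AE_circ
  using AE_lborel_singleton[of "pi/2"] AE_lborel_singleton[of "-(pi/2)"]
proof eventually_elim
  case (elim \<theta>)
  show ?case
  proof
    assume \<theta>: "\<theta> \<in> {-pi..<pi}"
    show "cos \<theta> \<noteq> 0"
    proof
      assume "cos \<theta> = 0"
      then have "cos \<bar>\<theta>\<bar> = cos (pi / 2)" by simp
      then have "\<bar>\<theta>\<bar> = pi / 2" using \<theta> by (intro cos_inj_pi[of "\<bar>\<theta>\<bar>" "pi / 2"]) auto
      then show False using \<theta> elim by auto
    qed
  qed
qed

lemma strip_measurable [measurable]: "strip_re \<in> borel_measurable borel" "strip_im \<in> borel_measurable borel"
proof -
  obtain \<xi> \<xi>' where a: "\<And>n. conj_pair (\<xi> n) (\<xi>' n)"
    "\<And>\<theta>. cos \<theta> \<noteq> 0 \<Longrightarrow> (\<lambda>n. \<xi> n \<theta>) \<longlonglongrightarrow> strip_re \<theta>"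
    "\<And>\<theta>. cos \<theta> \<noteq> 0 \<Longrightarrow> (\<lambda>n. \<xi>' n \<theta>) \<longlonglongrightarrow> strip_im \<theta>"
    by (rule strip_approximation) blast
  note [measurable] = conj_pair_measurable[OF a(1)]
  show "strip_re \<in> borel_measurable borel"
  proof (rule borel_measurable_LIMSEQ_real)
    show "(\<lambda>n. if cos \<theta> = 0 then 1 else \<xi> n \<theta>) \<longlonglongrightarrow> strip_re \<theta>" for \<theta>
      using a(2)[of \<theta>] by (auto simp: strip_re_def)
  qed measurable
  show "strip_im \<in> borel_measurable borel"
  proof (rule borel_measurable_LIMSEQ_real)
    show "(\<lambda>n. if cos \<theta> = 0 then 0 else \<xi>' n \<theta>) \<longlonglongrightarrow> strip_im \<theta>" for \<theta>
      using a(3)[of \<theta>] by (auto simp: strip_im_def)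
  qed measurable
qed

lemma strip_symmetries:
  assumes "cos \<theta> \<noteq> 0"
  shows "strip_re (- \<theta>) = strip_re \<theta>" "strip_im (- \<theta>) = - strip_im \<theta>"
    "strip_re (\<theta> + pi) = - strip_re \<theta>" "strip_im (\<theta> + pi) = - strip_im \<theta>"
proof -
  obtain \<xi> \<xi>' where a: "\<And>\<theta>. cos \<theta> \<noteq> 0 \<Longrightarrow> (\<lambda>n. \<xi> n \<theta>) \<longlonglongrightarrow> strip_re \<theta>"
    "\<And>\<theta>. cos \<theta> \<noteq> 0 \<Longrightarrow> (\<lambda>n. \<xi>' n \<theta>) \<longlonglongrightarrow> strip_im \<theta>"
    and s: "\<And>n \<theta>. \<xi> n (- \<theta>) = \<xi> n \<theta>" "\<And>n \<theta>. \<xi>' n (- \<theta>) = - \<xi>' n \<theta>"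
    "\<And>n \<theta>. \<xi> n (\<theta> + pi) = - \<xi> n \<theta>" "\<And>n \<theta>. \<xi>' n (\<theta> + pi) = - \<xi>' n \<theta>"
    by (rule strip_approximation) blast
  have c: "cos (- \<theta>) \<noteq> 0" "cos (\<theta> + pi) \<noteq> 0" using assms by auto
  note l = a(1)[OF assms] a(2)[OF assms]
  show "strip_re (- \<theta>) = strip_re \<theta>"
    using a(1)[OF c(1)] l(1) unfolding s by (rule LIMSEQ_unique)
  show "strip_im (- \<theta>) = - strip_im \<theta>"
    using a(2)[OF c(1)] tendsto_minus[OF l(2)] unfolding s by (rule LIMSEQ_unique)
  show "strip_re (\<theta> + pi) = - strip_re \<theta>"
    using a(1)[OF c(2)] tendsto_minus[OF l(1)] unfolding s by (rule LIMSEQ_unique)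
  show "strip_im (\<theta> + pi) = - strip_im \<theta>"
    using a(2)[OF c(2)] tendsto_minus[OF l(2)] unfolding s by (rule LIMSEQ_unique)
qed

text \<open>The uniform law on the circle is invariant under the reflection, which changes the sign
  of the imaginary part only, and under the half-turn, which changes both signs.\<close>

lemma distr_strip:
  "distr circ (borel \<Otimes>\<^sub>M borel) (\<lambda>\<theta>. (strip_re \<theta>, - strip_im \<theta>)) = distr circ (borel \<Otimes>\<^sub>M borel) (\<lambda>\<theta>. (strip_re \<theta>, strip_im \<theta>))"
  "distr circ (borel \<Otimes>\<^sub>M borel) (\<lambda>\<theta>. (- strip_re \<theta>, - strip_im \<theta>)) = distr circ (borel \<Otimes>\<^sub>M borel) (\<lambda>\<theta>. (strip_re \<theta>, strip_im \<theta>))"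
proof -
  have em: "emeasure (distr circ (borel \<Otimes>\<^sub>M borel) h) A = (\<integral>\<^sup>+\<theta>. indicator A (h \<theta>) \<partial>circ)"
    if "A \<in> sets (borel \<Otimes>\<^sub>M borel)" "h \<in> measurable borel (borel \<Otimes>\<^sub>M borel)" for A and h :: "real \<Rightarrow> real \<times> real"
  proof -
    have h: "h \<in> measurable circ (borel \<Otimes>\<^sub>M borel)" using that(2) by (simp cong: measurable_cong_sets)
    have "emeasure (distr circ (borel \<Otimes>\<^sub>M borel) h) A = (\<integral>\<^sup>+z. indicator A z \<partial>distr circ (borel \<Otimes>\<^sub>M borel) h)"
      using that by simp
    also have "\<dots> = (\<integral>\<^sup>+\<theta>. indicator A (h \<theta>) \<partial>circ)"
      using that h by (intro nn_integral_distr) auto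
    finally show ?thesis .
  qed
  show "distr circ (borel \<Otimes>\<^sub>M borel) (\<lambda>\<theta>. (strip_re \<theta>, - strip_im \<theta>)) = distr circ (borel \<Otimes>\<^sub>M borel) (\<lambda>\<theta>. (strip_re \<theta>, strip_im \<theta>))"
  proof (rule measure_eqI)
    fix A assume "A \<in> sets (distr circ (borel \<Otimes>\<^sub>M borel) (\<lambda>\<theta>. (strip_re \<theta>, - strip_im \<theta>)))"
    then have A[measurable]: "A \<in> sets (borel \<Otimes>\<^sub>M borel)" by simp
    have "(\<integral>\<^sup>+\<theta>. indicator A (strip_re \<theta>, - strip_im \<theta>) \<partial>circ) = (\<integral>\<^sup>+\<theta>. indicator A (strip_re (- \<theta>), strip_im (- \<theta>)) \<partial>circ)"
      by (rule nn_integral_cong_AE) (use AE_cos_nonzero in \<open>eventually_elim, simp add: strip_symmetries\<close>)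
    also have "\<dots> = (\<integral>\<^sup>+\<theta>. indicator A (strip_re \<theta>, strip_im \<theta>) \<partial>circ)"
      by (rule nn_integral_circ_uminus[of "\<lambda>\<theta>. indicator A (strip_re \<theta>, strip_im \<theta>)"]) measurable
    finally show "emeasure (distr circ (borel \<Otimes>\<^sub>M borel) (\<lambda>\<theta>. (strip_re \<theta>, - strip_im \<theta>))) A = emeasure (distr circ (borel \<Otimes>\<^sub>M borel) (\<lambda>\<theta>. (strip_re \<theta>, strip_im \<theta>))) A"
      using A by (subst (1 2) em) auto
  qed simp
  show "distr circ (borel \<Otimes>\<^sub>M borel) (\<lambda>\<theta>. (- strip_re \<theta>, - strip_im \<theta>)) = distr circ (borel \<Otimes>\<^sub>M borel) (\<lambda>\<theta>. (strip_re \<theta>, strip_im \<theta>))"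
  proof (rule measure_eqI)
    fix A assume "A \<in> sets (distr circ (borel \<Otimes>\<^sub>M borel) (\<lambda>\<theta>. (- strip_re \<theta>, - strip_im \<theta>)))"
    then have A[measurable]: "A \<in> sets (borel \<Otimes>\<^sub>M borel)" by simp
    have "(\<integral>\<^sup>+\<theta>. indicator A (- strip_re \<theta>, - strip_im \<theta>) \<partial>circ) = (\<integral>\<^sup>+\<theta>. indicator A (strip_re (\<theta> + pi), strip_im (\<theta> + pi)) \<partial>circ)"
      by (rule nn_integral_cong_AE) (use AE_cos_nonzero in \<open>eventually_elim, simp add: strip_symmetries\<close>)
    also have "\<dots> = (\<integral>\<^sup>+\<theta>. indicator A (strip_re \<theta>, strip_im \<theta>) \<partial>circ)"
      by (rule nn_integral_circ_shift[of "\<lambda>\<theta>. indicator A (strip_re \<theta>, strip_im \<theta>)"]) (measurable, simp add: strip_periodic)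
    finally show "emeasure (distr circ (borel \<Otimes>\<^sub>M borel) (\<lambda>\<theta>. (- strip_re \<theta>, - strip_im \<theta>))) A = emeasure (distr circ (borel \<Otimes>\<^sub>M borel) (\<lambda>\<theta>. (strip_re \<theta>, strip_im \<theta>))) A"
      using A by (subst (1 2) em) auto
  qed simp
qed

lemma integral_strip_symmetries:
  fixes H :: "real \<times> real \<Rightarrow> real"
  assumes H: "H \<in> borel_measurable (borel \<Otimes>\<^sub>M borel)"
  shows "(\<integral>\<theta>. H (strip_re \<theta>, - strip_im \<theta>) \<partial>circ) = (\<integral>\<theta>. H (strip_re \<theta>, strip_im \<theta>) \<partial>circ)"
    "(\<integral>\<theta>. H (- strip_re \<theta>, - strip_im \<theta>) \<partial>circ) = (\<integral>\<theta>. H (strip_re \<theta>, strip_im \<theta>) \<partial>circ)"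
    "(\<integral>\<theta>. H (- strip_re \<theta>, strip_im \<theta>) \<partial>circ) = (\<integral>\<theta>. H (strip_re \<theta>, strip_im \<theta>) \<partial>circ)"
proof -
  have 1: "(\<integral>\<theta>. G (strip_re \<theta>, - strip_im \<theta>) \<partial>circ) = (\<integral>\<theta>. G (strip_re \<theta>, strip_im \<theta>) \<partial>circ)"
    and 2: "(\<integral>\<theta>. G (- strip_re \<theta>, - strip_im \<theta>) \<partial>circ) = (\<integral>\<theta>. G (strip_re \<theta>, strip_im \<theta>) \<partial>circ)"
    if G: "G \<in> borel_measurable (borel \<Otimes>\<^sub>M borel)" for G :: "real \<times> real \<Rightarrow> real"
  proof -
    have d: "(\<integral>\<theta>. G (h \<theta>) \<partial>circ) = (\<integral>z. G z \<partial>distr circ (borel \<Otimes>\<^sub>M borel) h)"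
      if "h \<in> measurable borel (borel \<Otimes>\<^sub>M borel)" for h
      using that by (subst integral_distr[OF _ G]) (simp_all cong: measurable_cong_sets)
    show "(\<integral>\<theta>. G (strip_re \<theta>, - strip_im \<theta>) \<partial>circ) = (\<integral>\<theta>. G (strip_re \<theta>, strip_im \<theta>) \<partial>circ)"
      "(\<integral>\<theta>. G (- strip_re \<theta>, - strip_im \<theta>) \<partial>circ) = (\<integral>\<theta>. G (strip_re \<theta>, strip_im \<theta>) \<partial>circ)"
      by (subst (1 2) d, measurable, simp add: distr_strip)+
  qed
  show "(\<integral>\<theta>. H (strip_re \<theta>, - strip_im \<theta>) \<partial>circ) = (\<integral>\<theta>. H (strip_re \<theta>, strip_im \<theta>) \<partial>circ)"
    "(\<integral>\<theta>. H (- strip_re \<theta>, - strip_im \<theta>) \<partial>circ) = (\<integral>\<theta>. H (strip_re \<theta>, strip_im \<theta>) \<partial>circ)"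
    using 1[OF H] 2[OF H] by auto
  \<comment> \<open>The third symmetry is the composition of the two others.\<close>
  have "(\<lambda>z. H (fst z, - snd z)) \<in> borel_measurable (borel \<Otimes>\<^sub>M borel)"
    using H by measurable
  from 1[OF H] 2[OF this] show "(\<integral>\<theta>. H (- strip_re \<theta>, strip_im \<theta>) \<partial>circ) = (\<integral>\<theta>. H (strip_re \<theta>, strip_im \<theta>) \<partial>circ)"
    by simp
qed

lemma cosh_strip_re: "cosh (s * strip_re \<theta>) = cosh s"
  using strip_re_values[of \<theta>] by (auto simp: cosh_minus)

text \<open>By the mean value property \<open>exp (s * F)\<close> has mean 1. Averaging real parts
  over \<open>s\<close> and \<open>- s\<close> gives
  \<open>cosh (s * strip_re \<theta>) * cos (s * strip_im \<theta>)\<close>, whose first factor is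
  the constant \<open>cosh s\<close> because the real part is 1 or -1.\<close>

lemma char_strip_im: "(\<integral>\<theta>. cos (s * strip_im \<theta>) \<partial>circ) = 1 / cosh s"
proof -
  obtain \<xi> \<xi>' where a: "\<And>n. conj_pair (\<xi> n) (\<xi>' n)" "\<And>n \<theta>. \<bar>\<xi> n \<theta>\<bar> \<le> 3"
    "\<And>\<theta>. cos \<theta> \<noteq> 0 \<Longrightarrow> (\<lambda>n. \<xi> n \<theta>) \<longlonglongrightarrow> strip_re \<theta>"
    "\<And>\<theta>. cos \<theta> \<noteq> 0 \<Longrightarrow> (\<lambda>n. \<xi>' n \<theta>) \<longlonglongrightarrow> strip_im \<theta>"
    by (rule strip_approximation) blast
  note [measurable] = conj_pair_measurable[OF a(1)]
  have E: "(\<integral>\<theta>. exp (s * strip_re \<theta>) * cos (s * strip_im \<theta>) \<partial>circ) = 1" for s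
  proof -
    have "(\<integral>\<theta>. exp (s * \<xi> n \<theta>) * cos (s * \<xi>' n \<theta>) \<partial>circ) = 1" for n
    proof -
      have e1: "Re (exp (of_real s * Complex (\<xi> n \<theta>) (\<xi>' n \<theta>))) = exp (s * \<xi> n \<theta>) * cos (s * \<xi>' n \<theta>)" for \<theta>
        by (simp add: Re_exp)
      have "integrable circ (\<lambda>\<theta>. exp (of_real s * Complex (\<xi> n \<theta>) (\<xi>' n \<theta>)))"
      proof (rule circ.integrable_const_bound[where B = "exp (3 * \<bar>s\<bar>)"])
        have "s * \<xi> n \<theta> \<le> 3 * \<bar>s\<bar>" for \<theta>
          using mult_left_mono[OF a(2)[of n \<theta>] abs_ge_zero[of s]] abs_ge_self[of "s * \<xi> n \<theta>"] by (simp add: abs_mult)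
        then show "AE \<theta> in circ. norm (exp (of_real s * Complex (\<xi> n \<theta>) (\<xi>' n \<theta>))) \<le> exp (3 * \<bar>s\<bar>)"
          by (intro AE_I2) simp
        show "(\<lambda>\<theta>. exp (of_real s * Complex (\<xi> n \<theta>) (\<xi>' n \<theta>))) \<in> borel_measurable circ"
          unfolding Complex_eq by measurable
      qed
      then have "(\<integral>\<theta>. Re (exp (of_real s * Complex (\<xi> n \<theta>) (\<xi>' n \<theta>))) \<partial>circ) = Re (\<integral>\<theta>. exp (of_real s * Complex (\<xi> n \<theta>) (\<xi>' n \<theta>)) \<partial>circ)"
        by (rule integral_Re)
      then show ?thesis unfolding e1 conj_pair_mean_exp[OF a(1)] by simp
    qed
    moreover have "(\<lambda>n. \<integral>\<theta>. exp (s * \<xi> n \<theta>) * cos (s * \<xi>' n \<theta>) \<partial>circ) \<longlonglongrightarrow> (\<integral>\<theta>. exp (s * strip_re \<theta>) * cos (s * strip_im \<theta>) \<partial>circ)"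
    proof (rule integral_dominated_convergence[where w = "\<lambda>_. exp (3 * \<bar>s\<bar>)"])
      show "AE \<theta> in circ. (\<lambda>n. exp (s * \<xi> n \<theta>) * cos (s * \<xi>' n \<theta>)) \<longlonglongrightarrow> exp (s * strip_re \<theta>) * cos (s * strip_im \<theta>)"
        using AE_cos_nonzero by eventually_elim (intro tendsto_intros a)
      show "AE \<theta> in circ. norm (exp (s * \<xi> n \<theta>) * cos (s * \<xi>' n \<theta>)) \<le> exp (3 * \<bar>s\<bar>)" for n
      proof (rule AE_I2)
        fix \<theta>
        have "s * \<xi> n \<theta> \<le> 3 * \<bar>s\<bar>"
          using mult_left_mono[OF a(2)[of n \<theta>] abs_ge_zero[of s]] abs_ge_self[of "s * \<xi> n \<theta>"] by (simp add: abs_mult)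
        then have "exp (s * \<xi> n \<theta>) * \<bar>cos (s * \<xi>' n \<theta>)\<bar> \<le> exp (3 * \<bar>s\<bar>) * 1" by (intro mult_mono) auto
        then show "norm (exp (s * \<xi> n \<theta>) * cos (s * \<xi>' n \<theta>)) \<le> exp (3 * \<bar>s\<bar>)" by (simp add: abs_mult)
      qed
      show "(\<lambda>\<theta>. exp (s * strip_re \<theta>) * cos (s * strip_im \<theta>)) \<in> borel_measurable circ"
        "(\<lambda>\<theta>. exp (s * \<xi> n \<theta>) * cos (s * \<xi>' n \<theta>)) \<in> borel_measurable circ" for n
        by measurable
    qed simp
    ultimately show ?thesis by (simp add: LIMSEQ_const_iff)
  qed
  have int: "integrable circ (\<lambda>\<theta>. exp (s * strip_re \<theta>) * cos (s * strip_im \<theta>))" for s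
  proof (rule circ.integrable_const_bound[where B = "exp \<bar>s\<bar>"])
    show "AE \<theta> in circ. norm (exp (s * strip_re \<theta>) * cos (s * strip_im \<theta>)) \<le> exp \<bar>s\<bar>"
    proof (rule AE_I2)
      fix \<theta>
      have "s * strip_re \<theta> \<le> \<bar>s\<bar>" using strip_re_values[of \<theta>] by auto
      then have "exp (s * strip_re \<theta>) * \<bar>cos (s * strip_im \<theta>)\<bar> \<le> exp \<bar>s\<bar> * 1" by (intro mult_mono) auto
      then show "norm (exp (s * strip_re \<theta>) * cos (s * strip_im \<theta>)) \<le> exp \<bar>s\<bar>" by (simp add: abs_mult)
    qed
  qed measurable
  have "cosh s * (\<integral>\<theta>. cos (s * strip_im \<theta>) \<partial>circ) = (\<integral>\<theta>. cosh (s * strip_re \<theta>) * cos (s * strip_im \<theta>) \<partial>circ)"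
    by (simp add: cosh_strip_re)
  also have "\<dots> = (\<integral>\<theta>. (exp (s * strip_re \<theta>) * cos (s * strip_im \<theta>) + exp ((- s) * strip_re \<theta>) * cos ((- s) * strip_im \<theta>)) / 2 \<partial>circ)"
    by (intro Bochner_Integration.integral_cong refl) (simp add: cosh_def field_simps)
  also have "\<dots> = 1" using int[of s] int[of "- s"] E[of s] E[of "- s"] by simp
  finally have e: "cosh s * (\<integral>\<theta>. cos (s * strip_im \<theta>) \<partial>circ) = 1" .
  have "cosh s \<noteq> 0" using cosh_real_pos[of s] by simp
  with e show ?thesis by (simp add: field_simps)
qed

text \<open>This is \<open>ln x \<le> x - 1\<close> at \<open>x = (1 + y) / (3 * p)\<close>. The
  rate 1/3 is the one for which \<open>nn_integral_exp_strip_im\<close> provides exponential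
  moments.\<close>

lemma powr_le_exp:
  fixes p :: real
  assumes "0 < p"
  shows "\<exists>K\<ge>0. \<forall>y\<ge>0. (1 + y) powr p \<le> K * exp (y / 3)"
proof (intro exI[of _ "exp (1 / 3 - p + p * ln (3 * p))"] conjI allI impI)
  fix y :: real assume y: "0 \<le> y"
  have "ln ((1 + y) / (3 * p)) \<le> (1 + y) / (3 * p) - 1"
    using assms y by (intro ln_le_minus_one) simp
  then have "ln (1 + y) - ln (3 * p) \<le> (1 + y) / (3 * p) - 1"
    using assms y by (subst (asm) ln_div) auto
  then have "p * (ln (1 + y) - ln (3 * p)) \<le> p * ((1 + y) / (3 * p) - 1)"
    using assms by (intro mult_left_mono) auto
  also have "\<dots> = (1 + y) / 3 - p" using assms by (simp add: field_simps)
  finally have "p * ln (1 + y) \<le> (1 / 3 - p + p * ln (3 * p)) + y / 3" by (simp add: algebra_simps add_divide_distrib)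
  then have "exp (p * ln (1 + y)) \<le> exp ((1 / 3 - p + p * ln (3 * p)) + y / 3)" by (simp only: exp_le_cancel_iff)
  then show "(1 + y) powr p \<le> exp (1 / 3 - p + p * ln (3 * p)) * exp (y / 3)"
    using y by (simp only: exp_add) (simp add: powr_def)
qed simp

text \<open>The mean value property is applied to \<open>exp (- \<i> * \<kappa> * F)\<close>, with
  real part \<open>exp (\<kappa> * \<xi>') * cos (\<kappa> * \<xi>)\<close>. The approximants
  satisfy \<open>\<bar>\<xi>\<bar> \<le> 3\<close>, so
  \<open>\<bar>\<kappa>\<bar> \<le> 1 / 3\<close> keeps the cosine above \<open>cos 1 > 0\<close>,
  and Fatou's lemma passes to the limit.\<close>

lemma nn_integral_exp_strip_im:
  assumes k: "\<bar>\<kappa>\<bar> \<le> 1 / 3"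
  shows "(\<integral>\<^sup>+\<theta>. ennreal (exp (\<kappa> * strip_im \<theta>)) \<partial>circ) < \<infinity>"
proof -
  obtain \<xi> \<xi>' where a: "\<And>n. conj_pair (\<xi> n) (\<xi>' n)" "\<And>n \<theta>. \<bar>\<xi> n \<theta>\<bar> \<le> 3"
    "\<And>\<theta>. cos \<theta> \<noteq> 0 \<Longrightarrow> (\<lambda>n. \<xi> n \<theta>) \<longlonglongrightarrow> strip_re \<theta>"
    "\<And>\<theta>. cos \<theta> \<noteq> 0 \<Longrightarrow> (\<lambda>n. \<xi>' n \<theta>) \<longlonglongrightarrow> strip_im \<theta>"
    by (rule strip_approximation) blast
  note [measurable] = conj_pair_measurable[OF a(1)]
  define G where "G = (\<lambda>n \<theta>. exp (\<kappa> * \<xi>' n \<theta>) * cos (\<kappa> * \<xi> n \<theta>))"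
  have cospos: "cos 1 \<le> cos (\<kappa> * x)" if "\<bar>x\<bar> \<le> 3" for x
  proof -
    have "\<bar>\<kappa> * x\<bar> \<le> 1 / 3 * 3" unfolding abs_mult using k that by (intro mult_mono) auto
    moreover have "(1::real) \<le> pi" using pi_gt3 by simp
    ultimately have "cos 1 \<le> cos \<bar>\<kappa> * x\<bar>" by (intro cos_monotone_0_pi_le) auto
    then show ?thesis by simp
  qed
  have c1: "0 < cos (1::real)" using pi_gt3 by (intro cos_gt_zero) auto
  have Gint: "integrable circ (G n)" "(\<integral>\<theta>. G n \<theta> \<partial>circ) = 1" for n
  proof -
    obtain B where B: "\<And>t. \<bar>\<xi>' n t\<bar> \<le> B" using conj_pair_bounded[OF a(1)[of n]] by auto
    let ?E = "\<lambda>\<theta>. exp ((- \<i> * of_real \<kappa>) * Complex (\<xi> n \<theta>) (\<xi>' n \<theta>))"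
    have int: "integrable circ ?E"
    proof (rule circ.integrable_const_bound[where B = "exp (1 / 3 * B)"])
      have "\<kappa> * \<xi>' n \<theta> \<le> 1 / 3 * B" for \<theta>
      proof -
        have "\<bar>\<kappa> * \<xi>' n \<theta>\<bar> \<le> 1 / 3 * B" unfolding abs_mult using k B[of \<theta>] by (intro mult_mono) auto
        then show ?thesis by linarith
      qed
      then show "AE \<theta> in circ. norm (?E \<theta>) \<le> exp (1 / 3 * B)" by (intro AE_I2) simp
      show "?E \<in> borel_measurable circ" unfolding Complex_eq by measurable
    qed
    have Re: "Re (?E \<theta>) = G n \<theta>" for \<theta> by (simp add: Re_exp G_def)
    show "integrable circ (G n)" using integrable_Re[OF int] unfolding Re .
    show "(\<integral>\<theta>. G n \<theta> \<partial>circ) = 1"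
      using integral_Re[OF int] unfolding Re conj_pair_mean_exp[OF a(1)] by simp
  qed
  have Gpos: "0 \<le> G n \<theta>" for n \<theta> using cospos[OF a(2)[of n \<theta>]] c1 by (simp add: G_def)
  have "(\<integral>\<^sup>+\<theta>. ennreal (exp (\<kappa> * strip_im \<theta>) * cos 1) \<partial>circ) \<le> (\<integral>\<^sup>+\<theta>. liminf (\<lambda>n. ennreal (G n \<theta>)) \<partial>circ)"
  proof (rule nn_integral_mono_AE)
    show "AE \<theta> in circ. ennreal (exp (\<kappa> * strip_im \<theta>) * cos 1) \<le> liminf (\<lambda>n. ennreal (G n \<theta>))"
      using AE_cos_nonzero
    proof eventually_elim
      case (elim \<theta>)
      have "(\<lambda>n. G n \<theta>) \<longlonglongrightarrow> exp (\<kappa> * strip_im \<theta>) * cos (\<kappa> * strip_re \<theta>)"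
        unfolding G_def by (intro tendsto_intros a elim)
      then have "liminf (\<lambda>n. ennreal (G n \<theta>)) = ennreal (exp (\<kappa> * strip_im \<theta>) * cos (\<kappa> * strip_re \<theta>))"
        by (intro lim_imp_Liminf tendsto_ennrealI) auto
      moreover have "exp (\<kappa> * strip_im \<theta>) * cos 1 \<le> exp (\<kappa> * strip_im \<theta>) * cos (\<kappa> * strip_re \<theta>)"
        using strip_re_values[of \<theta>] by (intro mult_left_mono cospos) auto
      ultimately show ?case by (simp add: ennreal_leI)
    qed
  qed
  also have "\<dots> \<le> liminf (\<lambda>n. \<integral>\<^sup>+\<theta>. ennreal (G n \<theta>) \<partial>circ)"
    unfolding G_def by (rule nn_integral_liminf) measurable
  also have "(\<lambda>n. \<integral>\<^sup>+\<theta>. ennreal (G n \<theta>) \<partial>circ) = (\<lambda>n. 1)"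
    using Gint Gpos by (simp add: nn_integral_eq_integral)
  finally have "(\<integral>\<^sup>+\<theta>. ennreal (exp (\<kappa> * strip_im \<theta>) * cos 1) \<partial>circ) \<le> 1" by (simp add: Liminf_const)
  then have "(\<integral>\<^sup>+\<theta>. ennreal (exp (\<kappa> * strip_im \<theta>)) \<partial>circ) * ennreal (cos 1) \<le> 1"
    using c1 by (subst nn_integral_multc[symmetric]) (auto simp: ennreal_mult)
  note le = this
  show ?thesis
  proof (rule ccontr)
    assume "\<not> ?thesis"
    then have "(\<integral>\<^sup>+\<theta>. ennreal (exp (\<kappa> * strip_im \<theta>)) \<partial>circ) = \<infinity>" by (simp add: less_top[symmetric])
    with le c1 show False by (simp add: ennreal_top_mult top_unique)
  qed
qed

lemma strip_moment:
  assumes "0 < p"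
  shows "integrable circ (\<lambda>\<theta>. (1 + \<bar>strip_im \<theta>\<bar>) powr p)"
proof -
  obtain K where K: "0 \<le> K" "\<And>y. 0 \<le> y \<Longrightarrow> (1 + y) powr p \<le> K * exp (y / 3)" using powr_le_exp[OF assms] by blast
  have "integrable circ (\<lambda>\<theta>. exp (\<kappa> * strip_im \<theta>))" if "\<bar>\<kappa>\<bar> \<le> 1/3" for \<kappa>
    using nn_integral_exp_strip_im[OF that] by (intro integrableI_nonneg) auto
  from this[of "1/3"] this[of "-1/3"]
  have "integrable circ (\<lambda>\<theta>. K * (exp (1/3 * strip_im \<theta>) + exp (-1/3 * strip_im \<theta>)))" by simp
  then show ?thesis
  proof (rule Bochner_Integration.integrable_bound)
    show "AE \<theta> in circ. norm ((1 + \<bar>strip_im \<theta>\<bar>) powr p) \<le> norm (K * (exp (1/3 * strip_im \<theta>) + exp (-1/3 * strip_im \<theta>)))"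
    proof (rule AE_I2)
      fix \<theta>
      have "(1 + \<bar>strip_im \<theta>\<bar>) powr p \<le> K * exp (\<bar>strip_im \<theta>\<bar> / 3)" by (rule K) simp
      also have "\<dots> \<le> K * (exp (1/3 * strip_im \<theta>) + exp (-1/3 * strip_im \<theta>))"
        using K(1) by (intro mult_left_mono) (auto simp: abs_if)
      finally show "norm ((1 + \<bar>strip_im \<theta>\<bar>) powr p) \<le> norm (K * (exp (1/3 * strip_im \<theta>) + exp (-1/3 * strip_im \<theta>)))"
        by simp
    qed
  qed measurable
qed

lemma integrable_strip_im: "integrable circ (\<lambda>\<theta>. \<bar>strip_im \<theta>\<bar>)"
  using strip_moment[of 1] by (rule Bochner_Integration.integrable_bound) auto

text \<open>The factor that Jensen's inequality puts in front of the second sign. The constant of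
  the theorem is bounded by it in \<open>exit_time_moment\<close>.\<close>

definition strip_const :: real where
  "strip_const = (\<integral>\<theta>. \<bar>strip_im \<theta>\<bar> \<partial>circ)"

section \<open>From the boundary values to independent signs\<close>

definition signs :: "(real \<times> real) measure" where
  "signs = measure_pmf (pmf_of_set ({1, -1} \<times> {1, -1}))"

lemma integral_signs: "(\<integral>z. H z \<partial>signs) = (H (1, 1) + H (1, -1) + H (-1, 1) + H (-1, -1)) / (4::real)"
  unfolding signs_def by (subst integral_pmf_of_set) (auto simp: insert_Times_insert)

lemma step_law_signs:
  assumes p: "1 < p"
  shows "step_law signs fst (\<lambda>z. C * snd z) p"
proof -
  interpret prob_space signs unfolding signs_def by (rule prob_space_measure_pmf)
  show ?thesis
  proof
    show "integrable signs (\<lambda>w. (1 + \<bar>fst w\<bar> + \<bar>C * snd w\<bar>) powr p)"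
      unfolding signs_def by (rule integrable_measure_pmf_finite) simp
    show "distr signs (borel \<Otimes>\<^sub>M borel) (\<lambda>w. (- fst w, - (C * snd w))) = distr signs (borel \<Otimes>\<^sub>M borel) (\<lambda>w. (fst w, C * snd w))"
    proof (rule measure_eqI)
      fix A assume "A \<in> sets (distr signs (borel \<Otimes>\<^sub>M borel) (\<lambda>w. (- fst w, - (C * snd w))))"
      then have A: "A \<in> sets (borel \<Otimes>\<^sub>M borel)" by simp
      have em: "emeasure (distr signs (borel \<Otimes>\<^sub>M borel) h) A = (\<integral>\<^sup>+z. indicator A (h z) \<partial>signs)" for h
      proof -
        have "emeasure (distr signs (borel \<Otimes>\<^sub>M borel) h) A = (\<integral>\<^sup>+z. indicator A z \<partial>distr signs (borel \<Otimes>\<^sub>M borel) h)"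
          using A by simp
        also have "\<dots> = (\<integral>\<^sup>+z. indicator A (h z) \<partial>signs)"
          using A by (intro nn_integral_distr) (auto simp: signs_def space_pair_measure)
        finally show ?thesis .
      qed
      have "(\<integral>\<^sup>+z. indicator A (- fst z, - (C * snd z)) \<partial>signs) = (\<integral>\<^sup>+z. indicator A (fst z, C * snd z) \<partial>signs)"
        unfolding signs_def
        by (subst (1 2) nn_integral_pmf_of_set) (auto simp: insert_Times_insert add_ac)
      then show "emeasure (distr signs (borel \<Otimes>\<^sub>M borel) (\<lambda>w. (- fst w, - (C * snd w)))) A =
          emeasure (distr signs (borel \<Otimes>\<^sub>M borel) (\<lambda>w. (fst w, C * snd w))) A"
        unfolding em .
    qed simp
  qed (use p in \<open>auto simp: signs_def\<close>)
qed

text \<open>By the reflections, the signs of the two coordinates are independent and uniform given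
  \<open>\<bar>strip_im\<bar>\<close>. Symmetrising over the four sign choices leaves functions of
  \<open>\<bar>strip_im\<bar>\<close> alone, and for each choice convexity in the second argument
  allows Jensen's inequality.\<close>

lemma strip_jensen:
  fixes Q :: "'a::real_normed_vector \<times> 'a \<Rightarrow> real"
  assumes p: "1 < p" and Q: "good p Q"
  shows "integrable circ (\<lambda>\<theta>. Q (x + strip_re \<theta> *\<^sub>R v, y + strip_im \<theta> *\<^sub>R v))"
    and "step_law.avg signs fst (\<lambda>z. strip_const * snd z) Q x y v \<le> (\<integral>\<theta>. Q (x + strip_re \<theta> *\<^sub>R v, y + strip_im \<theta> *\<^sub>R v) \<partial>circ)"
proof -
  have moment: "integrable circ (\<lambda>\<theta>. (1 + \<bar>strip_re \<theta>\<bar> + \<bar>strip_im \<theta>\<bar>) powr p)"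
  proof -
    have "integrable circ (\<lambda>\<theta>. 2 powr p * (1 + \<bar>strip_im \<theta>\<bar>) powr p)" using p strip_moment[of p] by simp
    then show ?thesis
    proof (rule Bochner_Integration.integrable_bound)
      show "AE \<theta> in circ. norm ((1 + \<bar>strip_re \<theta>\<bar> + \<bar>strip_im \<theta>\<bar>) powr p) \<le> norm (2 powr p * (1 + \<bar>strip_im \<theta>\<bar>) powr p)"
      proof (rule AE_I2)
        fix \<theta>
        have "(1 + \<bar>strip_re \<theta>\<bar> + \<bar>strip_im \<theta>\<bar>) powr p \<le> (2 * (1 + \<bar>strip_im \<theta>\<bar>)) powr p"
          using strip_re_values[of \<theta>] p by (intro powr_mono2) auto
        also have "\<dots> = 2 powr p * (1 + \<bar>strip_im \<theta>\<bar>) powr p" by (rule powr_mult)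
        finally show "norm ((1 + \<bar>strip_re \<theta>\<bar> + \<bar>strip_im \<theta>\<bar>) powr p) \<le> norm (2 powr p * (1 + \<bar>strip_im \<theta>\<bar>) powr p)" by simp
      qed
    qed measurable
  qed
  interpret L: step_law circ strip_re strip_im p
    by unfold_locales (use p moment distr_strip(2) in \<open>auto cong: measurable_cong_sets\<close>)
  interpret S: step_law signs fst "\<lambda>z. strip_const * snd z" p using p by (rule step_law_signs)
  define H where "H = (\<lambda>z. Q (x + fst z *\<^sub>R v, y + snd z *\<^sub>R v))"
  have H: "H \<in> borel_measurable (borel \<Otimes>\<^sub>M borel)"
    using L.line_measurable[OF goodD(1)[OF Q]] by (simp add: H_def split_beta')
  show int: "integrable circ (\<lambda>\<theta>. Q (x + strip_re \<theta> *\<^sub>R v, y + strip_im \<theta> *\<^sub>R v))"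
    by (rule L.integrand_integrable[OF Q])
  have intH: "integrable circ (\<lambda>\<theta>. H (strip_re \<theta>, strip_im \<theta>))" using int by (simp add: H_def)
  have intH': "integrable circ (\<lambda>\<theta>. H (s, r * \<bar>strip_im \<theta>\<bar>))" if s: "\<bar>s\<bar> = 1" "\<bar>r\<bar> = 1" for s r
  proof -
    obtain K where K: "0 \<le> K" "\<And>x y. \<bar>Q (x, y)\<bar> \<le> K * (1 + norm x + norm y) powr p"
      using goodD(4)[OF Q] by blast
    have "integrable circ (\<lambda>\<theta>. K * ((1 + norm x + norm y) powr p * (1 + norm v) powr p * (1 + \<bar>strip_re \<theta>\<bar> + \<bar>strip_im \<theta>\<bar>) powr p))"
      using moment by simp
    then show ?thesis
    proof (rule Bochner_Integration.integrable_bound)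
      show "(\<lambda>\<theta>. H (s, r * \<bar>strip_im \<theta>\<bar>)) \<in> borel_measurable circ" using H by measurable
      show "AE \<theta> in circ. norm (H (s, r * \<bar>strip_im \<theta>\<bar>)) \<le> norm (K * ((1 + norm x + norm y) powr p * (1 + norm v) powr p * (1 + \<bar>strip_re \<theta>\<bar> + \<bar>strip_im \<theta>\<bar>) powr p))"
      proof (rule AE_I2)
        fix \<theta>
        have "\<bar>strip_re \<theta>\<bar> = 1" using strip_re_values[of \<theta>] by auto
        then show "norm (H (s, r * \<bar>strip_im \<theta>\<bar>)) \<le> norm (K * ((1 + norm x + norm y) powr p * (1 + norm v) powr p * (1 + \<bar>strip_re \<theta>\<bar> + \<bar>strip_im \<theta>\<bar>) powr p))"
          using L.integrand_bound[of Q K x s v y "r * \<bar>strip_im \<theta>\<bar>", OF K(2,1)] s K(1)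
          by (simp add: H_def abs_mult)
      qed
    qed
  qed
  have jensen: "H (s, r * strip_const) \<le> (\<integral>\<theta>. H (s, r * \<bar>strip_im \<theta>\<bar>) \<partial>circ)" if s: "\<bar>s\<bar> = 1" "\<bar>r\<bar> = 1" for s r
  proof -
    have "(\<lambda>u. H (s, r * u)) (circ.expectation (\<lambda>\<theta>. \<bar>strip_im \<theta>\<bar>)) \<le> circ.expectation (\<lambda>\<theta>. H (s, r * \<bar>strip_im \<theta>\<bar>))"
    proof (rule circ.jensens_inequality[where I = UNIV and q = "\<lambda>u. H (s, r * u)"])
      show "convex_on UNIV (\<lambda>u. H (s, r * u))"
      proof (rule convex_onI)
        fix t u1 u2 :: real assume t: "0 < t" "t < 1"
        have "y + (r * ((1 - t) *\<^sub>R u1 + t *\<^sub>R u2)) *\<^sub>R v = (1 - t) *\<^sub>R (y + (r * u1) *\<^sub>R v) + t *\<^sub>R (y + (r * u2) *\<^sub>R v)"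
          by (simp add: algebra_simps)
        then show "H (s, r * ((1 - t) *\<^sub>R u1 + t *\<^sub>R u2)) \<le> (1 - t) * H (s, r * u1) + t * H (s, r * u2)"
          using convex_onD[OF goodD(2)[OF Q, of "x + s *\<^sub>R v"], of t "y + (r * u1) *\<^sub>R v" "y + (r * u2) *\<^sub>R v"] t
          unfolding H_def fst_conv snd_conv by simp
      qed simp
    qed (use integrable_strip_im intH'[OF s] in auto)
    then show ?thesis by (simp add: strip_const_def)
  qed
  \<comment> \<open>The same four points in another order: replacing both coordinates by their
    moduli permutes the sign choices.\<close>
  have "(\<Sum>z\<in>{1,-1}\<times>{1,-1}. H (fst z * strip_re \<theta>, snd z * strip_im \<theta>)) = (\<Sum>z\<in>{1,-1}\<times>{1,-1}. H (fst z, snd z * \<bar>strip_im \<theta>\<bar>))" for \<theta>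
    using strip_re_values[of \<theta>] by (auto simp: insert_Times_insert abs_if)
  then have four: "H (strip_re \<theta>, strip_im \<theta>) + H (strip_re \<theta>, - strip_im \<theta>) + H (- strip_re \<theta>, strip_im \<theta>) + H (- strip_re \<theta>, - strip_im \<theta>)
     = H (1, 1 * \<bar>strip_im \<theta>\<bar>) + H (1, (-1) * \<bar>strip_im \<theta>\<bar>) + H (-1, 1 * \<bar>strip_im \<theta>\<bar>) + H (-1, (-1) * \<bar>strip_im \<theta>\<bar>)" for \<theta>
    by (simp add: insert_Times_insert add_ac)
  have ints: "integrable circ (\<lambda>\<theta>. H (e * strip_re \<theta>, d * strip_im \<theta>))" if e: "\<bar>e\<bar> = 1" "\<bar>d\<bar> = 1" for e d
  proof (rule Bochner_Integration.integrable_bound[OF Bochner_Integration.integrable_add[OF Bochner_Integration.integrable_add[OF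
        integrable_abs[OF intH'[of 1 1]] integrable_abs[OF intH'[of 1 "-1"]]]
        Bochner_Integration.integrable_add[OF integrable_abs[OF intH'[of "-1" 1]] integrable_abs[OF intH'[of "-1" "-1"]]]]])
    show "(\<lambda>\<theta>. H (e * strip_re \<theta>, d * strip_im \<theta>)) \<in> borel_measurable circ" using H by measurable
    show "AE \<theta> in circ. norm (H (e * strip_re \<theta>, d * strip_im \<theta>)) \<le>
      norm (\<bar>H (1, 1 * \<bar>strip_im \<theta>\<bar>)\<bar> + \<bar>H (1, - 1 * \<bar>strip_im \<theta>\<bar>)\<bar> + (\<bar>H (- 1, 1 * \<bar>strip_im \<theta>\<bar>)\<bar> + \<bar>H (- 1, - 1 * \<bar>strip_im \<theta>\<bar>)\<bar>))"
    proof (rule AE_I2)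
      fix \<theta>
      have "e * strip_re \<theta> = 1 \<or> e * strip_re \<theta> = -1" "d * strip_im \<theta> = 1 * \<bar>strip_im \<theta>\<bar> \<or> d * strip_im \<theta> = - 1 * \<bar>strip_im \<theta>\<bar>"
        using e strip_re_values[of \<theta>] by (auto simp: abs_if split: if_splits)
      then show "norm (H (e * strip_re \<theta>, d * strip_im \<theta>)) \<le>
        norm (\<bar>H (1, 1 * \<bar>strip_im \<theta>\<bar>)\<bar> + \<bar>H (1, - 1 * \<bar>strip_im \<theta>\<bar>)\<bar> + (\<bar>H (- 1, 1 * \<bar>strip_im \<theta>\<bar>)\<bar> + \<bar>H (- 1, - 1 * \<bar>strip_im \<theta>\<bar>)\<bar>))"
        by (elim disjE) (simp_all only:, auto)
    qed
  qed auto
  have "4 * (\<integral>\<theta>. H (strip_re \<theta>, strip_im \<theta>) \<partial>circ) =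
    (\<integral>\<theta>. H (strip_re \<theta>, strip_im \<theta>) \<partial>circ) + (\<integral>\<theta>. H (strip_re \<theta>, - strip_im \<theta>) \<partial>circ)
    + (\<integral>\<theta>. H (- strip_re \<theta>, strip_im \<theta>) \<partial>circ) + (\<integral>\<theta>. H (- strip_re \<theta>, - strip_im \<theta>) \<partial>circ)"
    by (simp add: integral_strip_symmetries[OF H])
  also have "\<dots> = (\<integral>\<theta>. H (strip_re \<theta>, strip_im \<theta>) + H (strip_re \<theta>, - strip_im \<theta>) + H (- strip_re \<theta>, strip_im \<theta>) + H (- strip_re \<theta>, - strip_im \<theta>) \<partial>circ)"
    using ints[of 1 1] ints[of 1 "-1"] ints[of "-1" 1] ints[of "-1" "-1"] by simp
  also have "\<dots> = (\<integral>\<theta>. H (1, 1 * \<bar>strip_im \<theta>\<bar>) + H (1, (-1) * \<bar>strip_im \<theta>\<bar>) + H (-1, 1 * \<bar>strip_im \<theta>\<bar>) + H (-1, (-1) * \<bar>strip_im \<theta>\<bar>) \<partial>circ)"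
    unfolding four ..
  also have "\<dots> = (\<integral>\<theta>. H (1, 1 * \<bar>strip_im \<theta>\<bar>) \<partial>circ) + (\<integral>\<theta>. H (1, (-1) * \<bar>strip_im \<theta>\<bar>) \<partial>circ)
     + (\<integral>\<theta>. H (-1, 1 * \<bar>strip_im \<theta>\<bar>) \<partial>circ) + (\<integral>\<theta>. H (-1, (-1) * \<bar>strip_im \<theta>\<bar>) \<partial>circ)"
    using intH'[of 1 1] intH'[of 1 "-1"] intH'[of "-1" 1] intH'[of "-1" "-1"] by simp
  finally have 4: "4 * (\<integral>\<theta>. H (strip_re \<theta>, strip_im \<theta>) \<partial>circ) = \<dots>" .
  have "4 * S.avg Q x y v = H (1, 1 * strip_const) + H (1, (-1) * strip_const) + H (-1, 1 * strip_const) + H (-1, (-1) * strip_const)"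
    unfolding S.avg_def integral_signs by (simp add: H_def)
  also have "\<dots> \<le> 4 * (\<integral>\<theta>. H (strip_re \<theta>, strip_im \<theta>) \<partial>circ)"
    unfolding 4 by (intro add_mono jensen) auto
  finally show "S.avg Q x y v \<le> (\<integral>\<theta>. Q (x + strip_re \<theta> *\<^sub>R v, y + strip_im \<theta> *\<^sub>R v) \<partial>circ)"
    by (simp add: H_def)
qed

text \<open>The pairs of \<open>strip_approximation\<close> are inserted into
  \<open>circ_nonpos_modulate\<close>. Their second components are not bounded uniformly in
  \<open>n\<close>, so the limit is taken by Fatou's lemma; this is where the lower bound of
  \<open>Q\<close> in terms of \<open>x\<close> alone enters.\<close>

lemma circ_nonpos_signs:
  fixes Q :: "'a::real_normed_vector \<times> 'a \<Rightarrow> real"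
  assumes p: "1 < p" and Q: "good p Q" "circ_nonpos Q" and fg: "conj_pair f g" and v: "trig_poly v"
  shows "(\<integral>t. step_law.avg signs fst (\<lambda>z. strip_const * snd z) Q (f t) (g t) (v t) \<partial>circ) \<le> 0"
proof -
  interpret S: step_law signs fst "\<lambda>z. strip_const * snd z" p using p by (rule step_law_signs)
  obtain \<xi> \<xi>' where a: "\<And>n. conj_pair (\<xi> n) (\<xi>' n)" "\<And>n \<theta>. \<bar>\<xi> n \<theta>\<bar> \<le> 3"
    "\<And>\<theta>. cos \<theta> \<noteq> 0 \<Longrightarrow> (\<lambda>n. \<xi> n \<theta>) \<longlonglongrightarrow> strip_re \<theta>"
    "\<And>\<theta>. cos \<theta> \<noteq> 0 \<Longrightarrow> (\<lambda>n. \<xi>' n \<theta>) \<longlonglongrightarrow> strip_im \<theta>"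
    by (rule strip_approximation) blast
  note [measurable] = conj_pair_measurable[OF a(1)]
  obtain K where K: "0 \<le> K" "\<And>x y. \<bar>Q (x, y)\<bar> \<le> K * (1 + norm x + norm y) powr p"
    "\<And>x y. - K * (1 + norm x) powr p \<le> Q (x, y)"
    using goodD(4)[OF Q(1)] by blast
  obtain B1 where B1: "\<And>t. norm (f t) \<le> B1" "\<And>t. norm (g t) \<le> B1" using conj_pair_bounded[OF fg] by blast
  obtain B2 where B2: "\<And>t. norm (v t) \<le> B2" using trig_poly_bounded[OF v] by blast
  have nnB: "0 \<le> B2" "0 \<le> B1" using order_trans[OF norm_ge_zero B2] order_trans[OF norm_ge_zero B1(1)] .
  \<comment> \<open>A bound for \<open>- Q\<close> along all approximants, from
    \<open>\<bar>\<xi>\<bar> \<le> 3\<close>; adding \<open>L\<close> makes the integrands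
    nonnegative.\<close>
  define L where "L = K * (1 + (B1 + 3 * B2)) powr p"
  have L0: "0 \<le> L" unfolding L_def using K(1) by simp
  have low: "0 \<le> Q (f t + s *\<^sub>R v t, y) + L" if "\<bar>s\<bar> \<le> 3" for s t y
  proof -
    have "norm (f t + s *\<^sub>R v t) \<le> B1 + 3 * B2"
      using B1(1)[of t] B2[of t] that nnB
      by (intro order_trans[OF norm_triangle_ineq] add_mono) (auto intro!: mult_mono)
    then have "K * (1 + norm (f t + s *\<^sub>R v t)) powr p \<le> L"
      unfolding L_def using K(1) p by (intro mult_left_mono powr_mono2) auto
    then show ?thesis using K(3)[of "f t + s *\<^sub>R v t" y] by linarith
  qed
  define F where "F = (\<lambda>t s r. Q (f t + s *\<^sub>R v t, g t + r *\<^sub>R v t) + L)"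
  note c = conj_pair_continuous[OF fg] trig_poly_continuous[OF v]
  have cf: "continuous_on UNIV (\<lambda>z. f (k z))" "continuous_on UNIV (\<lambda>z. g (k z))" "continuous_on UNIV (\<lambda>z. v (k z))"
    if "continuous_on UNIV k" for k :: "'z::topological_space \<Rightarrow> real"
    using c that by (auto intro: continuous_on_compose2)
  have Fc: "continuous_on UNIV (\<lambda>u. F (fst u) (fst (snd u)) (snd (snd u)))"
    unfolding F_def
    by (intro continuous_on_add continuous_on_const continuous_on_compose2[OF goodD(1)[OF Q(1)]])
       (auto intro!: continuous_intros cf)
  have Fm: "(\<lambda>u. F (h u) (k u) (l u)) \<in> borel_measurable M"
    if [measurable]: "h \<in> borel_measurable M" "k \<in> borel_measurable M" "l \<in> borel_measurable M" for h k l :: "'m \<Rightarrow> real" and M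
  proof -
    have "(\<lambda>u. (h u, k u, l u)) \<in> measurable M borel"
      unfolding borel_prod[symmetric] by measurable
    from borel_measurable_continuous_on[OF Fc this] show ?thesis by simp
  qed
  have meas1: "(\<lambda>u. F (fst u) (\<xi> n (snd u)) (\<xi>' n (snd u))) \<in> borel_measurable (circ \<Otimes>\<^sub>M circ)" for n
    by (rule Fm) measurable
  have meas2: "(\<lambda>\<theta>. F t (\<xi> n \<theta>) (\<xi>' n \<theta>)) \<in> borel_measurable circ" for n t
    by (rule Fm) measurable
  have meas3: "(\<lambda>t. \<integral>\<^sup>+\<theta>. ennreal (F t (\<xi> n \<theta>) (\<xi>' n \<theta>)) \<partial>circ) \<in> borel_measurable circ" for n
    using circ.borel_measurable_nn_integral[of "\<lambda>t \<theta>. ennreal (F t (\<xi> n \<theta>) (\<xi>' n \<theta>))" circ] meas1[of n]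
    by (simp add: split_beta')
  have Fpos: "0 \<le> F t s r" if "\<bar>s\<bar> \<le> 3" for t s r unfolding F_def using low[OF that] by simp
  have approx: "(\<integral>\<^sup>+t. (\<integral>\<^sup>+\<theta>. ennreal (F t (\<xi> n \<theta>) (\<xi>' n \<theta>)) \<partial>circ) \<partial>circ) \<le> ennreal L" for n
  proof -
    obtain B3 where B3: "\<And>t. \<bar>\<xi> n t\<bar> \<le> B3 \<and> \<bar>\<xi>' n t\<bar> \<le> B3" using conj_pair_bounded[OF a(1)[of n]] by auto
    have nnB3: "0 \<le> B3" using B3[of 0] by linarith
    have "norm (f t + \<xi> n \<theta> *\<^sub>R v t) \<le> B1 + B3 * B2" "norm (g t + \<xi>' n \<theta> *\<^sub>R v t) \<le> B1 + B3 * B2" for t \<theta>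
      using B1 B2 B3 nnB nnB3
      by (auto intro!: order_trans[OF norm_triangle_ineq] add_mono mult_mono)
    then have FB: "\<bar>F t (\<xi> n \<theta>) (\<xi>' n \<theta>)\<bar> \<le> K * (1 + (B1 + B3 * B2) + (B1 + B3 * B2)) powr p + L" for t \<theta>
      unfolding F_def using p K L0
      by (intro order_trans[OF abs_triangle_ineq] add_mono bounded_growth) auto
    have int: "integrable circ (\<lambda>\<theta>. F t (\<xi> n \<theta>) (\<xi>' n \<theta>))" for t
      by (rule circ.integrable_const_bound[OF AE_I2]) (use FB meas2 in auto)
    have int': "integrable circ (\<lambda>\<theta>. Q (f t + \<xi> n \<theta> *\<^sub>R v t, g t + \<xi>' n \<theta> *\<^sub>R v t))" for t
      using Bochner_Integration.integrable_diff[OF int[of t] circ.integrable_const[of L]] by (simp add: F_def)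
    have Ft: "(\<integral>\<theta>. F t (\<xi> n \<theta>) (\<xi>' n \<theta>) \<partial>circ) = (\<integral>\<theta>. Q (f t + \<xi> n \<theta> *\<^sub>R v t, g t + \<xi>' n \<theta> *\<^sub>R v t) \<partial>circ) + L" for t
      unfolding F_def using int' by simp
    have bd: "\<bar>\<integral>\<theta>. F t (\<xi> n \<theta>) (\<xi>' n \<theta>) \<partial>circ\<bar> \<le> (\<integral>\<theta>. K * (1 + (B1 + B3 * B2) + (B1 + B3 * B2)) powr p + L \<partial>circ)" for t
      by (rule integral_abs_bound_integral[OF int]) (use FB in auto)
    have measI: "(\<lambda>t. \<integral>\<theta>. F t (\<xi> n \<theta>) (\<xi>' n \<theta>) \<partial>circ) \<in> borel_measurable circ"
      using circ.borel_measurable_lebesgue_integral[of "\<lambda>t \<theta>. F t (\<xi> n \<theta>) (\<xi>' n \<theta>)" circ] meas1[of n]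
      by (simp add: split_beta')
    have intI: "integrable circ (\<lambda>t. \<integral>\<theta>. F t (\<xi> n \<theta>) (\<xi>' n \<theta>) \<partial>circ)"
      by (rule circ.integrable_const_bound[OF AE_I2 measI]) (use bd in auto)
    have "(\<integral>\<^sup>+t. (\<integral>\<^sup>+\<theta>. ennreal (F t (\<xi> n \<theta>) (\<xi>' n \<theta>)) \<partial>circ) \<partial>circ) = (\<integral>\<^sup>+t. ennreal (\<integral>\<theta>. F t (\<xi> n \<theta>) (\<xi>' n \<theta>) \<partial>circ) \<partial>circ)"
      using int Fpos a(2) by (simp add: nn_integral_eq_integral)
    also have "\<dots> = ennreal (\<integral>t. (\<integral>\<theta>. F t (\<xi> n \<theta>) (\<xi>' n \<theta>) \<partial>circ) \<partial>circ)"
      using intI Fpos a(2) by (intro nn_integral_eq_integral) auto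
    also have "(\<integral>t. (\<integral>\<theta>. F t (\<xi> n \<theta>) (\<xi>' n \<theta>) \<partial>circ) \<partial>circ) =
       (\<integral>t. (\<integral>\<theta>. Q (f t + \<xi> n \<theta> *\<^sub>R v t, g t + \<xi>' n \<theta> *\<^sub>R v t) \<partial>circ) \<partial>circ) + L"
      using Bochner_Integration.integrable_diff[OF intI circ.integrable_const[of L]] unfolding Ft by simp
    also have "\<dots> \<le> L" using circ_nonpos_modulate[OF p Q fg v a(1)[of n]] by simp
    finally show ?thesis by (simp add: ennreal_leI)
  qed
  have "(\<integral>\<^sup>+t. (\<integral>\<^sup>+\<theta>. ennreal (F t (strip_re \<theta>) (strip_im \<theta>)) \<partial>circ) \<partial>circ) \<le>
    (\<integral>\<^sup>+t. liminf (\<lambda>n. \<integral>\<^sup>+\<theta>. ennreal (F t (\<xi> n \<theta>) (\<xi>' n \<theta>)) \<partial>circ) \<partial>circ)"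
  proof (rule nn_integral_mono)
    fix t
    have "(\<integral>\<^sup>+\<theta>. ennreal (F t (strip_re \<theta>) (strip_im \<theta>)) \<partial>circ) = (\<integral>\<^sup>+\<theta>. liminf (\<lambda>n. ennreal (F t (\<xi> n \<theta>) (\<xi>' n \<theta>))) \<partial>circ)"
    proof (rule nn_integral_cong_AE)
      show "AE \<theta> in circ. ennreal (F t (strip_re \<theta>) (strip_im \<theta>)) = liminf (\<lambda>n. ennreal (F t (\<xi> n \<theta>) (\<xi>' n \<theta>)))"
        using AE_cos_nonzero
      proof eventually_elim
        case (elim \<theta>)
        have "isCont Q z" for z using goodD(1)[OF Q(1)] unfolding continuous_on_eq_continuous_at[OF open_UNIV] by blast
        then have "(\<lambda>n. F t (\<xi> n \<theta>) (\<xi>' n \<theta>)) \<longlonglongrightarrow> F t (strip_re \<theta>) (strip_im \<theta>)"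
          unfolding F_def by (intro tendsto_intros isCont_tendsto_compose[of _ Q] a elim)
        then show ?case by (intro lim_imp_Liminf[symmetric] tendsto_ennrealI) auto
      qed
    qed
    also have "\<dots> \<le> liminf (\<lambda>n. \<integral>\<^sup>+\<theta>. ennreal (F t (\<xi> n \<theta>) (\<xi>' n \<theta>)) \<partial>circ)"
      using meas2 by (intro nn_integral_liminf) auto
    finally show "(\<integral>\<^sup>+\<theta>. ennreal (F t (strip_re \<theta>) (strip_im \<theta>)) \<partial>circ) \<le> liminf (\<lambda>n. \<integral>\<^sup>+\<theta>. ennreal (F t (\<xi> n \<theta>) (\<xi>' n \<theta>)) \<partial>circ)" .
  qed
  also have "\<dots> \<le> liminf (\<lambda>n. \<integral>\<^sup>+t. (\<integral>\<^sup>+\<theta>. ennreal (F t (\<xi> n \<theta>) (\<xi>' n \<theta>)) \<partial>circ) \<partial>circ)"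
    by (rule nn_integral_liminf) (rule meas3)
  also have "\<dots> \<le> liminf (\<lambda>n. ennreal L)" by (intro Liminf_mono always_eventually allI approx)
  finally have main: "(\<integral>\<^sup>+t. (\<integral>\<^sup>+\<theta>. ennreal (F t (strip_re \<theta>) (strip_im \<theta>)) \<partial>circ) \<partial>circ) \<le> ennreal L"
    by (simp add: Liminf_const)
  have pw: "ennreal (S.avg Q (f t) (g t) (v t) + L) \<le> (\<integral>\<^sup>+\<theta>. ennreal (F t (strip_re \<theta>) (strip_im \<theta>)) \<partial>circ)" for t
  proof -
    note J = strip_jensen(1)[OF p Q(1), of "f t" "v t" "g t"] strip_jensen(2)[OF p Q(1), of "f t" "g t" "v t"]
    have b: "\<bar>strip_re \<theta>\<bar> \<le> 3" for \<theta> using strip_re_values[of \<theta>] by auto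
    have "(\<integral>\<^sup>+\<theta>. ennreal (F t (strip_re \<theta>) (strip_im \<theta>)) \<partial>circ) = ennreal (\<integral>\<theta>. F t (strip_re \<theta>) (strip_im \<theta>) \<partial>circ)"
      by (rule nn_integral_eq_integral) (use J(1) Fpos b in \<open>auto simp: F_def\<close>)
    also have "(\<integral>\<theta>. F t (strip_re \<theta>) (strip_im \<theta>) \<partial>circ) = (\<integral>\<theta>. Q (f t + strip_re \<theta> *\<^sub>R v t, g t + strip_im \<theta> *\<^sub>R v t) \<partial>circ) + L"
      unfolding F_def using J(1) by simp
    finally show ?thesis using J(2) by (simp add: ennreal_leI)
  qed
  have avgc: "continuous_on UNIV (\<lambda>t. S.avg Q (f t) (g t) (v t))"
    unfolding continuous_on_eq_continuous_at[OF open_UNIV]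
  proof (intro ballI continuous_at_sequentiallyI S.avg_tendsto[OF Q(1)])
    fix t and u :: "nat \<Rightarrow> real" assume u: "u \<longlonglongrightarrow> t"
    have "isCont f t" "isCont g t" "isCont v t"
      using c by (simp_all add: continuous_on_eq_continuous_at)
    then show "(\<lambda>k. f (u k)) \<longlonglongrightarrow> f t" "(\<lambda>k. g (u k)) \<longlonglongrightarrow> g t" "(\<lambda>k. v (u k)) \<longlonglongrightarrow> v t"
      using u by (auto intro: isCont_tendsto_compose)
  qed
  have avgm: "(\<lambda>t. S.avg Q (f t) (g t) (v t)) \<in> borel_measurable circ"
    using borel_measurable_continuous_onI[OF avgc] by (simp cong: measurable_cong_sets)
  have avgpos: "0 \<le> S.avg Q (f t) (g t) (v t) + L" for t
    unfolding S.avg_def integral_signs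
    using low[of 1 t] low[of "-1" t] by (auto simp: field_simps) (smt (verit) low)
  have "(\<integral>\<^sup>+t. ennreal (S.avg Q (f t) (g t) (v t) + L) \<partial>circ) \<le> ennreal L"
    by (rule order_trans[OF nn_integral_mono main]) (rule pw)
  then have intavg: "integrable circ (\<lambda>t. S.avg Q (f t) (g t) (v t) + L)" and "(\<integral>t. S.avg Q (f t) (g t) (v t) + L \<partial>circ) \<le> L"
  proof -
    assume le: "(\<integral>\<^sup>+t. ennreal (S.avg Q (f t) (g t) (v t) + L) \<partial>circ) \<le> ennreal L"
    show i: "integrable circ (\<lambda>t. S.avg Q (f t) (g t) (v t) + L)"
      using avgm avgpos le by (intro integrableI_nonneg) (auto intro: order_le_less_trans)
    have "(\<integral>\<^sup>+t. ennreal (S.avg Q (f t) (g t) (v t) + L) \<partial>circ) = ennreal (\<integral>t. S.avg Q (f t) (g t) (v t) + L \<partial>circ)"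
      by (rule nn_integral_eq_integral[OF i]) (use avgpos in auto)
    with le show "(\<integral>t. S.avg Q (f t) (g t) (v t) + L \<partial>circ) \<le> L" using L0 by (simp add: ennreal_le_iff)
  qed
  moreover have "integrable circ (\<lambda>t. S.avg Q (f t) (g t) (v t))"
    using Bochner_Integration.integrable_diff[OF intavg circ.integrable_const[of L]] by simp
  ultimately show ?thesis by simp
qed

section \<open>Decoupling of stochastic integrals\<close>

text \<open>Sums of Borel functions into a nonseparable space need not be Borel. Finite combinations
  of fixed vectors with measurable real coefficients are stable under sums, scalar factors and
  pairing, and continuous functions of them are measurable.\<close>

inductive span_measurable :: "'w measure \<Rightarrow> ('w \<Rightarrow> 'a::real_normed_vector) \<Rightarrow> bool" for G where
  base: "a \<in> borel_measurable G \<Longrightarrow> span_measurable G (\<lambda>\<omega>. a \<omega> *\<^sub>R x)"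
| add: "span_measurable G X \<Longrightarrow> span_measurable G Y \<Longrightarrow> span_measurable G (\<lambda>\<omega>. X \<omega> + Y \<omega>)"

lemma span_measurable_zero: "span_measurable G (\<lambda>\<omega>. 0)"
  using span_measurable.base[of "\<lambda>_. 0" G 0] by simp

lemma span_measurable_sum:
  "(\<And>i. i \<in> I \<Longrightarrow> span_measurable G (X i)) \<Longrightarrow> span_measurable G (\<lambda>\<omega>. \<Sum>i\<in>I. X i \<omega>)"
proof (induction I rule: infinite_finite_induct)
  case (insert i I)
  have "span_measurable G (\<lambda>\<omega>. X i \<omega> + (\<Sum>i\<in>I. X i \<omega>))"
    using insert by (intro span_measurable.add) auto
  then show ?case using insert by simp
qed (simp_all add: span_measurable_zero)

lemma span_measurable_scale:
  assumes "span_measurable G X" "b \<in> borel_measurable G"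
  shows "span_measurable G (\<lambda>\<omega>. b \<omega> *\<^sub>R X \<omega>)"
  using assms
proof (induction rule: span_measurable.induct)
  case (base a x)
  have "(\<lambda>\<omega>. b \<omega> * a \<omega>) \<in> borel_measurable G" using base by measurable
  from span_measurable.base[OF this, of x] show ?case by simp
next
  case (add X Y)
  then show ?case by (simp add: scaleR_right_distrib span_measurable.add)
qed

lemma span_measurable_compose:
  assumes "span_measurable G X" "h \<in> measurable M G"
  shows "span_measurable M (\<lambda>\<omega>. X (h \<omega>))"
  using assms
proof (induction rule: span_measurable.induct)
  case (base a x)
  from span_measurable.base[OF measurable_compose[OF base(2,1)]] show ?case .
next
  case (add X Y)
  then show ?case by (intro span_measurable.add)
qed

lemma span_measurable_finite_sum:
  assumes "span_measurable G X"
  shows "\<exists>n a x. (\<forall>i<n. a i \<in> borel_measurable G) \<and> X = (\<lambda>\<omega>. \<Sum>i<n::nat. a i \<omega> *\<^sub>R x i)"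
  using assms
proof (induction rule: span_measurable.induct)
  case (base a x)
  then show ?case by (intro exI[of _ 1] exI[of _ "\<lambda>_. a"] exI[of _ "\<lambda>_. x"]) auto
next
  case (add X Y)
  then obtain n a x m b y where X: "\<And>i. i < n \<Longrightarrow> a i \<in> borel_measurable G" "X = (\<lambda>\<omega>. \<Sum>i<n::nat. a i \<omega> *\<^sub>R x i)"
    and Y: "\<And>i. i < m \<Longrightarrow> b i \<in> borel_measurable G" "Y = (\<lambda>\<omega>. \<Sum>i<m::nat. b i \<omega> *\<^sub>R y i)"
    by blast
  define c where "c = (\<lambda>i. if i < n then a i else b (i - n))"
  define z where "z = (\<lambda>i. if i < n then x i else y (i - n))"
  have "(\<Sum>i<n + m. c i \<omega> *\<^sub>R z i) = X \<omega> + Y \<omega>" for \<omega>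
  proof -
    have "(\<Sum>i<n + k. c i \<omega> *\<^sub>R z i) = (\<Sum>i<n. a i \<omega> *\<^sub>R x i) + (\<Sum>i<k. b i \<omega> *\<^sub>R y i)" for k
      by (induction k) (auto simp: c_def z_def algebra_simps)
    then show ?thesis by (simp add: X Y)
  qed
  moreover have "\<forall>i<n + m. c i \<in> borel_measurable G" using X(1) Y(1) by (auto simp: c_def)
  ultimately show ?case by (intro exI[of _ "n + m"] exI[of _ c] exI[of _ z]) auto
qed

lemma span_measurable_continuous:
  fixes X :: "'w \<Rightarrow> 'a::real_normed_vector" and h :: "'a \<Rightarrow> 'b::topological_space"
  assumes "span_measurable G X" "continuous_on UNIV h"
  shows "(\<lambda>\<omega>. h (X \<omega>)) \<in> borel_measurable G"
proof -
  obtain n a x where "\<forall>i<n. a i \<in> borel_measurable G" "X = (\<lambda>\<omega>. \<Sum>i<n::nat. a i \<omega> *\<^sub>R x i)"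
    using span_measurable_finite_sum[OF assms(1)] by blast
  then show ?thesis using measurable_finite_span[OF _ assms(2), of n a G x] by simp
qed

lemma span_measurable_Pair:
  fixes X :: "'w \<Rightarrow> 'a::real_normed_vector" and Y :: "'w \<Rightarrow> 'c::real_normed_vector"
  assumes "span_measurable G X" "span_measurable G Y"
  shows "span_measurable G (\<lambda>\<omega>. (X \<omega>, Y \<omega>))"
proof -
  have 1: "span_measurable G (\<lambda>\<omega>. (X \<omega>, 0 :: 'c))" if "span_measurable G X" for X :: "'w \<Rightarrow> 'a"
    using that
  proof (induction rule: span_measurable.induct)
    case (base a x)
    from span_measurable.base[OF base, of "(x, 0 :: 'c)"] show ?case by simp
  next
    case (add X Y)
    from span_measurable.add[OF add.IH] show ?case by simp
  qed
  have 2: "span_measurable G (\<lambda>\<omega>. (0 :: 'a, Y \<omega>))" if "span_measurable G Y" for Y :: "'w \<Rightarrow> 'c"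
    using that
  proof (induction rule: span_measurable.induct)
    case (base a x)
    from span_measurable.base[OF base, of "(0 :: 'a, x)"] show ?case by simp
  next
    case (add X Y)
    from span_measurable.add[OF add.IH] show ?case by simp
  qed
  from span_measurable.add[OF 1[OF assms(1)] 2[OF assms(2)]] show ?thesis by simp
qed

lemma span_measurable_norm [measurable_dest]:
  "span_measurable G X \<Longrightarrow> (\<lambda>\<omega>. norm (X \<omega>)) \<in> borel_measurable G"
  by (erule span_measurable_continuous) (intro continuous_intros)

context step_law
begin

text \<open>The hypothesis \<open>law\<close> says that \<open>u\<close> has law \<open>N\<close>
  and is independent of \<open>G\<close>. Position and vector are \<open>G\<close>-measurable, so
  freezing them turns the mean of \<open>Q\<close> into the mean of \<open>avg Q\<close>, which is
  at most \<open>step S Q\<close> because the vector lies in \<open>S\<close>. The integrability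
  statement carries the induction to the next step.\<close>

lemma step_increment:
  fixes X Y \<phi> :: "'w \<Rightarrow> 'a::real_normed_vector" and u :: "'w \<Rightarrow> 'n"
  assumes M: "prob_space M" and G: "sets G \<subseteq> sets M" "space G = space M"
    and u: "u \<in> measurable M N"
    and law: "distr M (G \<Otimes>\<^sub>M N) (\<lambda>\<omega>. (\<omega>, u \<omega>)) = distr M G (\<lambda>\<omega>. \<omega>) \<Otimes>\<^sub>M N"
    and Q: "good p Q" and S: "finite S" "\<And>\<omega>. \<phi> \<omega> \<in> S"
    and X: "span_measurable G X" and Y: "span_measurable G Y" and \<phi>: "span_measurable G \<phi>"
    and int: "integrable M (\<lambda>\<omega>. (1 + norm (X \<omega>) + norm (Y \<omega>)) powr p)"
  shows "integrable M (\<lambda>\<omega>. (1 + norm (X \<omega> + a (u \<omega>) *\<^sub>R \<phi> \<omega>) + norm (Y \<omega> + b (u \<omega>) *\<^sub>R \<phi> \<omega>)) powr p)"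
    and "(\<integral>\<omega>. Q (X \<omega> + a (u \<omega>) *\<^sub>R \<phi> \<omega>, Y \<omega> + b (u \<omega>) *\<^sub>R \<phi> \<omega>) \<partial>M) \<le> (\<integral>\<omega>. step S Q (X \<omega>, Y \<omega>) \<partial>M)"
proof -
  interpret M: prob_space M by fact
  have idm: "(\<lambda>\<omega>. \<omega>) \<in> measurable M G"
    using G by (auto simp: measurable_def intro: sets.sets_into_space)
  interpret MG: prob_space "distr M G (\<lambda>\<omega>. \<omega>)" by (rule M.prob_space_distr[OF idm])
  interpret P: pair_prob_space "distr M G (\<lambda>\<omega>. \<omega>)" N ..
  have S0: "S \<noteq> {}" using S(2) by blast
  have um: "(\<lambda>\<omega>. (\<omega>, u \<omega>)) \<in> measurable M (G \<Otimes>\<^sub>M N)" using idm u by (rule measurable_Pair)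
  have X': "span_measurable (G \<Otimes>\<^sub>M N) (\<lambda>z. X (fst z) + a (snd z) *\<^sub>R \<phi> (fst z))"
    and Y': "span_measurable (G \<Otimes>\<^sub>M N) (\<lambda>z. Y (fst z) + b (snd z) *\<^sub>R \<phi> (fst z))"
    by (intro span_measurable.add span_measurable_scale span_measurable_compose[OF X] span_measurable_compose[OF Y]
          span_measurable_compose[OF \<phi>]; measurable)+
  define B where "B = (\<Sum>v\<in>S. norm v)"
  have \<phi>B: "norm (\<phi> \<omega>) \<le> B" for \<omega> unfolding B_def using S by (intro member_le_sum) auto
  \<comment> \<open>A function of \<open>\<omega>\<close> times a function of \<open>w\<close>,
    hence integrable for the product measure.\<close>
  define bd where "bd = (\<lambda>z. (1 + norm (X (fst z)) + norm (Y (fst z))) powr p * ((1 + B) powr p * (1 + \<bar>a (snd z)\<bar> + \<bar>b (snd z)\<bar>) powr p))"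
  have bd_le: "(1 + norm (X \<omega> + a w *\<^sub>R \<phi> \<omega>) + norm (Y \<omega> + b w *\<^sub>R \<phi> \<omega>)) powr p \<le> bd (\<omega>, w)" for \<omega> w
  proof -
    have "(1 + norm (X \<omega> + a w *\<^sub>R \<phi> \<omega>) + norm (Y \<omega> + b w *\<^sub>R \<phi> \<omega>)) powr p
        \<le> ((1 + norm (X \<omega>) + norm (Y \<omega>)) * (1 + norm (\<phi> \<omega>)) * (1 + \<bar>a w\<bar> + \<bar>b w\<bar>)) powr p"
      using p by (intro powr_mono2 growth_mult) auto
    also have "\<dots> \<le> ((1 + norm (X \<omega>) + norm (Y \<omega>)) * (1 + B) * (1 + \<bar>a w\<bar> + \<bar>b w\<bar>)) powr p"
      using p \<phi>B[of \<omega>] by (intro powr_mono2 mult_right_mono mult_left_mono) auto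
    also have "\<dots> = bd (\<omega>, w)" by (simp add: bd_def powr_mult)
    finally show ?thesis .
  qed
  have mX: "(\<lambda>\<omega>. (1 + norm (X \<omega>) + norm (Y \<omega>)) powr p) \<in> borel_measurable G"
    using span_measurable_norm[OF X] span_measurable_norm[OF Y] by measurable
  have intG: "integrable (distr M G (\<lambda>\<omega>. \<omega>)) (\<lambda>\<omega>. (1 + norm (X \<omega>) + norm (Y \<omega>)) powr p)"
    using int by (subst integrable_distr_eq[OF idm mX])
  have mX'[measurable]: "(\<lambda>z. (1 + norm (X (fst z)) + norm (Y (fst z))) powr p) \<in> borel_measurable (G \<Otimes>\<^sub>M N)"
    using measurable_compose[OF measurable_fst mX] .
  have mbd: "bd \<in> borel_measurable (G \<Otimes>\<^sub>M N)" unfolding bd_def by measurable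
  have sP: "sets (distr M G (\<lambda>\<omega>. \<omega>) \<Otimes>\<^sub>M N) = sets (G \<Otimes>\<^sub>M N)" by (intro sets_pair_measure_cong) auto
  have bdint: "integrable (distr M G (\<lambda>\<omega>. \<omega>) \<Otimes>\<^sub>M N) bd"
  proof -
    have "integrable (distr M G (\<lambda>\<omega>. \<omega>) \<Otimes>\<^sub>M N) (\<lambda>(\<omega>, w). (1 + norm (X \<omega>) + norm (Y \<omega>)) powr p * ((1 + B) powr p * (1 + \<bar>a w\<bar> + \<bar>b w\<bar>) powr p))"
    proof (rule P.Fubini_integrable)
      show "(\<lambda>(\<omega>, w). (1 + norm (X \<omega>) + norm (Y \<omega>)) powr p * ((1 + B) powr p * (1 + \<bar>a w\<bar> + \<bar>b w\<bar>) powr p)) \<in> borel_measurable (distr M G (\<lambda>\<omega>. \<omega>) \<Otimes>\<^sub>M N)"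
        using mbd unfolding measurable_cong_sets[OF sP refl] bd_def split_beta' .
    qed (use intG moment in \<open>auto simp: abs_mult\<close>)
    then show ?thesis by (simp add: bd_def split_beta')
  qed
  \<comment> \<open>The freezing rule: under the joint law the increment can be integrated out
    first, with \<open>\<omega>\<close> fixed.\<close>
  have sub: "integrable M (\<lambda>\<omega>. h (\<omega>, u \<omega>)) \<and> (\<integral>\<omega>. h (\<omega>, u \<omega>) \<partial>M) = (\<integral>\<omega>. (\<integral>w. h (\<omega>, w) \<partial>N) \<partial>M)"
    if h: "h \<in> borel_measurable (G \<Otimes>\<^sub>M N)" "\<And>z. \<bar>h z\<bar> \<le> C * bd z" for h :: "'w \<times> 'n \<Rightarrow> real" and C
  proof -
    have "integrable (distr M G (\<lambda>\<omega>. \<omega>) \<Otimes>\<^sub>M N) (\<lambda>z. C * bd z)" using bdint by simp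
    then have hi: "integrable (distr M G (\<lambda>\<omega>. \<omega>) \<Otimes>\<^sub>M N) h"
      by (rule Bochner_Integration.integrable_bound)
         (use h in \<open>auto simp: measurable_cong_sets[OF sP refl] intro!: AE_I2 order_trans[OF _ abs_ge_self]\<close>)
    have mI: "(\<lambda>\<omega>. \<integral>w. h (\<omega>, w) \<partial>N) \<in> borel_measurable G"
      using h(1) by (intro borel_measurable_lebesgue_integral) simp
    have "(\<integral>\<omega>. h (\<omega>, u \<omega>) \<partial>M) = (\<integral>z. h z \<partial>(distr M G (\<lambda>\<omega>. \<omega>) \<Otimes>\<^sub>M N))"
      unfolding law[symmetric] by (rule integral_distr[OF um h(1), symmetric])
    also have "\<dots> = (\<integral>\<omega>. (\<integral>w. h (\<omega>, w) \<partial>N) \<partial>distr M G (\<lambda>\<omega>. \<omega>))"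
      by (rule P.integral_fst'[OF hi, symmetric])
    also have "\<dots> = (\<integral>\<omega>. (\<integral>w. h (\<omega>, w) \<partial>N) \<partial>M)"
      by (rule integral_distr[OF idm mI])
    finally have "(\<integral>\<omega>. h (\<omega>, u \<omega>) \<partial>M) = (\<integral>\<omega>. (\<integral>w. h (\<omega>, w) \<partial>N) \<partial>M)" .
    moreover have "integrable M (\<lambda>\<omega>. h (\<omega>, u \<omega>))"
      using hi unfolding law[symmetric] by (subst (asm) integrable_distr_eq[OF um h(1)])
    ultimately show ?thesis by simp
  qed
  have m1: "(\<lambda>z. (1 + norm (X (fst z) + a (snd z) *\<^sub>R \<phi> (fst z)) + norm (Y (fst z) + b (snd z) *\<^sub>R \<phi> (fst z))) powr p) \<in> borel_measurable (G \<Otimes>\<^sub>M N)"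
    using span_measurable_norm[OF X'] span_measurable_norm[OF Y'] by measurable
  show "integrable M (\<lambda>\<omega>. (1 + norm (X \<omega> + a (u \<omega>) *\<^sub>R \<phi> \<omega>) + norm (Y \<omega> + b (u \<omega>) *\<^sub>R \<phi> \<omega>)) powr p)"
  proof -
    have "integrable M (\<lambda>\<omega>. (\<lambda>z. (1 + norm (X (fst z) + a (snd z) *\<^sub>R \<phi> (fst z)) + norm (Y (fst z) + b (snd z) *\<^sub>R \<phi> (fst z))) powr p) (\<omega>, u \<omega>))"
      by (rule sub[OF m1, of 1, THEN conjunct1]) (use bd_le in auto)
    then show ?thesis by simp
  qed
  obtain K where K: "0 \<le> K" "\<And>x y. \<bar>Q (x, y)\<bar> \<le> K * (1 + norm x + norm y) powr p"
    using goodD(4)[OF Q] by blast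
  have m2: "(\<lambda>z. Q (X (fst z) + a (snd z) *\<^sub>R \<phi> (fst z), Y (fst z) + b (snd z) *\<^sub>R \<phi> (fst z))) \<in> borel_measurable (G \<Otimes>\<^sub>M N)"
    by (rule span_measurable_continuous[OF span_measurable_Pair[OF X' Y'] goodD(1)[OF Q]])
  have QB: "\<bar>Q (X (fst z) + a (snd z) *\<^sub>R \<phi> (fst z), Y (fst z) + b (snd z) *\<^sub>R \<phi> (fst z))\<bar> \<le> K * bd z" for z
    using bd_le[of "fst z" "snd z"] K(1) by (intro order_trans[OF K(2)] mult_left_mono) auto
  have mI: "(\<lambda>\<omega>. avg Q (X \<omega>) (Y \<omega>) (\<phi> \<omega>)) \<in> borel_measurable G"
    unfolding avg_def
    using m2 borel_measurable_lebesgue_integral[of "\<lambda>\<omega> w. Q (X \<omega> + a w *\<^sub>R \<phi> \<omega>, Y \<omega> + b w *\<^sub>R \<phi> \<omega>)" G]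
    by (simp add: split_beta')
  obtain L where L: "0 \<le> L" "\<And>x y. \<bar>step S Q (x, y)\<bar> \<le> L * (1 + norm x + norm y) powr p"
    using goodD(4)[OF good_step[OF Q S(1) S0]] by blast
  have mS: "(\<lambda>\<omega>. step S Q (X \<omega>, Y \<omega>)) \<in> borel_measurable G"
    by (rule span_measurable_continuous[OF span_measurable_Pair[OF X Y] goodD(1)[OF good_step[OF Q S(1) S0]]])
  have GM: "f \<in> borel_measurable G \<Longrightarrow> f \<in> borel_measurable M" for f :: "'w \<Rightarrow> real"
    by (rule measurable_compose[OF idm])
  have "(\<integral>\<omega>. Q (X \<omega> + a (u \<omega>) *\<^sub>R \<phi> \<omega>, Y \<omega> + b (u \<omega>) *\<^sub>R \<phi> \<omega>) \<partial>M) = (\<integral>\<omega>. avg Q (X \<omega>) (Y \<omega>) (\<phi> \<omega>) \<partial>M)"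
    using sub[OF m2 QB] unfolding avg_def by simp
  also have "\<dots> \<le> (\<integral>\<omega>. step S Q (X \<omega>, Y \<omega>) \<partial>M)"
  proof (rule integral_mono)
    have "integrable M (\<lambda>\<omega>. L * (1 + norm (X \<omega>) + norm (Y \<omega>)) powr p)" using int by simp
    then show "integrable M (\<lambda>\<omega>. step S Q (X \<omega>, Y \<omega>))"
      by (rule Bochner_Integration.integrable_bound) (use GM[OF mS] L in \<open>auto intro!: AE_I2\<close>)
    obtain K' where K': "0 \<le> K'" "\<And>x y. \<bar>Q (x, y)\<bar> \<le> K' * (1 + norm x + norm y) powr p" "\<And>x y. - K' * (1 + norm x) powr p \<le> Q (x, y)"
      using goodD(4)[OF Q] by blast
    have "integrable M (\<lambda>\<omega>. (K' * (1 + B) powr p * mom) * (1 + norm (X \<omega>) + norm (Y \<omega>)) powr p)" using int by simp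
    then show "integrable M (\<lambda>\<omega>. avg Q (X \<omega>) (Y \<omega>) (\<phi> \<omega>))"
    proof (rule Bochner_Integration.integrable_bound)
      show "AE \<omega> in M. norm (avg Q (X \<omega>) (Y \<omega>) (\<phi> \<omega>)) \<le> norm ((K' * (1 + B) powr p * mom) * (1 + norm (X \<omega>) + norm (Y \<omega>)) powr p)"
      proof (rule AE_I2)
        fix \<omega>
        have "norm (avg Q (X \<omega>) (Y \<omega>) (\<phi> \<omega>)) \<le> (K' * (1 + norm (\<phi> \<omega>)) powr p * mom) * (1 + norm (X \<omega>) + norm (Y \<omega>)) powr p"
          using avg_bounds(1)[OF Q K'] by simp
        also have "\<dots> \<le> (K' * (1 + B) powr p * mom) * (1 + norm (X \<omega>) + norm (Y \<omega>)) powr p"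
          using K'(1) mom_nonneg p \<phi>B[of \<omega>] by (intro mult_right_mono mult_left_mono powr_mono2) auto
        finally show "norm (avg Q (X \<omega>) (Y \<omega>) (\<phi> \<omega>)) \<le> norm ((K' * (1 + B) powr p * mom) * (1 + norm (X \<omega>) + norm (Y \<omega>)) powr p)"
          by simp
      qed
    qed (rule GM[OF mI])
    show "avg Q (X \<omega>) (Y \<omega>) (\<phi> \<omega>) \<le> step S Q (X \<omega>, Y \<omega>)" for \<omega>
      by (rule avg_le_step[OF S])
  qed
  finally show "(\<integral>\<omega>. Q (X \<omega> + a (u \<omega>) *\<^sub>R \<phi> \<omega>, Y \<omega> + b (u \<omega>) *\<^sub>R \<phi> \<omega>) \<partial>M) \<le> (\<integral>\<omega>. step S Q (X \<omega>, Y \<omega>) \<partial>M)" .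
qed

end

theorem gaussian_decoupling:
  fixes \<phi> :: "nat \<Rightarrow> 'w \<Rightarrow> 'a::real_normed_vector" and u :: "nat \<Rightarrow> 'w \<Rightarrow> real \<times> real"
  assumes p: "1 < p" and c: "circ_nonpos (base_value p c :: 'a \<times> 'a \<Rightarrow> real)"
    and M: "prob_space M" and G: "\<And>k. k \<in> {1..K} \<Longrightarrow> sets (G k) \<subseteq> sets M \<and> space (G k) = space M"
    and \<sigma>: "\<And>k. k \<in> {1..K} \<Longrightarrow> 0 < \<sigma> k"
    and u: "\<And>k. k \<in> {1..K} \<Longrightarrow> u k \<in> measurable M (borel \<Otimes>\<^sub>M borel)"
    and law: "\<And>k. k \<in> {1..K} \<Longrightarrow> distr M (G k \<Otimes>\<^sub>M (borel \<Otimes>\<^sub>M borel)) (\<lambda>\<omega>. (\<omega>, u k \<omega>)) = distr M (G k) (\<lambda>\<omega>. \<omega>) \<Otimes>\<^sub>M gauss2 (\<sigma> k)"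
    and S: "finite S" "\<And>k \<omega>. \<phi> k \<omega> \<in> S"
    and past: "\<And>j k. 1 \<le> j \<Longrightarrow> j < k \<Longrightarrow> k \<le> K \<Longrightarrow> u j \<in> measurable (G k) (borel \<Otimes>\<^sub>M borel)"
    and \<phi>: "\<And>j k. 1 \<le> j \<Longrightarrow> j \<le> k \<Longrightarrow> k \<le> K \<Longrightarrow> span_measurable (G k) (\<phi> j)"
  shows "(\<integral>\<^sup>+\<omega>. ennreal (norm (\<Sum>k=1..K. snd (u k \<omega>) *\<^sub>R \<phi> k \<omega>) powr p) \<partial>M)
     \<le> ennreal (c powr p) * (\<integral>\<^sup>+\<omega>. ennreal (norm (\<Sum>k=1..K. fst (u k \<omega>) *\<^sub>R \<phi> k \<omega>) powr p) \<partial>M)"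
proof -
  interpret M: prob_space M by fact
  have S0: "S \<noteq> {}" using S(2) by blast
  define X where "X = (\<lambda>k \<omega>. \<Sum>j=1..k. fst (u j \<omega>) *\<^sub>R \<phi> j \<omega>)"
  define Y where "Y = (\<lambda>k \<omega>. \<Sum>j=1..k. snd (u j \<omega>) *\<^sub>R \<phi> j \<omega>)"
  have SucX: "X k \<omega> = X (k - 1) \<omega> + fst (u k \<omega>) *\<^sub>R \<phi> k \<omega>" "Y k \<omega> = Y (k - 1) \<omega> + snd (u k \<omega>) *\<^sub>R \<phi> k \<omega>" if "k \<in> {1..K}" for k \<omega>
    using that by (cases k; simp add: X_def Y_def)+
  have spanXY: "span_measurable (G k) (X (k - 1))" "span_measurable (G k) (Y (k - 1))" if k: "k \<in> {1..K}" for k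
    unfolding X_def Y_def
    by (intro span_measurable_sum span_measurable_scale \<phi>
          measurable_compose[OF past measurable_fst] measurable_compose[OF past measurable_snd]; use k in auto)+
  have law': "distr M (G k \<Otimes>\<^sub>M gauss2 (\<sigma> k)) (\<lambda>\<omega>. (\<omega>, u k \<omega>)) = distr M (G k) (\<lambda>\<omega>. \<omega>) \<Otimes>\<^sub>M gauss2 (\<sigma> k)"
    "u k \<in> measurable M (gauss2 (\<sigma> k))" if k: "k \<in> {1..K}" for k
  proof -
    have "sets (G k \<Otimes>\<^sub>M gauss2 (\<sigma> k)) = sets (G k \<Otimes>\<^sub>M (borel \<Otimes>\<^sub>M borel))"
      by (intro sets_pair_measure_cong sets_gauss2) simp
    then have "distr M (G k \<Otimes>\<^sub>M gauss2 (\<sigma> k)) (\<lambda>\<omega>. (\<omega>, u k \<omega>)) = distr M (G k \<Otimes>\<^sub>M (borel \<Otimes>\<^sub>M borel)) (\<lambda>\<omega>. (\<omega>, u k \<omega>))"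
      by (intro distr_cong) auto
    with law[OF k] show "distr M (G k \<Otimes>\<^sub>M gauss2 (\<sigma> k)) (\<lambda>\<omega>. (\<omega>, u k \<omega>)) = distr M (G k) (\<lambda>\<omega>. \<omega>) \<Otimes>\<^sub>M gauss2 (\<sigma> k)" by simp
    show "u k \<in> measurable M (gauss2 (\<sigma> k))" using u[OF k] by (simp cong: measurable_cong_sets add: sets_gauss2)
  qed
  have int: "integrable M (\<lambda>\<omega>. (1 + norm (X k \<omega>) + norm (Y k \<omega>)) powr p)" if "k \<le> K" for k
    using that
  proof (induction k)
    case (Suc k)
    then have k: "Suc k \<in> {1..K}" by auto
    have "\<bar>base_value p c (x, y)\<bar> \<le> 0 \<or> True" for x y :: 'a by simp
    note inc = step_law.step_increment(1)[OF step_law_gauss2[OF \<sigma>[OF k] p] M conjunct1[OF G[OF k]] conjunct2[OF G[OF k]]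
        law'(2)[OF k] law'(1)[OF k] good_base_value[OF p] S(1) S(2) spanXY[OF k] \<phi>]
    show ?case unfolding SucX[OF k]
      by (rule inc) (use k Suc in auto)
  qed (simp add: X_def Y_def)
  \<comment> \<open>Time runs backwards: \<open>R j\<close> is the value function when
    \<open>j\<close> increments remain, and \<open>R (Suc j)\<close> averages over the increment
    with index \<open>K - j\<close>.\<close>
  define R where "R = rec_nat (base_value p c :: 'a \<times> 'a \<Rightarrow> real) (\<lambda>j V. step_law.step (gauss2 (\<sigma> (K - j))) fst snd S V)"
  have R0: "R 0 = base_value p c" and RSuc: "R (Suc j) = step_law.step (gauss2 (\<sigma> (K - j))) fst snd S (R j)" for j
    by (simp_all add: R_def)
  have R: "good p (R j) \<and> circ_nonpos (R j)" if "j \<le> K" for j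
    using that
  proof (induction j)
    case 0
    then show ?case using good_base_value[OF p] c by (simp add: R0)
  next
    case (Suc j)
    then have k: "K - j \<in> {1..K}" and IH: "good p (R j)" "circ_nonpos (R j)" by auto
    interpret L: step_law "gauss2 (\<sigma> (K - j))" fst snd p using \<sigma>[OF k] p by (rule step_law_gauss2)
    show ?case
      unfolding RSuc
      by (intro conjI L.good_step[OF IH(1) S(1) S0] L.circ_nonpos_step[OF IH(1) S(1) S0] circ_nonpos_gauss2[OF \<sigma>[OF k] p IH])
  qed
  have desc: "(\<integral>\<omega>. base_value p c (X K \<omega>, Y K \<omega>) \<partial>M) \<le> (\<integral>\<omega>. R j (X (K - j) \<omega>, Y (K - j) \<omega>) \<partial>M)" if "j \<le> K" for j
    using that
  proof (induction j)
    case (Suc j)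
    then have k: "K - j \<in> {1..K}" by auto
    have e: "K - j - 1 = K - Suc j" by simp
    have "(\<integral>\<omega>. base_value p c (X K \<omega>, Y K \<omega>) \<partial>M) \<le> (\<integral>\<omega>. R j (X (K - j) \<omega>, Y (K - j) \<omega>) \<partial>M)" using Suc by simp
    also have "\<dots> \<le> (\<integral>\<omega>. R (Suc j) (X (K - Suc j) \<omega>, Y (K - Suc j) \<omega>) \<partial>M)"
      unfolding SucX[OF k] RSuc e[symmetric]
      by (rule step_law.step_increment(2)[OF step_law_gauss2[OF \<sigma>[OF k] p] M conjunct1[OF G[OF k]] conjunct2[OF G[OF k]]
        law'(2)[OF k] law'(1)[OF k] conjunct1[OF R] S(1) S(2) spanXY[OF k] \<phi> int]) (use k Suc.prems in auto)
    finally show ?case .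
  qed (simp add: R0)
  have "(\<integral>\<omega>. base_value p c (X K \<omega>, Y K \<omega>) \<partial>M) \<le> R K (0, 0)"
    using desc[of K] by (simp add: X_def Y_def M.prob_space)
  also have "\<dots> \<le> 0" using R[of K] circ_nonpos_zero by auto
  finally have le0: "(\<integral>\<omega>. base_value p c (X K \<omega>, Y K \<omega>) \<partial>M) \<le> 0" .
  have span: "span_measurable M (X K)" "span_measurable M (Y K)"
  proof -
    have "span_measurable M (\<phi> j)" if "j \<in> {1..K}" for j
    proof -
      have "(\<lambda>\<omega>. \<omega>) \<in> measurable M (G j)"
        using G[OF that] by (auto simp: measurable_def intro: sets.sets_into_space)
      from span_measurable_compose[OF \<phi>[of j j] this] that show ?thesis by auto
    qed
    then show "span_measurable M (X K)" "span_measurable M (Y K)"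
      unfolding X_def Y_def
      by (intro span_measurable_sum span_measurable_scale measurable_compose[OF u measurable_fst] measurable_compose[OF u measurable_snd]; simp)+
  qed
  have ints: "integrable M (\<lambda>\<omega>. norm (X K \<omega>) powr p)" "integrable M (\<lambda>\<omega>. norm (Y K \<omega>) powr p)"
    by (rule Bochner_Integration.integrable_bound[OF int[OF order_refl]],
        use span_measurable_norm[OF span(1)] span_measurable_norm[OF span(2)] p in \<open>auto intro!: AE_I2 powr_mono2\<close>)+
  have "(\<integral>\<omega>. norm (Y K \<omega>) powr p \<partial>M) \<le> c powr p * (\<integral>\<omega>. norm (X K \<omega>) powr p \<partial>M)"
    using le0 ints by (simp add: base_value_def)
  then have "ennreal (\<integral>\<omega>. norm (Y K \<omega>) powr p \<partial>M) \<le> ennreal (c powr p) * ennreal (\<integral>\<omega>. norm (X K \<omega>) powr p \<partial>M)"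
    by (subst ennreal_mult[symmetric]) (auto intro!: ennreal_leI)
  then show ?thesis
    using ints unfolding X_def Y_def by (simp add: nn_integral_eq_integral)
qed

text \<open>The product formula on rectangles suffices, since \<open>\<A>\<close> and the rectangles
  are stable under intersections. Taking the whole space for \<open>A\<close> identifies the law of
  the pair.\<close>

lemma (in prob_space) joint_law_gauss2:
  fixes w v :: "'a \<Rightarrow> real"
  assumes A: "\<A> \<subseteq> events" "Int_stable \<A>" "space M \<in> \<A>"
    and w: "w \<in> borel_measurable M" and v: "v \<in> borel_measurable M" and \<sigma>: "0 < \<sigma>"
    and rect: "\<And>A C D. A \<in> \<A> \<Longrightarrow> C \<in> sets borel \<Longrightarrow> D \<in> sets borel \<Longrightarrow>
      prob (A \<inter> {\<omega> \<in> space M. w \<omega> \<in> C \<and> v \<omega> \<in> D}) = prob A * (measure (gauss \<sigma>) C * measure (gauss \<sigma>) D)"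
  shows "distr M (sigma (space M) \<A> \<Otimes>\<^sub>M (borel \<Otimes>\<^sub>M borel)) (\<lambda>\<omega>. (\<omega>, (w \<omega>, v \<omega>))) = distr M (sigma (space M) \<A>) (\<lambda>\<omega>. \<omega>) \<Otimes>\<^sub>M gauss2 \<sigma>"
proof -
  let ?G = "sigma (space M) \<A>" and ?u = "\<lambda>\<omega>. (w \<omega>, v \<omega>)"
  interpret g: prob_space "gauss \<sigma>" using \<sigma> by (rule prob_space_gauss)
  have As: "\<A> \<subseteq> Pow (space M)" using A(1) sets.sets_into_space by blast
  have u: "?u \<in> measurable M (borel \<Otimes>\<^sub>M borel)" using w v by measurable
  have "distr M (borel \<Otimes>\<^sub>M borel) ?u = gauss2 \<sigma>"
    unfolding gauss2_def
  proof (rule pair_measure_eqI[symmetric])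
    show "sigma_finite_measure (gauss \<sigma>)" "sigma_finite_measure (gauss \<sigma>)"
      by (rule g.sigma_finite_measure_axioms)+
    show "sets (gauss \<sigma> \<Otimes>\<^sub>M gauss \<sigma>) = sets (distr M (borel \<Otimes>\<^sub>M borel) ?u)"
      using sets_gauss2 by (simp add: gauss2_def)
    fix C D assume "C \<in> sets (gauss \<sigma>)" "D \<in> sets (gauss \<sigma>)"
    then have C: "C \<in> sets borel" and D: "D \<in> sets borel" by auto
    have "emeasure (distr M (borel \<Otimes>\<^sub>M borel) ?u) (C \<times> D) = emeasure M (space M \<inter> {\<omega> \<in> space M. w \<omega> \<in> C \<and> v \<omega> \<in> D})"
      using C D u by (subst emeasure_distr) (auto intro!: arg_cong[where f = "emeasure M"])
    also have "\<dots> = ennreal (measure (gauss \<sigma>) C * measure (gauss \<sigma>) D)"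
      using rect[OF A(3) C D] by (simp add: emeasure_eq_measure prob_space)
    finally show "emeasure (gauss \<sigma>) C * emeasure (gauss \<sigma>) D = emeasure (distr M (borel \<Otimes>\<^sub>M borel) ?u) (C \<times> D)"
      by (simp add: g.emeasure_eq_measure ennreal_mult)
  qed
  note du = this
  define \<B> where "\<B> = {{\<omega> \<in> space M. w \<omega> \<in> C \<and> v \<omega> \<in> D} | C D. C \<in> sets borel \<and> D \<in> sets (borel :: real measure)}"
  have Bev: "\<B> \<subseteq> events" unfolding \<B>_def using w v by auto
  have "indep_set \<A> \<B>"
  proof (rule indep_setI[OF A(1) Bev])
    fix A B assume A': "A \<in> \<A>" and "B \<in> \<B>"
    then obtain C D where B: "B = {\<omega> \<in> space M. w \<omega> \<in> C \<and> v \<omega> \<in> D}" and CD: "C \<in> sets borel" "D \<in> sets borel"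
      by (auto simp: \<B>_def)
    have "prob B = measure (gauss \<sigma>) C * measure (gauss \<sigma>) D"
      using rect[OF A(3) CD] Bev \<open>B \<in> \<B>\<close> sets.sets_into_space[of B M] by (simp add: prob_space B Int_absorb1)
    then show "prob (A \<inter> B) = prob A * prob B" using rect[OF A' CD] by (simp add: B)
  qed
  moreover have "Int_stable \<B>"
  proof (rule Int_stableI)
    fix B B' assume "B \<in> \<B>" "B' \<in> \<B>"
    then obtain C D C' D' where "B = {\<omega> \<in> space M. w \<omega> \<in> C \<and> v \<omega> \<in> D}" "B' = {\<omega> \<in> space M. w \<omega> \<in> C' \<and> v \<omega> \<in> D'}"
      "C \<in> sets borel" "D \<in> sets borel" "C' \<in> sets borel" "D' \<in> sets borel" by (auto simp: \<B>_def)
    then show "B \<inter> B' \<in> \<B>"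
      unfolding \<B>_def by (intro CollectI exI[of _ "C \<inter> C'"] exI[of _ "D \<inter> D'"]) auto
  qed
  ultimately have "indep_sets (\<lambda>i. sigma_sets (space M) (case_bool \<A> \<B> i)) UNIV"
    using A(2) unfolding indep_set_def by (intro indep_sets_sigma) (auto split: bool.split)
  then have ind: "indep_set (sigma_sets (space M) \<A>) (sigma_sets (space M) \<B>)"
    unfolding indep_set_def by (rule indep_sets_mono_sets) (auto split: bool.split)
  have "{?u -` E \<inter> space M |E. E \<in> sets (borel \<Otimes>\<^sub>M borel)} \<subseteq> sigma_sets (space M) \<B>"
  proof -
    have "?u \<in> measurable (sigma (space M) \<B>) (borel \<Otimes>\<^sub>M borel)"
    proof (intro measurable_Pair)
      have Bs: "\<B> \<subseteq> Pow (space M)" by (auto simp: \<B>_def)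
      show "w \<in> borel_measurable (sigma (space M) \<B>)"
      proof (rule measurableI)
        fix C :: "real set" assume "C \<in> sets borel"
        then have "w -` C \<inter> space M \<in> \<B>"
          unfolding \<B>_def by (intro CollectI exI[of _ C] exI[of _ UNIV]) auto
        then show "w -` C \<inter> space (sigma (space M) \<B>) \<in> sets (sigma (space M) \<B>)"
          using Bs by (auto simp: space_measure_of_conv)
      qed auto
      show "v \<in> borel_measurable (sigma (space M) \<B>)"
      proof (rule measurableI)
        fix C :: "real set" assume "C \<in> sets borel"
        then have "v -` C \<inter> space M \<in> \<B>"
          unfolding \<B>_def by (intro CollectI exI[of _ UNIV] exI[of _ C]) auto
        then show "v -` C \<inter> space (sigma (space M) \<B>) \<in> sets (sigma (space M) \<B>)"
          using Bs by (auto simp: space_measure_of_conv)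
      qed auto
    qed
    moreover have "\<B> \<subseteq> Pow (space M)" by (auto simp: \<B>_def)
    ultimately show ?thesis by (auto dest: measurable_sets simp: space_measure_of_conv)
  qed
  note sB = this
  have idm: "(\<lambda>\<omega>. \<omega>) \<in> measurable M ?G"
    using A(1) As by (intro measurable_measure_of) (auto intro: sets.sets_into_space simp: Int_absorb2)
  interpret G: prob_space "distr M ?G (\<lambda>\<omega>. \<omega>)" by (rule prob_space_distr[OF idm])
  interpret g2: prob_space "gauss2 \<sigma>" using \<sigma> by (rule prob_space_gauss2)
  have um: "(\<lambda>\<omega>. (\<omega>, ?u \<omega>)) \<in> measurable M (?G \<Otimes>\<^sub>M (borel \<Otimes>\<^sub>M borel))" using idm u by (rule measurable_Pair)
  show ?thesis
  proof (rule pair_measure_eqI[symmetric])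
    show "sigma_finite_measure (distr M ?G (\<lambda>\<omega>. \<omega>))" "sigma_finite_measure (gauss2 \<sigma>)"
      by (rule G.sigma_finite_measure_axioms g2.sigma_finite_measure_axioms)+
    show "sets (distr M ?G (\<lambda>\<omega>. \<omega>) \<Otimes>\<^sub>M gauss2 \<sigma>) = sets (distr M (?G \<Otimes>\<^sub>M (borel \<Otimes>\<^sub>M borel)) (\<lambda>\<omega>. (\<omega>, ?u \<omega>)))"
      using sets_pair_measure_cong[OF refl sets_gauss2, of ?G] by (simp cong: sets_pair_measure_cong)
    fix C E assume "C \<in> sets (distr M ?G (\<lambda>\<omega>. \<omega>))" "E \<in> sets (gauss2 \<sigma>)"
    then have C: "C \<in> sets ?G" and E: "E \<in> sets (borel \<Otimes>\<^sub>M borel)" by (auto simp: sets_gauss2)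
    have C': "C \<in> sigma_sets (space M) \<A>" "C \<subseteq> space M"
      using C As sigma_sets_into_sp[OF As] by auto
    have E': "?u -` E \<inter> space M \<in> sigma_sets (space M) \<B>" using sB E by blast
    have "emeasure (distr M ?G (\<lambda>\<omega>. \<omega>)) C = prob C"
      using C C' by (subst emeasure_distr[OF idm]) (auto simp: emeasure_eq_measure Int_absorb2)
    moreover have "emeasure (gauss2 \<sigma>) E = prob (?u -` E \<inter> space M)"
      using E unfolding du[symmetric] by (subst emeasure_distr[OF u]) (auto simp: emeasure_eq_measure)
    moreover have "emeasure (distr M (?G \<Otimes>\<^sub>M (borel \<Otimes>\<^sub>M borel)) (\<lambda>\<omega>. (\<omega>, ?u \<omega>))) (C \<times> E) = prob (C \<inter> (?u -` E \<inter> space M))"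
    proof -
      have "(\<lambda>\<omega>. (\<omega>, ?u \<omega>)) -` (C \<times> E) \<inter> space M = C \<inter> (?u -` E \<inter> space M)" using C' by auto
      then show ?thesis using C E by (subst emeasure_distr[OF um]) (auto simp: emeasure_eq_measure)
    qed
    ultimately show "emeasure (distr M ?G (\<lambda>\<omega>. \<omega>)) C * emeasure (gauss2 \<sigma>) E =
        emeasure (distr M (?G \<Otimes>\<^sub>M (borel \<Otimes>\<^sub>M borel)) (\<lambda>\<omega>. (\<omega>, ?u \<omega>))) (C \<times> E)"
      using indep_setD[OF ind C'(1) E'] by (simp add: ennreal_mult)
  qed
qed

section \<open>Stochastic integrals of elementary processes\<close>

lemma sigma_measurableI:
  assumes "\<A> \<subseteq> Pow \<Omega>" "\<And>C. C \<in> sets N \<Longrightarrow> f -` C \<inter> \<Omega> \<in> \<A>" "f \<in> \<Omega> \<rightarrow> space N"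
  shows "f \<in> measurable (sigma \<Omega> \<A>) N"
  using assms by (intro measurableI) (auto simp: space_measure_of_conv)

lemma brownian_increment_prob:
  assumes "brownian_motion_wrt M F W" "0 \<le> s" "s < t" and A: "A \<in> sets (F s)" and C: "C \<in> sets borel"
  shows "measure M (A \<inter> {\<omega> \<in> space M. W t \<omega> - W s \<omega> \<in> C}) = measure M A * measure (gauss (sqrt (t - s))) C"
    and "(\<lambda>\<omega>. W t \<omega> - W s \<omega>) \<in> borel_measurable M"
proof -
  interpret prob_space M using assms(1) by (simp add: brownian_motion_wrt_def)
  define X where "X = (\<lambda>\<omega>. W t \<omega> - W s \<omega>)"
  have d: "distributed M lborel X (normal_density 0 (sqrt (t - s)))"
    and ind: "indep_set (sets (F s)) (sets (vimage_algebra (space M) X borel))"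
    using assms unfolding brownian_motion_wrt_def X_def by auto
  have Xm: "X \<in> measurable M lborel" using d by (rule distributed_measurable)
  then show "(\<lambda>\<omega>. W t \<omega> - W s \<omega>) \<in> borel_measurable M" by (simp add: X_def)
  have e: "{\<omega> \<in> space M. W t \<omega> - W s \<omega> \<in> C} = X -` C \<inter> space M" by (auto simp: X_def)
  have "X -` C \<inter> space M \<in> sets (vimage_algebra (space M) X borel)" using C by (rule in_vimage_algebra)
  from indep_setD[OF ind A this]
  have "prob (A \<inter> (X -` C \<inter> space M)) = prob A * prob (X -` C \<inter> space M)" .
  also have "prob (X -` C \<inter> space M) = measure (distr M lborel X) C"
    using C by (subst measure_distr[OF Xm]) auto
  also have "distr M lborel X = gauss (sqrt (t - s))"
    using distributed_distr_eq_density[OF d] by (simp add: gauss_def)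
  finally show "measure M (A \<inter> {\<omega> \<in> space M. W t \<omega> - W s \<omega> \<in> C}) = measure M A * measure (gauss (sqrt (t - s))) C"
    unfolding e .
qed

text \<open>\<open>V\<close> is independent of the integrand together with \<open>W\<close>, but not
  necessarily of the filtration \<open>F\<close>. Past events are therefore required to lie both in
  \<open>F\<close> and in the \<sigma>-algebra of that pair before they are combined with past
  events of \<open>V\<close>. Relative to the past so defined, the increments of \<open>W\<close>
  and \<open>V\<close> over one interval form a planar Gaussian pair.\<close>

theorem brownian_decoupling:
  fixes x :: "nat \<Rightarrow> nat \<Rightarrow> 'x::banach"
  assumes p: "1 < p" and c: "circ_nonpos (base_value p c :: 'x \<times> 'x \<Rightarrow> real)"
    and W: "brownian_motion_wrt M F W" and data: "elementary_data F K J t B" and V: "brownian_motion M V"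
    and ind: "independent_of_processes M V (elementary_process K J t B x) W"
  shows "(\<integral>\<^sup>+ \<omega>. ennreal (norm (elementary_integral K J t B x V \<omega>) powr p) \<partial>M)
         \<le> ennreal (c powr p) * (\<integral>\<^sup>+ \<omega>. ennreal (norm (elementary_integral K J t B x W \<omega>) powr p) \<partial>M)"
    and "(\<integral>\<^sup>+ \<omega>. ennreal (norm (elementary_integral K J t B x W \<omega>) powr p) \<partial>M)
         \<le> ennreal (c powr p) * (\<integral>\<^sup>+ \<omega>. ennreal (norm (elementary_integral K J t B x V \<omega>) powr p) \<partial>M)"
proof -
  interpret prob_space M using W by (simp add: brownian_motion_wrt_def)
  define F' where "F' = natural_filtration M V"
  have V': "brownian_motion_wrt M F' V" using V by (simp add: brownian_motion_def F'_def)
  have tmono: "t i < t j" if "i < j" "j \<le> K" for i j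
    using that
  proof (induction j)
    case (Suc j)
    have "t j < t (Suc j)" using data Suc.prems unfolding elementary_data_def by (auto dest!: bspec[of _ _ "Suc j"])
    with Suc show ?case by (cases "i = j") auto
  qed simp
  have t0: "0 \<le> t i" if "i \<le> K" for i
    using tmono[of 0 i] data that unfolding elementary_data_def by (cases "i = 0") auto
  have Fs: "sets (F s) \<subseteq> sets M" "space (F s) = space M" if "0 \<le> s" for s
    using W that unfolding brownian_motion_wrt_def filtration_def by auto
  have Fmono: "sets (F s) \<subseteq> sets (F r)" if "s \<le> r" for s r
    using W that unfolding brownian_motion_wrt_def filtration_def by auto
  have Wm: "W s \<in> borel_measurable (F s)" if "0 \<le> s" for s using W that unfolding brownian_motion_wrt_def by auto
  define ep where "ep = elementary_process K J t B x"
  define \<phi> where "\<phi> = (\<lambda>k \<omega>. if k \<in> {1..K} then \<Sum>m=1..J. indicator (B m k) \<omega> *\<^sub>R x k m else 0)"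
  \<comment> \<open>The right end \<open>t k\<close> lies in the \<open>k\<close>-th interval only,
    so \<open>\<phi> k\<close> is a value of the process and as such visible in
    \<open>PW\<close>.\<close>
  have ep\<phi>: "ep (t k) \<omega> = \<phi> k \<omega>" if k: "k \<in> {1..K}" for k \<omega>
  proof -
    have "ep (t k) \<omega> = (\<Sum>j=1..K. if j = k then \<phi> k \<omega> else 0)"
      unfolding ep_def elementary_process_def
    proof (intro sum.cong refl)
      fix j assume j: "j \<in> {1..K}"
      have "t k \<in> {t (j - 1)<..t j} \<longleftrightarrow> j = k"
      proof
        assume *: "t k \<in> {t (j - 1)<..t j}"
        show "j = k"
        proof (rule ccontr)
          assume "j \<noteq> k"
          then consider "j < k" | "k < j" by linarith
          then show False
          proof cases
            case 1
            then show False using tmono[of j k] k * by auto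
          next
            case 2
            then have "k \<le> j - 1" "j - 1 \<le> K" using j by auto
            then have "t k \<le> t (j - 1)" using tmono[of k "j - 1"] by (cases "k = j - 1") auto
            then show False using * by auto
          qed
        qed
      qed (use tmono[of "k - 1" k] k in auto)
      then show "(\<Sum>m=1..J. indicator ({t (j - 1)<..t j} \<times> B m j) (t k, \<omega>) *\<^sub>R x j m) = (if j = k then \<phi> k \<omega> else 0)"
        using k by (auto simp: \<phi>_def indicator_def intro!: sum.cong)
    qed
    then show ?thesis using k by simp
  qed
  \<comment> \<open>All subset sums of the given vectors: the indices \<open>m\<close> with
    \<open>\<omega> \<in> B m k\<close> select one of them.\<close>
  define S where "S = insert 0 (\<Union>k\<in>{1..K}. (\<lambda>A. \<Sum>m\<in>A. x k m) ` Pow {1..J})"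
  have S: "finite S" unfolding S_def by auto
  have \<phi>S: "\<phi> k \<omega> \<in> S" for k \<omega>
  proof (cases "k \<in> {1..K}")
    case True
    have "\<phi> k \<omega> = (\<Sum>m\<in>{m\<in>{1..J}. \<omega> \<in> B m k}. x k m)"
      unfolding sum.inter_filter[OF finite_atLeastAtMost]
      using True by (auto simp: \<phi>_def indicator_def intro!: sum.cong)
    moreover have "{m\<in>{1..J}. \<omega> \<in> B m k} \<in> Pow {1..J}" by auto
    ultimately have "\<phi> k \<omega> \<in> (\<lambda>A. \<Sum>m\<in>A. x k m) ` Pow {1..J}" by (rule image_eqI)
    with True show ?thesis unfolding S_def by blast
  next
    case False
    then have "\<phi> k \<omega> = 0" unfolding \<phi>_def by (rule if_not_P)
    then show ?thesis by (simp add: S_def)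
  qed
  define PV where "PV = vimage_algebra (space M) (\<lambda>\<omega>. \<lambda>t\<in>{0..}. V t \<omega>) (PiM {0..} (\<lambda>_. borel))"
  define PW where "PW = vimage_algebra (space M) (\<lambda>\<omega>. (\<lambda>t\<in>{0..}. ep t \<omega>, \<lambda>t\<in>{0..}. W t \<omega>)) (PiM {0..} (\<lambda>_. borel) \<Otimes>\<^sub>M PiM {0..} (\<lambda>_. borel))"
  have indPQ: "indep_set (sets PV) (sets PW)"
    using ind unfolding independent_of_processes_def PV_def PW_def ep_def by auto
  have spP: "space PV = space M" "space PW = space M" by (simp_all add: PV_def PW_def)
  have PVm: "V s \<in> borel_measurable PV" if s: "0 \<le> s" for s
  proof -
    have "(\<lambda>\<omega>. \<lambda>t\<in>{0..}. V t \<omega>) \<in> measurable PV (PiM {0..} (\<lambda>_. borel))"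
      unfolding PV_def by (rule measurable_vimage_algebra1) (auto simp: space_PiM)
    from measurable_compose[OF this measurable_component_singleton[of s "{0..}"]] s show ?thesis by simp
  qed
  have PWm0: "(\<lambda>\<omega>. (\<lambda>t\<in>{0..}. ep t \<omega>, \<lambda>t\<in>{0..}. W t \<omega>)) \<in> measurable PW (PiM {0..} (\<lambda>_. borel) \<Otimes>\<^sub>M PiM {0..} (\<lambda>_. borel))"
    unfolding PW_def by (rule measurable_vimage_algebra1) (auto simp: space_PiM space_pair_measure)
  have PWm: "W s \<in> borel_measurable PW" if s: "0 \<le> s" for s
    using measurable_compose[OF measurable_compose[OF PWm0 measurable_snd] measurable_component_singleton[of s "{0..}"]] s by simp
  have PWe: "ep s \<in> borel_measurable PW" if s: "0 \<le> s" for s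
    using measurable_compose[OF measurable_compose[OF PWm0 measurable_fst] measurable_component_singleton[of s "{0..}"]] s by simp
  have F'PV: "sets (F' s) \<subseteq> sets PV" if s: "0 \<le> s" for s
  proof -
    have "{V r -` A \<inter> space M |r A. 0 \<le> r \<and> r \<le> s \<and> A \<in> sets borel} \<subseteq> sets PV"
    proof safe
      fix r and A :: "real set" assume "0 \<le> r" "r \<le> s" "A \<in> sets borel"
      then show "V r -` A \<inter> space M \<in> sets PV" using measurable_sets[OF PVm[of r]] by (simp add: spP)
    qed
    then have "sigma_sets (space M) {V r -` A \<inter> space M |r A. 0 \<le> r \<and> r \<le> s \<and> A \<in> sets borel} \<subseteq> sets PV"
      using sets.sigma_sets_subset[of _ PV] by (simp add: spP)
    then show ?thesis
      unfolding F'_def natural_filtration_def by (subst sets_measure_of) auto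
  qed
  have F's: "sets (F' s) \<subseteq> sets M" "space (F' s) = space M" if "0 \<le> s" for s
    using V' that unfolding brownian_motion_wrt_def filtration_def by auto
  have F'mono: "sets (F' s) \<subseteq> sets (F' r)" if "s \<le> r" for s r
    using V' that unfolding brownian_motion_wrt_def filtration_def by auto
  have Vm: "V s \<in> borel_measurable (F' s)" if "0 \<le> s" for s using V' that unfolding brownian_motion_wrt_def by auto
  \<comment> \<open>A generator, stable under intersections, of the past at time
    \<open>t (k - 1)\<close>. Membership of \<open>A\<close> in \<open>F\<close> gives independence
    from the increment of \<open>W\<close>, membership in \<open>PW\<close> gives independence from
    \<open>V\<close>.\<close>
  define \<A> where "\<A> = (\<lambda>k. {A \<inter> B' | A B'. A \<in> sets (F (t (k - 1))) \<and> A \<in> sets PW \<and> B' \<in> sets (F' (t (k - 1)))})"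
  have \<A>I: "A \<inter> B' \<in> \<A> k" if "A \<in> sets (F (t (k - 1)))" "A \<in> sets PW" "B' \<in> sets (F' (t (k - 1)))" for A B' k
    using that by (auto simp: \<A>_def)
  have tk: "0 \<le> t (k - 1)" "t (k - 1) < t k" if "k \<in> {1..K}" for k
    using t0[of "k - 1"] tmono[of "k - 1" k] that by auto
  have spF: "space M \<in> sets (F s)" "space M \<in> sets (F' s)" if "0 \<le> s" for s
    using sets.top[of "F s"] sets.top[of "F' s"] Fs[OF that] F's[OF that] by auto
  have spPW: "space M \<in> sets PW" using sets.top[of PW] spP by simp
  have \<A>ev: "\<A> k \<subseteq> events" if k: "k \<in> {1..K}" for k
    using Fs(1)[OF tk(1)[OF k]] F's(1)[OF tk(1)[OF k]] by (auto simp: \<A>_def intro!: sets.Int)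
  have \<A>Pow: "\<A> k \<subseteq> Pow (space M)" if k: "k \<in> {1..K}" for k
    using \<A>ev[OF k] sets.sets_into_space by blast
  have \<A>Int: "Int_stable (\<A> k)" for k
  proof (rule Int_stableI)
    fix a b assume "a \<in> \<A> k" "b \<in> \<A> k"
    then obtain A1 B1 A2 B2 where "a = A1 \<inter> B1" "b = A2 \<inter> B2" and
      "A1 \<in> sets (F (t (k - 1)))" "A1 \<in> sets PW" "B1 \<in> sets (F' (t (k - 1)))"
      "A2 \<in> sets (F (t (k - 1)))" "A2 \<in> sets PW" "B2 \<in> sets (F' (t (k - 1)))"
      by (auto simp: \<A>_def)
    then show "a \<inter> b \<in> \<A> k"
      using \<A>I[of "A1 \<inter> A2" k "B1 \<inter> B2"] by (auto simp: Int_ac intro!: sets.Int)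
  qed
  have \<A>sp: "space M \<in> \<A> k" if k: "k \<in> {1..K}" for k
    using \<A>I[OF spF(1)[OF tk(1)[OF k]] spPW spF(2)[OF tk(1)[OF k]]] by simp
  define dW where "dW = (\<lambda>k \<omega>. W (t k) \<omega> - W (t (k - 1)) \<omega>)"
  define dV where "dV = (\<lambda>k \<omega>. V (t k) \<omega> - V (t (k - 1)) \<omega>)"
  define \<sigma> where "\<sigma> = (\<lambda>k. sqrt (t k - t (k - 1)))"
  have \<sigma>0: "0 < \<sigma> k" if "k \<in> {1..K}" for k using tk[OF that] by (simp add: \<sigma>_def)
  have dm: "dW k \<in> borel_measurable M" "dV k \<in> borel_measurable M" if k: "k \<in> {1..K}" for k
    unfolding dW_def dV_def
    using brownian_increment_prob(2)[OF W tk[OF k] sets.empty_sets sets.empty_sets] brownian_increment_prob(2)[OF V' tk[OF k] sets.empty_sets sets.empty_sets] by auto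
  have rect: "prob (a \<inter> {\<omega> \<in> space M. dW k \<omega> \<in> C \<and> dV k \<omega> \<in> D}) = prob a * (measure (gauss (\<sigma> k)) C * measure (gauss (\<sigma> k)) D)"
    if k: "k \<in> {1..K}" and a: "a \<in> \<A> k" and C: "C \<in> sets borel" and D: "D \<in> sets borel" for a k C D
  proof -
    obtain A B' where a_def: "a = A \<inter> B'" and A: "A \<in> sets (F (t (k - 1)))" "A \<in> sets PW" and B': "B' \<in> sets (F' (t (k - 1)))"
      using a by (auto simp: \<A>_def)
    have tkk: "0 \<le> t k" using tk[OF k] by simp
    have B'P: "B' \<in> sets PV" using F'PV[OF tk(1)[OF k]] B' by blast
    have "dW k \<in> borel_measurable PW" unfolding dW_def using PWm[OF tk(1)[OF k]] PWm[OF tkk] by measurable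
    then have w: "{\<omega> \<in> space M. dW k \<omega> \<in> C} \<in> sets PW" using measurable_sets[of "dW k" PW borel C] C spP by (simp add: vimage_def Int_def conj_commute)
    have "dV k \<in> borel_measurable PV" unfolding dV_def using PVm[OF tk(1)[OF k]] PVm[OF tkk] by measurable
    then have v: "{\<omega> \<in> space M. dV k \<omega> \<in> D} \<in> sets PV" using measurable_sets[of "dV k" PV borel D] D spP by (simp add: vimage_def Int_def conj_commute)
    \<comment> \<open>Regrouped into an event of \<open>V\<close> and an event of the integrand and
      \<open>W\<close>, which are independent. Each factor is then split because a Brownian
      increment is independent of its own past.\<close>
    have "a \<inter> {\<omega> \<in> space M. dW k \<omega> \<in> C \<and> dV k \<omega> \<in> D} = (B' \<inter> {\<omega> \<in> space M. dV k \<omega> \<in> D}) \<inter> (A \<inter> {\<omega> \<in> space M. dW k \<omega> \<in> C})"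
      by (auto simp: a_def)
    also have "prob \<dots> = prob (B' \<inter> {\<omega> \<in> space M. dV k \<omega> \<in> D}) * prob (A \<inter> {\<omega> \<in> space M. dW k \<omega> \<in> C})"
      by (rule indep_setD[OF indPQ]) (auto intro: B'P A w v sets.Int)
    also have "prob (B' \<inter> {\<omega> \<in> space M. dV k \<omega> \<in> D}) = prob B' * measure (gauss (\<sigma> k)) D"
      unfolding dV_def \<sigma>_def by (rule brownian_increment_prob(1)[OF V' tk[OF k] B' D])
    also have "prob (A \<inter> {\<omega> \<in> space M. dW k \<omega> \<in> C}) = prob A * measure (gauss (\<sigma> k)) C"
      unfolding dW_def \<sigma>_def by (rule brownian_increment_prob(1)[OF W tk[OF k] A(1) C])
    also have "(prob B' * measure (gauss (\<sigma> k)) D) * (prob A * measure (gauss (\<sigma> k)) C) = prob a * (measure (gauss (\<sigma> k)) C * measure (gauss (\<sigma> k)) D)"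
      using indep_setD[OF indPQ B'P A(2)] by (simp add: a_def Int_commute)
    finally show ?thesis .
  qed
  define G where "G = (\<lambda>k. sigma (space M) (\<A> k))"
  have GM: "sets (G k) \<subseteq> sets M \<and> space (G k) = space M" if k: "k \<in> {1..K}" for k
    unfolding G_def using \<A>Pow[OF k] \<A>ev[OF k] by (simp add: sets.sigma_sets_subset)
  have WG: "W s \<in> borel_measurable (G k)" if k: "k \<in> {1..K}" and s: "0 \<le> s" "s \<le> t (k - 1)" for s k
    unfolding G_def
  proof (rule sigma_measurableI[OF \<A>Pow[OF k]])
    fix C :: "real set" assume C: "C \<in> sets borel"
    have 1: "W s -` C \<inter> space M \<in> sets (F (t (k - 1)))"
      using measurable_sets[OF Wm[OF s(1)] C] Fmono[OF s(2)] Fs[OF s(1)] by auto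
    have 2: "W s -` C \<inter> space M \<in> sets PW" using measurable_sets[OF PWm[OF s(1)] C] by (simp add: spP)
    show "W s -` C \<inter> space M \<in> \<A> k" using \<A>I[OF 1 2 spF(2)[OF tk(1)[OF k]]] by simp
  qed auto
  have VG: "V s \<in> borel_measurable (G k)" if k: "k \<in> {1..K}" and s: "0 \<le> s" "s \<le> t (k - 1)" for s k
    unfolding G_def
  proof (rule sigma_measurableI[OF \<A>Pow[OF k]])
    fix C :: "real set" assume C: "C \<in> sets borel"
    have 1: "V s -` C \<inter> space M \<in> sets (F' (t (k - 1)))"
      using measurable_sets[OF Vm[OF s(1)] C] F'mono[OF s(2)] F's[OF s(1)] by auto
    show "V s -` C \<inter> space M \<in> \<A> k" using \<A>I[OF spF(1)[OF tk(1)[OF k]] spPW 1] by (simp add: Int_commute Int_left_commute)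
  qed auto
  have past: "dW j \<in> borel_measurable (G k)" "dV j \<in> borel_measurable (G k)" if "1 \<le> j" "j < k" "k \<le> K" for j k
  proof -
    have k: "k \<in> {1..K}" using that by auto
    have tle: "t i \<le> t (k - 1)" if "i \<le> k - 1" for i
      using tmono[of i "k - 1"] that order_trans[OF diff_le_self[of k 1], of K] k by (cases "i = k - 1") (auto simp: less_imp_le)
    have le: "0 \<le> t j" "t j \<le> t (k - 1)" "0 \<le> t (j - 1)" "t (j - 1) \<le> t (k - 1)"
      using tle[of j] tle[of "j - 1"] t0[of j] t0[of "j - 1"] that by linarith+
    show "dW j \<in> borel_measurable (G k)" "dV j \<in> borel_measurable (G k)"
      unfolding dW_def dV_def
      using WG[OF k le(1,2)] WG[OF k le(3,4)] VG[OF k le(1,2)] VG[OF k le(3,4)] by measurable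
  qed
  have \<phi>G: "span_measurable (G k) (\<phi> j)" if "1 \<le> j" "j \<le> k" "k \<le> K" for j k
  proof -
    have k: "k \<in> {1..K}" and j: "j \<in> {1..K}" using that by auto
    have jk: "t (j - 1) \<le> t (k - 1)" using tmono[of "j - 1" "k - 1"] that order_trans[OF diff_le_self[of k 1], of K] by (cases "j = k") (auto simp: less_imp_le)
    have BF: "B m j \<in> sets (F (t (j - 1)))" if "m \<in> {1..J}" for m
      using data j that unfolding elementary_data_def by auto
    have \<phi>j: "\<phi> j = (\<lambda>\<omega>. \<Sum>m=1..J. indicator (B m j) \<omega> *\<^sub>R x j m)"
      unfolding \<phi>_def using j by (simp only: if_True)
    have F\<phi>: "span_measurable (F (t (j - 1))) (\<phi> j)"
      unfolding \<phi>j by (intro span_measurable_sum span_measurable.base borel_measurable_indicator BF)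
    \<comment> \<open>The single sets \<open>B m j\<close> need not belong to \<open>PW\<close>. The
      level sets of \<open>\<phi> j\<close> do, and they determine \<open>\<phi> j\<close> because
      its values lie in the finite set \<open>S\<close>.\<close>
    have lev: "{\<omega> \<in> space M. \<phi> j \<omega> = v} \<in> \<A> k" for v
    proof -
      have "(\<lambda>\<omega>. norm (\<phi> j \<omega> - v)) \<in> borel_measurable (F (t (j - 1)))"
        using F\<phi> by (rule span_measurable_continuous) (intro continuous_intros)
      then have "{\<omega> \<in> space (F (t (j - 1))). norm (\<phi> j \<omega> - v) = 0} \<in> sets (F (t (j - 1)))"
        by measurable
      then have 1: "{\<omega> \<in> space M. \<phi> j \<omega> = v} \<in> sets (F (t (k - 1)))"
        using Fmono[OF jk] Fs[OF tk(1)[OF j]] by auto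
      have "ep (t j) -` {v} \<inter> space PW \<in> sets PW"
        using t0[of j] j by (intro measurable_sets[OF PWe]) auto
      then have 2: "{\<omega> \<in> space M. \<phi> j \<omega> = v} \<in> sets PW"
        using ep\<phi>[OF j] by (simp add: spP vimage_def Int_def conj_commute)
      show ?thesis using \<A>I[OF 1 2 spF(2)[OF tk(1)[OF k]]] by (simp add: Int_absorb2)
    qed
    have "span_measurable (G k) (\<lambda>\<omega>. \<Sum>v\<in>S. indicator {\<omega> \<in> space M. \<phi> j \<omega> = v} \<omega> *\<^sub>R v)"
    proof (intro span_measurable_sum span_measurable.base borel_measurable_indicator)
      show "{\<omega> \<in> space M. \<phi> j \<omega> = v} \<in> sets (G k)" for v
        using lev[of v] \<A>Pow[OF k] unfolding G_def by simp
    qed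
    then have sp: "span_measurable (G k) (\<lambda>\<omega>. indicator (space M) \<omega> *\<^sub>R \<phi> j \<omega>)"
    proof -
      have "(\<Sum>v\<in>S. indicator {\<omega> \<in> space M. \<phi> j \<omega> = v} \<omega> *\<^sub>R v) = indicator (space M) \<omega> *\<^sub>R \<phi> j \<omega>" for \<omega>
      proof -
        have "(\<Sum>v\<in>S. indicator {\<omega> \<in> space M. \<phi> j \<omega> = v} \<omega> *\<^sub>R v) = (\<Sum>v\<in>S. if v = \<phi> j \<omega> then indicator (space M) \<omega> *\<^sub>R v else 0)"
          by (intro sum.cong) (auto simp: indicator_def)
        then show ?thesis using S \<phi>S by simp
      qed
      then show "span_measurable (G k) (\<lambda>\<omega>. \<Sum>v\<in>S. indicator {\<omega> \<in> space M. \<phi> j \<omega> = v} \<omega> *\<^sub>R v) \<Longrightarrow> ?thesis" by simp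
    qed
    have "B m j \<subseteq> space M" if "m \<in> {1..J}" for m
      using data j that sets.sets_into_space Fs(2)[OF tk(1)[OF j]] unfolding elementary_data_def by blast
    then have "\<phi> j \<omega> = indicator (space M) \<omega> *\<^sub>R \<phi> j \<omega>" for \<omega>
      unfolding \<phi>j scaleR_sum_right by (intro sum.cong) (auto simp: indicator_def)
    with sp show ?thesis by simp
  qed
  have um: "(\<lambda>\<omega>. (dW k \<omega>, dV k \<omega>)) \<in> measurable M (borel \<Otimes>\<^sub>M borel)" "(\<lambda>\<omega>. (dV k \<omega>, dW k \<omega>)) \<in> measurable M (borel \<Otimes>\<^sub>M borel)"
    if "k \<in> {1..K}" for k using dm[OF that] by measurable
  have upast: "(\<lambda>\<omega>. (dW j \<omega>, dV j \<omega>)) \<in> measurable (G k) (borel \<Otimes>\<^sub>M borel)" "(\<lambda>\<omega>. (dV j \<omega>, dW j \<omega>)) \<in> measurable (G k) (borel \<Otimes>\<^sub>M borel)"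
    if "1 \<le> j" "j < k" "k \<le> K" for j k using past[OF that] by measurable
  have law1: "distr M (G k \<Otimes>\<^sub>M (borel \<Otimes>\<^sub>M borel)) (\<lambda>\<omega>. (\<omega>, (dW k \<omega>, dV k \<omega>))) = distr M (G k) (\<lambda>\<omega>. \<omega>) \<Otimes>\<^sub>M gauss2 (\<sigma> k)" if k: "k \<in> {1..K}" for k
    unfolding G_def
    by (rule joint_law_gauss2[OF \<A>ev[OF k] \<A>Int \<A>sp[OF k] dm[OF k] \<sigma>0[OF k] rect[OF k]])
  \<comment> \<open>With the coordinates exchanged, the same theorem yields the reverse
    inequality.\<close>
  have law2: "distr M (G k \<Otimes>\<^sub>M (borel \<Otimes>\<^sub>M borel)) (\<lambda>\<omega>. (\<omega>, (dV k \<omega>, dW k \<omega>))) = distr M (G k) (\<lambda>\<omega>. \<omega>) \<Otimes>\<^sub>M gauss2 (\<sigma> k)" if k: "k \<in> {1..K}" for k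
    unfolding G_def
  proof (rule joint_law_gauss2[OF \<A>ev[OF k] \<A>Int \<A>sp[OF k] dm(2)[OF k] dm(1)[OF k] \<sigma>0[OF k]])
    fix A C D assume "A \<in> \<A> k" "C \<in> sets (borel :: real measure)" "D \<in> sets (borel :: real measure)"
    from rect[OF k this(1,3,2)]
    show "prob (A \<inter> {\<omega> \<in> space M. dV k \<omega> \<in> C \<and> dW k \<omega> \<in> D}) = prob A * (measure (gauss (\<sigma> k)) C * measure (gauss (\<sigma> k)) D)"
      by (simp add: conj_commute mult.commute)
  qed
  have ei: "elementary_integral K J t B x U \<omega> = (\<Sum>k=1..K. (U (t k) \<omega> - U (t (k - 1)) \<omega>) *\<^sub>R \<phi> k \<omega>)" for U \<omega>
    unfolding elementary_integral_def
  proof (intro sum.cong refl)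
    fix k assume k: "k \<in> {1..K}"
    have "\<phi> k \<omega> = (\<Sum>m=1..J. indicator (B m k) \<omega> *\<^sub>R x k m)"
      unfolding \<phi>_def using k by (simp only: if_True)
    then show "(\<Sum>m=1..J. (indicator (B m k) \<omega> * (U (t k) \<omega> - U (t (k - 1)) \<omega>)) *\<^sub>R x k m) = (U (t k) \<omega> - U (t (k - 1)) \<omega>) *\<^sub>R \<phi> k \<omega>"
      by (simp only: scaleR_sum_right scaleR_scaleR mult.commute)
  qed
  show "(\<integral>\<^sup>+ \<omega>. ennreal (norm (elementary_integral K J t B x V \<omega>) powr p) \<partial>M)
         \<le> ennreal (c powr p) * (\<integral>\<^sup>+ \<omega>. ennreal (norm (elementary_integral K J t B x W \<omega>) powr p) \<partial>M)"
    using gaussian_decoupling[where u = "\<lambda>k \<omega>. (dW k \<omega>, dV k \<omega>)", OF p c prob_space_axioms GM \<sigma>0 um(1) law1 S \<phi>S upast(1) \<phi>G]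
    unfolding ei by (simp add: dW_def dV_def)
  show "(\<integral>\<^sup>+ \<omega>. ennreal (norm (elementary_integral K J t B x W \<omega>) powr p) \<partial>M)
         \<le> ennreal (c powr p) * (\<integral>\<^sup>+ \<omega>. ennreal (norm (elementary_integral K J t B x V \<omega>) powr p) \<partial>M)"
    using gaussian_decoupling[where u = "\<lambda>k \<omega>. (dV k \<omega>, dW k \<omega>)", OF p c prob_space_axioms GM \<sigma>0 um(2) law2 S \<phi>S upast(2) \<phi>G]
    unfolding ei by (simp add: dW_def dV_def)
qed

section \<open>Haar functions and Paley--Walsh martingales\<close>

lemma haar_filtration_sets:
  "sets (haar_filtration n) = sigma_sets {0..1} {haar k -` A \<inter> {0..1} | k A. k \<le> n \<and> A \<in> sets borel}"
  "space (haar_filtration n) = {0..1}"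
  unfolding haar_filtration_def by (auto simp: space_measure_of_conv sets_measure_of_conv)

lemma haar_level_mem:
  assumes "i \<le> n" "A \<in> sets borel"
  shows "{y \<in> {0..1}. haar i y \<in> A} \<in> sets (haar_filtration n)"
proof -
  have "{y \<in> {0..1}. haar i y \<in> A} = haar i -` A \<inter> {0..1}" by auto
  then show ?thesis unfolding haar_filtration_sets using assms by (auto intro: sigma_sets.Basic)
qed

text \<open>Failure to separate \<open>y\<close> from \<open>y'\<close> holds for the generators and
  survives complements and countable unions.\<close>

lemma haar_filtration_saturated:
  assumes "A \<in> sets (haar_filtration n)" and y: "y \<in> {0..1}" "y' \<in> {0..1}" and eq: "\<And>i. i \<le> n \<Longrightarrow> haar i y = haar i y'"
  shows "y \<in> A \<longleftrightarrow> y' \<in> A"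
  using assms(1) unfolding haar_filtration_sets
proof (induction rule: sigma_sets.induct)
  case (Basic a)
  then show ?case using eq y by auto
qed (use y in auto)

lemma haar_filtration_measurable_const:
  fixes f :: "real \<Rightarrow> 'a::t1_space"
  assumes f: "f \<in> borel_measurable (haar_filtration n)" and y: "y \<in> {0..1}" "y' \<in> {0..1}"
    and eq: "\<And>i. i \<le> n \<Longrightarrow> haar i y = haar i y'"
  shows "f y = f y'"
proof -
  have "f -` {f y} \<inter> space (haar_filtration n) \<in> sets (haar_filtration n)"
    using f by (rule measurable_sets) auto
  then have "y \<in> f -` {f y} \<inter> space (haar_filtration n) \<longleftrightarrow> y' \<in> f -` {f y} \<inter> space (haar_filtration n)"
    using y eq by (rule haar_filtration_saturated)
  then show ?thesis using y by (auto simp: haar_filtration_sets)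
qed

text \<open>Integer numerators over \<open>2 ^ Suc k\<close> present the half as a dyadic interval
  of the next generation, so that nesting becomes an inequality between natural numbers.\<close>

definition haar_left :: "nat \<Rightarrow> real set" where
  "haar_left n = (let k = floor_log n; j = n - 2 ^ k in {real (2 * j) / 2 ^ Suc k ..< real (2 * j + 1) / 2 ^ Suc k})"

definition haar_right :: "nat \<Rightarrow> real set" where
  "haar_right n = (let k = floor_log n; j = n - 2 ^ k in {real (2 * j + 1) / 2 ^ Suc k ..< real (2 * j + 2) / 2 ^ Suc k})"

definition haar_support :: "nat \<Rightarrow> real set" where
  "haar_support n = (let k = floor_log n; j = n - 2 ^ k in {real j / 2 ^ k ..< real (j + 1) / 2 ^ k})"

lemma haar_eq: "0 < n \<Longrightarrow> haar n x = indicator (haar_left n) x - indicator (haar_right n) x"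
proof -
  assume n: "0 < n"
  define k where "k = floor_log n"
  have le: "2 ^ k \<le> n" using n unfolding k_def by (rule floor_log_exp2_le)
  have e: "real n - 2 ^ k = real (n - 2 ^ k)" using le by (simp add: of_nat_diff)
  have 1: "real (2 * j) / 2 ^ Suc k = real j / 2 ^ k" and 2: "real (2 * j + 1) / 2 ^ Suc k = (real j + 1/2) / 2 ^ k"
    and 3: "real (2 * j + 2) / 2 ^ Suc k = (real j + 1) / 2 ^ k" for j
    by (simp_all add: field_simps)
  show ?thesis
    using n unfolding haar_def haar_left_def haar_right_def Let_def k_def[symmetric] e 1 2 3 by simp
qed

lemma haar_support_split:
  "haar_support n = haar_left n \<union> haar_right n" "haar_left n \<inter> haar_right n = {}"
proof -
  define k where "k = floor_log n"
  define j where "j = n - 2 ^ k"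
  have 1: "real j / 2 ^ k = real (2 * j) / 2 ^ Suc k" "real (j + 1) / 2 ^ k = real (2 * j + 2) / 2 ^ Suc k"
    by (simp_all add: field_simps)
  have 2: "real (2 * j) / 2 ^ Suc k \<le> real (2 * j + 1) / 2 ^ Suc k" "real (2 * j + 1) / 2 ^ Suc k \<le> real (2 * j + 2) / 2 ^ Suc k"
    by (intro divide_right_mono; simp)+
  show "haar_support n = haar_left n \<union> haar_right n"
    unfolding haar_support_def haar_left_def haar_right_def Let_def k_def[symmetric] j_def[symmetric] 1
    using 2 by auto
  show "haar_left n \<inter> haar_right n = {}"
    unfolding haar_left_def haar_right_def Let_def by auto
qed

lemma haar_support_subset:
  assumes "0 < n" shows "haar_support n \<subseteq> {0..<1}"
proof -
  define k where "k = floor_log n"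
  define j where "j = n - 2 ^ k"
  have "n < 2 ^ Suc k" using floor_log_exp2_gt[of n] by (simp add: k_def)
  moreover have "2 ^ k \<le> n" using assms unfolding k_def by (rule floor_log_exp2_le)
  ultimately have "j + 1 \<le> 2 ^ k" by (auto simp: j_def)
  then have "real (j + 1) \<le> 2 ^ k" by (metis of_nat_le_iff of_nat_numeral of_nat_power)
  then have "real (j + 1) / 2 ^ k \<le> 1" by (simp add: field_simps)
  moreover have "0 \<le> real j / 2 ^ k" by simp
  ultimately show ?thesis
    unfolding haar_support_def Let_def k_def[symmetric] j_def[symmetric]
    by (auto intro: order_trans less_le_trans)
qed

lemma haar_values:
  assumes "0 < n"
  shows "y \<in> haar_left n \<Longrightarrow> haar n y = 1" "y \<in> haar_right n \<Longrightarrow> haar n y = -1" "y \<notin> haar_support n \<Longrightarrow> haar n y = 0"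
  using haar_eq[OF assms, of y] haar_support_split[of n] by (auto simp: indicator_def)

lemma haar_left_nonempty: "haar_left n \<noteq> {}"
  unfolding haar_left_def Let_def by (simp add: field_simps)

lemma haar_eq_iff:
  assumes "0 < n"
  shows "haar n y = 1 \<longleftrightarrow> y \<in> haar_left n" "haar n y = - 1 \<longleftrightarrow> y \<in> haar_right n"
  using haar_eq[OF assms, of y] haar_support_split(2)[of n] by (auto simp: indicator_def)

lemma haar_0: "haar 0 y = 1"
  by (simp add: haar_def)

lemma haar_measurable [measurable]: "haar n \<in> borel_measurable borel"
proof (cases "n = 0")
  case False
  have "haar_left n \<in> sets borel" "haar_right n \<in> sets borel"
    unfolding haar_left_def haar_right_def Let_def by auto
  then have "(\<lambda>y. indicator (haar_left n) y - indicator (haar_right n) y :: real) \<in> borel_measurable borel" by measurable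
  then show ?thesis using haar_eq[of n] False by (simp cong: measurable_cong)
qed (simp add: haar_0 cong: measurable_cong)

text \<open>A coarse dyadic interval either contains a finer one or is disjoint from it, so
  membership of \<open>x\<close> depends on the index \<open>j\<close> alone.\<close>

lemma dyadic_interval_const:
  assumes qk: "q \<le> k" and x: "x \<in> {real j / 2 ^ k ..< real (j + 1) / 2 ^ k}"
  shows "x \<in> {real a / 2 ^ q ..< real (a + 1) / 2 ^ q} \<longleftrightarrow> a * 2 ^ (k - q) \<le> j \<and> j < (a + 1) * 2 ^ (k - q)"
proof -
  have le: "real b / 2 ^ q \<le> x \<longleftrightarrow> b * 2 ^ (k - q) \<le> j" for b
  proof -
    have p: "(2::real) ^ k = 2 ^ q * 2 ^ (k - q)" using qk by (simp flip: power_add)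
    have "real b / 2 ^ q \<le> x \<longleftrightarrow> real b * 2 ^ (k - q) \<le> x * 2 ^ k" unfolding p by (simp add: field_simps)
    also have "\<dots> \<longleftrightarrow> real (b * 2 ^ (k - q)) \<le> x * 2 ^ k" by simp
    also have "\<dots> \<longleftrightarrow> b * 2 ^ (k - q) \<le> j"
    proof
      assume "real (b * 2 ^ (k - q)) \<le> x * 2 ^ k"
      also have "x * 2 ^ k < real (j + 1)" using x by (simp add: field_simps)
      finally have "b * 2 ^ (k - q) < j + 1" by (simp only: of_nat_less_iff)
      then show "b * 2 ^ (k - q) \<le> j" by simp
    next
      assume "b * 2 ^ (k - q) \<le> j"
      then have "real (b * 2 ^ (k - q)) \<le> real j" by (simp only: of_nat_le_iff)
      also have "\<dots> \<le> x * 2 ^ k" using x by (simp add: field_simps)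
      finally show "real (b * 2 ^ (k - q)) \<le> x * 2 ^ k" .
    qed
    finally show ?thesis .
  qed
  show ?thesis using le[of a] le[of "a + 1"] by (auto simp: not_le[symmetric])
qed

text \<open>An earlier Haar function of the same generation has a disjoint support; the halves
  belonging to an earlier generation are unions of dyadic intervals of the generation of
  \<open>n\<close>.\<close>

lemma haar_const_on_support:
  assumes "i < n" and x: "x \<in> haar_support n" "x' \<in> haar_support n"
  shows "haar i x = haar i x'"
proof (cases "i = 0")
  case False
  define k where "k = floor_log n"
  define j where "j = n - 2 ^ k"
  define k' where "k' = floor_log i"
  define j' where "j' = i - 2 ^ k'"
  have kk: "k' \<le> k" unfolding k_def k'_def using assms(1) by (intro floor_log_le_iff) simp
  have x2: "x \<in> {real j / 2 ^ k ..< real (j + 1) / 2 ^ k}" "x' \<in> {real j / 2 ^ k ..< real (j + 1) / 2 ^ k}"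
    using x unfolding haar_support_def Let_def k_def[symmetric] j_def[symmetric] by auto
  show ?thesis
  proof (cases "k' = k")
    case True
    have le: "2 ^ k \<le> i" using False True floor_log_exp2_le[of i] by (simp add: k'_def)
    then have "j' + 1 \<le> j" using assms(1) True by (simp add: j_def j'_def)
    then have "real (j' + 1) / 2 ^ k \<le> real j / 2 ^ k" by (intro divide_right_mono) (simp_all only: of_nat_le_iff zero_le_power zero_le_numeral)
    moreover have "haar_support i = {real j' / 2 ^ k ..< real (j' + 1) / 2 ^ k}"
      unfolding haar_support_def Let_def k'_def[symmetric] j'_def by (simp add: True)
    ultimately have "x \<notin> haar_support i" "x' \<notin> haar_support i"
      using x2 by auto
    then show ?thesis using haar_values(3)[of i] False by simp
  next
    case False': False
    then have "Suc k' \<le> k" using kk by simp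
    note d = dyadic_interval_const[OF this x2(1)] dyadic_interval_const[OF this x2(2)]
    have "x \<in> haar_left i \<longleftrightarrow> x' \<in> haar_left i"
      unfolding haar_left_def Let_def k'_def[symmetric] j'_def[symmetric] using d[of "2 * j'"] by simp
    moreover have "x \<in> haar_right i \<longleftrightarrow> x' \<in> haar_right i"
      unfolding haar_right_def Let_def k'_def[symmetric] j'_def[symmetric] using d[of "2 * j' + 1"] by (simp add: add.commute)
    ultimately show ?thesis using haar_eq[of i] False by (simp add: indicator_def)
  qed
qed (simp add: haar_0)

text \<open>The Haar functions are numbered like a binary heap: the supports with indices
  \<open>2 * m\<close> and \<open>2 * m + 1\<close> are the left and the right half of the support
  with index \<open>m\<close>.\<close>

lemma haar_support_parent:
  assumes "2 \<le> n"
  shows "haar_support n = {y. haar (n div 2) y = (if even n then 1 else - 1)}"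
proof -
  define k where "k = floor_log n"
  define j where "j = n - 2 ^ k"
  have k1: "k = Suc (floor_log (n div 2))" unfolding k_def using assms by (intro floor_log_rec) auto
  define k' where "k' = floor_log (n div 2)"
  have le: "2 ^ k \<le> n" using assms unfolding k_def by (intro floor_log_exp2_le) simp
  have m0: "0 < n div 2" using assms by auto
  have j': "n div 2 - 2 ^ k' = j div 2" using k1 le by (auto simp: j_def k'_def)
  have par: "even j \<longleftrightarrow> even n" using k1 le by (auto simp: j_def)
  have k: "k = Suc k'" using k1 by (simp add: k'_def)
  have S: "haar_support n = {real j / 2 ^ Suc k' ..< real (j + 1) / 2 ^ Suc k'}"
    unfolding haar_support_def Let_def k_def[symmetric] j_def[symmetric] by (simp only: k)
  have "y \<in> haar_support n \<longleftrightarrow> haar (n div 2) y = (if even n then 1 else - 1)" for y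
  proof (cases "even n")
    case True
    then have "j = 2 * (j div 2)" using par by simp
    then have "haar_support n = haar_left (n div 2)"
      unfolding S haar_left_def Let_def k'_def[symmetric] j' by simp
    then show ?thesis
      using True haar_eq_iff[OF m0, of y] by simp
  next
    case False
    then have "j = 2 * (j div 2) + 1" using par by simp
    then have "haar_support n = haar_right (n div 2)"
      unfolding S haar_right_def Let_def k'_def[symmetric] j' by (metis Suc_1 Suc_eq_plus1 add_Suc_right)
    then show ?thesis
      using False haar_eq_iff[OF m0, of y] by simp
  qed
  then show ?thesis unfolding set_eq_iff mem_Collect_eq by blast
qed

lemma has_integral_indicator_interval:
  fixes u :: "'a::banach"
  assumes "l \<le> r" "{l..<r} \<subseteq> T"
  shows "((\<lambda>y. indicator {l..<r} y *\<^sub>R u) has_integral (r - l) *\<^sub>R u) T"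
proof -
  have "((\<lambda>y. u) has_integral (r - l) *\<^sub>R u) {l..r}"
    using has_integral_const_real[of u l r] assms(1) by simp
  then have "((\<lambda>y. u) has_integral (r - l) *\<^sub>R u) {l..<r}"
    using assms(1) by (intro has_integral_off_point[of _ _ "{l..r}" r "{l..<r}"]) auto
  then have "((\<lambda>y. if y \<in> {l..<r} then u else 0) has_integral (r - l) *\<^sub>R u) T"
    using assms(2) by (subst has_integral_restrict) auto
  then show ?thesis by (rule has_integral_eq[rotated]) (auto simp: indicator_def)
qed

text \<open>The interval in the second claim is the support of a Haar function of generation
  \<open>n\<close>. Its index exceeds \<open>n\<close>, so every \<open>haar i\<close> with
  \<open>i \<le> n\<close> is constant on it. It gives the atom positive measure.\<close>

lemma haar_atom:
  assumes y0: "y0 \<in> {0..<1}"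
  shows "{y \<in> {0..1}. \<forall>i\<le>n. haar i y = haar i y0} \<in> sets (haar_filtration n)"
    and "\<exists>l r. l < r \<and> {l..<r} \<subseteq> {y \<in> {0..1}. \<forall>i\<le>n. haar i y = haar i y0}"
proof -
  have "{y \<in> {0..1}. \<forall>i\<le>n. haar i y = haar i y0} = (\<Inter>i\<in>{..n}. {y \<in> {0..1}. haar i y \<in> {haar i y0}})" by auto
  also have "\<dots> \<in> sets (haar_filtration n)"
    by (intro sets.finite_INT haar_level_mem) auto
  finally show "{y \<in> {0..1}. \<forall>i\<le>n. haar i y = haar i y0} \<in> sets (haar_filtration n)" .
  define a where "a = nat \<lfloor>y0 * 2 ^ n\<rfloor>"
  have a: "real a \<le> y0 * 2 ^ n" "y0 * 2 ^ n < real a + 1" using y0 by (auto simp: a_def)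
  have an: "a < 2 ^ n"
  proof -
    have "y0 * 2 ^ n < 1 * 2 ^ n" using y0 by (intro mult_strict_right_mono) auto
    then have "real a < real (2 ^ n)" using a(1) unfolding of_nat_power of_nat_numeral by linarith
    then show ?thesis unfolding of_nat_less_iff .
  qed
  define m where "m = 2 ^ n + a"
  have fl: "floor_log m = n" unfolding m_def using an by (intro floor_log_eqI) auto
  have D: "haar_support m = {real a / 2 ^ n ..< real (a + 1) / 2 ^ n}"
    unfolding haar_support_def Let_def fl by (simp add: m_def)
  have yD: "y0 \<in> haar_support m" unfolding D using a by (auto simp: field_simps)
  have lt: "i < m" if "i \<le> n" for i
    using that less_exp[of n] unfolding m_def by linarith
  have "haar_support m \<subseteq> {0..<1}" by (rule haar_support_subset) (simp add: m_def)
  then have "haar_support m \<subseteq> {y \<in> {0..1}. \<forall>i\<le>n. haar i y = haar i y0}"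
    using haar_const_on_support[OF lt _ yD] by auto
  then show "\<exists>l r. l < r \<and> {l..<r} \<subseteq> {y \<in> {0..1}. \<forall>i\<le>n. haar i y = haar i y0}"
    unfolding D by (intro exI[of _ "real a / 2 ^ n"] exI[of _ "real (a + 1) / 2 ^ n"]) (auto simp: field_simps)
qed

lemma integral_const_on:
  fixes f :: "real \<Rightarrow> 'a::banach"
  assumes A: "A \<in> sets borel" "A \<subseteq> {0..1}" and f: "\<And>y. y \<in> A \<Longrightarrow> f y = u"
  shows "integral A f = measure lebesgue A *\<^sub>R u"
proof -
  have "emeasure lebesgue A \<le> emeasure lebesgue {0..1::real}" using A by (intro emeasure_mono) auto
  then have lm: "A \<in> lmeasurable"
    using A by (intro fmeasurableI) (auto intro: le_less_trans)
  have ind: "indicat_real A = (\<lambda>x. if x \<in> A then 1 else 0)" by (auto simp: indicator_def)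
  have "((\<lambda>x. 1::real) has_integral measure lebesgue A) A"
    using lm unfolding lmeasurable_iff_has_integral ind has_integral_restrict_UNIV .
  then have "((\<lambda>x. 1 *\<^sub>R u) has_integral measure lebesgue A *\<^sub>R u) A"
    by (rule has_integral_scaleR_left)
  then have "(f has_integral measure lebesgue A *\<^sub>R u) A"
    by (rule has_integral_eq[rotated]) (simp add: f)
  then show ?thesis by (rule integral_unique)
qed

lemma haar_filtration_borel: "A \<in> sets (haar_filtration n) \<Longrightarrow> A \<in> sets borel"
proof -
  assume "A \<in> sets (haar_filtration n)"
  moreover have "sigma_sets {0..1} {haar k -` A \<inter> {0..1} | k A. k \<le> n \<and> A \<in> sets borel} \<subseteq> sets borel"
  proof
    fix B assume "B \<in> sigma_sets {0..1} {haar k -` A \<inter> {0..1} | k A. k \<le> n \<and> A \<in> sets borel}"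
    then show "B \<in> sets borel"
    proof (induction rule: sigma_sets.induct)
      case (Basic a)
      then obtain k A where "a = haar k -` A \<inter> {0..1}" "A \<in> sets borel" by auto
      then show ?case using measurable_sets[OF haar_measurable, of A k] by auto
    qed auto
  qed
  ultimately show ?thesis unfolding haar_filtration_sets by auto
qed

text \<open>The step from \<open>n - 1\<close> to \<open>n\<close> splits a single atom, the support
  of \<open>haar n\<close>, into two halves of equal length. On every other atom the martingale
  property forces the increment to vanish; on this one it makes the increments on the halves
  opposite. The point 1, which lies in no support, is left out.\<close>

theorem paley_walsh_increment:
  fixes f :: "nat \<Rightarrow> real \<Rightarrow> 'a::banach"
  assumes f: "paley_walsh N f" and n: "n \<le> N"
  shows "\<exists>x. \<forall>y\<in>{0..<1}. mdiff f n y = haar n y *\<^sub>R x"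
proof (cases "n = 0")
  case True
  have "f 0 \<in> borel_measurable (haar_filtration 0)" using f unfolding paley_walsh_def by simp
  then have e: "f 0 y = f 0 0" if "y \<in> {0..<1}" for y
    by (rule haar_filtration_measurable_const) (use that in \<open>auto simp: haar_0\<close>)
  show ?thesis
    unfolding True mdiff_def haar_0 by (intro exI[of _ "f 0 0"] ballI) (simp only: e, simp)
next
  case False
  then have n0: "0 < n" by simp
  have fm: "f m \<in> borel_measurable (haar_filtration m)" if "m \<le> N" for m
    using f that unfolding paley_walsh_def by auto
  have mart: "integral A (f n) = integral A (f (n - 1))" if "A \<in> sets (haar_filtration (n - 1))" for A
    using f n that diff_le_self[of n 1] unfolding paley_walsh_def by blast
  define A where "A = (\<lambda>y0. {y \<in> {0..1}. \<forall>i\<le>n - 1. haar i y = haar i y0})"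
  have AF: "A y0 \<in> sets (haar_filtration (n - 1))" if "y0 \<in> {0..<1}" for y0
    unfolding A_def by (rule haar_atom(1)[OF that])
  \<comment> \<open>For \<open>n = 1\<close> the atom is all of \<open>{0..1}\<close> and exceeds
    the support by the point 1.\<close>
  have AD: "y \<in> haar_support n" if y: "y0 \<in> haar_support n" "y \<in> A y0" "y \<noteq> 1" for y y0
  proof (cases "n = 1")
    case True
    then show ?thesis using y unfolding A_def haar_support_def by auto
  next
    case False
    then have "2 \<le> n" using n0 by simp
    moreover have "haar (n div 2) y = haar (n div 2) y0" using y calculation unfolding A_def by auto
    ultimately show ?thesis using y(1) by (simp add: haar_support_parent)
  qed
  have AD': "y0 \<in> haar_support n" if y: "y0 \<in> {0..<1}" "y \<in> haar_support n" "y \<in> A y0" for y y0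
  proof (cases "n = 1")
    case True
    then show ?thesis using y unfolding haar_support_def by auto
  next
    case False
    then have "2 \<le> n" using n0 by simp
    moreover have "haar (n div 2) y = haar (n div 2) y0" using y calculation unfolding A_def by auto
    ultimately show ?thesis using y(2) by (simp add: haar_support_parent)
  qed
  have off: "mdiff f n y0 = 0" if y0: "y0 \<in> {0..<1}" "y0 \<notin> haar_support n" for y0
  proof -
    have sub: "A y0 \<subseteq> {0..1}" by (auto simp: A_def)
    have c1: "f (n - 1) y = f (n - 1) y0" if "y \<in> A y0" for y
      using that y0 n by (intro haar_filtration_measurable_const[OF fm]) (auto simp: A_def)
    have c2: "f n y = f n y0" if y: "y \<in> A y0" for y
    proof (rule haar_filtration_measurable_const[OF fm[OF n]])
      fix i assume i: "i \<le> n"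
      have "y \<notin> haar_support n" using AD'[OF y0(1) _ y] y0(2) by blast
      then show "haar i y = haar i y0"
        using i y y0(2) haar_values(3)[OF n0] by (cases "i = n") (auto simp: A_def)
    qed (use y y0 in \<open>auto simp: A_def\<close>)
    have b: "A y0 \<in> sets borel" using haar_filtration_borel[OF AF[OF y0(1)]] .
    have "measure lebesgue (A y0) *\<^sub>R f n y0 = measure lebesgue (A y0) *\<^sub>R f (n - 1) y0"
      using mart[OF AF[OF y0(1)]] integral_const_on[OF b sub c1] integral_const_on[OF b sub c2] by simp
    moreover have "0 < measure lebesgue (A y0)"
    proof -
      obtain l r where lr: "l < r" "{l..<r} \<subseteq> A y0" using haar_atom(2)[OF y0(1), of "n - 1"] unfolding A_def by blast
      have "emeasure lebesgue (A y0) \<le> emeasure lebesgue {0..1::real}" using sub by (intro emeasure_mono) auto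
      then have "A y0 \<in> fmeasurable lebesgue"
        using b by (intro fmeasurableI) (auto intro: le_less_trans)
      then have "measure lebesgue {l..<r} \<le> measure lebesgue (A y0)"
        using lr(2) by (intro measure_mono_fmeasurable) auto
      then show ?thesis using lr(1) by simp
    qed
    ultimately show ?thesis using n0 by (simp add: mdiff_def)
  qed
  define k where "k = floor_log n"
  define j where "j = n - 2 ^ k"
  define l where "l = real (2 * j) / 2 ^ Suc k"
  define m where "m = real (2 * j + 1) / 2 ^ Suc k"
  define r where "r = real (2 * j + 2) / 2 ^ Suc k"
  have L: "haar_left n = {l..<m}" and R: "haar_right n = {m..<r}"
    unfolding haar_left_def haar_right_def Let_def l_def m_def r_def j_def k_def by simp_all
  have lens: "m - l = 1 / 2 ^ Suc k" "r - m = 1 / 2 ^ Suc k"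
    unfolding l_def m_def r_def by (simp_all only: diff_divide_distrib[symmetric]) simp_all
  have lm: "l < m" "m < r" using lens by (smt (verit) divide_pos_pos zero_less_power)+
  have lD: "l \<in> haar_support n" "m \<in> haar_support n" using lm unfolding haar_support_split(1) L R by auto
  have D01: "haar_support n \<subseteq> {0..<1}" using haar_support_subset[OF n0] .
  have A1: "haar_support n \<subseteq> A l"
  proof
    fix y assume y: "y \<in> haar_support n"
    have "haar i y = haar i l" if "i \<le> n - 1" for i
      using that n0 by (intro haar_const_on_support[OF _ y lD(1)]) simp
    then show "y \<in> A l" using y D01 by (auto simp: A_def)
  qed
  have c0: "f (n - 1) y = f (n - 1) l" if "y \<in> A l" for y
    using that lD D01 n by (intro haar_filtration_measurable_const[OF fm]) (auto simp: A_def)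
  have cL: "f n y = f n l" if y: "y \<in> haar_left n" for y
  proof (rule haar_filtration_measurable_const[OF fm[OF n]])
    have yD: "y \<in> haar_support n" using y haar_support_split by auto
    show "y \<in> {0..1}" "l \<in> {0..1}" using yD lD D01 by auto
    fix i assume "i \<le> n"
    then show "haar i y = haar i l"
      using haar_values(1)[OF n0 y] haar_values(1)[OF n0, of l] lm L haar_const_on_support[OF _ yD lD(1), of i]
      by (cases "i = n") auto
  qed
  have cR: "f n y = f n m" if y: "y \<in> haar_right n" for y
  proof (rule haar_filtration_measurable_const[OF fm[OF n]])
    have yD: "y \<in> haar_support n" using y haar_support_split by auto
    show "y \<in> {0..1}" "m \<in> {0..1}" using yD lD D01 by auto
    fix i assume "i \<le> n"
    then show "haar i y = haar i m"
      using haar_values(2)[OF n0 y] haar_values(2)[OF n0, of m] lm R haar_const_on_support[OF _ yD lD(2), of i]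
      by (cases "i = n") auto
  qed
  have sub: "{l..<m} \<subseteq> A l" "{m..<r} \<subseteq> A l" using A1 L R haar_support_split(1)[of n] by auto
  have int1: "((\<lambda>y. indicator {l..<m} y *\<^sub>R f n l + indicator {m..<r} y *\<^sub>R f n m) has_integral (m - l) *\<^sub>R f n l + (r - m) *\<^sub>R f n m) (A l)"
    using lm sub by (intro has_integral_add has_integral_indicator_interval) auto
  have int2: "((\<lambda>y. indicator {l..<m} y *\<^sub>R f (n - 1) l + indicator {m..<r} y *\<^sub>R f (n - 1) l) has_integral (m - l) *\<^sub>R f (n - 1) l + (r - m) *\<^sub>R f (n - 1) l) (A l)"
    using lm sub by (intro has_integral_add has_integral_indicator_interval) auto
  have part: "y \<in> {l..<m} \<or> y \<in> {m..<r}" if "y \<in> A l" "y \<noteq> 1" for y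
    using AD[OF lD(1) that] haar_support_split(1)[of n] L R by auto
  have "(f n has_integral (m - l) *\<^sub>R f n l + (r - m) *\<^sub>R f n m) (A l)"
  proof (rule has_integral_spike[OF negligible_sing[of 1] _ int1])
    fix y assume "y \<in> A l - {1}"
    then consider "y \<in> {l..<m}" "y \<notin> {m..<r}" | "y \<notin> {l..<m}" "y \<in> {m..<r}" using part[of y] by fastforce
    then show "f n y = indicator {l..<m} y *\<^sub>R f n l + indicator {m..<r} y *\<^sub>R f n m"
      using cL[of y, unfolded L] cR[of y, unfolded R] by cases (simp_all only: indicator_simps scaleR_one scaleR_zero_left add_0 add_0_right simp_thms)
  qed
  then have I1: "integral (A l) (f n) = (m - l) *\<^sub>R f n l + (r - m) *\<^sub>R f n m" by (rule integral_unique)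
  have "(f (n - 1) has_integral (m - l) *\<^sub>R f (n - 1) l + (r - m) *\<^sub>R f (n - 1) l) (A l)"
  proof (rule has_integral_spike[OF negligible_sing[of 1] _ int2])
    fix y assume "y \<in> A l - {1}"
    then show "f (n - 1) y = indicator {l..<m} y *\<^sub>R f (n - 1) l + indicator {m..<r} y *\<^sub>R f (n - 1) l"
      using part[of y] c0[of y] by (auto simp: indicator_def)
  qed
  then have I2: "integral (A l) (f (n - 1)) = (m - l) *\<^sub>R f (n - 1) l + (r - m) *\<^sub>R f (n - 1) l" by (rule integral_unique)
  have "(1 / 2 ^ Suc k) *\<^sub>R (f n l + f n m) = (1 / 2 ^ Suc k) *\<^sub>R (f (n - 1) l + f (n - 1) l)"
    using mart[OF AF[of l]] lD(1) D01 unfolding I1 I2 lens by (auto simp: scaleR_right_distrib)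
  then have e: "f n l + f n m = f (n - 1) l + f (n - 1) l"
    by (subst (asm) scaleR_cancel_left) auto
  show ?thesis
  proof (intro exI[of _ "f n l - f (n - 1) l"] ballI)
    fix y :: real assume y: "y \<in> {0..<1}"
    consider "y \<in> haar_left n" | "y \<in> haar_right n" | "y \<notin> haar_support n" using haar_support_split by auto
    then show "mdiff f n y = haar n y *\<^sub>R (f n l - f (n - 1) l)"
    proof cases
      case 1
      then have "f (n - 1) y = f (n - 1) l" using c0 sub L by auto
      then show ?thesis using cL[OF 1] haar_values(1)[OF n0 1] n0 by (simp add: mdiff_def)
    next
      case 2
      then have "f (n - 1) y = f (n - 1) l" using c0 sub R by auto
      then show ?thesis using cR[OF 2] haar_values(2)[OF n0 2] n0 e by (simp add: mdiff_def algebra_simps)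
    next
      case 3
      then show ?thesis using off[OF y 3] haar_values(3)[OF n0 3] by simp
    qed
  qed
qed

section \<open>Decoupling along the Haar filtration\<close>

lemma prob_space_unit_interval: "prob_space unit_interval"
  by (rule prob_space_restrict_space) auto

lemma haar_cases: "haar i y \<in> {-1, 0, 1}"
proof (cases "i = 0")
  case False
  then show ?thesis using haar_support_split[of i] haar_values[of i y] by blast
qed (simp add: haar_0)

text \<open>A real function that depends on finitely many Haar functions is simple. This settles
  measurability and integrability of all scalar quantities below, however they are built from Banach
  space vectors.\<close>

lemma haar_determined:
  fixes F :: "real \<Rightarrow> real"
  assumes F: "\<And>y y'. (\<And>i. i \<le> n \<Longrightarrow> haar i y = haar i y') \<Longrightarrow> F y = F y'"
  shows "F \<in> borel_measurable borel" "finite (range F)" "integrable unit_interval F"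
proof -
  define h where "h = (\<lambda>y. \<lambda>i\<in>{..n}. haar i y)"
  have hi: "h y = h y' \<longleftrightarrow> (\<forall>i\<le>n. haar i y = haar i y')" for y y'
    unfolding h_def by (auto simp: restrict_def fun_eq_iff)
  have "range h \<subseteq> {..n} \<rightarrow>\<^sub>E {-1, 0, 1}" unfolding h_def image_subset_iff restrict_PiE_iff using haar_cases by blast
  then have fin: "finite (range h)" by (rule finite_subset) (intro finite_PiE, auto)
  have Fh: "F = (\<lambda>w. F (SOME y. h y = w)) \<circ> h"
  proof
    fix y
    have "h (SOME y'. h y' = h y) = h y" by (rule someI) simp
    then show "F y = ((\<lambda>w. F (SOME y. h y = w)) \<circ> h) y" using F[of y "SOME y'. h y' = h y"] hi by auto
  qed
  have "range F = (\<lambda>w. F (SOME y. h y = w)) ` range h" by (subst Fh) (simp add: image_comp)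
  then show fr: "finite (range F)" using fin by simp
  have "simple_function borel F" unfolding simple_function_def
  proof (intro conjI ballI)
    fix v
    have "F -` {v} = (\<Union>w\<in>{w \<in> range h. F (SOME y. h y = w) = v}. h -` {w})"
      by (subst (1) Fh) auto
    also have "\<dots> \<in> sets borel"
    proof (intro sets.finite_UN)
      fix w assume "w \<in> {w \<in> range h. F (SOME y. h y = w) = v}"
      then obtain y0 where "w = h y0" by auto
      then have "h -` {w} = (\<Inter>i\<in>{..n}. haar i -` {haar i y0} \<inter> space borel)" using hi by auto
      also have "\<dots> \<in> sets borel" by (intro sets.finite_INT measurable_sets[OF haar_measurable]) auto
      finally show "h -` {w} \<in> sets borel" .
    qed (use fin in auto)
    finally show "F -` {v} \<inter> space borel \<in> sets borel" by simp
  qed (use fr in simp)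
  then show m: "F \<in> borel_measurable borel" by (rule borel_measurable_simple_function)
  have "finite ((\<lambda>v. \<bar>v\<bar>) ` range F)" using fr by simp
  then have "\<bar>F y\<bar> \<le> Max ((\<lambda>v. \<bar>v\<bar>) ` range F)" for y by (intro Max_ge) auto
  then show "integrable unit_interval F"
    using m by (intro finite_measure.integrable_const_bound[OF prob_space.finite_measure[OF prob_space_unit_interval]])
      (auto intro!: AE_I2 simp: measurable_restrict_space1)
qed

lemma integral_haar: "0 < n \<Longrightarrow> (\<integral>y. haar n y \<partial>unit_interval) = 0"
proof -
  assume n: "0 < n"
  define k where "k = floor_log n"
  define j where "j = n - 2 ^ k"
  have L: "haar_left n = {real (2 * j) / 2 ^ Suc k ..< real (2 * j + 1) / 2 ^ Suc k}"
    and R: "haar_right n = {real (2 * j + 1) / 2 ^ Suc k ..< real (2 * j + 2) / 2 ^ Suc k}"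
    unfolding haar_left_def haar_right_def Let_def k_def j_def by simp_all
  have 2: "real (2 * j) / 2 ^ Suc k \<le> real (2 * j + 1) / 2 ^ Suc k" "real (2 * j + 1) / 2 ^ Suc k \<le> real (2 * j + 2) / 2 ^ Suc k"
    by (intro divide_right_mono; simp)+
  have ml: "measure lborel (haar_left n) = 1 / 2 ^ Suc k" unfolding L using 2 by (simp only: measure_lborel_Ico diff_divide_distrib[symmetric]) simp
  have mr: "measure lborel (haar_right n) = 1 / 2 ^ Suc k" unfolding R using 2 by (simp only: measure_lborel_Ico diff_divide_distrib[symmetric]) simp
  have il: "integrable lborel (indicat_real (haar_left n))" unfolding L using 2 by (intro integrable_real_indicator) auto
  have ir: "integrable lborel (indicat_real (haar_right n))" unfolding R using 2 by (intro integrable_real_indicator) auto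
  have sub: "haar_left n \<subseteq> {0..1}" "haar_right n \<subseteq> {0..1}"
    using haar_support_subset[OF n] haar_support_split(1)[of n] by (auto intro: less_imp_le)
  have "(\<integral>y. haar n y \<partial>unit_interval) = (\<integral>y. indicator {0..1} y *\<^sub>R haar n y \<partial>lborel)"
    by (subst integral_restrict_space) auto
  also have "\<dots> = (\<integral>y. indicat_real (haar_left n) y - indicat_real (haar_right n) y \<partial>lborel)"
    using sub by (intro Bochner_Integration.integral_cong refl) (auto simp: haar_eq[OF n] indicator_def)
  also have "\<dots> = 0"
    using il ir ml mr by (subst Bochner_Integration.integral_diff) auto
  finally show ?thesis .
qed

text \<open>A choice of signs is encoded by the set of indices with sign 1; a sum over
  \<open>Pow {..n}\<close> is then \<open>2 ^ Suc n\<close> times an expectation over independent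
  signs.\<close>

definition sign_of :: "nat set \<Rightarrow> nat \<Rightarrow> real" where
  "sign_of A i = (if i \<in> A then 1 else -1)"

text \<open>The flag \<open>e\<close> selects which of the two sums carries the signs, so that both decoupling
  inequalities come out of the same induction.\<close>

definition haar_sum :: "bool \<Rightarrow> (nat \<Rightarrow> 'a::real_vector) \<Rightarrow> nat \<Rightarrow> nat set \<Rightarrow> real \<Rightarrow> 'a" where
  "haar_sum e x n A y = (\<Sum>i\<le>n. ((if e then sign_of A i else 1) * haar i y) *\<^sub>R x i)"

lemma haar_sum_cong: "(\<And>i. i \<le> n \<Longrightarrow> haar i y = haar i y') \<Longrightarrow> haar_sum e x n A y = haar_sum e x n A y'"
  unfolding haar_sum_def by (intro sum.cong) auto

lemma haar_sum_Suc:
  assumes "A \<subseteq> {..n}"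
  shows "haar_sum e x (Suc n) A y = haar_sum e x n A y + ((if e then -1 else 1) * haar (Suc n) y) *\<^sub>R x (Suc n)"
    and "haar_sum e x (Suc n) (insert (Suc n) A) y = haar_sum e x n A y + haar (Suc n) y *\<^sub>R x (Suc n)"
proof -
  have "Suc n \<notin> A" using assms by auto
  then show "haar_sum e x (Suc n) A y = haar_sum e x n A y + ((if e then -1 else 1) * haar (Suc n) y) *\<^sub>R x (Suc n)"
    unfolding haar_sum_def by (simp add: sign_of_def)
  have "(\<Sum>i\<le>n. ((if e then sign_of (insert (Suc n) A) i else 1) * haar i y) *\<^sub>R x i) = (\<Sum>i\<le>n. ((if e then sign_of A i else 1) * haar i y) *\<^sub>R x i)"
    by (intro sum.cong) (auto simp: sign_of_def)
  then show "haar_sum e x (Suc n) (insert (Suc n) A) y = haar_sum e x n A y + haar (Suc n) y *\<^sub>R x (Suc n)"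
    unfolding haar_sum_def by (simp add: sign_of_def)
qed

lemma sum_Pow_insert:
  fixes f :: "'b set \<Rightarrow> 'c::comm_monoid_add"
  assumes "finite B" "b \<notin> B"
  shows "(\<Sum>A\<in>Pow (insert b B). f A) = (\<Sum>A\<in>Pow B. f A + f (insert b A))"
proof -
  have "inj_on (insert b) (Pow B)" using assms(2) by (auto simp: inj_on_def)
  moreover have "Pow B \<inter> insert b ` Pow B = {}" using assms(2) by auto
  ultimately show ?thesis
    using assms(1) by (simp add: Pow_insert sum.union_disjoint sum.reindex sum.distrib)
qed

lemma haar_sum_decoupling:
  fixes x :: "nat \<Rightarrow> 'a::real_normed_vector"
  assumes p: "1 < p" and Q: "good p Q" "circ_nonpos Q"
  shows "(\<Sum>A\<in>Pow {..n}. \<integral>y. Q (haar_sum e x n A y, strip_const *\<^sub>R haar_sum (\<not> e) x n A y) \<partial>unit_interval) \<le> 0"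
  using Q
proof (induction n arbitrary: Q)
  interpret U: prob_space unit_interval by (rule prob_space_unit_interval)
  interpret S: step_law signs fst "\<lambda>z. strip_const * snd z" p using p by (rule step_law_signs)
  let ?C = strip_const
  case (0 Q)
  have fin: "finite {0, x 0}" "{0, x 0} \<noteq> {}" by auto
  \<comment> \<open>\<open>haar 0\<close> is constant, so only one sign is random at index 0;
    evenness supplies the remaining two sign pairs.\<close>
  have ev: "Q (- v, - w) = Q (v, w)" for v w using goodD(3)[OF 0(1)] .
  have "(\<Sum>A\<in>Pow {..0::nat}. \<integral>y. Q (haar_sum e x 0 A y, ?C *\<^sub>R haar_sum (\<not> e) x 0 A y) \<partial>unit_interval) =
    Q (x 0, ?C *\<^sub>R x 0) + (if e then Q (- x 0, ?C *\<^sub>R x 0) else Q (x 0, - (?C *\<^sub>R x 0)))"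
    by (simp add: haar_sum_def sign_of_def haar_0 U.prob_space Pow_insert atMost_0 del: space_restrict_space2)
  also have "\<dots> = 2 * S.avg Q 0 0 (x 0)"
    unfolding S.avg_def integral_signs using ev[of "x 0" "?C *\<^sub>R x 0"] ev[of "x 0" "- (?C *\<^sub>R x 0)"] by simp
  also have "\<dots> \<le> 2 * S.step {0, x 0} Q (0, 0)" using S.avg_le_step[OF fin(1), of "x 0" Q 0 0] by simp
  also have "\<dots> \<le> 0"
    using circ_nonpos_zero[OF S.circ_nonpos_step[OF 0(1) fin circ_nonpos_signs[OF p 0]]] by simp
  finally show ?case .
next
  interpret U: prob_space unit_interval by (rule prob_space_unit_interval)
  interpret S: step_law signs fst "\<lambda>z. strip_const * snd z" p using p by (rule step_law_signs)
  let ?C = strip_const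
  case (Suc n Q)
  define v where "v = x (Suc n)"
  define h where "h = haar (Suc n)"
  have fin: "finite {0, v}" "{0, v} \<noteq> {}" by auto
  define T where "T = S.step {0, v} Q"
  have IH: "(\<Sum>A\<in>Pow {..n}. \<integral>y. T (haar_sum e x n A y, ?C *\<^sub>R haar_sum (\<not> e) x n A y) \<partial>unit_interval) \<le> 0"
    unfolding T_def by (rule Suc.IH[OF S.good_step[OF Suc.prems(1) fin] S.circ_nonpos_step[OF Suc.prems(1) fin circ_nonpos_signs[OF p Suc.prems]]])
  have step: "(\<integral>y. Q (haar_sum e x (Suc n) A y, ?C *\<^sub>R haar_sum (\<not> e) x (Suc n) A y) \<partial>unit_interval) +
      (\<integral>y. Q (haar_sum e x (Suc n) (insert (Suc n) A) y, ?C *\<^sub>R haar_sum (\<not> e) x (Suc n) (insert (Suc n) A) y) \<partial>unit_interval) \<le>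
      2 * (\<integral>y. T (haar_sum e x n A y, ?C *\<^sub>R haar_sum (\<not> e) x n A y) \<partial>unit_interval)" if A: "A \<subseteq> {..n}" for A
  proof -
    define X where "X = haar_sum e x n A"
    define Y where "Y = (\<lambda>y. ?C *\<^sub>R haar_sum (\<not> e) x n A y)"
    define G1 where "G1 = (\<lambda>y. Q (haar_sum e x (Suc n) A y, ?C *\<^sub>R haar_sum (\<not> e) x (Suc n) A y))"
    define G2 where "G2 = (\<lambda>y. Q (haar_sum e x (Suc n) (insert (Suc n) A) y, ?C *\<^sub>R haar_sum (\<not> e) x (Suc n) (insert (Suc n) A) y))"
    define d where "d = (if e then -1 else 1 :: real)"
    have G1: "G1 y = Q (X y + (d * h y) *\<^sub>R v, Y y + (?C * (- d * h y)) *\<^sub>R v)" for y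
      unfolding G1_def haar_sum_Suc(1)[OF A] X_def Y_def v_def h_def d_def by (simp add: scaleR_right_distrib)
    have G2: "G2 y = Q (X y + h y *\<^sub>R v, Y y + (?C * h y) *\<^sub>R v)" for y
      unfolding G2_def haar_sum_Suc(2)[OF A] X_def Y_def v_def h_def by (simp add: scaleR_right_distrib)
    have det: "G1 y = G1 y'" "G2 y = G2 y'" "T (X y, Y y) = T (X y', Y y')" "h y = h y'"
      if H: "\<And>i. i \<le> Suc n \<Longrightarrow> haar i y = haar i y'" for y y'
    proof -
      have c: "haar_sum b x (Suc n) B y = haar_sum b x (Suc n) B y'" "haar_sum b x n B y = haar_sum b x n B y'" for b B
        using H by (auto intro!: haar_sum_cong)
      show "G1 y = G1 y'" "G2 y = G2 y'" "T (X y, Y y) = T (X y', Y y')" "h y = h y'"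
        unfolding G1_def G2_def X_def Y_def h_def by (simp_all only: c H order_refl)
    qed
    have int: "integrable unit_interval G1" "integrable unit_interval G2" "integrable unit_interval (\<lambda>y. T (X y, Y y))" "integrable unit_interval h"
      by (rule haar_determined(3)[of "Suc n"], rule det, assumption)+
    obtain l where l: "l \<in> haar_left (Suc n)"
      using haar_left_nonempty by blast
    \<comment> \<open>Half the difference of \<open>G1 + G2\<close> between the two halves of the
      support, on which \<open>X\<close> and \<open>Y\<close> are constant. Subtracting
      \<open>q * h\<close> equalises the halves without changing the integral, since
      \<open>h\<close> has mean 0.\<close>
    define q where "q = (Q (X l + d *\<^sub>R v, Y l + (?C * - d) *\<^sub>R v) + Q (X l + v, Y l + ?C *\<^sub>R v) - Q (X l - d *\<^sub>R v, Y l + (?C * d) *\<^sub>R v) - Q (X l - v, Y l - ?C *\<^sub>R v)) / 2"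
    have pw: "G1 y + G2 y - q * h y \<le> 2 * T (X y, Y y)" for y
    proof (cases "y \<in> haar_support (Suc n)")
      case True
      have lD: "l \<in> haar_support (Suc n)" using l haar_support_split by auto
      have hs: "haar i y = haar i l" if "i \<le> n" for i
        using that by (intro haar_const_on_support[OF _ True lD]) simp
      have XY: "X y = X l" "Y y = Y l" unfolding X_def Y_def by (simp_all cong: haar_sum_cong[OF hs])
      have avg: "4 * S.avg Q (X l) (Y l) v \<le> 4 * T (X y, Y y)"
        unfolding T_def XY using S.avg_le_step[OF fin(1), of v Q "X l" "Y l"] by simp
      have h: "h y = 1 \<or> h y = -1" using True haar_values[of "Suc n" y] haar_support_split(1)[of "Suc n"] by (auto simp: h_def)
      have "2 * (G1 y + G2 y - q * h y) = 4 * S.avg Q (X l) (Y l) v"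
        unfolding S.avg_def integral_signs G1 G2 XY q_def using h by (cases e) (auto simp: d_def)
      then show ?thesis using avg by simp
    next
      case False
      then have "h y = 0" using haar_values(3) by (simp add: h_def)
      then have "G1 y + G2 y - q * h y = 2 * S.avg Q (X y) (Y y) 0"
        unfolding S.avg_def integral_signs G1 G2 by simp
      also have "\<dots> \<le> 2 * T (X y, Y y)" unfolding T_def using S.avg_le_step[OF fin(1), of 0 Q "X y" "Y y"] by simp
      finally show ?thesis .
    qed
    have "(\<integral>y. G1 y \<partial>unit_interval) + (\<integral>y. G2 y \<partial>unit_interval) = (\<integral>y. G1 y + G2 y - q * h y \<partial>unit_interval)"
      using int integral_haar[of "Suc n"] by (simp add: h_def)
    also have "\<dots> \<le> (\<integral>y. 2 * T (X y, Y y) \<partial>unit_interval)"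
      using int pw by (intro integral_mono) auto
    finally show ?thesis unfolding G1_def G2_def X_def Y_def by simp
  qed
  have "(\<Sum>A\<in>Pow {..Suc n}. \<integral>y. Q (haar_sum e x (Suc n) A y, ?C *\<^sub>R haar_sum (\<not> e) x (Suc n) A y) \<partial>unit_interval) \<le>
    (\<Sum>A\<in>Pow {..n}. 2 * (\<integral>y. T (haar_sum e x n A y, ?C *\<^sub>R haar_sum (\<not> e) x n A y) \<partial>unit_interval))"
    unfolding atMost_Suc by (subst sum_Pow_insert) (auto intro!: sum_mono step)
  also have "\<dots> \<le> 0" using IH by (simp flip: sum_distrib_left)
  finally show ?case .
qed

lemma nn_integral_rademacher:
  fixes \<Phi> :: "(nat \<Rightarrow> real) \<Rightarrow> ennreal"
  assumes r: "rademacher_seq M r" and \<Phi>: "\<And>s s'. (\<And>i. i \<le> n \<Longrightarrow> s i = s' i) \<Longrightarrow> \<Phi> s = \<Phi> s'"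
  shows "(\<integral>\<^sup>+\<omega>. \<Phi> (\<lambda>i. r i \<omega>) \<partial>M) = (\<Sum>A\<in>Pow {..n}. \<Phi> (sign_of A) * ennreal (1 / 2 ^ Suc n))"
proof -
  interpret prob_space M using r by (simp add: rademacher_seq_def)
  have iv: "indep_vars (\<lambda>_. borel) r UNIV" using r by (simp add: rademacher_seq_def)
  have rm [measurable]: "r i \<in> borel_measurable M" for i using iv unfolding indep_vars_def by auto
  define E where "E = (\<lambda>A. {\<omega> \<in> space M. \<forall>i\<le>n. r i \<omega> = sign_of A i})"
  have Em [measurable]: "E A \<in> sets M" for A unfolding E_def by measurable
  have PE: "prob (E A) = 1 / 2 ^ Suc n" for A
  proof -
    have "E A = (\<Inter>i\<in>{..n}. r i -` {sign_of A i} \<inter> space M)" unfolding E_def by auto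
    then have "prob (E A) = (\<Prod>i\<in>{..n}. prob (r i -` {sign_of A i} \<inter> space M))"
      using indep_varsD[OF iv, of "{..n}" "\<lambda>i. {sign_of A i}"] by simp
    also have "\<dots> = (\<Prod>i\<in>{..n}. 1 / 2)"
    proof (intro prod.cong refl)
      fix i
      have "r i -` {s} \<inter> space M = {\<omega> \<in> space M. r i \<omega> = s}" for s by auto
      then show "prob (r i -` {sign_of A i} \<inter> space M) = 1 / 2"
        using r by (auto simp: rademacher_seq_def sign_of_def)
    qed
    finally show ?thesis by (simp add: power_one_over)
  qed
  have inj: "A = B" if "\<omega> \<in> E A" "\<omega> \<in> E B" "A \<subseteq> {..n}" "B \<subseteq> {..n}" for A B \<omega>
  proof -
    have "i \<in> A \<longleftrightarrow> i \<in> B" if "i \<le> n" for i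
      using \<open>\<omega> \<in> E A\<close> \<open>\<omega> \<in> E B\<close> that by (auto simp: E_def sign_of_def split: if_splits)
    then show ?thesis using that by auto
  qed
  \<comment> \<open>A Rademacher variable may take other values on a null set, so the events
    \<open>E A\<close> exhaust the space almost surely only.\<close>
  have "prob (\<Union>A\<in>Pow {..n}. E A) = (\<Sum>A\<in>Pow {..n}. prob (E A))"
    by (intro finite_measure_finite_Union) (auto simp: disjoint_family_on_def dest: inj)
  also have "\<dots> = 1" unfolding PE by (simp add: card_Pow)
  finally have AE: "AE \<omega> in M. \<omega> \<in> (\<Union>A\<in>Pow {..n}. E A)" by (intro AE_prob_1)
  have "(\<integral>\<^sup>+\<omega>. \<Phi> (\<lambda>i. r i \<omega>) \<partial>M) = (\<integral>\<^sup>+\<omega>. (\<Sum>A\<in>Pow {..n}. \<Phi> (sign_of A) * indicator (E A) \<omega>) \<partial>M)"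
  proof (rule nn_integral_cong_AE)
    show "AE \<omega> in M. \<Phi> (\<lambda>i. r i \<omega>) = (\<Sum>A\<in>Pow {..n}. \<Phi> (sign_of A) * indicator (E A) \<omega>)"
      using AE
    proof eventually_elim
      case (elim \<omega>)
      then obtain B where B: "B \<subseteq> {..n}" "\<omega> \<in> E B" by auto
      have "(\<Sum>A\<in>Pow {..n}. \<Phi> (sign_of A) * indicator (E A) \<omega>) = (\<Sum>A\<in>Pow {..n}. if A = B then \<Phi> (sign_of B) else 0)"
        using B inj by (intro sum.cong) (auto simp: indicator_def)
      also have "\<dots> = \<Phi> (sign_of B)" using B by (simp add: sum.delta)
      also have "\<dots> = \<Phi> (\<lambda>i. r i \<omega>)" using B by (intro \<Phi>) (auto simp: E_def)
      finally show ?case by simp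
    qed
  qed
  also have "\<dots> = (\<Sum>A\<in>Pow {..n}. \<Phi> (sign_of A) * emeasure M (E A))"
    by (subst nn_integral_sum) (auto simp: nn_integral_cmult_indicator)
  finally show ?thesis by (simp add: emeasure_eq_measure PE)
qed

theorem paley_walsh_decoupling:
  fixes f :: "nat \<Rightarrow> real \<Rightarrow> 'x::banach"
  assumes p: "1 < p" and c: "0 \<le> c" "circ_nonpos (base_value p c :: 'x \<times> 'x \<Rightarrow> real)"
    and f: "paley_walsh N f" and r: "rademacher_seq M r"
  shows "ennreal (strip_const powr p) * (\<integral>\<^sup>+ z. ennreal (norm (\<Sum>n\<le>N. r n (snd z) *\<^sub>R mdiff f n (fst z)) powr p) \<partial>(unit_interval \<Otimes>\<^sub>M M))
         \<le> ennreal (c powr p) * (\<integral>\<^sup>+ y. ennreal (norm (\<Sum>n\<le>N. mdiff f n y) powr p) \<partial>unit_interval)"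
    and "ennreal (strip_const powr p) * (\<integral>\<^sup>+ y. ennreal (norm (\<Sum>n\<le>N. mdiff f n y) powr p) \<partial>unit_interval)
         \<le> ennreal (c powr p) * (\<integral>\<^sup>+ z. ennreal (norm (\<Sum>n\<le>N. r n (snd z) *\<^sub>R mdiff f n (fst z)) powr p) \<partial>(unit_interval \<Otimes>\<^sub>M M))"
proof -
  interpret U: prob_space unit_interval by (rule prob_space_unit_interval)
  interpret M: prob_space M using r by (simp add: rademacher_seq_def)
  interpret UM: pair_prob_space unit_interval M ..
  have rm [measurable]: "r i \<in> borel_measurable M" for i
    using r unfolding rademacher_seq_def M.indep_vars_def by auto
  have hm [measurable]: "haar i \<in> borel_measurable unit_interval" for i
    by (intro measurable_restrict_space1) simp
  have "\<forall>n\<in>{..N}. \<exists>x. \<forall>y\<in>{0..<1}. mdiff f n y = haar n y *\<^sub>R x" using paley_walsh_increment[OF f] by auto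
  then obtain x where "\<forall>n\<in>{..N}. \<forall>y\<in>{0..<1}. mdiff f n y = haar n y *\<^sub>R x n"
    unfolding bchoice_iff by blast
  then have x: "mdiff f n y = haar n y *\<^sub>R x n" if "n \<le> N" "y \<in> {0..<1}" for n y
    using that unfolding atMost_iff[symmetric] by blast
  define C where "C = strip_const powr p"
  define I where "I = (\<lambda>e A. \<integral>y. norm (haar_sum e x N A y) powr p \<partial>unit_interval)"
  have I0: "0 \<le> I e A" for e A unfolding I_def by (rule integral_nonneg_AE) simp
  have hi: "integrable unit_interval (\<lambda>y. norm (haar_sum e x N A y) powr p)" for e A
    by (rule haar_determined(3)[of N]) (simp cong: haar_sum_cong)
  have [measurable]: "(\<lambda>y. norm (haar_sum e x N A y) powr p) \<in> borel_measurable unit_interval" for e A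
    by (rule borel_measurable_integrable[OF hi])
  have nnI: "(\<integral>\<^sup>+ y. ennreal (norm (haar_sum e x N A y) powr p) \<partial>unit_interval) = ennreal (I e A)" for e A
    unfolding I_def using hi by (intro nn_integral_eq_integral) auto
  have AE1: "AE y in unit_interval. y \<in> {0..<1}"
    using AE_lborel_singleton[of "1::real"] by (subst AE_restrict_space_iff) (auto elim: eventually_mono)
  define J0 where "J0 = I False {}"
  have I_False: "I False A = J0" for A unfolding J0_def I_def haar_sum_def by simp
  have "(\<integral>\<^sup>+ y. ennreal (norm (\<Sum>n\<le>N. mdiff f n y) powr p) \<partial>unit_interval) =
     (\<integral>\<^sup>+ y. ennreal (norm (haar_sum False x N {} y) powr p) \<partial>unit_interval)"
  proof (rule nn_integral_cong_AE)
    show "AE y in unit_interval. ennreal (norm (\<Sum>n\<le>N. mdiff f n y) powr p) = ennreal (norm (haar_sum False x N {} y) powr p)"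
      using AE1 by eventually_elim (simp add: haar_sum_def x)
  qed
  then have J: "(\<integral>\<^sup>+ y. ennreal (norm (\<Sum>n\<le>N. mdiff f n y) powr p) \<partial>unit_interval) = ennreal (J0)"
    using nnI I_False by simp
  have contp: "continuous_on UNIV (\<lambda>v::'x. norm v powr p)" using p by (intro continuous_intros continuous_on_powr') auto
  have "(\<integral>\<^sup>+ z. ennreal (norm (\<Sum>n\<le>N. r n (snd z) *\<^sub>R mdiff f n (fst z)) powr p) \<partial>(unit_interval \<Otimes>\<^sub>M M)) =
    (\<integral>\<^sup>+ z. ennreal (norm (\<Sum>n<Suc N. (r n (snd z) * haar n (fst z)) *\<^sub>R x n) powr p) \<partial>(unit_interval \<Otimes>\<^sub>M M))"
  proof (rule nn_integral_cong_AE)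
    have "AE z in unit_interval \<Otimes>\<^sub>M M. fst z \<in> {0..<1}"
    proof (rule UM.AE_pair_measure)
      have "{z \<in> space (unit_interval \<Otimes>\<^sub>M M). fst z \<in> {0..<1}} = fst -` {0..<1} \<inter> space (unit_interval \<Otimes>\<^sub>M M)" by auto
      also have "\<dots> \<in> sets (unit_interval \<Otimes>\<^sub>M M)"
        by (rule measurable_sets[OF measurable_fst]) (auto simp: sets_restrict_space_iff)
      finally show "{z \<in> space (unit_interval \<Otimes>\<^sub>M M). fst z \<in> {0..<1}} \<in> sets (unit_interval \<Otimes>\<^sub>M M)" .
      show "AE y in unit_interval. AE \<omega> in M. fst (y, \<omega>) \<in> {0..<1}" using AE1 by eventually_elim simp
    qed
    then show "AE z in unit_interval \<Otimes>\<^sub>M M. ennreal (norm (\<Sum>n\<le>N. r n (snd z) *\<^sub>R mdiff f n (fst z)) powr p) =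
       ennreal (norm (\<Sum>n<Suc N. (r n (snd z) * haar n (fst z)) *\<^sub>R x n) powr p)"
      by eventually_elim (simp add: x lessThan_Suc_atMost)
  qed
  also have "\<dots> = (\<integral>\<^sup>+y. (\<integral>\<^sup>+\<omega>. ennreal (norm (\<Sum>n<Suc N. (r n \<omega> * haar n y) *\<^sub>R x n) powr p) \<partial>M) \<partial>unit_interval)"
  proof -
    have "(\<lambda>z. norm (\<Sum>n<Suc N. (r n (snd z) * haar n (fst z)) *\<^sub>R x n) powr p) \<in> borel_measurable (unit_interval \<Otimes>\<^sub>M M)"
      by (rule measurable_finite_span[OF _ contp]) measurable
    then have "(\<lambda>z. ennreal (norm (\<Sum>n<Suc N. (r n (snd z) * haar n (fst z)) *\<^sub>R x n) powr p)) \<in> borel_measurable (unit_interval \<Otimes>\<^sub>M M)" by measurable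
    from M.nn_integral_fst[OF this] show ?thesis by simp
  qed
  also have "\<dots> = (\<integral>\<^sup>+y. (\<Sum>A\<in>Pow {..N}. ennreal (norm (haar_sum True x N A y) powr p) * ennreal (1 / 2 ^ Suc N)) \<partial>unit_interval)"
  proof (rule nn_integral_cong)
    fix y
    show "(\<integral>\<^sup>+\<omega>. ennreal (norm (\<Sum>n<Suc N. (r n \<omega> * haar n y) *\<^sub>R x n) powr p) \<partial>M) =
      (\<Sum>A\<in>Pow {..N}. ennreal (norm (haar_sum True x N A y) powr p) * ennreal (1 / 2 ^ Suc N))"
      unfolding haar_sum_def if_True lessThan_Suc_atMost
      by (rule nn_integral_rademacher[OF r]) (auto intro!: arg_cong[where f = "\<lambda>v. ennreal (norm v powr p)"] sum.cong)
  qed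
  also have "\<dots> = (\<Sum>A\<in>Pow {..N}. ennreal (I True A) * ennreal (1 / 2 ^ Suc N))"
    by (subst nn_integral_sum) (measurable, simp add: nn_integral_multc nnI)
  also have "\<dots> = ennreal (\<Sum>A\<in>Pow {..N}. I True A * (1 / 2 ^ Suc N))"
    by (simp add: I0 flip: ennreal_mult)
  finally have E: "(\<integral>\<^sup>+ z. ennreal (norm (\<Sum>n\<le>N. r n (snd z) *\<^sub>R mdiff f n (fst z)) powr p) \<partial>(unit_interval \<Otimes>\<^sub>M M)) =
    ennreal (\<Sum>A\<in>Pow {..N}. I True A * (1 / 2 ^ Suc N))" .
  have J00: "0 \<le> J0" using I0 by (simp add: J0_def)
  have C0: "0 \<le> strip_const" unfolding strip_const_def by (rule integral_nonneg_AE) simp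
  \<comment> \<open>For \<open>e = False\<close> the signs sit in the second argument, which gives
    the first inequality; for \<open>e = True\<close> they sit in the first argument, which gives
    the second one.\<close>
  have main: "(\<Sum>A\<in>Pow {..N}. C * I (\<not> e) A - c powr p * I e A) \<le> 0" for e
  proof -
    have "(\<integral>y. base_value p c (haar_sum e x N A y, strip_const *\<^sub>R haar_sum (\<not> e) x N A y) \<partial>unit_interval) = C * I (\<not> e) A - c powr p * I e A" for A
      unfolding base_value_def I_def C_def using hi C0 by (simp add: powr_mult)
    with haar_sum_decoupling[OF p good_base_value[OF p] c(2), where n = N and e = e and x = x] show ?thesis by simp
  qed
  have cardS: "(\<Sum>A\<in>Pow {..N}. K) = K * 2 ^ Suc N" for K :: real by (simp add: card_Pow)
  have "C * (\<Sum>A\<in>Pow {..N}. I True A) \<le> c powr p * J0 * 2 ^ Suc N"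
    using main[of False] cardS[of "c powr p * J0"] by (simp add: sum_subtractf sum_distrib_left I_False del: sum_constant)
  then have 1: "C * (\<Sum>A\<in>Pow {..N}. I True A * (1 / 2 ^ Suc N)) \<le> c powr p * J0"
    unfolding sum_distrib_right[symmetric] by (simp add: field_simps)
  have "C * J0 * 2 ^ Suc N \<le> c powr p * (\<Sum>A\<in>Pow {..N}. I True A)"
    using main[of True] cardS[of "C * J0"] by (simp add: sum_subtractf sum_distrib_left I_False del: sum_constant)
  then have 2: "C * J0 \<le> c powr p * (\<Sum>A\<in>Pow {..N}. I True A * (1 / 2 ^ Suc N))"
    unfolding sum_distrib_right[symmetric] by (simp add: field_simps)
  show "ennreal (strip_const powr p) * (\<integral>\<^sup>+ z. ennreal (norm (\<Sum>n\<le>N. r n (snd z) *\<^sub>R mdiff f n (fst z)) powr p) \<partial>(unit_interval \<Otimes>\<^sub>M M))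
         \<le> ennreal (c powr p) * (\<integral>\<^sup>+ y. ennreal (norm (\<Sum>n\<le>N. mdiff f n y) powr p) \<partial>unit_interval)"
    unfolding E J using 1 J00 by (simp add: C_def I0 sum_nonneg flip: ennreal_mult)
  show "ennreal (strip_const powr p) * (\<integral>\<^sup>+ y. ennreal (norm (\<Sum>n\<le>N. mdiff f n y) powr p) \<partial>unit_interval)
         \<le> ennreal (c powr p) * (\<integral>\<^sup>+ z. ennreal (norm (\<Sum>n\<le>N. r n (snd z) *\<^sub>R mdiff f n (fst z)) powr p) \<partial>(unit_interval \<Otimes>\<^sub>M M))"
    unfolding E J using 2 J00 by (simp add: C_def I0 sum_nonneg flip: ennreal_mult)
qed

section \<open>The exit time of Brownian motion\<close>

text \<open>A multiple of \<open>\<bar>x\<bar>\<close> is a mixture of the functions \<open>1 - cos (s x)\<close>, so that first absolute moments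
  are monotone in the real parts of characteristic functions. This is how the exit time of the
  Brownian motion is compared with the conformal map of the strip.\<close>

definition abs_const :: ennreal where
  "abs_const = (\<integral>\<^sup>+s. ennreal ((1 - cos s) / s\<^sup>2) \<partial>lborel)"

lemma one_minus_cos_le: "(1 - cos s) / s\<^sup>2 \<le> 1" for s :: real
proof (cases "s = 0")
  case False
  have "cos s = 1 - 2 * (sin (s / 2))\<^sup>2" using cos_double_sin[of "s / 2"] by simp
  moreover have "(sin (s / 2))\<^sup>2 \<le> (s / 2)\<^sup>2"
    using abs_sin_x_le_abs_x[of "s / 2"] by (simp only: abs_le_square_iff)
  ultimately have "1 - cos s \<le> s\<^sup>2 / 2" by (simp add: power_divide)
  also have "\<dots> \<le> s\<^sup>2" by simp
  finally show ?thesis using False by (simp add: divide_le_eq)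
qed simp

text \<open>Positivity and finiteness allow the constant to be cancelled in
  \<open>sqrt_moment_le_strip_const\<close>.\<close>

lemma abs_const_pos: "abs_const \<noteq> 0"
proof
  assume "abs_const = 0"
  then have "AE s in lborel. ennreal ((1 - cos s) / s\<^sup>2) = 0"
    unfolding abs_const_def by (subst (asm) nn_integral_0_iff_AE) auto
  then have "AE s::real in lborel. s \<notin> {0<..<1}"
  proof eventually_elim
    case (elim s)
    show ?case
    proof
      assume s: "s \<in> {0<..<1}"
      then have "cos s < cos 0" using pi_gt3 by (intro cos_monotone_0_pi) auto
      then have "0 < (1 - cos s) / s\<^sup>2" using s by simp
      then show False using elim by (simp add: ennreal_eq_0_iff)
    qed
  qed
  then have "emeasure lborel {0<..<1::real} = 0" by (subst (asm) AE_iff_measurable[of "{0<..<1}"]) auto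
  then show False by simp
qed

lemma abs_const_finite: "abs_const < \<infinity>"
proof -
  have tail: "(\<integral>\<^sup>+s. ennreal (2 / s\<^sup>2) * indicator {1..} s \<partial>lborel) < \<infinity>"
  proof -
    have "(\<integral>\<^sup>+s. ennreal (2 / s\<^sup>2) * indicator {1..} s \<partial>lborel) = ennreal (0 - (- 2 / 1))"
    proof (rule nn_integral_FTC_atLeast)
      show "((\<lambda>s::real. - 2 / s) has_field_derivative 2 / s\<^sup>2) (at s)" if "1 \<le> s" for s
        using that by (auto intro!: derivative_eq_intros simp: power2_eq_square)
      show "((\<lambda>s::real. - 2 / s) \<longlongrightarrow> 0) at_top" by real_asymp
    qed auto
    then show ?thesis by simp
  qed
  have tail': "(\<integral>\<^sup>+s. ennreal (2 / s\<^sup>2) * indicator {1..} (- s) \<partial>lborel) = (\<integral>\<^sup>+s. ennreal (2 / s\<^sup>2) * indicator {1..} s \<partial>lborel)"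
    using nn_integral_real_affine[of "\<lambda>s. ennreal (2 / s\<^sup>2) * indicator {1..} s" "-1" 0] by simp
  have "abs_const \<le> (\<integral>\<^sup>+s. indicator {-1..1} s + (ennreal (2 / s\<^sup>2) * indicator {1..} s + ennreal (2 / s\<^sup>2) * indicator {1..} (- s)) \<partial>lborel)"
    unfolding abs_const_def
  proof (rule nn_integral_mono)
    fix s :: real
    have "(1 - cos s) / s\<^sup>2 \<le> 2 / s\<^sup>2" by (intro divide_right_mono) auto
    then have b: "ennreal ((1 - cos s) / s\<^sup>2) \<le> ennreal (2 / s\<^sup>2)" by (rule ennreal_leI)
    have a: "ennreal ((1 - cos s) / s\<^sup>2) \<le> 1" using ennreal_leI[OF one_minus_cos_le[of s]] by simp
    consider "s \<in> {-1..1}" | "1 \<le> s" | "s \<le> -1" by fastforce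
    then show "ennreal ((1 - cos s) / s\<^sup>2) \<le> indicator {-1..1} s + (ennreal (2 / s\<^sup>2) * indicator {1..} s + ennreal (2 / s\<^sup>2) * indicator {1..} (- s))"
    proof cases
      case 1
      then show ?thesis using a by (simp add: add_increasing2)
    next
      case 2
      then show ?thesis using b by (simp add: add_increasing add_increasing2)
    next
      case 3
      then show ?thesis using b by (simp add: add_increasing)
    qed
  qed
  also have "\<dots> = 2 + ((\<integral>\<^sup>+s. ennreal (2 / s\<^sup>2) * indicator {1..} s \<partial>lborel) + (\<integral>\<^sup>+s. ennreal (2 / s\<^sup>2) * indicator {1..} s \<partial>lborel))"
    by (simp add: nn_integral_add nn_integral_cmult tail')
  also have "\<dots> < \<infinity>" using tail by (simp add: ennreal_mult_less_top)
  finally show ?thesis .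
qed

lemma abs_const_mult: "(\<integral>\<^sup>+s. ennreal ((1 - cos (s * x)) / s\<^sup>2) \<partial>lborel) = abs_const * ennreal \<bar>x\<bar>"
proof (cases "x = 0")
  case False
  have "abs_const = ennreal \<bar>x\<bar> * (\<integral>\<^sup>+s. ennreal ((1 - cos (x * s)) / (x * s)\<^sup>2) \<partial>lborel)"
    unfolding abs_const_def using nn_integral_real_affine[of "\<lambda>s. ennreal ((1 - cos s) / s\<^sup>2)" x 0] False by simp
  also have "(\<integral>\<^sup>+s. ennreal ((1 - cos (x * s)) / (x * s)\<^sup>2) \<partial>lborel) = (\<integral>\<^sup>+s. ennreal (1 / x\<^sup>2) * ennreal ((1 - cos (s * x)) / s\<^sup>2) \<partial>lborel)"
    by (intro nn_integral_cong) (simp add: power_mult_distrib mult.commute flip: ennreal_mult)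
  also have "\<dots> = ennreal (1 / x\<^sup>2) * (\<integral>\<^sup>+s. ennreal ((1 - cos (s * x)) / s\<^sup>2) \<partial>lborel)"
    by (rule nn_integral_cmult) measurable
  finally have "ennreal \<bar>x\<bar> * abs_const = (ennreal \<bar>x\<bar> * ennreal \<bar>x\<bar> * ennreal (1 / x\<^sup>2)) * (\<integral>\<^sup>+s. ennreal ((1 - cos (s * x)) / s\<^sup>2) \<partial>lborel)"
    by (simp only: mult.assoc)
  also have "ennreal \<bar>x\<bar> * ennreal \<bar>x\<bar> * ennreal (1 / x\<^sup>2) = 1"
    using False by (simp flip: ennreal_mult add: power2_eq_square abs_mult_self_eq)
  finally show ?thesis by (simp add: mult.commute)
qed simp

lemma (in prob_space) abs_moment:
  assumes Z [measurable]: "Z \<in> borel_measurable M"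
  shows "abs_const * (\<integral>\<^sup>+\<omega>. ennreal \<bar>Z \<omega>\<bar> \<partial>M) = (\<integral>\<^sup>+s. ennreal ((1 - (\<integral>\<omega>. cos (s * Z \<omega>) \<partial>M)) / s\<^sup>2) \<partial>lborel)"
proof -
  interpret pair_sigma_finite lborel M ..
  have "abs_const * (\<integral>\<^sup>+\<omega>. ennreal \<bar>Z \<omega>\<bar> \<partial>M) = (\<integral>\<^sup>+\<omega>. (\<integral>\<^sup>+s. ennreal ((1 - cos (s * Z \<omega>)) / s\<^sup>2) \<partial>lborel) \<partial>M)"
    unfolding abs_const_mult by (rule nn_integral_cmult[symmetric]) measurable
  also have "\<dots> = (\<integral>\<^sup>+s. (\<integral>\<^sup>+\<omega>. ennreal ((1 - cos (s * Z \<omega>)) / s\<^sup>2) \<partial>M) \<partial>lborel)"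
    by (rule Fubini') measurable
  also have "\<dots> = (\<integral>\<^sup>+s. ennreal ((1 - (\<integral>\<omega>. cos (s * Z \<omega>) \<partial>M)) / s\<^sup>2) \<partial>lborel)"
  proof (rule nn_integral_cong)
    fix s :: real
    have i: "integrable M (\<lambda>\<omega>. cos (s * Z \<omega>))" by (rule integrable_const_bound[of _ 1]) auto
    have "(\<integral>\<^sup>+\<omega>. ennreal ((1 - cos (s * Z \<omega>)) / s\<^sup>2) \<partial>M) = ennreal (\<integral>\<omega>. (1 - cos (s * Z \<omega>)) / s\<^sup>2 \<partial>M)"
      using i by (intro nn_integral_eq_integral) auto
    also have "(\<integral>\<omega>. (1 - cos (s * Z \<omega>)) / s\<^sup>2 \<partial>M) = (1 - (\<integral>\<omega>. cos (s * Z \<omega>) \<partial>M)) / s\<^sup>2"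
      using i by (simp add: prob_space)
    finally show "(\<integral>\<^sup>+\<omega>. ennreal ((1 - cos (s * Z \<omega>)) / s\<^sup>2) \<partial>M) = ennreal ((1 - (\<integral>\<omega>. cos (s * Z \<omega>) \<partial>M)) / s\<^sup>2)" .
  qed
  finally show ?thesis .
qed

lemma cos_std_normal: "(\<integral>x. cos (s * x) \<partial>std_normal_distribution) = exp (- (s\<^sup>2 / 2))"
proof -
  interpret prob_space std_normal_distribution by (rule prob_space_normal_density) simp
  have i: "integrable std_normal_distribution (\<lambda>x. iexp (s * x))"
    using integrable_iexp[of "\<lambda>x. complex_of_real (s * x)"] by simp
  have "(\<integral>x. cos (s * x) \<partial>std_normal_distribution) = (\<integral>x. Re (iexp (s * x)) \<partial>std_normal_distribution)"
    by (simp add: Re_exp)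
  also have "\<dots> = Re (char std_normal_distribution s)" unfolding char_def by (rule integral_Re[OF i])
  finally show ?thesis unfolding char_std_normal_distribution by simp
qed

text \<open>For a standard normal \<open>\<gamma>\<close>, the variable
  \<open>sqrt t * \<gamma>\<close> has the characteristic function
  \<open>exp (- s^2 * t / 2)\<close>. For random \<open>t\<close> the integrand becomes a Laplace
  transform, and the left side becomes the first absolute moment of a Brownian motion at an
  independent time.\<close>

lemma abs_moment_exponential:
  assumes "0 \<le> t"
  shows "abs_const * (\<integral>\<^sup>+x. ennreal \<bar>x\<bar> \<partial>std_normal_distribution) * ennreal (sqrt t) =
    (\<integral>\<^sup>+s. ennreal ((1 - exp (- (s\<^sup>2 * t / 2))) / s\<^sup>2) \<partial>lborel)"
proof -
  interpret prob_space std_normal_distribution by (rule prob_space_normal_density) simp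
  have "(\<integral>\<^sup>+x. ennreal \<bar>sqrt t * x\<bar> \<partial>std_normal_distribution) = ennreal (sqrt t) * (\<integral>\<^sup>+x. ennreal \<bar>x\<bar> \<partial>std_normal_distribution)"
    using assms by (simp add: abs_mult ennreal_mult nn_integral_cmult)
  then have "abs_const * (\<integral>\<^sup>+x. ennreal \<bar>x\<bar> \<partial>std_normal_distribution) * ennreal (sqrt t) =
    abs_const * (\<integral>\<^sup>+x. ennreal \<bar>sqrt t * x\<bar> \<partial>std_normal_distribution)" by (simp add: ac_simps)
  also have "\<dots> = (\<integral>\<^sup>+s. ennreal ((1 - (\<integral>x. cos (s * (sqrt t * x)) \<partial>std_normal_distribution)) / s\<^sup>2) \<partial>lborel)"
    by (rule abs_moment) measurable
  also have "(\<lambda>s. \<integral>x. cos (s * (sqrt t * x)) \<partial>std_normal_distribution) = (\<lambda>s. exp (- (s\<^sup>2 * t / 2)))"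
    using cos_std_normal[of "s * sqrt t" for s] assms by (simp add: mult.assoc power_mult_distrib)
  finally show ?thesis .
qed

text \<open>Integrating \<open>abs_moment_exponential\<close> over \<open>T\<close> writes the left
  side as a mixture of \<open>1 - E exp (- s^2 * T / 2)\<close>. The hypothesis compares it for each
  \<open>s\<close> with \<open>1 - 1 / cosh s\<close>, which gives the corresponding mixture for
  \<open>strip_im\<close>.\<close>

lemma (in prob_space) sqrt_moment_le_strip_const:
  assumes T [measurable]: "T \<in> borel_measurable M" and T0: "\<And>\<omega>. 0 \<le> T \<omega>"
    and laplace: "\<And>s. 0 < s \<Longrightarrow> 1 / cosh s \<le> (\<integral>\<omega>. exp (- (s\<^sup>2 * T \<omega> / 2)) \<partial>M)"
  shows "(\<integral>\<^sup>+x. ennreal \<bar>x\<bar> \<partial>std_normal_distribution) * (\<integral>\<^sup>+\<omega>. ennreal (sqrt (T \<omega>)) \<partial>M) \<le> ennreal strip_const"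
proof -
  interpret pair_sigma_finite lborel M ..
  let ?G = "\<integral>\<^sup>+x. ennreal \<bar>x\<bar> \<partial>std_normal_distribution"
  have "abs_const * (?G * (\<integral>\<^sup>+\<omega>. ennreal (sqrt (T \<omega>)) \<partial>M)) = (\<integral>\<^sup>+\<omega>. abs_const * ?G * ennreal (sqrt (T \<omega>)) \<partial>M)"
    by (simp add: nn_integral_cmult mult.assoc)
  also have "\<dots> = (\<integral>\<^sup>+\<omega>. (\<integral>\<^sup>+s. ennreal ((1 - exp (- (s\<^sup>2 * T \<omega> / 2))) / s\<^sup>2) \<partial>lborel) \<partial>M)"
    by (intro nn_integral_cong abs_moment_exponential T0)
  also have "\<dots> = (\<integral>\<^sup>+s. (\<integral>\<^sup>+\<omega>. ennreal ((1 - exp (- (s\<^sup>2 * T \<omega> / 2))) / s\<^sup>2) \<partial>M) \<partial>lborel)"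
    by (rule Fubini') measurable
  also have "\<dots> \<le> (\<integral>\<^sup>+s. ennreal ((1 - 1 / cosh s) / s\<^sup>2) \<partial>lborel)"
  proof (rule nn_integral_mono)
    fix s :: real
    have e: "0 \<le> s\<^sup>2 * T \<omega> / 2" for \<omega> using T0[of \<omega>] by simp
    have i: "integrable M (\<lambda>\<omega>. exp (- (s\<^sup>2 * T \<omega> / 2)))"
      using e by (intro integrable_const_bound[of _ 1]) auto
    \<comment> \<open>Both sides are even in \<open>s\<close> and equal 1 at \<open>s = 0\<close>,
      so the hypothesis for positive \<open>s\<close> covers all cases.\<close>
    have le: "1 / cosh s \<le> (\<integral>\<omega>. exp (- (s\<^sup>2 * T \<omega> / 2)) \<partial>M)"
      using laplace[of s] laplace[of "- s"] by (cases s "0::real" rule: linorder_cases) (auto simp: prob_space)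
    have "(\<integral>\<^sup>+\<omega>. ennreal ((1 - exp (- (s\<^sup>2 * T \<omega> / 2))) / s\<^sup>2) \<partial>M) = ennreal (\<integral>\<omega>. (1 - exp (- (s\<^sup>2 * T \<omega> / 2))) / s\<^sup>2 \<partial>M)"
      using i e by (intro nn_integral_eq_integral) auto
    also have "(\<integral>\<omega>. (1 - exp (- (s\<^sup>2 * T \<omega> / 2))) / s\<^sup>2 \<partial>M) = (1 - (\<integral>\<omega>. exp (- (s\<^sup>2 * T \<omega> / 2)) \<partial>M)) / s\<^sup>2"
      using i by (simp add: prob_space)
    also have "ennreal \<dots> \<le> ennreal ((1 - 1 / cosh s) / s\<^sup>2)"
      using le by (intro ennreal_leI divide_right_mono) auto
    finally show "(\<integral>\<^sup>+\<omega>. ennreal ((1 - exp (- (s\<^sup>2 * T \<omega> / 2))) / s\<^sup>2) \<partial>M) \<le> ennreal ((1 - 1 / cosh s) / s\<^sup>2)" .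
  qed
  also have "\<dots> = abs_const * (\<integral>\<^sup>+\<theta>. ennreal \<bar>strip_im \<theta>\<bar> \<partial>circ)"
    unfolding char_strip_im[symmetric] by (rule circ.abs_moment[symmetric]) measurable
  also have "(\<integral>\<^sup>+\<theta>. ennreal \<bar>strip_im \<theta>\<bar> \<partial>circ) = ennreal strip_const"
    unfolding strip_const_def by (rule nn_integral_eq_integral[OF integrable_strip_im]) simp
  finally show ?thesis
    using abs_const_pos abs_const_finite by (simp add: ennreal_mult_le_mult_iff top.not_eq_extremum)
qed

section \<open>Gaussian exponential moments and Brownian increments\<close>

lemma gauss_exp:
  assumes "0 < \<sigma>"
  shows "integrable (gauss \<sigma>) (\<lambda>x. exp (r * x))" "(\<integral>x. exp (r * x) \<partial>gauss \<sigma>) = exp (r\<^sup>2 * \<sigma>\<^sup>2 / 2)"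
proof -
  have e: "normal_density 0 \<sigma> x * exp (r * x) = exp (r\<^sup>2 * \<sigma>\<^sup>2 / 2) * normal_density (r * \<sigma>\<^sup>2) \<sigma> x" for x
  proof -
    have "- x\<^sup>2 / (2 * \<sigma>\<^sup>2) + r * x = r\<^sup>2 * \<sigma>\<^sup>2 / 2 + - (x - r * \<sigma>\<^sup>2)\<^sup>2 / (2 * \<sigma>\<^sup>2)"
      using assms by (simp add: field_simps power2_eq_square)
    then have "exp (- x\<^sup>2 / (2 * \<sigma>\<^sup>2)) * exp (r * x) = exp (r\<^sup>2 * \<sigma>\<^sup>2 / 2) * exp (- (x - r * \<sigma>\<^sup>2)\<^sup>2 / (2 * \<sigma>\<^sup>2))"
      by (simp flip: exp_add)
    then show ?thesis by (simp add: normal_density_def)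
  qed
  show "integrable (gauss \<sigma>) (\<lambda>x. exp (r * x))"
    unfolding gauss_def using assms by (subst integrable_density) (auto simp: e integrable_normal_density)
  show "(\<integral>x. exp (r * x) \<partial>gauss \<sigma>) = exp (r\<^sup>2 * \<sigma>\<^sup>2 / 2)"
    unfolding gauss_def using assms by (subst integral_density) (auto simp: e integral_normal_density)
qed

lemma gauss_cosh_sinh:
  assumes "0 < \<sigma>"
  shows "integrable (gauss \<sigma>) (\<lambda>x. cosh (r * x))" "(\<integral>x. cosh (r * x) \<partial>gauss \<sigma>) = exp (r\<^sup>2 * \<sigma>\<^sup>2 / 2)"
    and "integrable (gauss \<sigma>) (\<lambda>x. sinh (r * x))" "(\<integral>x. sinh (r * x) \<partial>gauss \<sigma>) = 0"
  using gauss_exp[OF assms, of r] gauss_exp[OF assms, of "- r"] by (simp_all add: cosh_field_def sinh_field_def)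

lemma gauss_exp_abs:
  assumes "0 < \<sigma>"
  shows "integrable (gauss \<sigma>) (\<lambda>x. exp (r * \<bar>x\<bar>))" "(\<integral>x. exp (r * \<bar>x\<bar>) \<partial>gauss \<sigma>) \<le> 2 * exp (r\<^sup>2 * \<sigma>\<^sup>2 / 2)"
proof -
  note i = gauss_exp[OF assms, of r] gauss_exp[OF assms, of "- r"]
  have le: "exp (r * \<bar>x\<bar>) \<le> exp (r * x) + exp (- r * x)" for x by (cases "0 \<le> x") auto
  have i2: "integrable (gauss \<sigma>) (\<lambda>x. exp (r * x) + exp (- r * x))" using i by (intro Bochner_Integration.integrable_add) auto
  show i3: "integrable (gauss \<sigma>) (\<lambda>x. exp (r * \<bar>x\<bar>))"
    by (rule Bochner_Integration.integrable_bound[OF i2]) (use le in \<open>auto intro: order_trans\<close>)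
  have "(\<integral>x. exp (r * \<bar>x\<bar>) \<partial>gauss \<sigma>) \<le> (\<integral>x. exp (r * x) + exp (- r * x) \<partial>gauss \<sigma>)"
    by (rule integral_mono[OF i3 i2]) (rule le)
  also have "\<dots> = 2 * exp (r\<^sup>2 * \<sigma>\<^sup>2 / 2)" using i by simp
  finally show "(\<integral>x. exp (r * \<bar>x\<bar>) \<partial>gauss \<sigma>) \<le> 2 * exp (r\<^sup>2 * \<sigma>\<^sup>2 / 2)" .
qed

lemma gauss_unit_interval: "0 < \<sigma> \<Longrightarrow> measure (gauss \<sigma>) {-1<..<1} \<le> 1 / \<sigma>"
proof -
  assume s: "0 < \<sigma>"
  have le: "normal_density 0 \<sigma> x \<le> 1 / (2 * \<sigma>)" for x
  proof -
    have "2 * \<sigma> = sqrt (4 * \<sigma>\<^sup>2)" using s by (simp add: real_sqrt_mult)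
    also have "\<dots> \<le> sqrt (2 * pi * \<sigma>\<^sup>2)" using pi_gt3 by (intro real_sqrt_le_mono mult_right_mono) auto
    finally have "1 / sqrt (2 * pi * \<sigma>\<^sup>2) \<le> 1 / (2 * \<sigma>)" using s by (intro divide_left_mono) auto
    moreover have "exp (- (x - 0)\<^sup>2 / (2 * \<sigma>\<^sup>2)) \<le> 1" by simp
    ultimately have "1 / sqrt (2 * pi * \<sigma>\<^sup>2) * exp (- (x - 0)\<^sup>2 / (2 * \<sigma>\<^sup>2)) \<le> 1 / (2 * \<sigma>) * 1"
      using s by (intro mult_mono) auto
    then show ?thesis by (simp add: normal_density_def)
  qed
  have "emeasure (gauss \<sigma>) {-1<..<1} = (\<integral>\<^sup>+x. ennreal (normal_density 0 \<sigma> x) * indicator {-1<..<1} x \<partial>lborel)"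
    unfolding gauss_def by (rule emeasure_density) auto
  also have "\<dots> \<le> (\<integral>\<^sup>+x. ennreal (1 / (2 * \<sigma>)) * indicator {-1<..<1} (x :: real) \<partial>lborel)"
    by (rule nn_integral_mono) (rule mult_right_mono[OF ennreal_leI[OF le]], simp)
  also have "\<dots> = ennreal (1 / (2 * \<sigma>)) * emeasure lborel {-1<..<1::real}" by (rule nn_integral_cmult_indicator) simp
  also have "\<dots> = ennreal (1 / (2 * \<sigma>)) * ennreal 2" by simp
  also have "\<dots> = ennreal (1 / \<sigma>)" using s by (simp flip: ennreal_mult del: ennreal_numeral)
  finally show ?thesis using s by (simp add: measure_def enn2real_leI)
qed

lemma brownian_increment_distr:
  assumes "brownian_motion_wrt M F W" "0 \<le> s" "s < t"
  shows "(\<lambda>\<omega>. W t \<omega> - W s \<omega>) \<in> borel_measurable M"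
    and "distr M borel (\<lambda>\<omega>. W t \<omega> - W s \<omega>) = gauss (sqrt (t - s))"
proof -
  have d: "distributed M lborel (\<lambda>\<omega>. W t \<omega> - W s \<omega>) (normal_density 0 (sqrt (t - s)))"
    using assms unfolding brownian_motion_wrt_def by auto
  show "(\<lambda>\<omega>. W t \<omega> - W s \<omega>) \<in> borel_measurable M"
    using distributed_measurable[OF d] by simp
  show "distr M borel (\<lambda>\<omega>. W t \<omega> - W s \<omega>) = gauss (sqrt (t - s))"
    using distributed_distr_eq_density[OF d] by (simp add: gauss_def cong: distr_cong)
qed

lemma brownian_increment_integral:
  fixes g :: "real \<Rightarrow> real"
  assumes B: "brownian_motion_wrt M F W" "0 \<le> s" "s < t" and g: "g \<in> borel_measurable borel"
  shows "integrable (gauss (sqrt (t - s))) g \<Longrightarrow> integrable M (\<lambda>\<omega>. g (W t \<omega> - W s \<omega>))"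
    and "(\<integral>\<omega>. g (W t \<omega> - W s \<omega>) \<partial>M) = (\<integral>x. g x \<partial>gauss (sqrt (t - s)))"
  using integrable_distr_eq[OF brownian_increment_distr(1)[OF B] g] integral_distr[OF brownian_increment_distr(1)[OF B] g]
  by (simp_all add: brownian_increment_distr(2)[OF B])

lemma brownian_increment_product:
  fixes g :: "real \<Rightarrow> real"
  assumes B: "brownian_motion_wrt M F W" "0 \<le> s" "s < t"
    and U: "U \<in> borel_measurable (F s)" "integrable M U"
    and g: "g \<in> borel_measurable borel" "integrable (gauss (sqrt (t - s))) g"
  shows "integrable M (\<lambda>\<omega>. U \<omega> * g (W t \<omega> - W s \<omega>))"
    and "(\<integral>\<omega>. U \<omega> * g (W t \<omega> - W s \<omega>) \<partial>M) = (\<integral>\<omega>. U \<omega> \<partial>M) * (\<integral>x. g x \<partial>gauss (sqrt (t - s)))"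
proof -
  interpret prob_space M using B by (simp add: brownian_motion_wrt_def)
  interpret filtration "space M" F using B by (simp add: brownian_motion_wrt_def)
  have ind: "indep_set (sets (F s)) (sets (vimage_algebra (space M) (\<lambda>\<omega>. W t \<omega> - W s \<omega>) borel))"
    using B unfolding brownian_motion_wrt_def by auto
  note D = brownian_increment_distr(1)[OF B]
  have "indep_var borel U borel (\<lambda>\<omega>. g (W t \<omega> - W s \<omega>))"
    unfolding indep_var_eq
  proof (intro conjI indep_set_sigma_sets)
    show "random_variable borel U" using U(2) by simp
    show "random_variable borel (\<lambda>\<omega>. g (W t \<omega> - W s \<omega>))" using D g(1) by measurable
    show "Int_stable {U -` A \<inter> space M |A. A \<in> sets borel}"
      unfolding Int_stable_def by (safe, metis (no_types, lifting) Int_assoc inf_left_idem inf_commute vimage_Int sets.Int)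
    show "Int_stable {(\<lambda>\<omega>. g (W t \<omega> - W s \<omega>)) -` A \<inter> space M |A. A \<in> sets borel}"
      unfolding Int_stable_def by (safe, metis (no_types, lifting) Int_assoc inf_left_idem inf_commute vimage_Int sets.Int)
    show "indep_set {U -` A \<inter> space M |A. A \<in> sets borel} {(\<lambda>\<omega>. g (W t \<omega> - W s \<omega>)) -` A \<inter> space M |A. A \<in> sets borel}"
      unfolding indep_set_def
    proof (rule indep_sets_mono_sets[OF ind[unfolded indep_set_def]])
      fix i
      have 1: "U -` A \<inter> space M \<in> sets (F s)" if "A \<in> sets borel" for A
        using measurable_sets[OF U(1) that] by (simp add: space_F)
      have 2: "(\<lambda>\<omega>. g (W t \<omega> - W s \<omega>)) -` A \<inter> space M \<in> sets (vimage_algebra (space M) (\<lambda>\<omega>. W t \<omega> - W s \<omega>) borel)" if "A \<in> sets borel" for A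
        using in_vimage_algebra[OF measurable_sets[OF g(1) that], of "\<lambda>\<omega>. W t \<omega> - W s \<omega>" "space M"]
        by (simp add: vimage_comp comp_def)
      show "(case i of True \<Rightarrow> {U -` A \<inter> space M |A. A \<in> sets borel} | False \<Rightarrow> {(\<lambda>\<omega>. g (W t \<omega> - W s \<omega>)) -` A \<inter> space M |A. A \<in> sets borel}) \<subseteq>
        (case i of True \<Rightarrow> sets (F s) | False \<Rightarrow> sets (vimage_algebra (space M) (\<lambda>\<omega>. W t \<omega> - W s \<omega>) borel))"
        using 1 2 by (cases i) auto
    qed
  qed
  from indep_var_integrable[OF this U(2) brownian_increment_integral(1)[OF B g]]
    indep_var_lebesgue_integral[OF this U(2) brownian_increment_integral(1)[OF B g]]
  show "integrable M (\<lambda>\<omega>. U \<omega> * g (W t \<omega> - W s \<omega>))"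
    and "(\<integral>\<omega>. U \<omega> * g (W t \<omega> - W s \<omega>) \<partial>M) = (\<integral>\<omega>. U \<omega> \<partial>M) * (\<integral>x. g x \<partial>gauss (sqrt (t - s)))"
    by (simp_all add: brownian_increment_integral(2)[OF B g(1)])
qed

text \<open>A discrete exit time, so that the stopping argument involves only increments over
  intervals of length \<open>h\<close>. The paths that never satisfy the condition, for which
  \<open>LEAST\<close> is unspecified, form a null event for Brownian motion.\<close>

definition grid_hit :: "(real \<Rightarrow> 'w \<Rightarrow> real) \<Rightarrow> real \<Rightarrow> 'w \<Rightarrow> nat" where
  "grid_hit W h \<omega> = (LEAST k. 1 \<le> \<bar>W (real k * h) \<omega>\<bar>)"

text \<open>A jump \<open>d\<close> from inside the interval overshoots by at most
  \<open>\<bar>d\<bar>\<close>. If \<open>\<bar>d\<bar> \<le> \<delta>\<close>, this costs a factor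
  \<open>exp (s * \<delta>)\<close>; otherwise the factor
  \<open>exp (l * (\<bar>d\<bar> - \<delta>)) \<ge> 1\<close> is inserted, as in an exponential
  Chebyshev inequality with free parameter \<open>l\<close>.\<close>

lemma overshoot_bound:
  fixes s x d \<delta> l :: real
  assumes "0 \<le> s" "0 \<le> l" and x: "\<bar>x\<bar> < 1"
  shows "cosh (s * (x + d)) \<le> cosh s * (exp (s * \<delta>) + exp (- l * \<delta>) * exp ((s + l) * \<bar>d\<bar>))"
proof -
  have "cosh (s * (x + d)) = cosh \<bar>s * (x + d)\<bar>" by simp
  also have "\<dots> \<le> cosh (s * 1 + s * \<bar>d\<bar>)"
  proof -
    have "\<bar>s * (x + d)\<bar> = s * \<bar>x + d\<bar>" using assms(1) by (simp add: abs_mult)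
    also have "\<dots> \<le> s * (1 + \<bar>d\<bar>)" using x assms(1) by (intro mult_left_mono) auto
    finally show ?thesis using assms(1) by (subst cosh_real_nonneg_le_iff) (auto simp: distrib_left)
  qed
  also have "\<dots> = cosh s * cosh (s * \<bar>d\<bar>) + sinh s * sinh (s * \<bar>d\<bar>)" by (simp add: cosh_add)
  also have "\<dots> \<le> cosh s * cosh (s * \<bar>d\<bar>) + cosh s * sinh (s * \<bar>d\<bar>)"
    using assms(1) by (intro add_left_mono mult_right_mono sinh_less_cosh_real[THEN less_imp_le]) auto
  also have "\<dots> = cosh s * exp (s * \<bar>d\<bar>)" by (simp add: cosh_plus_sinh flip: distrib_left)
  also have "\<dots> \<le> cosh s * (exp (s * \<delta>) + exp (- l * \<delta>) * exp ((s + l) * \<bar>d\<bar>))"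
  proof (intro mult_left_mono)
    show "exp (s * \<bar>d\<bar>) \<le> exp (s * \<delta>) + exp (- l * \<delta>) * exp ((s + l) * \<bar>d\<bar>)"
    proof (cases "\<bar>d\<bar> \<le> \<delta>")
      case True
      then have "exp (s * \<bar>d\<bar>) \<le> exp (s * \<delta>)" using assms(1) by (simp add: mult_left_mono)
      then show ?thesis by (simp add: add_increasing2)
    next
      case False
      then have "0 \<le> l * (\<bar>d\<bar> - \<delta>)" using assms(2) by simp
      then have "s * \<bar>d\<bar> \<le> - l * \<delta> + (s + l) * \<bar>d\<bar>" by (simp add: algebra_simps)
      then have "exp (s * \<bar>d\<bar>) \<le> exp (- l * \<delta>) * exp ((s + l) * \<bar>d\<bar>)" by (simp only: exp_add[symmetric] exp_le_cancel_iff)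
      then show ?thesis by (simp add: add_increasing)
    qed
  qed simp
  finally show ?thesis .
qed

text \<open>The martingale \<open>exp (- s^2 * t / 2) * cosh (s * W t)\<close> is stopped at the
  first grid time with \<open>\<bar>W\<bar> \<ge> 1\<close>. Without overshoot the hyperbolic cosine
  would equal \<open>cosh s\<close> there. The second summand pays for large overshoots at all grid
  times; its last factor bounds the sum of the discount factors.\<close>

lemma grid_laplace:
  assumes B: "brownian_motion M W" and h: "0 < h" and s: "0 < s" and l: "0 \<le> l"
  shows "1 \<le> cosh s * (exp (s * \<delta>) * (\<integral>\<omega>. exp (- (s\<^sup>2 * (h * real (grid_hit W h \<omega>)) / 2)) \<partial>M) +
    exp (- l * \<delta>) * (2 * exp ((s + l)\<^sup>2 * h / 2)) * (2 / (s\<^sup>2 * h)))"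
proof -
  define F where "F = natural_filtration M W"
  have B: "brownian_motion_wrt M F W" using B by (simp add: brownian_motion_def F_def)
  interpret prob_space M using B by (simp add: brownian_motion_wrt_def)
  interpret filtration "space M" F using B by (simp add: brownian_motion_wrt_def)
  define w where "w = (\<lambda>k::nat. W (real k * h))"
  define D where "D = (\<lambda>k \<omega>. w (Suc k) \<omega> - w k \<omega>)"
  define G where "G = (\<lambda>k::nat. F (real k * h))"
  have sub: "sets (G k) \<subseteq> sets M" for k using B h by (simp add: brownian_motion_wrt_def G_def)
  have wF: "w i \<in> borel_measurable (G k)" if "i \<le> k" for i k
  proof -
    have "w i \<in> borel_measurable (F (real i * h))" using B h by (simp add: brownian_motion_wrt_def w_def)
    moreover have "sets (F (real i * h)) \<subseteq> sets (F (real k * h))" using that h by (intro sets_F_mono mult_right_mono) auto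
    ultimately show ?thesis unfolding G_def measurable_def by (auto simp: space_F)
  qed
  have GM: "f \<in> borel_measurable M" if "f \<in> borel_measurable (G k)" for f :: "'a \<Rightarrow> real" and k
    using that sub[of k] unfolding measurable_def G_def by (auto simp: space_F)
  have wM [measurable]: "w i \<in> borel_measurable M" for i using GM[OF wF[OF order_refl]] .
  define A where "A = (\<lambda>k. {\<omega> \<in> space M. \<forall>i\<le>k. \<bar>w i \<omega>\<bar> < 1})"
  have AG: "A k \<in> sets (G k)" for k
  proof -
    have "A k = (\<Inter>i\<in>{..k}. w i -` {-1<..<1} \<inter> space (G k))" unfolding A_def G_def space_F by (auto simp: abs_less_iff)
    also have "\<dots> \<in> sets (G k)" by (intro sets.finite_INT measurable_sets[OF wF]) auto
    finally show ?thesis .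
  qed
  have AM [measurable]: "A k \<in> sets M" for k using AG sub by blast
  have times: "0 \<le> real k * h" "real k * h < real (Suc k) * h" "real (Suc k) * h - real k * h = h" for k
    using h by (auto simp: algebra_simps)
  have sh: "0 < sqrt h" "(sqrt h)\<^sup>2 = h" using h by auto
  note incr = brownian_increment_integral[OF B times(1,2), unfolded times(3)]
  note prod = brownian_increment_product[OF B times(1,2), unfolded times(3)]
  define q where "q = exp (- (s\<^sup>2 * h / 2))"
  have q: "0 < q" "q < 1" using s h by (auto simp: q_def)
  have qK: "exp (- (s\<^sup>2 * (h * real n) / 2)) = q ^ n" for n
    unfolding q_def by (simp add: exp_of_nat_mult[symmetric] algebra_simps)
  \<comment> \<open>The contribution, without discount factor, of the paths that are still inside at
    grid index \<open>k\<close>.\<close>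
  define a where "a = (\<lambda>k. \<integral>\<omega>. indicator (A k) \<omega> * cosh (s * w k \<omega>) \<partial>M)"
  have cw: "cosh (s * w k \<omega>) \<le> cosh s" "\<bar>sinh (s * w k \<omega>)\<bar> \<le> cosh s" if "\<omega> \<in> A k" for k \<omega>
  proof -
    have "\<bar>w k \<omega>\<bar> \<le> 1" using that by (auto simp: A_def intro: less_imp_le)
    then have b: "\<bar>s * w k \<omega>\<bar> \<le> s" using s by (simp add: abs_mult mult_left_le)
    have "cosh \<bar>s * w k \<omega>\<bar> \<le> cosh s" using b s by (subst cosh_real_nonneg_le_iff) auto
    then show "cosh (s * w k \<omega>) \<le> cosh s" by simp
    moreover have "\<bar>sinh (s * w k \<omega>)\<bar> \<le> cosh (s * w k \<omega>)"
      using sinh_less_cosh_real[of "\<bar>s * w k \<omega>\<bar>"] by (simp add: sinh_real_abs[symmetric] del: sinh_real_abs) 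
    ultimately show "\<bar>sinh (s * w k \<omega>)\<bar> \<le> cosh s" by simp
  qed
  have cosh_pos: "0 \<le> cosh (x::real)" for x by (simp add: less_imp_le)
  define Uc where "Uc = (\<lambda>k \<omega>. indicator (A k) \<omega> * cosh (s * w k \<omega>))"
  define Us where "Us = (\<lambda>k \<omega>. indicator (A k) \<omega> * sinh (s * w k \<omega>))"
  have U: "Uc k \<in> borel_measurable (G k)" "Us k \<in> borel_measurable (G k)" for k
  proof -
    note [measurable] = AG[of k] wF[OF order_refl[of k]]
    have [measurable]: "cosh \<in> borel_measurable (borel :: real measure)" "sinh \<in> borel_measurable (borel :: real measure)"
      by (intro borel_measurable_continuous_onI continuous_intros)+
    show "Uc k \<in> borel_measurable (G k)" "Us k \<in> borel_measurable (G k)" unfolding Uc_def Us_def by measurable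
  qed
  have UI: "integrable M (Uc k)" "integrable M (Us k)" for k
    by (rule integrable_const_bound[of _ "cosh s", OF AE_I2 GM[OF U(1)]], use cw(1) in \<open>auto simp: Uc_def indicator_def cosh_pos\<close>)
      (rule integrable_const_bound[of _ "cosh s", OF AE_I2 GM[OF U(2)]], use cw(2) in \<open>auto simp: Us_def indicator_def cosh_pos\<close>)
  have Dm [measurable]: "D k \<in> borel_measurable M" for k unfolding D_def by measurable
  have cm: "(\<lambda>x::real. cosh (s * x)) \<in> borel_measurable borel" "(\<lambda>x::real. sinh (s * x)) \<in> borel_measurable borel"
    by (intro borel_measurable_continuous_onI continuous_intros)+
  \<comment> \<open>After integration the term with the hyperbolic sine vanishes by symmetry of the
    increment, and the other one gains the factor \<open>1 / q\<close>, which the discount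
    cancels.\<close>
  have next_eq: "indicator (A k) \<omega> * cosh (s * w (Suc k) \<omega>) = Uc k \<omega> * cosh (s * D k \<omega>) + Us k \<omega> * sinh (s * D k \<omega>)" for k \<omega>
  proof -
    have "s * w (Suc k) \<omega> = s * w k \<omega> + s * D k \<omega>" by (simp add: D_def algebra_simps)
    then show ?thesis unfolding Uc_def Us_def by (simp only: cosh_add) (simp add: algebra_simps)
  qed
  note P = prod[OF U(1)[unfolded G_def] UI(1) cm(1) gauss_cosh_sinh(1)[OF sh(1), of s]]
    prod[OF U(2)[unfolded G_def] UI(2) cm(2) gauss_cosh_sinh(3)[OF sh(1), of s]]
  have nextI: "integrable M (\<lambda>\<omega>. indicator (A k) \<omega> * cosh (s * w (Suc k) \<omega>))"
    and next_val: "(\<integral>\<omega>. indicator (A k) \<omega> * cosh (s * w (Suc k) \<omega>) \<partial>M) = a k / q" for k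
    unfolding next_eq using P[of k] gauss_cosh_sinh(2,4)[OF sh(1), of s]
    by (simp_all add: D_def w_def a_def Uc_def q_def exp_minus sh(2) field_simps)
  define Hm where "Hm = (\<lambda>k. A k - A (Suc k))"
  have [measurable]: "Hm k \<in> sets M" for k unfolding Hm_def by measurable
  have Asub: "A (Suc k) \<subseteq> A k" for k unfolding A_def by auto
  define R where "R = exp (- l * \<delta>) * (2 * exp ((s + l)\<^sup>2 * h / 2))"
  \<comment> \<open>Paths still inside pass on to \<open>a (Suc k)\<close>; those that leave, the
    event \<open>Hm k\<close>, are bounded by the overshoot estimate. The term with \<open>R\<close>
    is not restricted to \<open>Hm k\<close>; the discount factor makes it summable.\<close>
  have step: "q ^ k * a k \<le> q ^ Suc k * a (Suc k) + cosh s * (exp (s * \<delta>) * (q ^ Suc k * prob (Hm k)) + R * q ^ Suc k)" for k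
  proof -
    have Ei: "integrable M (\<lambda>\<omega>. exp ((s + l) * \<bar>D k \<omega>\<bar>))" and Ev: "(\<integral>\<omega>. exp ((s + l) * \<bar>D k \<omega>\<bar>) \<partial>M) \<le> 2 * exp ((s + l)\<^sup>2 * h / 2)"
      using incr[of "\<lambda>x. exp ((s + l) * \<bar>x\<bar>)" k] gauss_exp_abs[OF sh(1), of "s + l"] by (simp_all add: D_def w_def sh(2))
    have i2: "integrable M (\<lambda>\<omega>. Uc (Suc k) \<omega> + cosh s * (exp (s * \<delta>) * indicator (Hm k) \<omega> + exp (- l * \<delta>) * exp ((s + l) * \<bar>D k \<omega>\<bar>)))"
      using UI Ei by (intro Bochner_Integration.integrable_add integrable_mult_right) (auto simp: emeasure_eq_measure)
    have "a k / q \<le> (\<integral>\<omega>. Uc (Suc k) \<omega> + cosh s * (exp (s * \<delta>) * indicator (Hm k) \<omega> + exp (- l * \<delta>) * exp ((s + l) * \<bar>D k \<omega>\<bar>)) \<partial>M)"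
      unfolding next_val[symmetric]
    proof (rule integral_mono[OF nextI i2])
      fix \<omega>
      consider "\<omega> \<notin> A k" | "\<omega> \<in> A (Suc k)" | "\<omega> \<in> Hm k" using Asub[of k] by (auto simp: Hm_def)
      then show "indicator (A k) \<omega> * cosh (s * w (Suc k) \<omega>) \<le> Uc (Suc k) \<omega> + cosh s * (exp (s * \<delta>) * indicator (Hm k) \<omega> + exp (- l * \<delta>) * exp ((s + l) * \<bar>D k \<omega>\<bar>))"
      proof cases
        case 1
        then show ?thesis by (simp add: Uc_def cosh_pos)
      next
        case 2
        then show ?thesis using Asub[of k] by (auto simp: Uc_def cosh_pos Hm_def)
      next
        case 3
        then have "\<bar>w k \<omega>\<bar> < 1" by (simp add: Hm_def A_def)
        from overshoot_bound[OF less_imp_le[OF s] l this, of "D k \<omega>" \<delta>] 3 show ?thesis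
          by (simp add: Hm_def Uc_def D_def)
      qed
    qed
    also have "\<dots> = a (Suc k) + cosh s * (exp (s * \<delta>) * prob (Hm k) + exp (- l * \<delta>) * (\<integral>\<omega>. exp ((s + l) * \<bar>D k \<omega>\<bar>) \<partial>M))"
      using UI(1)[of "Suc k"] Ei by (simp add: a_def Uc_def emeasure_eq_measure)
    also have "\<dots> \<le> a (Suc k) + cosh s * (exp (s * \<delta>) * prob (Hm k) + R)"
      unfolding R_def using Ev by (intro add_left_mono mult_left_mono cosh_pos) auto
    finally have "q ^ Suc k * (a k / q) \<le> q ^ Suc k * (a (Suc k) + cosh s * (exp (s * \<delta>) * prob (Hm k) + R))"
      using q by (intro mult_left_mono) auto
    moreover have "q ^ Suc k * (a k / q) = q ^ k * a k" using q by simp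
    ultimately show ?thesis by (simp add: algebra_simps)
  qed
  have sum: "a 0 \<le> q ^ n * a n + cosh s * (exp (s * \<delta>) * (\<Sum>k<n. q ^ Suc k * prob (Hm k)) + R * (\<Sum>k<n. q ^ Suc k))" for n
  proof (induction n)
    case (Suc n)
    then show ?case using step[of n] by (simp add: algebra_simps)
  qed simp
  have a0: "a 0 = 1"
  proof -
    have "AE \<omega> in M. W 0 \<omega> = 0" using B by (simp add: brownian_motion_wrt_def)
    then have "AE \<omega> in M. indicator (A 0) \<omega> * cosh (s * w 0 \<omega>) = 1"
      using AE_space by eventually_elim (simp add: A_def w_def)
    then have "a 0 = (\<integral>\<omega>. 1 \<partial>M)" unfolding a_def
      by (intro integral_cong_AE GM[OF U(1)[of 0], unfolded Uc_def]) auto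
    then show ?thesis by (simp add: prob_space)
  qed
  have an: "a n \<le> cosh s" for n
  proof -
    have "a n \<le> (\<integral>\<omega>. cosh s \<partial>M)" unfolding a_def
      by (rule integral_mono[OF UI(1)[of n, unfolded Uc_def]]) (use cw(1) cosh_pos in \<open>auto simp: indicator_def\<close>)
    then show ?thesis by (simp add: prob_space)
  qed
  define K where "K = grid_hit W h"
  have [measurable]: "K \<in> measurable M (count_space UNIV)"
    unfolding K_def grid_hit_def w_def[symmetric, THEN fun_cong] by measurable
  define L where "L = (\<integral>\<omega>. q ^ K \<omega> \<partial>M)"
  have iL: "integrable M (\<lambda>\<omega>. q ^ K \<omega>)"
    using q by (intro integrable_const_bound[of _ 1]) (auto intro!: AE_I2 power_le_one)
  have HK: "K \<omega> = Suc k" if "\<omega> \<in> Hm k" for \<omega> k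
    unfolding K_def grid_hit_def
  proof (rule Least_equality)
    have 1: "\<forall>i\<le>k. \<bar>w i \<omega>\<bar> < 1" and 2: "\<not> (\<forall>i\<le>Suc k. \<bar>w i \<omega>\<bar> < 1)" using that by (auto simp: Hm_def A_def)
    then show "1 \<le> \<bar>W (real (Suc k) * h) \<omega>\<bar>" unfolding w_def by (metis le_Suc_eq not_le)
    show "Suc k \<le> i" if "1 \<le> \<bar>W (real i * h) \<omega>\<bar>" for i
      using 1 that unfolding w_def by (metis not_less not_less_eq_eq)
  qed
  have hits: "(\<Sum>k<n. q ^ Suc k * prob (Hm k)) \<le> L" for n
  proof -
    have "(\<Sum>k<n. q ^ Suc k * prob (Hm k)) = (\<integral>\<omega>. (\<Sum>k<n. q ^ Suc k * indicator (Hm k) \<omega>) \<partial>M)"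
      by (subst Bochner_Integration.integral_sum) (auto simp: emeasure_eq_measure)
    also have "\<dots> \<le> L" unfolding L_def
    proof (rule integral_mono[OF _ iL])
      show "integrable M (\<lambda>\<omega>. \<Sum>k<n. q ^ Suc k * indicator (Hm k) \<omega>)"
        by (intro Bochner_Integration.integrable_sum integrable_mult_right) (auto simp: emeasure_eq_measure)
      fix \<omega>
      have "(\<Sum>k<n. q ^ Suc k * indicator (Hm k) \<omega>) \<le> (\<Sum>k<n. if k = K \<omega> - 1 then q ^ K \<omega> else 0)"
      proof (rule sum_mono)
        fix k
        show "q ^ Suc k * indicator (Hm k) \<omega> \<le> (if k = K \<omega> - 1 then q ^ K \<omega> else 0)"
          using HK[of \<omega> k] q by (cases "\<omega> \<in> Hm k") simp_all
      qed
      also have "\<dots> \<le> q ^ K \<omega>" using q by (simp add: sum.delta)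
      finally show "(\<Sum>k<n. q ^ Suc k * indicator (Hm k) \<omega>) \<le> q ^ K \<omega>" .
    qed
    finally show ?thesis .
  qed
  have geo: "(\<Sum>k<n. q ^ Suc k) \<le> 2 / (s\<^sup>2 * h)" for n
  proof -
    have "(\<Sum>k<n. q ^ Suc k) = q * ((1 - q ^ n) / (1 - q))"
      using q by (simp add: sum_gp_strict flip: sum_distrib_left)
    also have "\<dots> \<le> q * (1 / (1 - q))" using q by (intro mult_left_mono divide_right_mono) auto
    also have "\<dots> \<le> 2 / (s\<^sup>2 * h)"
    proof -
      have "1 + s\<^sup>2 * h / 2 \<le> exp (s\<^sup>2 * h / 2)" by (rule exp_ge_add_one_self)
      also have "\<dots> = 1 / q" by (simp add: q_def exp_minus field_simps)
      finally have "q * (1 + s\<^sup>2 * h / 2) \<le> 1" using q by (simp add: field_simps)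
      moreover have "0 < s\<^sup>2 * h" using s h by simp
      ultimately show ?thesis using q by (simp add: field_simps)
    qed
    finally show ?thesis .
  qed
  have R0: "0 \<le> R" unfolding R_def by simp
  \<comment> \<open>The first summand estimates the paths that are still inside after
    \<open>n\<close> steps; it disappears in the limit because \<open>q < 1\<close>.\<close>
  have "1 \<le> q ^ n * cosh s + cosh s * (exp (s * \<delta>) * L + R * (2 / (s\<^sup>2 * h)))" for n
  proof -
    have "1 \<le> q ^ n * a n + cosh s * (exp (s * \<delta>) * (\<Sum>k<n. q ^ Suc k * prob (Hm k)) + R * (\<Sum>k<n. q ^ Suc k))"
      using sum[of n] a0 by simp
    also have "\<dots> \<le> q ^ n * cosh s + cosh s * (exp (s * \<delta>) * L + R * (2 / (s\<^sup>2 * h)))"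
      using q hits[of n] geo[of n] R0 an[of n] by (intro add_mono mult_left_mono cosh_pos) auto
    finally show ?thesis .
  qed
  moreover have "(\<lambda>n. q ^ n * cosh s + cosh s * (exp (s * \<delta>) * L + R * (2 / (s\<^sup>2 * h)))) \<longlonglongrightarrow>
      0 * cosh s + cosh s * (exp (s * \<delta>) * L + R * (2 / (s\<^sup>2 * h)))"
    using q by (intro tendsto_intros LIMSEQ_realpow_zero) auto
  ultimately have "1 \<le> 0 * cosh s + cosh s * (exp (s * \<delta>) * L + R * (2 / (s\<^sup>2 * h)))"
    by (intro LIMSEQ_le_const) auto
  then show ?thesis unfolding L_def R_def K_def qK by simp
qed

text \<open>The infimum \<open>T\<close> of the grid hitting times over the meshes
  \<open>1 / (j + 1)\<close> is measurable by construction, and by the intermediate value theorem it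
  dominates the exit time almost surely. The moment estimate is therefore proved for
  \<open>T\<close>.\<close>

theorem exit_time_moment:
  assumes B: "brownian_motion M W"
  shows "(\<integral>\<^sup>+x. ennreal \<bar>x\<bar> \<partial>std_normal_distribution) * (\<integral>\<^sup>+\<omega>. ennreal (sqrt (exit_time W \<omega>)) \<partial>M) \<le> ennreal strip_const"
proof -
  define F where "F = natural_filtration M W"
  have BF: "brownian_motion_wrt M F W" using B by (simp add: brownian_motion_def F_def)
  interpret prob_space M using BF by (simp add: brownian_motion_wrt_def)
  interpret filtration "space M" F using BF by (simp add: brownian_motion_wrt_def)
  have Wm: "W t \<in> borel_measurable M" if "0 \<le> t" for t
  proof -
    have "W t \<in> borel_measurable (F t)" "sets (F t) \<subseteq> sets M" using BF that by (simp_all add: brownian_motion_wrt_def)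
    then show ?thesis unfolding measurable_def by (auto simp: space_F)
  qed
  define h where "h = (\<lambda>j::nat. 1 / real (Suc j))"
  have h: "0 < h j" for j by (simp add: h_def)
  define \<sigma> where "\<sigma> = (\<lambda>j \<omega>. h j * real (grid_hit W (h j) \<omega>))"
  have \<sigma>m [measurable]: "\<sigma> j \<in> borel_measurable M" for j
  proof -
    have [measurable]: "(\<lambda>\<omega>. W (real k * h j) \<omega>) \<in> borel_measurable M" for k using Wm[of "real k * h j"] h[of j] by simp
    show ?thesis unfolding \<sigma>_def grid_hit_def by measurable
  qed
  have \<sigma>0: "0 \<le> \<sigma> j \<omega>" for j \<omega> using h[of j] by (simp add: \<sigma>_def)
  define T where "T = (\<lambda>\<omega>. INF j. \<sigma> j \<omega>)"
  have Tm: "T \<in> borel_measurable M" unfolding T_def by measurable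
  have T0: "0 \<le> T \<omega>" for \<omega> unfolding T_def by (intro cINF_greatest \<sigma>0) simp
  have Tle: "T \<omega> \<le> \<sigma> j \<omega>" for j \<omega> unfolding T_def using \<sigma>0 by (intro cINF_lower bdd_belowI2[of _ 0]) auto
  have laplace: "1 / cosh s \<le> (\<integral>\<omega>. exp (- (s\<^sup>2 * T \<omega> / 2)) \<partial>M)" if s: "0 < s" for s
  proof -
    let ?L = "\<integral>\<omega>. exp (- (s\<^sup>2 * T \<omega> / 2)) \<partial>M"
    have int: "integrable M (\<lambda>\<omega>. exp (- (s\<^sup>2 * U \<omega> / 2)))" if "U \<in> borel_measurable M" "\<And>\<omega>. 0 \<le> U \<omega>" for U
    proof (rule integrable_const_bound[of _ 1])
      show "AE \<omega> in M. norm (exp (- (s\<^sup>2 * U \<omega> / 2))) \<le> 1" using that(2) by simp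
    qed (use that(1) in measurable)
    have mono: "(\<integral>\<omega>. exp (- (s\<^sup>2 * \<sigma> j \<omega> / 2)) \<partial>M) \<le> ?L" for j
    proof (rule integral_mono[OF int[OF \<sigma>m \<sigma>0] int[OF Tm T0]])
      fix \<omega>
      have "s\<^sup>2 * T \<omega> / 2 \<le> s\<^sup>2 * \<sigma> j \<omega> / 2" using Tle[of \<omega> j] by (intro divide_right_mono mult_left_mono) auto
      then show "exp (- (s\<^sup>2 * \<sigma> j \<omega> / 2)) \<le> exp (- (s\<^sup>2 * T \<omega> / 2))" by simp
    qed
    have main: "1 \<le> cosh s * (exp (s * \<delta>) * ?L)" if \<delta>: "0 < \<delta>" for \<delta>
    proof -
      \<comment> \<open>The error for \<open>l = sqrt (j + 1)\<close>: with this choice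
        \<open>(s + l)^2 * h j\<close> stays bounded, while \<open>exp (- l * \<delta>)\<close>
        beats the growth of \<open>1 / h j = j + 1\<close>.\<close>
      define e where "e = (\<lambda>j::nat. exp (- sqrt (real (Suc j)) * \<delta>) * (2 * exp ((s + sqrt (real (Suc j)))\<^sup>2 * h j / 2)) * (2 / (s\<^sup>2 * h j)))"
      have "1 \<le> cosh s * (exp (s * \<delta>) * ?L + e j)" for j
      proof -
        have "1 \<le> cosh s * (exp (s * \<delta>) * (\<integral>\<omega>. exp (- (s\<^sup>2 * \<sigma> j \<omega> / 2)) \<partial>M) + e j)"
          using grid_laplace[OF B h[of j] s, of "sqrt (real (Suc j))" \<delta>] by (simp add: \<sigma>_def e_def)
        also have "\<dots> \<le> cosh s * (exp (s * \<delta>) * ?L + e j)"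
          using mono[of j] by (intro mult_left_mono add_right_mono) (auto intro: less_imp_le)
        finally show ?thesis .
      qed
      note b = this
      have "e \<longlonglongrightarrow> 0" unfolding e_def h_def using s \<delta> by real_asymp
      then have lim: "(\<lambda>j. cosh s * (exp (s * \<delta>) * ?L + e j)) \<longlonglongrightarrow> cosh s * (exp (s * \<delta>) * ?L + 0)"
        by (intro tendsto_intros)
      have "1 \<le> cosh s * (exp (s * \<delta>) * ?L + 0)" by (rule LIMSEQ_le_const[OF lim]) (use b in blast)
      then show ?thesis by simp
    qed
    \<comment> \<open>The parameter \<open>\<delta>\<close> tends to 0 only after the mesh, since
      the error estimate is not uniform in \<open>\<delta>\<close>.\<close>
    have "((\<lambda>\<delta>. cosh s * (exp (s * \<delta>) * ?L)) \<longlongrightarrow> cosh s * (exp (s * 0) * ?L)) (at_right 0)"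
      by (intro tendsto_intros)
    then have "1 \<le> cosh s * (exp (s * 0) * ?L)"
      by (rule tendsto_lowerbound) (auto simp: eventually_at_right_less[THEN eventually_mono] main)
    then show ?thesis using cosh_real_pos[of s] by (simp add: field_simps)
  qed
  \<comment> \<open>Remaining inside along the whole grid implies \<open>\<bar>W t\<bar> < 1\<close>
    at each grid time \<open>t\<close>, an event of probability at most
    \<open>1 / sqrt t\<close>.\<close>
  have hitting: "AE \<omega> in M. \<exists>k. 1 \<le> \<bar>W (real k * h j) \<omega>\<bar>" for j
  proof -
    define N where "N = {\<omega> \<in> space M. \<forall>k. \<bar>W (real k * h j) \<omega>\<bar> < 1}"
    have [measurable]: "(\<lambda>\<omega>. W (real k * h j) \<omega>) \<in> borel_measurable M" for k using Wm[of "real k * h j"] h[of j] by simp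
    have Nm: "N \<in> sets M" unfolding N_def by measurable
    have "prob N \<le> 1 / sqrt (real (Suc k) * h j)" for k
    proof -
      let ?t = "real (Suc k) * h j"
      have t: "0 < ?t" using h[of j] by simp
      have [measurable]: "W 0 \<in> borel_measurable M" using Wm[of 0] by simp
      have AE0: "AE \<omega> in M. W 0 \<omega> = 0" using BF by (simp add: brownian_motion_wrt_def)
      have "prob N \<le> prob {\<omega> \<in> space M. W ?t \<omega> - W 0 \<omega> \<in> {-1<..<1}}"
      proof (rule finite_measure_mono_AE)
        show "AE \<omega> in M. \<omega> \<in> N \<longrightarrow> \<omega> \<in> {\<omega> \<in> space M. W ?t \<omega> - W 0 \<omega> \<in> {-1<..<1}}"
          using AE0 AE_space
        proof eventually_elim
          case (elim \<omega>)
          show ?case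
          proof
            assume "\<omega> \<in> N"
            then have "\<bar>W ?t \<omega>\<bar> < 1" unfolding N_def by blast
            then show "\<omega> \<in> {\<omega> \<in> space M. W ?t \<omega> - W 0 \<omega> \<in> {-1<..<1}}" using elim by (auto simp: abs_less_iff)
          qed
        qed
        show "{\<omega> \<in> space M. W ?t \<omega> - W 0 \<omega> \<in> {-1<..<1}} \<in> sets M" by measurable
      qed
      also have "\<dots> = measure (distr M borel (\<lambda>\<omega>. W ?t \<omega> - W 0 \<omega>)) {-1<..<1}"
        by (subst measure_distr[OF brownian_increment_distr(1)[OF BF order_refl t]]) (auto intro!: arg_cong[where f = prob])
      also have "\<dots> = measure (gauss (sqrt ?t)) {-1<..<1}"
        using brownian_increment_distr(2)[OF BF order_refl t] by simp
      also have "\<dots> \<le> 1 / sqrt ?t" using t by (intro gauss_unit_interval) simp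
      finally show ?thesis .
    qed
    moreover have "(\<lambda>k. 1 / sqrt (real (Suc k) * h j)) \<longlonglongrightarrow> 0" using h[of j] by real_asymp
    ultimately have "prob N \<le> 0" by (intro LIMSEQ_le_const) auto
    then have "prob N = 0" by (simp add: measure_le_0_iff)
    then have "AE \<omega> in M. \<omega> \<notin> N" using Nm by (subst (asm) prob_eq_0) auto
    then show ?thesis using AE_space by eventually_elim (auto simp: N_def not_less)
  qed
  have "AE \<omega> in M. \<forall>j. \<exists>k. 1 \<le> \<bar>W (real k * h j) \<omega>\<bar>" using hitting by (simp add: AE_all_countable)
  moreover have "AE \<omega> in M. W 0 \<omega> = 0" "AE \<omega> in M. continuous_on {0..} (\<lambda>t. W t \<omega>)" using BF by (simp_all add: brownian_motion_wrt_def)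
  ultimately have exit: "AE \<omega> in M. exit_time W \<omega> \<le> T \<omega>"
  proof eventually_elim
    case (elim \<omega>)
    show ?case unfolding T_def
    proof (rule cINF_greatest)
      fix j
      let ?t = "real (grid_hit W (h j) \<omega>) * h j"
      have t0: "0 \<le> ?t" using h[of j] by simp
      have "\<exists>k. 1 \<le> \<bar>W (real k * h j) \<omega>\<bar>" using elim by blast
      then have ge: "1 \<le> \<bar>W ?t \<omega>\<bar>" unfolding grid_hit_def by (rule LeastI_ex)
      have cont: "continuous_on {0..?t} (\<lambda>t. \<bar>W t \<omega>\<bar>)"
        by (rule continuous_on_rabs, rule continuous_on_subset[OF elim(3)]) auto
      have "\<bar>W 0 \<omega>\<bar> \<le> 1" using elim(2) by simp
      from IVT'[OF this ge t0 cont] obtain t where t: "0 \<le> t" "t \<le> ?t" "\<bar>W t \<omega>\<bar> = 1" by blast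
      then have "exit_time W \<omega> \<le> t" unfolding exit_time_def by (intro cInf_lower bdd_belowI[of _ 0]) auto
      then show "exit_time W \<omega> \<le> \<sigma> j \<omega>" using t by (simp add: \<sigma>_def mult.commute)
    qed simp
  qed
  have "(\<integral>\<^sup>+\<omega>. ennreal (sqrt (exit_time W \<omega>)) \<partial>M) \<le> (\<integral>\<^sup>+\<omega>. ennreal (sqrt (T \<omega>)) \<partial>M)"
    using exit by (intro nn_integral_mono_AE, eventually_elim) (rule ennreal_leI, simp)
  then have "(\<integral>\<^sup>+x. ennreal \<bar>x\<bar> \<partial>std_normal_distribution) * (\<integral>\<^sup>+\<omega>. ennreal (sqrt (exit_time W \<omega>)) \<partial>M) \<le>
    (\<integral>\<^sup>+x. ennreal \<bar>x\<bar> \<partial>std_normal_distribution) * (\<integral>\<^sup>+\<omega>. ennreal (sqrt (T \<omega>)) \<partial>M)" by (rule mult_left_mono) simp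
  also have "\<dots> \<le> ennreal strip_const" by (rule sqrt_moment_le_strip_const[OF Tm T0 laplace])
  finally show ?thesis .
qed

section \<open>The constants\<close>

text \<open>For \<open>k = 0\<close> the hypothesis forces \<open>a = 0\<close>, and the product of
  \<open>\<infinity>\<close> and 0 is 0.\<close>

lemma ennreal_reciprocal_mult_le:
  fixes a b k :: ennreal
  assumes "a \<le> k * b" "k \<noteq> \<top>"
  shows "1 / k * a \<le> b"
proof (cases "k = 0")
  case False
  have "1 / k * a = a / k" by (simp add: ennreal_divide_times divide_ennreal_def mult.commute)
  also have "\<dots> \<le> b"
    using assms False by (simp add: divide_le_posI_ennreal zero_less_iff_neq_zero mult.commute)
  finally show ?thesis .
qed (use assms in simp)

theorem corollary4p13:
  fixes p :: real
  assumes "1 < p"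
  shows "max (beta_gamma_plus TYPE('w1) TYPE('x::banach) p)
             (beta_gamma_minus TYPE('w1) TYPE('x) p) \<le> hilbert_const TYPE('x) p \<and>
    (\<forall>(N :: 'n measure) \<gamma> (M :: 'm measure) W.
       prob_space N \<and> distributed N lborel \<gamma> std_normal_density \<and> brownian_motion M W \<longrightarrow>
       (\<integral>\<^sup>+ \<omega>. ennreal \<bar>\<gamma> \<omega>\<bar> \<partial>N) * (\<integral>\<^sup>+ \<omega>. ennreal (sqrt (exit_time W \<omega>)) \<partial>M) *
         max (beta_Delta_plus TYPE('w2) TYPE('x) p) (beta_Delta_minus TYPE('w2) TYPE('x) p)
       \<le> hilbert_const TYPE('x) p)"
proof (intro conjI allI impI)
  have nonpos: "circ_nonpos (base_value p c :: 'x \<times> 'x \<Rightarrow> real)" if "0 \<le> c" "\<forall>f :: real \<Rightarrow> 'x. step_function f \<longrightarrow>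
     (\<integral>\<^sup>+ t \<in> {-pi..<pi}. ennreal (norm (hilbert_transform f t) powr p) \<partial>lborel)
       \<le> ennreal (c powr p) * (\<integral>\<^sup>+ t \<in> {-pi..<pi}. ennreal (norm (f t) powr p) \<partial>lborel)" for c
    using that by (intro circ_nonpos_base_value assms) auto
  show "max (beta_gamma_plus TYPE('w1) TYPE('x::banach) p) (beta_gamma_minus TYPE('w1) TYPE('x) p) \<le> hilbert_const TYPE('x) p"
    unfolding hilbert_const_def
  \<comment> \<open>Every constant is an infimum of admissible numbers, so it suffices that each
    \<open>c\<close> admissible for the Hilbert transform is admissible in both decoupling
    inequalities.\<close>
  proof (safe intro!: Inf_greatest)
    fix c :: real assume c: "0 \<le> c" "\<forall>f :: real \<Rightarrow> 'x. step_function f \<longrightarrow>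
     (\<integral>\<^sup>+ t \<in> {-pi..<pi}. ennreal (norm (hilbert_transform f t) powr p) \<partial>lborel)
       \<le> ennreal (c powr p) * (\<integral>\<^sup>+ t \<in> {-pi..<pi}. ennreal (norm (f t) powr p) \<partial>lborel)"
    note D = brownian_decoupling[OF assms nonpos[OF c]]
    have "beta_gamma_plus TYPE('w1) TYPE('x) p \<le> ennreal c"
      unfolding beta_gamma_plus_def using c(1) D(1) by (intro Inf_lower imageI) blast
    moreover have "beta_gamma_minus TYPE('w1) TYPE('x) p \<le> ennreal c"
      unfolding beta_gamma_minus_def
      using c(1) ennreal_reciprocal_mult_le[OF D(2) ennreal_neq_top] by (intro Inf_lower imageI) blast
    ultimately show "max (beta_gamma_plus TYPE('w1) TYPE('x) p) (beta_gamma_minus TYPE('w1) TYPE('x) p) \<le> ennreal c" by simp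
  qed
  fix N :: "'n measure" and \<gamma> and M :: "'m measure" and W
  assume a: "prob_space N \<and> distributed N lborel \<gamma> std_normal_density \<and> brownian_motion M W"
  have "(\<integral>\<^sup>+ \<omega>. ennreal \<bar>\<gamma> \<omega>\<bar> \<partial>N) = (\<integral>\<^sup>+x. ennreal \<bar>x\<bar> \<partial>std_normal_distribution)"
  proof -
    have d: "distributed N lborel \<gamma> std_normal_density" using a by simp
    have "(\<integral>\<^sup>+x. ennreal \<bar>x\<bar> \<partial>distr N lborel \<gamma>) = (\<integral>\<^sup>+ \<omega>. ennreal \<bar>\<gamma> \<omega>\<bar> \<partial>N)"
      using distributed_measurable[OF d] by (subst nn_integral_distr) auto
    then show ?thesis using distributed_distr_eq_density[OF d] by simp
  qed
  then have const: "(\<integral>\<^sup>+ \<omega>. ennreal \<bar>\<gamma> \<omega>\<bar> \<partial>N) * (\<integral>\<^sup>+ \<omega>. ennreal (sqrt (exit_time W \<omega>)) \<partial>M) \<le> ennreal strip_const"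
    using exit_time_moment[of M W] a by simp
  have C0: "0 \<le> strip_const" unfolding strip_const_def by (rule integral_nonneg_AE) simp
  have "ennreal strip_const * max (beta_Delta_plus TYPE('w2) TYPE('x) p) (beta_Delta_minus TYPE('w2) TYPE('x) p) \<le> hilbert_const TYPE('x) p"
  \<comment> \<open>Division by the constant is possible in one case; in the other the left side is
    0, even if the second factor is infinite.\<close>
  proof (cases "strip_const = 0")
    case False
    with C0 have C: "0 < strip_const" by simp
    show ?thesis unfolding hilbert_const_def
    proof (safe intro!: Inf_greatest)
      fix c :: real assume c: "0 \<le> c" "\<forall>f :: real \<Rightarrow> 'x. step_function f \<longrightarrow>
       (\<integral>\<^sup>+ t \<in> {-pi..<pi}. ennreal (norm (hilbert_transform f t) powr p) \<partial>lborel)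
         \<le> ennreal (c powr p) * (\<integral>\<^sup>+ t \<in> {-pi..<pi}. ennreal (norm (f t) powr p) \<partial>lborel)"
      note D = paley_walsh_decoupling[OF assms c(1) nonpos[OF c]]
      \<comment> \<open>Cancels the power of \<open>strip_const\<close>, so that \<open>c\<close>
        admissible for the Hilbert transform makes \<open>c / strip_const\<close> admissible for the
        Paley-Walsh constants.\<close>
      have scale: "a \<le> ennreal ((c / strip_const) powr p) * b" if "ennreal (strip_const powr p) * a \<le> ennreal (c powr p) * b" for a b
      proof -
        have "ennreal (1 / strip_const powr p) * (ennreal (strip_const powr p) * a) \<le> ennreal (1 / strip_const powr p) * (ennreal (c powr p) * b)"
          using that by (rule mult_left_mono) simp
        moreover have "ennreal (1 / strip_const powr p) * ennreal (strip_const powr p) = 1"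
          using C by (simp flip: ennreal_mult)
        moreover have "ennreal (1 / strip_const powr p) * ennreal (c powr p) = ennreal ((c / strip_const) powr p)"
          using C c(1) by (simp add: powr_divide flip: ennreal_mult)
        ultimately show ?thesis by (simp add: mult.assoc[symmetric])
      qed
      have "beta_Delta_plus TYPE('w2) TYPE('x) p \<le> ennreal (c / strip_const)"
        unfolding beta_Delta_plus_def using c(1) C scale[OF D(1)] by (intro Inf_lower imageI) (simp, blast)
      moreover have "beta_Delta_minus TYPE('w2) TYPE('x) p \<le> ennreal (c / strip_const)"
        unfolding beta_Delta_minus_def
        using c(1) C ennreal_reciprocal_mult_le[OF scale[OF D(2)] ennreal_neq_top] by (intro Inf_lower imageI) (simp, blast)
      ultimately have "ennreal strip_const * max (beta_Delta_plus TYPE('w2) TYPE('x) p) (beta_Delta_minus TYPE('w2) TYPE('x) p) \<le>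
        ennreal strip_const * ennreal (c / strip_const)" by (intro mult_left_mono) auto
      also have "\<dots> = ennreal c" using C c(1) by (simp flip: ennreal_mult)
      finally show "ennreal strip_const * max (beta_Delta_plus TYPE('w2) TYPE('x) p) (beta_Delta_minus TYPE('w2) TYPE('x) p) \<le> ennreal c" .
    qed
  qed simp
  with const show "(\<integral>\<^sup>+ \<omega>. ennreal \<bar>\<gamma> \<omega>\<bar> \<partial>N) * (\<integral>\<^sup>+ \<omega>. ennreal (sqrt (exit_time W \<omega>)) \<partial>M) *
         max (beta_Delta_plus TYPE('w2) TYPE('x) p) (beta_Delta_minus TYPE('w2) TYPE('x) p) \<le> hilbert_const TYPE('x) p"
    by (meson mult_right_mono order_trans zero_le)
qed

end
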